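(* Let $k$ be a field and $X$ a smooth projective geometrically connected $k$-variety such that $\mathrm{Pic}(\bar X)$ is $\mathbb{Z}$-free and finitely generated. If $\beta(X)=0$, then $\mathrm{Am}^n(X,T)=0$ for all $n\ge2$ and all $k$-tori $T$.
   Context: Let $\bar k$ be a separable closure of $k$, $\mathfrak{g}_k=\mathrm{Gal}(\bar k/k)$, and $H^i(k,M):=H^i(\mathfrak{g}_k,M)$ for discrete $\mathfrak{g}_k$-modules $M$. For a $k$-scheme $Y$ put $\bar Y:=Y\times_k\bar k$. A $k$-torus $T$ need not be split; $\mathfrak{X}_*(\bar T)$ is the cocharacter $\mathfrak{g}_k$-lattice of $\bar T$. For a smooth geometrically integral $k$-variety $X$, let $\bar k[X]$ and $\bar k(X)$ be the ring of regular functions and the function field of $\bar X$. The exact sequence of discrete $\mathfrak{g}_k$-modules $$1\to\bar k[X]^\times\to\bar k(X)^\times\xrightarrow{\mathrm{div}}\mathrm{Div}(\bar X)\to\mathrm{Pic}(\bar X)\to0,$$ tensored with $\mathfrak{X}_*(\bar T)$, gives an exact sequence $$1\to T(\bar k[X])\to T(\bar k(X))\to\mathrm{Div}(\bar X)\otimes\mathfrak{X}_*(\bar T)\to\mathrm{Pic}(\bar X)\otimes\mathfrak{X}_*(\bar T)\to0,$$ hence double connecting homomorphisms $\partial^n\colon H^{n-2}(k,\mathrm{Pic}(\bar X)\otimes\mathfrak{X}_*(\bar T))\to H^n(k,T(\bar k[X]))$ for $n\ge2$. The $n$th Amitsur group is $\mathrm{Am}^n(X,T):=\mathrm{Im}(\partial^n)$.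 If $\mathrm{Pic}(\bar X)$ is free and finitely generated, the Néron–Severi torus $T_{\mathrm{NS}}$ is the $k$-torus whose character lattice is isomorphic to $\mathrm{Pic}(\bar X)$ as a $\mathfrak{g}_k$-module, so $\mathfrak{X}_*(\bar T_{\mathrm{NS}})\cong\mathrm{Pic}(\bar X)^\vee$ and $\mathrm{Pic}(\bar X)\otimes\mathfrak{X}_*(\bar T_{\mathrm{NS}})\cong\mathrm{End}(\mathrm{Pic}(\bar X))$. The universal torsor obstruction is $$\beta(X):=\partial^2(\mathrm{Id}_{\mathrm{Pic}(\bar X)})\in H^2(k,T_{\mathrm{NS}}(\bar k[X])),$$ where $\partial^2\colon\mathrm{End}(\mathrm{Pic}(\bar X))^{\mathfrak{g}_k}\to H^2(k,T_{\mathrm{NS}}(\bar k[X]))$ is the double connecting homomorphism $\partial^2\colon H^0(k,\mathrm{Pic}(\bar X)\otimes\mathfrak{X}_*(\bar T))\to H^2(k,T(\bar k[X]))$ for $T=T_{\mathrm{NS}}$, i.e. the one induced by the exact sequence $1\to T_{\mathrm{NS}}(\bar k[X])\to T_{\mathrm{NS}}(\bar k(X))\to\mathrm{Div}(\bar X)\otimes\mathfrak{X}_*(\bar T_{\mathrm{NS}})\to\mathrm{Pic}(\bar X)\otimes\mathfrak{X}_*(\bar T_{\mathrm{NS}})\to0$. *)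

theory Defs
  imports
    "HOL-Analysis.Abstract_Topology"
    "HOL-Algebra.Algebraic_Closure_Type"
    "HOL-Algebra.QuotRing"
    "HOL-Algebra.Free_Abelian_Groups"
    "HOL-Algebra.Product_Groups"
    "HOL-Library.Poly_Mapping"
    "HOL-Library.Product_Plus"
begin

section \<open>Polynomials and monoid algebras\<close>

text \<open>
  \<open>('v \<Rightarrow>\<^sub>0 nat) \<Rightarrow>\<^sub>0 'k\<close> is the polynomial ring over \<open>'k\<close> in variables indexed by \<open>'v\<close>;
  more generally \<open>'e \<Rightarrow>\<^sub>0 'k\<close> is the monoid algebra of the commutative monoid \<open>'e\<close>, so
  \<open>int \<Rightarrow>\<^sub>0 'k\<close> is the ring of Laurent polynomials in one variable.
\<close>

type_synonym ('v, 'k) mpoly = "('v \<Rightarrow>\<^sub>0 nat) \<Rightarrow>\<^sub>0 'k"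

abbreviation rng :: "'r::comm_ring_1 ring" where
  "rng \<equiv> ring_of_type_algebra"

abbreviation mconst :: "'k \<Rightarrow> ('e::zero \<Rightarrow>\<^sub>0 'k::zero)" where
  "mconst c \<equiv> Poly_Mapping.single 0 c"

definition mvar :: "'v \<Rightarrow> ('v, 'k::zero_neq_one) mpoly" where
  "mvar i = Poly_Mapping.single (Poly_Mapping.single i 1) 1"

text \<open>Evaluation at the point \<open>v\<close>, coefficients being mapped to the target ring by \<open>s\<close>.\<close>

definition meval :: "('k::zero \<Rightarrow> 'r::comm_ring_1) \<Rightarrow> ('v \<Rightarrow> 'r) \<Rightarrow> ('v, 'k) mpoly \<Rightarrow> 'r" where
  "meval s v p = (\<Sum>e\<in>Poly_Mapping.keys p. s (Poly_Mapping.lookup p e) *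
       (\<Prod>i\<in>Poly_Mapping.keys e. v i ^ Poly_Mapping.lookup e i))"

text \<open>The linear map of monoid algebras induced by a map \<open>h\<close> of the underlying monoids.\<close>

definition map_exp :: "('e \<Rightarrow> 'f) \<Rightarrow> ('e \<Rightarrow>\<^sub>0 'k::comm_monoid_add) \<Rightarrow> ('f \<Rightarrow>\<^sub>0 'k)" where
  "map_exp h p = (\<Sum>e\<in>Poly_Mapping.keys p. Poly_Mapping.single (h e) (Poly_Mapping.lookup p e))"

definition pderiv_at :: "'v \<Rightarrow> ('v, 'k::comm_ring_1) mpoly \<Rightarrow> ('v, 'k) mpoly" where
  "pderiv_at i p = (\<Sum>e\<in>Poly_Mapping.keys p.
     Poly_Mapping.single (e - Poly_Mapping.single i 1)
       (of_nat (Poly_Mapping.lookup e i) * Poly_Mapping.lookup p e))"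

definition homog :: "nat \<Rightarrow> ('n::finite, 'k::zero) mpoly \<Rightarrow> bool" where
  "homog d p \<longleftrightarrow> (\<forall>e\<in>Poly_Mapping.keys p. (\<Sum>i\<in>UNIV. Poly_Mapping.lookup e i) = d)"

definition homog_ideal :: "('n::finite, 'k::comm_ring_1) mpoly set \<Rightarrow> bool" where
  "homog_ideal I \<longleftrightarrow> ideal I rng \<and> I = Idl\<^bsub>rng\<^esub> {f \<in> I. \<exists>d. homog d f}"

text \<open>Extension of an ideal of polynomials along a homomorphism of coefficient fields.\<close>

definition ext_ideal ::
    "('k::comm_ring_1 \<Rightarrow> 'a::comm_ring_1) \<Rightarrow> ('v, 'k) mpoly set \<Rightarrow> ('v, 'a) mpoly set" where
  "ext_ideal \<iota> I = Idl\<^bsub>rng\<^esub> (Poly_Mapping.map \<iota> ` I)"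


section \<open>Separable closure and Galois group\<close>

definition is_separable_closure :: "('k::field \<Rightarrow> 'a::field) \<Rightarrow> bool" where
  "is_separable_closure \<iota> \<longleftrightarrow>
     \<iota> \<in> ring_hom rng rng \<and>
     (\<forall>x. \<exists>p::'k poly. coprime p (pderiv p) \<and> poly (map_poly \<iota> p) x = 0) \<and>
     (\<forall>p::'a poly. coprime p (pderiv p) \<and> degree p > 0 \<longrightarrow> (\<exists>x. poly p x = 0))"

definition gal :: "('k::field \<Rightarrow> 'a::field) \<Rightarrow> ('a \<Rightarrow> 'a) set" where
  "gal \<iota> = {\<sigma>. \<sigma> \<in> ring_hom rng rng \<and> bij \<sigma> \<and> \<sigma> \<circ> \<iota> = \<iota>}"


section \<open>Galois cohomology\<close>

record ('g, 'c) gmodule =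
  grp :: "'c monoid"
  act :: "'g \<Rightarrow> 'c \<Rightarrow> 'c"

text \<open>
  Throughout, \<open>G\<close> is a group of automorphisms of \<open>'a\<close> under composition, with its Krull topology:
  a basis of neighbourhoods of \<open>\<sigma>\<close> is given by the sets of those \<open>\<tau>\<close> that agree with \<open>\<sigma>\<close> on a
  finite set.  Modules are discrete and written multiplicatively, and \<open>H\<^sup>n\<close> is computed by
  continuous inhomogeneous cochains, i.e. locally constant functions of \<open>n\<close>-tuples.
\<close>

definition tuples :: "('a \<Rightarrow> 'a) set \<Rightarrow> nat \<Rightarrow> ('a \<Rightarrow> 'a) list set" where
  "tuples G n = {gs. length gs = n \<and> set gs \<subseteq> G}"

definition cochains ::
    "('a \<Rightarrow> 'a) set \<Rightarrow> nat \<Rightarrow> ('a \<Rightarrow> 'a, 'c) gmodule \<Rightarrow> (('a \<Rightarrow> 'a) list \<Rightarrow> 'c) set" where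
  "cochains G n M = {c \<in> tuples G n \<rightarrow>\<^sub>E carrier (grp M).
     \<forall>gs\<in>tuples G n. \<exists>F. finite F \<and>
       (\<forall>hs\<in>tuples G n. (\<forall>i<n. \<forall>x\<in>F. (hs ! i) x = (gs ! i) x) \<longrightarrow> c hs = c gs)}"

text \<open>For \<open>i = 1, \<dots>, n\<close> the pair \<open>g\<^sub>i, g\<^sub>i\<^sub>+\<^sub>1\<close> in \<open>[g\<^sub>1, \<dots>, g\<^sub>n\<^sub>+\<^sub>1]\<close> is replaced by its product.\<close>

definition merge :: "nat \<Rightarrow> ('a \<Rightarrow> 'a) list \<Rightarrow> ('a \<Rightarrow> 'a) list" where
  "merge i gs = take (i - 1) gs @ (gs ! (i - 1) \<circ> gs ! i) # drop (i + 1) gs"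

definition cobd ::
    "('a \<Rightarrow> 'a) set \<Rightarrow> nat \<Rightarrow> ('a \<Rightarrow> 'a, 'c) gmodule
      \<Rightarrow> (('a \<Rightarrow> 'a) list \<Rightarrow> 'c) \<Rightarrow> (('a \<Rightarrow> 'a) list \<Rightarrow> 'c)" where
  "cobd G n M c = (\<lambda>gs\<in>tuples G (Suc n).
     act M (hd gs) (c (tl gs))
     \<otimes>\<^bsub>grp M\<^esub> (\<Otimes>\<^bsub>grp M\<^esub>i\<in>{1..n}. c (merge i gs) [^]\<^bsub>grp M\<^esub> ((-1) ^ i :: int))
     \<otimes>\<^bsub>grp M\<^esub> (c (butlast gs) [^]\<^bsub>grp M\<^esub> ((-1) ^ Suc n :: int)))"

definition cochain_group ::
    "('a \<Rightarrow> 'a) set \<Rightarrow> nat \<Rightarrow> ('a \<Rightarrow> 'a, 'c) gmodule \<Rightarrow> (('a \<Rightarrow> 'a) list \<Rightarrow> 'c) monoid" where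
  "cochain_group G n M =
     \<lparr>carrier = cochains G n M,
      monoid.mult = (\<lambda>c d. \<lambda>gs\<in>tuples G n. c gs \<otimes>\<^bsub>grp M\<^esub> d gs),
      one = (\<lambda>gs\<in>tuples G n. \<one>\<^bsub>grp M\<^esub>)\<rparr>"

definition cocycles ::
    "('a \<Rightarrow> 'a) set \<Rightarrow> nat \<Rightarrow> ('a \<Rightarrow> 'a, 'c) gmodule \<Rightarrow> (('a \<Rightarrow> 'a) list \<Rightarrow> 'c) set" where
  "cocycles G n M =
     {c \<in> cochains G n M. cobd G n M c = \<one>\<^bsub>cochain_group G (Suc n) M\<^esub>}"

definition coboundaries ::
    "('a \<Rightarrow> 'a) set \<Rightarrow> nat \<Rightarrow> ('a \<Rightarrow> 'a, 'c) gmodule \<Rightarrow> (('a \<Rightarrow> 'a) list \<Rightarrow> 'c) set" where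
  "coboundaries G n M =
     (case n of 0 \<Rightarrow> {\<one>\<^bsub>cochain_group G 0 M\<^esub>} | Suc m \<Rightarrow> cobd G m M ` cochains G m M)"

definition cohomology ::
    "('a \<Rightarrow> 'a) set \<Rightarrow> nat \<Rightarrow> ('a \<Rightarrow> 'a, 'c) gmodule \<Rightarrow> (('a \<Rightarrow> 'a) list \<Rightarrow> 'c) set monoid" where
  "cohomology G n M =
     (cochain_group G n M)\<lparr>carrier := cocycles G n M\<rparr> Mod coboundaries G n M"

definition cls ::
    "('a \<Rightarrow> 'a) set \<Rightarrow> nat \<Rightarrow> ('a \<Rightarrow> 'a, 'c) gmodule
      \<Rightarrow> (('a \<Rightarrow> 'a) list \<Rightarrow> 'c) \<Rightarrow> (('a \<Rightarrow> 'a) list \<Rightarrow> 'c) set" where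
  "cls G n M c = coboundaries G n M #>\<^bsub>cochain_group G n M\<^esub> c"

text \<open>
  The connecting homomorphism \<open>H\<^sup>n(C) \<rightarrow> H\<^sup>n\<^sup>+\<^sup>1(A)\<close> of a short exact sequence
  \<open>1 \<rightarrow> A \<rightarrow> B \<rightarrow> C \<rightarrow> 1\<close> with maps \<open>f\<close> and \<open>g\<close>: lift a cocycle \<open>c\<close> to a cochain \<open>b\<close> in \<open>B\<close>
  and take the cocycle \<open>a\<close> in \<open>A\<close> with \<open>f \<circ> a = \<delta>b\<close>.
\<close>

definition connecting ::
    "('a \<Rightarrow> 'a) set \<Rightarrow> ('a \<Rightarrow> 'a, 'c) gmodule \<Rightarrow> ('a \<Rightarrow> 'a, 'd) gmodule \<Rightarrow> ('a \<Rightarrow> 'a, 'e) gmodule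
      \<Rightarrow> ('c \<Rightarrow> 'd) \<Rightarrow> ('d \<Rightarrow> 'e) \<Rightarrow> nat
      \<Rightarrow> (('a \<Rightarrow> 'a) list \<Rightarrow> 'e) set \<Rightarrow> (('a \<Rightarrow> 'a) list \<Rightarrow> 'c) set" where
  "connecting G A B C f g n \<xi> =
     (THE \<eta>. \<exists>c\<in>\<xi>. \<exists>b\<in>cochains G n B. \<exists>a\<in>cocycles G (Suc n) A.
        (\<forall>gs\<in>tuples G n. g (b gs) = c gs) \<and>
        (\<forall>gs\<in>tuples G (Suc n). f (a gs) = cobd G n B b gs) \<and>
        \<eta> = cls G (Suc n) A a)"

text \<open>
  The double connecting homomorphism \<open>H\<^sup>n(P) \<rightarrow> H\<^sup>n\<^sup>+\<^sup>2(A)\<close> of an exact sequence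
  \<open>1 \<rightarrow> A \<rightarrow> B \<rightarrow> D \<rightarrow> P \<rightarrow> 1\<close> with maps \<open>f\<close>, \<open>g\<close>, \<open>h\<close>, through the image of \<open>g\<close>.
\<close>

definition double_connecting ::
    "('a \<Rightarrow> 'a) set \<Rightarrow> ('a \<Rightarrow> 'a, 'c) gmodule \<Rightarrow> ('a \<Rightarrow> 'a, 'd) gmodule \<Rightarrow> ('a \<Rightarrow> 'a, 'e) gmodule
      \<Rightarrow> ('a \<Rightarrow> 'a, 'f) gmodule \<Rightarrow> ('c \<Rightarrow> 'd) \<Rightarrow> ('d \<Rightarrow> 'e) \<Rightarrow> ('e \<Rightarrow> 'f) \<Rightarrow> nat
      \<Rightarrow> (('a \<Rightarrow> 'a) list \<Rightarrow> 'f) set \<Rightarrow> (('a \<Rightarrow> 'a) list \<Rightarrow> 'c) set" where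
  "double_connecting G A B D P f g h n \<xi> =
     (let Q = \<lparr>grp = (grp D)\<lparr>carrier := g ` carrier (grp B)\<rparr>, act = act D\<rparr>
      in connecting G A B Q f g (Suc n) (connecting G Q D P (\<lambda>x. x) h n \<xi>))"


section \<open>Tensor products of abelian groups\<close>

definition tensor_rel :: "'c monoid \<Rightarrow> 'd monoid \<Rightarrow> ('c \<times> 'd \<Rightarrow>\<^sub>0 int) set" where
  "tensor_rel A B = generate (free_Abelian_group (carrier A \<times> carrier B))
     ({frag_of (a \<otimes>\<^bsub>A\<^esub> a', b) - frag_of (a, b) - frag_of (a', b) | a a' b.
         a \<in> carrier A \<and> a' \<in> carrier A \<and> b \<in> carrier B} \<union>
      {frag_of (a, b \<otimes>\<^bsub>B\<^esub> b') - frag_of (a, b) - frag_of (a, b') | a b b'.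
         a \<in> carrier A \<and> b \<in> carrier B \<and> b' \<in> carrier B})"

definition tensor :: "'c monoid \<Rightarrow> 'd monoid \<Rightarrow> ('c \<times> 'd \<Rightarrow>\<^sub>0 int) set monoid" where
  "tensor A B = free_Abelian_group (carrier A \<times> carrier B) Mod tensor_rel A B"

text \<open>
  \<open>tensor_map A' B' f h\<close> is the homomorphism \<open>f \<otimes> h\<close> into \<open>A' \<otimes> B'\<close>; the union below is over
  representatives of a class, whose images all lie in the same class.
\<close>

definition tensor_map ::
    "'c monoid \<Rightarrow> 'd monoid \<Rightarrow> ('a \<Rightarrow> 'c) \<Rightarrow> ('b \<Rightarrow> 'd)
      \<Rightarrow> ('a \<times> 'b \<Rightarrow>\<^sub>0 int) set \<Rightarrow> ('c \<times> 'd \<Rightarrow>\<^sub>0 int) set" where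
  "tensor_map A' B' f h \<tau> =
     (\<Union>x\<in>\<tau>. tensor_rel A' B' #>\<^bsub>free_Abelian_group (carrier A' \<times> carrier B')\<^esub>
        frag_extend (\<lambda>(a, b). frag_of (f a, h b)) x)"

definition tensor_module ::
    "('g, 'c) gmodule \<Rightarrow> ('g, 'd) gmodule \<Rightarrow> ('g, ('c \<times> 'd \<Rightarrow>\<^sub>0 int) set) gmodule" where
  "tensor_module M N =
     \<lparr>grp = tensor (grp M) (grp N),
      act = (\<lambda>\<sigma>. tensor_map (grp M) (grp N) (act M \<sigma>) (act N \<sigma>))\<rparr>"


section \<open>Projective varieties\<close>

text \<open>
  A projective \<open>k\<close>-scheme is a closed subscheme \<open>Proj k[x\<^sub>i | i \<in> 'n]/I\<close> of projective space of
  dimension \<open>CARD('n) - 1\<close>; it is given by its saturated homogeneous ideal \<open>I\<close>.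
\<close>

definition is_projective_scheme :: "('n::finite, 'k::field) mpoly set \<Rightarrow> bool" where
  "is_projective_scheme I \<longleftrightarrow> homog_ideal I \<and>
     (\<forall>f. (\<forall>i. \<exists>m. mvar i ^ m * f \<in> I) \<longrightarrow> f \<in> I)"

definition proj_points :: "('n::finite, 'k::field) mpoly set \<Rightarrow> ('n, 'k) mpoly set set" where
  "proj_points I = {x. primeideal x rng \<and> homog_ideal x \<and> I \<subseteq> x \<and> (\<exists>i. mvar i \<notin> x)}"

definition basic_open ::
    "('n::finite, 'k::field) mpoly set \<Rightarrow> ('n, 'k) mpoly \<Rightarrow> ('n, 'k) mpoly set set" where
  "basic_open I h = {x \<in> proj_points I. h \<notin> x}"

definition zariski :: "('n::finite, 'k::field) mpoly set \<Rightarrow> ('n, 'k) mpoly set topology" where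
  "zariski I = topology_generated_by {basic_open I h | h d. homog d h}"

definition is_geometrically_connected ::
    "('k::field \<Rightarrow> 'a::field) \<Rightarrow> ('n::finite, 'k) mpoly set \<Rightarrow> bool" where
  "is_geometrically_connected \<iota> I \<longleftrightarrow>
     proj_points (ext_ideal \<iota> I) \<noteq> {} \<and> connected_space (zariski (ext_ideal \<iota> I))"

text \<open>
  Smoothness over \<open>k\<close> of the closed subscheme of affine space with ideal \<open>J\<close>: at every point \<open>q\<close>
  the ideal is generated, locally at \<open>q\<close>, by sections whose differentials are linearly independent
  in \<open>\<Omega>\<^sup>1 \<otimes> \<kappa>(q)\<close> (Bosch-Luetkebohmert-Raynaud, Neron Models, 2.2).  The coefficients of a linear
  relation over \<open>\<kappa>(q)\<close> are written with common denominator, hence as polynomials modulo \<open>q\<close>.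
\<close>

definition is_smooth_affine :: "('v::finite, 'k::field) mpoly set \<Rightarrow> bool" where
  "is_smooth_affine J \<longleftrightarrow>
     (\<forall>q. primeideal q rng \<and> J \<subseteq> q \<longrightarrow>
       (\<exists>fs. set fs \<subseteq> J \<and>
         (\<forall>f\<in>J. \<exists>h. h \<notin> q \<and> h * f \<in> Idl\<^bsub>rng\<^esub> (set fs)) \<and>
         (\<forall>c::nat \<Rightarrow> ('v, 'k) mpoly.
            (\<forall>i. (\<Sum>r<length fs. c r * pderiv_at i (fs ! r)) \<in> q) \<longrightarrow> (\<forall>r<length fs. c r \<in> q))))"

text \<open>The chart \<open>x\<^sub>i \<noteq> 0\<close> is the section of the affine cone by the hyperplane \<open>x\<^sub>i = 1\<close>.\<close>

definition is_smooth :: "('n::finite, 'k::field) mpoly set \<Rightarrow> bool" where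
  "is_smooth I \<longleftrightarrow> (\<forall>i. is_smooth_affine (Idl\<^bsub>rng\<^esub> (I \<union> {mvar i - 1})))"


section \<open>Rational functions, divisors and the Picard group\<close>

text \<open>
  In this section \<open>I\<close> is the homogeneous ideal of an integral projective scheme over a field (below:
  of \<open>X\<close> over the separable closure; a smooth connected scheme is integral).  Rational functions are
  classes of fractions \<open>a/b\<close> of forms of the same degree.  Asking \<open>b\<close> to be a non-zero-divisor
  modulo \<open>I\<close> means \<open>b \<notin> I\<close> when \<open>I\<close> is prime, and makes the formulas meaningful for every \<open>I\<close>.
\<close>

definition fracs ::
    "('n::finite, 'a::field) mpoly set \<Rightarrow> (('n, 'a) mpoly \<times> ('n, 'a) mpoly) set" where
  "fracs I = {(a, b). (\<exists>d. homog d a \<and> homog d b) \<and> (\<forall>f. b * f \<in> I \<longrightarrow> f \<in> I)}"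

definition frac_class ::
    "('n::finite, 'a::field) mpoly set \<Rightarrow> ('n, 'a) mpoly \<Rightarrow> ('n, 'a) mpoly
      \<Rightarrow> (('n, 'a) mpoly \<times> ('n, 'a) mpoly) set" where
  "frac_class I a b = {(c, d) \<in> fracs I. a * d - c * b \<in> I}"

definition function_field ::
    "('n::finite, 'a::field) mpoly set \<Rightarrow> (('n, 'a) mpoly \<times> ('n, 'a) mpoly) set ring" where
  "function_field I =
     \<lparr>carrier = (\<lambda>(a, b). frac_class I a b) ` fracs I,
      monoid.mult = (\<lambda>u v. \<Union>(a, b)\<in>u. \<Union>(c, d)\<in>v. frac_class I (a * c) (b * d)),
      one = frac_class I 1 1,
      ring.zero = frac_class I 0 1,
      add = (\<lambda>u v. \<Union>(a, b)\<in>u. \<Union>(c, d)\<in>v. frac_class I (a * d + c * b) (b * d))\<rparr>"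

definition local_ring ::
    "('n::finite, 'a::field) mpoly set \<Rightarrow> ('n, 'a) mpoly set
      \<Rightarrow> (('n, 'a) mpoly \<times> ('n, 'a) mpoly) set ring" where
  "local_ring I x = (function_field I)
     \<lparr>carrier := {u \<in> carrier (function_field I). \<exists>(a, b)\<in>u. b \<notin> x}\<rparr>"

definition regular_functions ::
    "('n::finite, 'a::field) mpoly set \<Rightarrow> (('n, 'a) mpoly \<times> ('n, 'a) mpoly) set ring" where
  "regular_functions I = (function_field I)
     \<lparr>carrier := {u \<in> carrier (function_field I).
        \<forall>x\<in>proj_points I. u \<in> carrier (local_ring I x)}\<rparr>"

text \<open>
  \<open>Div\<close> is the group of Cartier divisors, i.e. of global sections of \<open>K\<^sup>\<times>/O\<^sup>\<times>\<close> (on a smooth variety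
  these are the Weil divisors).  Such a section assigns to each point \<open>x\<close> a class modulo \<open>O\<^sub>x\<^sup>\<times>\<close>
  and is locally given by one rational function; finitely many open sets suffice for this since a
  projective scheme is quasi-compact.
\<close>

definition divisor_group ::
    "('n::finite, 'a::field) mpoly set
      \<Rightarrow> (('n, 'a) mpoly set \<Rightarrow> (('n, 'a) mpoly \<times> ('n, 'a) mpoly) set set) monoid" where
  "divisor_group I =
     (let P = product_group (proj_points I)
                (\<lambda>x. units_of (function_field I) Mod Units (local_ring I x))
      in P\<lparr>carrier := {s \<in> carrier P.
        \<exists>F. finite F \<and>
          (\<forall>x\<in>proj_points I. \<exists>(h, u)\<in>F. x \<in> basic_open I h) \<and>
          (\<forall>(h, u)\<in>F. (\<exists>d. homog d h) \<and> u \<in> Units (function_field I) \<and>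
            (\<forall>y\<in>basic_open I h.
               s y = Units (local_ring I y) #>\<^bsub>units_of (function_field I)\<^esub> u))}\<rparr>)"

definition div_map ::
    "('n::finite, 'a::field) mpoly set \<Rightarrow> (('n, 'a) mpoly \<times> ('n, 'a) mpoly) set
      \<Rightarrow> (('n, 'a) mpoly set \<Rightarrow> (('n, 'a) mpoly \<times> ('n, 'a) mpoly) set set)" where
  "div_map I u = (\<lambda>x\<in>proj_points I.
     Units (local_ring I x) #>\<^bsub>units_of (function_field I)\<^esub> u)"

definition principal_divisors ::
    "('n::finite, 'a::field) mpoly set
      \<Rightarrow> (('n, 'a) mpoly set \<Rightarrow> (('n, 'a) mpoly \<times> ('n, 'a) mpoly) set set) set" where
  "principal_divisors I = div_map I ` Units (function_field I)"

definition pic_map ::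
    "('n::finite, 'a::field) mpoly set
      \<Rightarrow> (('n, 'a) mpoly set \<Rightarrow> (('n, 'a) mpoly \<times> ('n, 'a) mpoly) set set)
      \<Rightarrow> (('n, 'a) mpoly set \<Rightarrow> (('n, 'a) mpoly \<times> ('n, 'a) mpoly) set set) set" where
  "pic_map I s = principal_divisors I #>\<^bsub>divisor_group I\<^esub> s"

text \<open>The Galois actions are induced by the action on the coefficients of polynomials.\<close>

definition act_frac ::
    "('a::field \<Rightarrow> 'a) \<Rightarrow> (('n::finite, 'a) mpoly \<times> ('n, 'a) mpoly) set
      \<Rightarrow> (('n, 'a) mpoly \<times> ('n, 'a) mpoly) set" where
  "act_frac \<sigma> u = map_prod (Poly_Mapping.map \<sigma>) (Poly_Mapping.map \<sigma>) ` u"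

text \<open>\<open>(\<sigma>s)(x) = \<sigma>(s(\<sigma>\<^sup>-\<^sup>1x))\<close>, where \<open>\<sigma>\<^sup>-\<^sup>1x\<close> is the preimage of the prime ideal \<open>x\<close>.\<close>

definition act_div ::
    "('n::finite, 'a::field) mpoly set \<Rightarrow> ('a \<Rightarrow> 'a)
      \<Rightarrow> (('n, 'a) mpoly set \<Rightarrow> (('n, 'a) mpoly \<times> ('n, 'a) mpoly) set set)
      \<Rightarrow> (('n, 'a) mpoly set \<Rightarrow> (('n, 'a) mpoly \<times> ('n, 'a) mpoly) set set)" where
  "act_div I \<sigma> s = (\<lambda>x\<in>proj_points I. act_frac \<sigma> ` s (Poly_Mapping.map \<sigma> -` x))"

definition regular_units_module where
  "regular_units_module I = \<lparr>grp = units_of (regular_functions I), act = act_frac\<rparr>"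

definition function_field_units_module where
  "function_field_units_module I = \<lparr>grp = units_of (function_field I), act = act_frac\<rparr>"

definition div_module where
  "div_module I = \<lparr>grp = divisor_group I, act = act_div I\<rparr>"

definition pic_module where
  "pic_module I =
     \<lparr>grp = divisor_group I Mod principal_divisors I, act = (\<lambda>\<sigma>. image (act_div I \<sigma>))\<rparr>"


section \<open>Tori\<close>

text \<open>
  An affine group scheme, given as a closed subscheme (with ideal \<open>ideal_of\<close>) of affine space with
  coordinates indexed by \<open>'m\<close>, and by polynomials for its group law; \<open>Inl\<close> and \<open>Inr\<close> index the
  coordinates of the first and of the second factor.
\<close>

record (overloaded) ('m, 'k) affine_group =
  ideal_of :: "('m, 'k) mpoly set"
  mult_of :: "'m \<Rightarrow> ('m + 'm, 'k) mpoly"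
  unit_of :: "'m \<Rightarrow> 'k"
  inv_of :: "'m \<Rightarrow> ('m, 'k) mpoly"

text \<open>The product of two points with coordinates in a ring.\<close>

definition pt_mult ::
    "('m, 'k::zero) affine_group \<Rightarrow> ('k \<Rightarrow> 'r::comm_ring_1) \<Rightarrow> ('m \<Rightarrow> 'r) \<Rightarrow> ('m \<Rightarrow> 'r) \<Rightarrow> ('m \<Rightarrow> 'r)" where
  "pt_mult T s v w = (\<lambda>i. meval s (case_sum v w) (mult_of T i))"

definition ideal2 :: "('m, 'k::field) affine_group \<Rightarrow> ('m + 'm, 'k) mpoly set" where
  "ideal2 T = Idl\<^bsub>rng\<^esub>
     (meval mconst (\<lambda>i. mvar (Inl i)) ` ideal_of T \<union>
      meval mconst (\<lambda>i. mvar (Inr i)) ` ideal_of T)"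

definition ideal3 :: "('m, 'k::field) affine_group \<Rightarrow> ('m + 'm + 'm, 'k) mpoly set" where
  "ideal3 T = Idl\<^bsub>rng\<^esub>
     (meval mconst (\<lambda>i. mvar (Inl i)) ` ideal_of T \<union>
      meval mconst (\<lambda>i. mvar (Inr (Inl i))) ` ideal_of T \<union>
      meval mconst (\<lambda>i. mvar (Inr (Inr i))) ` ideal_of T)"

definition is_group_scheme :: "('m::finite, 'k::field) affine_group \<Rightarrow> bool" where
  "is_group_scheme T \<longleftrightarrow>
     ideal (ideal_of T) rng \<and>
     (\<forall>f\<in>ideal_of T. meval mconst (mult_of T) f \<in> ideal2 T) \<and>
     (\<forall>f\<in>ideal_of T. meval (\<lambda>c. c) (unit_of T) f = 0) \<and>
     (\<forall>f\<in>ideal_of T. meval mconst (inv_of T) f \<in> ideal_of T) \<and>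
     (let x = \<lambda>i. mvar (Inl i); y = \<lambda>i. mvar (Inr (Inl i)); z = \<lambda>i. mvar (Inr (Inr i)) in
       \<forall>i. pt_mult T mconst (pt_mult T mconst x y) z i
           - pt_mult T mconst x (pt_mult T mconst y z) i \<in> ideal3 T) \<and>
     (\<forall>i. pt_mult T mconst (\<lambda>j. mconst (unit_of T j)) mvar i - mvar i \<in> ideal_of T) \<and>
     (\<forall>i. pt_mult T mconst mvar (\<lambda>j. mconst (unit_of T j)) i - mvar i \<in> ideal_of T) \<and>
     (\<forall>i. pt_mult T mconst (inv_of T) mvar i - mconst (unit_of T i) \<in> ideal_of T) \<and>
     (\<forall>i. pt_mult T mconst mvar (inv_of T) i - mconst (unit_of T i) \<in> ideal_of T)"

definition base_change ::
    "('k::field \<Rightarrow> 'a::field) \<Rightarrow> ('m, 'k) affine_group \<Rightarrow> ('m, 'a) affine_group" where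
  "base_change \<iota> T =
     \<lparr>ideal_of = ext_ideal \<iota> (ideal_of T),
      mult_of = (\<lambda>i. Poly_Mapping.map \<iota> (mult_of T i)),
      unit_of = (\<lambda>i. \<iota> (unit_of T i)),
      inv_of = (\<lambda>i. Poly_Mapping.map \<iota> (inv_of T i))\<rparr>"

text \<open>
  For an abelian group \<open>'e\<close>, the group algebra \<open>'e \<Rightarrow>\<^sub>0 'a\<close> with comultiplication \<open>e \<mapsto> e \<otimes> e\<close>
  is the coordinate ring of the diagonalizable group with character group \<open>'e\<close>.  A homomorphism
  from that group to \<open>T\<close> is a point \<open>v\<close> of \<open>T\<close> with coordinates in this ring that satisfies
  \<open>v(st) = v(s)v(t)\<close>.
\<close>

definition is_hom_from_diag ::
    "('m, 'a::field) affine_group \<Rightarrow> ('m \<Rightarrow> ('e::ab_group_add \<Rightarrow>\<^sub>0 'a)) \<Rightarrow> bool" where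
  "is_hom_from_diag T v \<longleftrightarrow>
     (\<forall>f\<in>ideal_of T. meval mconst v f = 0) \<and>
     (\<forall>i. map_exp (\<lambda>e. (e, e)) (v i) =
        pt_mult T mconst (\<lambda>j. map_exp (\<lambda>e. (e, 0)) (v j)) (\<lambda>j. map_exp (\<lambda>e. (0, e)) (v j)) i)"

text \<open>
  A torus becomes isomorphic to \<open>G\<^sub>m\<^sup>r\<close> over the separable closure.  The coordinate ring of
  \<open>G\<^sub>m\<^sup>r\<close> is the ring of Laurent polynomials in the first \<open>r\<close> variables, and a homomorphism from
  \<open>G\<^sub>m\<^sup>r\<close> to \<open>T\<close> is an isomorphism iff it identifies the coordinate rings.
\<close>

definition is_torus :: "('k::field \<Rightarrow> 'a::field) \<Rightarrow> ('m::finite, 'k) affine_group \<Rightarrow> bool" where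
  "is_torus \<iota> T \<longleftrightarrow> is_group_scheme T \<and>
     (\<exists>r (\<psi> :: 'm \<Rightarrow> ((nat \<Rightarrow>\<^sub>0 int) \<Rightarrow>\<^sub>0 'a)).
        is_hom_from_diag (base_change \<iota> T) \<psi> \<and>
        range (meval mconst \<psi>) = {p. \<forall>e\<in>Poly_Mapping.keys p. Poly_Mapping.keys e \<subseteq> {..<r}} \<and>
        (\<forall>f. meval mconst \<psi> f = 0 \<longrightarrow> f \<in> ideal_of (base_change \<iota> T)))"

text \<open>In the following two definitions \<open>T\<close> is the base change to the separable closure.\<close>

definition cochar_module ::
    "('m, 'a::field) affine_group \<Rightarrow> ('a \<Rightarrow> 'a, 'm \<Rightarrow> (int \<Rightarrow>\<^sub>0 'a)) gmodule" where
  "cochar_module T =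
     \<lparr>grp = \<lparr>carrier = {l. is_hom_from_diag T l},
             monoid.mult = pt_mult T mconst,
             one = (\<lambda>i. mconst (unit_of T i))\<rparr>,
      act = (\<lambda>\<sigma> l i. Poly_Mapping.map \<sigma> (l i))\<rparr>"

definition char_module ::
    "('m, 'a::field) affine_group \<Rightarrow> ('a \<Rightarrow> 'a, ('m, 'a) mpoly set) gmodule" where
  "char_module T =
     \<lparr>grp = (units_of (rng Quot ideal_of T))
        \<lparr>carrier := {c \<in> Units (rng Quot ideal_of T). \<forall>f\<in>c.
           meval mconst (mult_of T) f
             - meval mconst (\<lambda>i. mvar (Inl i)) f * meval mconst (\<lambda>i. mvar (Inr i)) f \<in> ideal2 T}\<rparr>,
      act = (\<lambda>\<sigma>. image (Poly_Mapping.map \<sigma>))\<rparr>"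

text \<open>The integer \<open>n\<close> such that the composite of \<open>l : G\<^sub>m \<rightarrow> T\<close> and \<open>c : T \<rightarrow> G\<^sub>m\<close> is \<open>t \<mapsto> t\<^sup>n\<close>.\<close>

definition char_pairing ::
    "('m, 'a::field) mpoly set \<Rightarrow> ('m \<Rightarrow> (int \<Rightarrow>\<^sub>0 'a)) \<Rightarrow> int" where
  "char_pairing c l = (THE n. \<forall>f\<in>c. meval mconst l f = Poly_Mapping.single n 1)"


section \<open>Amitsur groups and the universal torsor obstruction\<close>

text \<open>
  The exact sequence of units, divisors and divisor classes on \<open>X\<close> over the separable closure is
  tensored with the cocharacter lattice of \<open>T\<close>.  For \<open>R\<close> the ring of regular functions or the
  function field, \<open>T(R)\<close> is \<open>R\<^sup>\<times> \<otimes> \<X>\<^sub>*(T)\<close>, where \<open>u \<otimes> l\<close> stands for the point \<open>l(u)\<close>.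
\<close>

definition regular_points where
  "regular_points \<iota> I T =
     tensor_module (regular_units_module (ext_ideal \<iota> I)) (cochar_module (base_change \<iota> T))"

definition rational_points where
  "rational_points \<iota> I T =
     tensor_module (function_field_units_module (ext_ideal \<iota> I)) (cochar_module (base_change \<iota> T))"

definition div_cochar where
  "div_cochar \<iota> I T =
     tensor_module (div_module (ext_ideal \<iota> I)) (cochar_module (base_change \<iota> T))"

definition pic_cochar where
  "pic_cochar \<iota> I T =
     tensor_module (pic_module (ext_ideal \<iota> I)) (cochar_module (base_change \<iota> T))"

text \<open>\<open>H\<^sup>n(k, Pic \<otimes> \<X>\<^sub>*(T)) \<rightarrow> H\<^sup>n\<^sup>+\<^sup>2(k, T(k[X]))\<close>\<close>

definition amitsur_map where
  "amitsur_map \<iota> I T n =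
     (let I' = ext_ideal \<iota> I; L = grp (cochar_module (base_change \<iota> T)) in
      double_connecting (gal \<iota>)
        (regular_points \<iota> I T) (rational_points \<iota> I T) (div_cochar \<iota> I T) (pic_cochar \<iota> I T)
        (tensor_map (grp (function_field_units_module I')) L (\<lambda>u. u) (\<lambda>l. l))
        (tensor_map (grp (div_module I')) L (div_map I') (\<lambda>l. l))
        (tensor_map (grp (pic_module I')) L (pic_map I') (\<lambda>l. l))
        n)"

text \<open>For \<open>n \<ge> 2\<close>.\<close>

definition Am where
  "Am \<iota> I T n = amitsur_map \<iota> I T (n - 2) ` carrier (cohomology (gal \<iota>) (n - 2) (pic_cochar \<iota> I T))"

text \<open>
  \<open>T\<close> is a Neron-Severi torus, by means of the isomorphism of Galois modules \<open>j\<close> from the Picard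
  group to the character lattice of \<open>T\<close>.
\<close>

definition is_NS_torus where
  "is_NS_torus \<iota> I T j \<longleftrightarrow>
     (let P = pic_module (ext_ideal \<iota> I); C = char_module (base_change \<iota> T) in
      is_torus \<iota> T \<and> j \<in> iso (grp P) (grp C) \<and>
      (\<forall>\<sigma>\<in>gal \<iota>. \<forall>q\<in>carrier (grp P). j (act P \<sigma> q) = act C \<sigma> (j q)))"

text \<open>
  The endomorphism \<open>q \<mapsto> \<Sum> m \<langle>j q, l\<rangle> p\<close> of the Picard group given by a representative
  \<open>x = \<Sum> m (p, l)\<close> of an element of \<open>Pic \<otimes> \<X>\<^sub>*(T) = Pic \<otimes> Pic\<^sup>\<or> = End(Pic)\<close>, and the element
  corresponding to the identity.
\<close>

definition tensor_endo where
  "tensor_endo \<iota> I j x q =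
     (let P = grp (pic_module (ext_ideal \<iota> I)) in
      finprod P (\<lambda>(p, l). p [^]\<^bsub>P\<^esub> (Poly_Mapping.lookup x (p, l) * char_pairing (j q) l :: int))
        (Poly_Mapping.keys x))"

definition id_pic where
  "id_pic \<iota> I T j =
     (THE \<tau>. \<tau> \<in> carrier (grp (pic_cochar \<iota> I T)) \<and>
        (\<forall>x\<in>\<tau>. \<forall>q\<in>carrier (grp (pic_module (ext_ideal \<iota> I))). tensor_endo \<iota> I j x q = q))"

definition universal_torsor_obstruction where
  "universal_torsor_obstruction \<iota> I T j =
     amitsur_map \<iota> I T 0
       (cls (gal \<iota>) 0 (pic_cochar \<iota> I T) (\<lambda>gs\<in>tuples (gal \<iota>) 0. id_pic \<iota> I T j))"

end

theory Submission
  imports Defs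
begin

text \<open>
  The double connecting homomorphism of \<open>T\<close> is the cup product with \<open>\<beta>(X)\<close>.  On cochains: let \<open>N\<close> be
  the cocharacter lattice of \<open>T\<^sub>N\<^sub>S\<close>, dual to \<open>Pic\<close>.  An element \<open>d\<close> of \<open>Div \<otimes> N = Hom(Pic, Div)\<close> lifting
  the identity is an additive section of \<open>Div \<rightarrow> Pic\<close>.  The vanishing of \<open>\<beta>(X)\<close> says that its coboundary,
  a 1-cocycle with values in principal divisors \<open>\<otimes> N\<close>, lifts to a 1-cocycle \<open>e\<close> with values in
  \<open>k(X)\<^sup>\<times> \<otimes> N\<close>.  A cocycle \<open>\<xi>\<close> with values in \<open>Pic \<otimes> \<X>\<^sub>*(T)\<close> is lifted to \<open>Div \<otimes> \<X>\<^sub>*(T)\<close> by applying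
  \<open>d\<close>, the coboundary of this lift is lifted by \<open>e \<union> \<xi>\<close>, and \<open>e \<union> \<xi>\<close> is again a cocycle.
\<close>


section \<open>Tensor products\<close>

text \<open>\<open>connecting\<close>, \<open>char_pairing\<close> and \<open>id_pic\<close> are
  definite descriptions, so each yields information only after a uniqueness proof. For the
  connecting maps this is done once, in the form that any compatible chain of lifts computes the
  double connecting homomorphism. The cup product is therefore needed for cochains only, with a left
  factor of degree 0 or 1. With the convention (e cup xi)(g, hs) = e(g) paired with g xi(hs), the
  signs come from delta(d cup xi) = (delta d) cup xi for a cocycle xi and delta(e cup xi) = (delta
  e) cup xi - e cup (delta xi). Exactness after tensoring is obtained from dual bases of the
  cocharacter lattice. These come from a splitting over the separable closure, which turns
  characters and cocharacters into integer vectors. A splitting is in general not Galois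
  equivariant, so equivariance is derived separately, from the invariance of the pairing and from
  the uniqueness of the tensor representing the identity of the Picard group.\<close>

lemma hom_finprod:
  assumes "h \<in> hom G H" "comm_group G" "comm_group H" "f \<in> A \<rightarrow> carrier G"
  shows "h (finprod G f A) = finprod H (\<lambda>x. h (f x)) A"
proof -
  interpret G: comm_group G by fact
  interpret H: comm_group H by fact
  interpret group_hom G H h
    using assms(1) by unfold_locales
  show ?thesis
    using assms(4)
  proof (induction A rule: infinite_finite_induct)
    case (insert x A)
    then have "(\<lambda>x. h (f x)) \<in> A \<rightarrow> carrier H" "h (f x) \<in> carrier H"
      by (auto simp: Pi_iff)
    with insert show ?case
      by (simp add: Pi_iff)
  qed auto
qed

lemma hom_mult_fun:
  assumes "comm_group H" "f \<in> hom G H" "h \<in> hom G H"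
  shows "(\<lambda>x. f x \<otimes>\<^bsub>H\<^esub> h x) \<in> hom G H"
proof -
  interpret H: comm_group H by fact
  show ?thesis
  proof (rule homI)
    fix x y assume "x \<in> carrier G" "y \<in> carrier G"
    then show "f (x \<otimes>\<^bsub>G\<^esub> y) \<otimes>\<^bsub>H\<^esub> h (x \<otimes>\<^bsub>G\<^esub> y) = f x \<otimes>\<^bsub>H\<^esub> h x \<otimes>\<^bsub>H\<^esub> (f y \<otimes>\<^bsub>H\<^esub> h y)"
      using hom_in_carrier[OF assms(2)] hom_in_carrier[OF assms(3)]
      by (simp add: hom_mult[OF assms(2)] hom_mult[OF assms(3)] H.m_ac)
  qed (use hom_in_carrier[OF assms(2)] hom_in_carrier[OF assms(3)] in auto)
qed

lemma hom_const_one: "group H \<Longrightarrow> (\<lambda>_. \<one>\<^bsub>H\<^esub>) \<in> hom G H"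
  by (simp add: homI group.is_monoid monoid.one_closed)

lemma hom_finprod_fun:
  assumes "comm_group H" "\<And>i. i \<in> A \<Longrightarrow> f i \<in> hom G H"
  shows "(\<lambda>x. finprod H (\<lambda>i. f i x) A) \<in> hom G H"
proof -
  interpret H: comm_group H by fact
  show ?thesis
  proof (rule homI)
    fix x y assume "x \<in> carrier G" "y \<in> carrier G"
    then have c: "f i x \<in> carrier H" "f i y \<in> carrier H" if "i \<in> A" for i
      using hom_in_carrier[OF assms(2)[OF that]] by auto
    with \<open>x \<in> _\<close> \<open>y \<in> _\<close> have "finprod H (\<lambda>i. f i (x \<otimes>\<^bsub>G\<^esub> y)) A = finprod H (\<lambda>i. f i x \<otimes>\<^bsub>H\<^esub> f i y) A"
      using assms(2) by (intro H.finprod_cong') (auto simp: hom_mult)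
    also have "\<dots> = finprod H (\<lambda>i. f i x) A \<otimes>\<^bsub>H\<^esub> finprod H (\<lambda>i. f i y) A"
      using c by (intro H.finprod_multf) auto
    finally show "finprod H (\<lambda>i. f i (x \<otimes>\<^bsub>G\<^esub> y)) A = \<dots>" .
  qed (use assms(2) in \<open>simp add: H.finprod_closed Pi_iff hom_def\<close>)
qed

lemma hom_int_pow_fun:
  assumes "comm_group H" "f \<in> hom G H"
  shows "(\<lambda>x. f x [^]\<^bsub>H\<^esub> (n::int)) \<in> hom G H"
proof -
  interpret H: comm_group H by fact
  have c: "f x \<in> carrier H" if "x \<in> carrier G" for x
    using hom_in_carrier[OF assms(2) that] .
  show ?thesis
    by (rule homI) (simp_all only: hom_mult[OF assms(2)] H.int_pow_distrib c H.int_pow_closed)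
qed

section \<open>Elementary tensors and the universal property\<close>

abbreviation tensor_free :: "'c monoid \<Rightarrow> 'd monoid \<Rightarrow> ('c \<times> 'd \<Rightarrow>\<^sub>0 int) monoid" where
  "tensor_free A B \<equiv> free_Abelian_group (carrier A \<times> carrier B)"

definition pure :: "'c monoid \<Rightarrow> 'd monoid \<Rightarrow> 'c \<Rightarrow> 'd \<Rightarrow> ('c \<times> 'd \<Rightarrow>\<^sub>0 int) set" where
  "pure A B a b = tensor_rel A B #>\<^bsub>tensor_free A B\<^esub> frag_of (a, b)"

definition bilinear_map :: "'c monoid \<Rightarrow> 'd monoid \<Rightarrow> ('e, 'x) monoid_scheme \<Rightarrow> ('c \<Rightarrow> 'd \<Rightarrow> 'e) \<Rightarrow> bool" where
  "bilinear_map A B C \<beta> \<longleftrightarrow> (\<forall>b\<in>carrier B. (\<lambda>a. \<beta> a b) \<in> hom A C) \<and> (\<forall>a\<in>carrier A. \<beta> a \<in> hom B C)"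

lemma keys_pair_diff:
  assumes "a \<in> S" "b \<in> S" "c \<in> S"
  shows "Poly_Mapping.keys (frag_of a - frag_of b - frag_of c) \<subseteq> S"
proof -
  have "Poly_Mapping.keys (frag_of a - frag_of b - frag_of c) \<subseteq>
        (Poly_Mapping.keys (frag_of a) \<union> Poly_Mapping.keys (frag_of b)) \<union> Poly_Mapping.keys (frag_of c)"
    using keys_diff[of "frag_of a - frag_of b" "frag_of c"] keys_diff[of "frag_of a" "frag_of b"] by blast
  also have "\<dots> \<subseteq> S" using assms by (auto simp: keys_frag_of)
  finally show ?thesis .
qed

locale tensor_groups = A: comm_group A + B: comm_group B
  for A :: "'c monoid" and B :: "'d monoid"
begin

lemma tensor_rel_subgroup: "subgroup (tensor_rel A B) (tensor_free A B)"
  unfolding tensor_rel_def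
  by (rule group.generate_is_subgroup[OF group_free_Abelian_group], rule subsetI)
     (elim UnE CollectE exE conjE; simp add: keys_pair_diff)

lemma tensor_rel_normal: "tensor_rel A B \<lhd> tensor_free A B"
  using tensor_rel_subgroup abelian_free_Abelian_group comm_group.normal_iff_subgroup by blast

sublocale T: comm_group "tensor A B"
  unfolding tensor_def
  by (rule comm_group.abelian_FactGroup[OF abelian_free_Abelian_group tensor_rel_subgroup])

lemma tensor_class:
  assumes "t \<in> carrier (tensor A B)"
  obtains x where "x \<in> carrier (tensor_free A B)" "t = tensor_rel A B #>\<^bsub>tensor_free A B\<^esub> x"
  using assms unfolding tensor_def carrier_FactGroup by (elim imageE) simp

lemma class_hom: "(\<lambda>x. tensor_rel A B #>\<^bsub>tensor_free A B\<^esub> x) \<in> hom (tensor_free A B) (tensor A B)"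
  unfolding tensor_def by (rule normal.r_coset_hom_Mod[OF tensor_rel_normal])

lemma pure_closed [simp]:
  "a \<in> carrier A \<Longrightarrow> b \<in> carrier B \<Longrightarrow> pure A B a b \<in> carrier (tensor A B)"
  unfolding pure_def using hom_in_carrier[OF class_hom] by (auto simp: keys_frag_of)

lemma class_eqI:
  assumes "x - y \<in> tensor_rel A B" "Poly_Mapping.keys x \<subseteq> carrier A \<times> carrier B"
    "Poly_Mapping.keys y \<subseteq> carrier A \<times> carrier B"
  shows "tensor_rel A B #>\<^bsub>tensor_free A B\<^esub> x = tensor_rel A B #>\<^bsub>tensor_free A B\<^esub> y"
proof -
  interpret F: comm_group "tensor_free A B" by (rule abelian_free_Abelian_group)
  have "x \<otimes>\<^bsub>tensor_free A B\<^esub> inv\<^bsub>tensor_free A B\<^esub> y \<in> tensor_rel A B"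
    using assms by simp
  then have "tensor_rel A B #>\<^bsub>tensor_free A B\<^esub> (x \<otimes>\<^bsub>tensor_free A B\<^esub> inv\<^bsub>tensor_free A B\<^esub> y) = tensor_rel A B"
    using F.coset_join2 tensor_rel_subgroup subgroup.mem_carrier by metis
  then show ?thesis
    using F.coset_mult_inv1[of "tensor_rel A B" x y] assms subgroup.subset[OF tensor_rel_subgroup] by simp
qed

lemma class_add:
  assumes "Poly_Mapping.keys x \<subseteq> carrier A \<times> carrier B" "Poly_Mapping.keys y \<subseteq> carrier A \<times> carrier B"
  shows "tensor_rel A B #>\<^bsub>tensor_free A B\<^esub> (x + y)
    = (tensor_rel A B #>\<^bsub>tensor_free A B\<^esub> x) \<otimes>\<^bsub>tensor A B\<^esub> (tensor_rel A B #>\<^bsub>tensor_free A B\<^esub> y)"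
  using hom_mult[OF class_hom, of x y] assms by simp

lemma pure_bilinear: "bilinear_map A B (tensor A B) (pure A B)"
  unfolding bilinear_map_def
proof (intro conjI ballI homI)
  have k: "Poly_Mapping.keys (frag_of (a, b)) \<subseteq> carrier A \<times> carrier B"
    if "a \<in> carrier A" "b \<in> carrier B" for a b using that by (auto simp: keys_frag_of)
  have k2: "Poly_Mapping.keys (frag_of (a, b) + frag_of (a', b')) \<subseteq> carrier A \<times> carrier B"
    if "a \<in> carrier A" "b \<in> carrier B" "a' \<in> carrier A" "b' \<in> carrier B" for a b a' b'
    using k[OF that(1,2)] k[OF that(3,4)] keys_add[of "frag_of (a, b)" "frag_of (a', b')"] by blast
  fix b a a' assume b: "b \<in> carrier B" and a: "a \<in> carrier A" "a' \<in> carrier A"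
  have "frag_of (a \<otimes>\<^bsub>A\<^esub> a', b) - (frag_of (a, b) + frag_of (a', b)) \<in> tensor_rel A B"
    unfolding tensor_rel_def using a b by (intro generate.incl UnI1) (force simp: algebra_simps)
  from class_eqI[OF this] show "pure A B (a \<otimes>\<^bsub>A\<^esub> a') b = pure A B a b \<otimes>\<^bsub>tensor A B\<^esub> pure A B a' b"
    unfolding pure_def using a b k k2 by (simp add: class_add)
next
  have k: "Poly_Mapping.keys (frag_of (a, b)) \<subseteq> carrier A \<times> carrier B"
    if "a \<in> carrier A" "b \<in> carrier B" for a b using that by (auto simp: keys_frag_of)
  have k2: "Poly_Mapping.keys (frag_of (a, b) + frag_of (a', b')) \<subseteq> carrier A \<times> carrier B"
    if "a \<in> carrier A" "b \<in> carrier B" "a' \<in> carrier A" "b' \<in> carrier B" for a b a' b'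
    using k[OF that(1,2)] k[OF that(3,4)] keys_add[of "frag_of (a, b)" "frag_of (a', b')"] by blast
  fix a b b' assume a: "a \<in> carrier A" and b: "b \<in> carrier B" "b' \<in> carrier B"
  have "frag_of (a, b \<otimes>\<^bsub>B\<^esub> b') - (frag_of (a, b) + frag_of (a, b')) \<in> tensor_rel A B"
    unfolding tensor_rel_def using a b by (intro generate.incl UnI2) (force simp: algebra_simps)
  from class_eqI[OF this] show "pure A B a (b \<otimes>\<^bsub>B\<^esub> b') = pure A B a b \<otimes>\<^bsub>tensor A B\<^esub> pure A B a b'"
    unfolding pure_def using a b k k2 by (simp add: class_add)
qed auto

lemma pure_mult_left:
  "a \<in> carrier A \<Longrightarrow> a' \<in> carrier A \<Longrightarrow> b \<in> carrier B \<Longrightarrow>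
    pure A B (a \<otimes>\<^bsub>A\<^esub> a') b = pure A B a b \<otimes>\<^bsub>tensor A B\<^esub> pure A B a' b"
  using pure_bilinear unfolding bilinear_map_def hom_def by auto

lemma pure_hom_left: "b \<in> carrier B \<Longrightarrow> (\<lambda>a. pure A B a b) \<in> hom A (tensor A B)"
  and pure_hom_right: "a \<in> carrier A \<Longrightarrow> pure A B a \<in> hom B (tensor A B)"
  using pure_bilinear by (auto simp: bilinear_map_def)

lemma pure_int_pow:
  assumes "a \<in> carrier A" "b \<in> carrier B"
  shows "pure A B (a [^]\<^bsub>A\<^esub> (n::int)) b = pure A B a (b [^]\<^bsub>B\<^esub> n)"
  using assms hom_int_pow[OF pure_hom_left[OF assms(2)] assms(1) A.is_group T.is_group]
    hom_int_pow[OF pure_hom_right[OF assms(1)] assms(2) B.is_group T.is_group] by simp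

text \<open>Inherited from the induction rule of the free abelian group on pairs. The closure step
  is a quotient of two tensors, which takes care of products and of negative coefficients at
  once.\<close>

lemma tensor_induct [consumes 1, case_names one pure diff]:
  assumes "t \<in> carrier (tensor A B)"
    and "P \<one>\<^bsub>tensor A B\<^esub>"
    and "\<And>a b. a \<in> carrier A \<Longrightarrow> b \<in> carrier B \<Longrightarrow> P (pure A B a b)"
    and "\<And>s t. s \<in> carrier (tensor A B) \<Longrightarrow> t \<in> carrier (tensor A B) \<Longrightarrow> P s \<Longrightarrow> P t
          \<Longrightarrow> P (s \<otimes>\<^bsub>tensor A B\<^esub> inv\<^bsub>tensor A B\<^esub> t)"
  shows "P t"
proof -
  interpret qt: group_hom "tensor_free A B" "tensor A B" "\<lambda>x. tensor_rel A B #>\<^bsub>tensor_free A B\<^esub> x"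
    by (simp add: group_hom_def group_hom_axioms_def class_hom T.is_group)
  obtain x where x: "Poly_Mapping.keys x \<subseteq> carrier A \<times> carrier B"
    and t: "t = tensor_rel A B #>\<^bsub>tensor_free A B\<^esub> x"
    using assms(1) unfolding tensor_def carrier_FactGroup by auto
  show ?thesis unfolding t
    using x
  proof (induction x rule: free_Abelian_group_induct[consumes 1, case_names zero diff one])
    case zero show ?case using assms(2) qt.hom_one by simp
  next
    case (diff x y)
    then show ?case
      using assms(4) qt.hom_closed[of x] qt.hom_closed[of y] qt.hom_mult[of x "-y"] qt.hom_inv[of y]
      by simp
  next
    case (one z) then show ?case using assms(3) by (cases z) (auto simp: pure_def)
  qed
qed

text \<open>The uniqueness half of the universal property. Identities between maps out of a tensor
  product are reduced by it to elementary tensors throughout.\<close>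

lemma tensor_hom_eqI:
  assumes "t \<in> carrier (tensor A B)" "f \<in> hom (tensor A B) C" "h \<in> hom (tensor A B) C" "group C"
    and "\<And>a b. a \<in> carrier A \<Longrightarrow> b \<in> carrier B \<Longrightarrow> f (pure A B a b) = h (pure A B a b)"
  shows "f t = h t"
proof -
  interpret f: group_hom "tensor A B" C f using assms by (simp add: group_hom_def group_hom_axioms_def)
  interpret h: group_hom "tensor A B" C h using assms by (simp add: group_hom_def group_hom_axioms_def)
  show ?thesis using assms(1) by (induction rule: tensor_induct) (simp_all add: assms)
qed

text \<open>A form of the universal property that keeps hold of representatives: a homomorphism on
  the free group is given, and its factorisation is described on every formal sum. This precision is
  needed for \<open>tensor_map\<close>, which is defined through representatives.\<close>

lemma tensor_lift:
  fixes C :: "('e, 'x) monoid_scheme"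
  assumes "comm_group C" "bilinear_map A B C \<beta>"
    and "\<phi> \<in> hom (tensor_free A B) C" "\<And>a b. a \<in> carrier A \<Longrightarrow> b \<in> carrier B \<Longrightarrow> \<phi> (frag_of (a, b)) = \<beta> a b"
  shows "\<exists>h\<in>hom (tensor A B) C.
    (\<forall>x\<in>carrier (tensor_free A B). h (tensor_rel A B #>\<^bsub>tensor_free A B\<^esub> x) = \<phi> x)"
proof -
  interpret C: comm_group C by fact
  interpret F: comm_group "tensor_free A B" by (rule abelian_free_Abelian_group)
  interpret \<phi>: group_hom "tensor_free A B" C \<phi>
    using assms(3) by unfold_locales
  have k: "Poly_Mapping.keys (frag_of (a, b)) \<subseteq> carrier A \<times> carrier B"
    if "a \<in> carrier A" "b \<in> carrier B" for a b using that by (auto simp: keys_frag_of)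
  have d: "\<phi> (x - y) = \<phi> x \<otimes>\<^bsub>C\<^esub> inv\<^bsub>C\<^esub> \<phi> y"
    if "Poly_Mapping.keys x \<subseteq> carrier A \<times> carrier B" "Poly_Mapping.keys y \<subseteq> carrier A \<times> carrier B" for x y
    using \<phi>.hom_mult[of x "-y"] \<phi>.hom_inv[of y] that by simp
  have b1: "\<beta> (a \<otimes>\<^bsub>A\<^esub> a') b = \<beta> a b \<otimes>\<^bsub>C\<^esub> \<beta> a' b" "\<beta> a b \<in> carrier C"
    if "a \<in> carrier A" "a' \<in> carrier A" "b \<in> carrier B" for a a' b
    using assms(2) that by (auto simp: bilinear_map_def hom_def)
  have b2: "\<beta> a (b \<otimes>\<^bsub>B\<^esub> b') = \<beta> a b \<otimes>\<^bsub>C\<^esub> \<beta> a b'"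
    if "a \<in> carrier A" "b \<in> carrier B" "b' \<in> carrier B" for a b b'
    using assms(2) that by (auto simp: bilinear_map_def hom_def)
  have k3: "Poly_Mapping.keys (frag_of (a, b) - frag_of (a', b')) \<subseteq> carrier A \<times> carrier B"
    if "a \<in> carrier A" "b \<in> carrier B" "a' \<in> carrier A" "b' \<in> carrier B" for a b a' b'
    using k[OF that(1,2)] k[OF that(3,4)] keys_diff[of "frag_of (a, b)" "frag_of (a', b')"] by blast
  \<comment> \<open>The word to which both families of relators are sent once bilinearity has been
    applied.\<close>
  have can: "x \<otimes>\<^bsub>C\<^esub> y \<otimes>\<^bsub>C\<^esub> inv\<^bsub>C\<^esub> x \<otimes>\<^bsub>C\<^esub> inv\<^bsub>C\<^esub> y = \<one>\<^bsub>C\<^esub>"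
    if "x \<in> carrier C" "y \<in> carrier C" for x y
    using that by (simp add: C.m_comm[of x y] C.m_assoc)
  have "tensor_rel A B \<subseteq> kernel (tensor_free A B) C \<phi>"
    unfolding tensor_rel_def
  proof (rule F.generate_subgroup_incl)
    have "\<phi> (frag_of (a \<otimes>\<^bsub>A\<^esub> a', b) - frag_of (a, b) - frag_of (a', b)) = \<one>\<^bsub>C\<^esub>"
      if "a \<in> carrier A" "a' \<in> carrier A" "b \<in> carrier B" for a a' b
      using that k k3 b1 can by (simp add: d assms(4))
    moreover have "\<phi> (frag_of (a, b \<otimes>\<^bsub>B\<^esub> b') - frag_of (a, b) - frag_of (a, b')) = \<one>\<^bsub>C\<^esub>"
      if "a \<in> carrier A" "b' \<in> carrier B" "b \<in> carrier B" for a b' b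
      using that k k3 b1 b2 can by (simp add: d assms(4))
    ultimately show "{frag_of (a \<otimes>\<^bsub>A\<^esub> a', b) - frag_of (a, b) - frag_of (a', b) | a a' b.
         a \<in> carrier A \<and> a' \<in> carrier A \<and> b \<in> carrier B} \<union>
      {frag_of (a, b \<otimes>\<^bsub>B\<^esub> b') - frag_of (a, b) - frag_of (a, b') | a b b'.
         a \<in> carrier A \<and> b \<in> carrier B \<and> b' \<in> carrier B} \<subseteq> kernel (tensor_free A B) C \<phi>"
      by (intro subsetI) (elim UnE CollectE exE conjE; simp add: keys_pair_diff kernel_def)
  qed (rule \<phi>.subgroup_kernel)
  then have ker: "\<phi> x = \<one>\<^bsub>C\<^esub>" if "x \<in> tensor_rel A B" for x
    using that by (auto simp: kernel_def)
  have eq: "\<phi> x = \<phi> y"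
    if xy: "x \<in> carrier (tensor_free A B)" "y \<in> carrier (tensor_free A B)"
      "tensor_rel A B #>\<^bsub>tensor_free A B\<^esub> x = tensor_rel A B #>\<^bsub>tensor_free A B\<^esub> y" for x y
  proof -
    have "x \<in> tensor_rel A B #>\<^bsub>tensor_free A B\<^esub> y"
      using F.rcos_self[OF xy(1) tensor_rel_subgroup] xy(3) by simp
    then obtain z where z: "z \<in> tensor_rel A B" "x = z \<otimes>\<^bsub>tensor_free A B\<^esub> y"
      by (auto simp: r_coset_def)
    then have "z \<in> carrier (tensor_free A B)"
      using subgroup.mem_carrier[OF tensor_rel_subgroup] by blast
    then show ?thesis using z xy \<phi>.hom_mult[of z y] ker \<phi>.hom_closed[of y] C.l_one[of "\<phi> y"] by metis
  qed
  obtain g where "g \<in> hom (tensor_free A B Mod tensor_rel A B) C"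
    and g: "\<And>x. x \<in> carrier (tensor_free A B) \<Longrightarrow> g (tensor_rel A B #>\<^bsub>tensor_free A B\<^esub> x) = \<phi> x"
    using FactGroup_universal[OF assms(3) tensor_rel_normal eq] by blast
  then show ?thesis unfolding tensor_def by blast
qed

lemma tensor_universal:
  fixes C :: "('e, 'x) monoid_scheme"
  assumes "comm_group C" "bilinear_map A B C \<beta>"
  shows "\<exists>h\<in>hom (tensor A B) C. \<forall>a\<in>carrier A. \<forall>b\<in>carrier B. h (pure A B a b) = \<beta> a b"
proof -
  have "case_prod \<beta> ` (carrier A \<times> carrier B) \<subseteq> carrier C"
    using assms(2) by (auto simp: bilinear_map_def hom_def)
  then obtain \<phi> where \<phi>: "\<phi> \<in> hom (tensor_free A B) C"
    "\<And>x. x \<in> carrier A \<times> carrier B \<Longrightarrow> \<phi> (frag_of x) = case_prod \<beta> x"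
    using comm_group.free_Abelian_group_universal[OF assms(1)] by metis
  have "\<phi> (frag_of (a, b)) = \<beta> a b" if "a \<in> carrier A" "b \<in> carrier B" for a b
    using \<phi>(2)[of "(a, b)"] that by simp
  from tensor_lift[OF assms \<phi>(1) this] obtain h where "h \<in> hom (tensor A B) C"
    "\<forall>x\<in>carrier (tensor_free A B). h (tensor_rel A B #>\<^bsub>tensor_free A B\<^esub> x) = \<phi> x"
    by blast
  with \<phi>(2) have "\<forall>a\<in>carrier A. \<forall>b\<in>carrier B. h (pure A B a b) = \<beta> a b"
    by (simp add: pure_def keys_frag_of)
  with \<open>h \<in> hom (tensor A B) C\<close> show ?thesis by blast
qed

end

lemma frag_extend_hom:
  assumes "\<And>a. a \<in> S \<Longrightarrow> Poly_Mapping.keys (f a) \<subseteq> S'"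
  shows "frag_extend f \<in> hom (free_Abelian_group S) (free_Abelian_group S')"
proof (rule homI)
  fix x assume "x \<in> carrier (free_Abelian_group S)"
  then show "frag_extend f x \<in> carrier (free_Abelian_group S')"
    using keys_frag_extend[of f x] assms by fastforce
qed (simp add: frag_extend_add)

text \<open>The union in \<open>tensor_map\<close> collapses because every representative of
  \<open>t\<close> contributes the same coset, namely the value at \<open>t\<close> of the
  homomorphism supplied by \<open>tensor_lift\<close>.\<close>

lemma tensor_map:
  assumes "comm_group A" "comm_group B" "comm_group A'" "comm_group B'" "f \<in> hom A A'" "h \<in> hom B B'"
  shows tensor_map_hom: "tensor_map A' B' f h \<in> hom (tensor A B) (tensor A' B')"
    and tensor_map_pure: "a \<in> carrier A \<Longrightarrow> b \<in> carrier B \<Longrightarrow>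
      tensor_map A' B' f h (pure A B a b) = pure A' B' (f a) (h b)"
proof -
  interpret T: tensor_groups A B using assms by (simp add: tensor_groups_def)
  interpret T': tensor_groups A' B' using assms by (simp add: tensor_groups_def)
  have fc: "f a \<in> carrier A'" if "a \<in> carrier A" for a using assms(5) that by (rule hom_in_carrier)
  have hc: "h b \<in> carrier B'" if "b \<in> carrier B" for b using assms(6) that by (rule hom_in_carrier)
  let ?e = "frag_extend (\<lambda>(a, b). frag_of (f a, h b))"
  let ?\<phi> = "\<lambda>x. tensor_rel A' B' #>\<^bsub>tensor_free A' B'\<^esub> ?e x"
  have "?e \<in> hom (tensor_free A B) (tensor_free A' B')"
    by (rule frag_extend_hom) (auto simp: keys_frag_of fc hc)
  from hom_compose[OF this T'.class_hom] have \<phi>: "?\<phi> \<in> hom (tensor_free A B) (tensor A' B')"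
    by (simp add: comp_def)
  have bil: "bilinear_map A B (tensor A' B') (\<lambda>a b. pure A' B' (f a) (h b))"
    unfolding bilinear_map_def
  proof (intro conjI ballI)
    fix b assume "b \<in> carrier B"
    from hom_compose[OF assms(5) T'.pure_hom_left[OF hc[OF this]]]
    show "(\<lambda>a. pure A' B' (f a) (h b)) \<in> hom A (tensor A' B')" by (simp add: comp_def)
  next
    fix a assume "a \<in> carrier A"
    from hom_compose[OF assms(6) T'.pure_hom_right[OF fc[OF this]]]
    show "(\<lambda>b. pure A' B' (f a) (h b)) \<in> hom B (tensor A' B')" by (simp add: comp_def)
  qed
  have ph: "?\<phi> (frag_of (a, b)) = pure A' B' (f a) (h b)" for a b
    by (simp add: pure_def)
  obtain k where k: "k \<in> hom (tensor A B) (tensor A' B')"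
    "\<forall>x\<in>carrier (tensor_free A B). k (tensor_rel A B #>\<^bsub>tensor_free A B\<^esub> x) = ?\<phi> x"
    using T.tensor_lift[OF T'.T.comm_group_axioms bil \<phi> ph] by blast
  have kp: "k (pure A B a b) = pure A' B' (f a) (h b)" if "a \<in> carrier A" "b \<in> carrier B" for a b
    using k(2) that by (simp add: pure_def keys_frag_of)
  have eq: "tensor_map A' B' f h t = k t" if t: "t \<in> carrier (tensor A B)" for t
  proof -
    interpret F: comm_group "tensor_free A B" by (rule abelian_free_Abelian_group)
    obtain x where x: "x \<in> carrier (tensor_free A B)" "t = tensor_rel A B #>\<^bsub>tensor_free A B\<^esub> x"
      using T.tensor_class[OF t] by metis
    have "?\<phi> y = k t" if "y \<in> t" for y
    proof -
      have y: "y \<in> carrier (tensor_free A B)"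
        using that x F.r_coset_subset_G subgroup.subset[OF T.tensor_rel_subgroup] by blast
      moreover have "tensor_rel A B #>\<^bsub>tensor_free A B\<^esub> y = t"
        using F.repr_independence[of y "tensor_rel A B" x] that x T.tensor_rel_subgroup y by auto
      ultimately show ?thesis using k(2) by metis
    qed
    moreover have "x \<in> t" using F.rcos_self[OF x(1) T.tensor_rel_subgroup] x(2) by simp
    ultimately show ?thesis unfolding tensor_map_def by blast
  qed
  show "tensor_map A' B' f h \<in> hom (tensor A B) (tensor A' B')"
    using k(1) by (auto simp: hom_def Pi_iff eq)
  show "tensor_map A' B' f h (pure A B a b) = pure A' B' (f a) (h b)"
    if "a \<in> carrier A" "b \<in> carrier B"
    using that eq[OF T.pure_closed[OF that]] kp by simp
qed


lemma tensor_hom_eqI2: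
  assumes "comm_group A" "comm_group B" "t \<in> carrier (tensor A B)" "f \<in> hom (tensor A B) C" "h \<in> hom (tensor A B) C" "group C"
    and "\<And>a b. a \<in> carrier A \<Longrightarrow> b \<in> carrier B \<Longrightarrow> f (pure A B a b) = h (pure A B a b)"
  shows "f t = h t"
  using tensor_groups.tensor_hom_eqI[of A B t f C h] assms by (simp add: tensor_groups_def)

section \<open>Contraction of tensors with an integer functional\<close>

definition additive_on :: "'d monoid \<Rightarrow> ('d \<Rightarrow> int) \<Rightarrow> bool" where
  "additive_on L \<kappa> \<longleftrightarrow> (\<forall>x\<in>carrier L. \<forall>y\<in>carrier L. \<kappa> (x \<otimes>\<^bsub>L\<^esub> y) = \<kappa> x + \<kappa> y)"

text \<open>The map from A \<otimes> L to A \<otimes> Z = A induced by \<kappa>. The choice operator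
  picks the homomorphism provided by the universal property; additivity of \<kappa> guarantees that
  there is one.\<close>

definition tcontract :: "'c monoid \<Rightarrow> 'd monoid \<Rightarrow> ('d \<Rightarrow> int) \<Rightarrow> ('c \<times> 'd \<Rightarrow>\<^sub>0 int) set \<Rightarrow> 'c" where
  "tcontract A L \<kappa> = (SOME h. h \<in> hom (tensor A L) A \<and>
     (\<forall>a\<in>carrier A. \<forall>l\<in>carrier L. h (pure A L a l) = a [^]\<^bsub>A\<^esub> \<kappa> l))"

context
  fixes A :: "'c monoid" and L :: "'d monoid"
  assumes A: "comm_group A" and L: "comm_group L"
begin

interpretation tensor_groups A L
  using A L by (simp add: tensor_groups_def)

lemma tcontract:
  assumes "additive_on L \<kappa>"
  shows tcontract_hom: "tcontract A L \<kappa> \<in> hom (tensor A L) A"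
    and tcontract_pure: "a \<in> carrier A \<Longrightarrow> l \<in> carrier L \<Longrightarrow>
      tcontract A L \<kappa> (pure A L a l) = a [^]\<^bsub>A\<^esub> \<kappa> l"
proof -
  have "(\<lambda>a. a [^]\<^bsub>A\<^esub> \<kappa> l) \<in> hom A A" for l
    by (rule homI) (auto simp: A.int_pow_distrib)
  moreover have "(\<lambda>l. a [^]\<^bsub>A\<^esub> \<kappa> l) \<in> hom L A" if "a \<in> carrier A" for a
    using that assms by (intro homI) (auto simp: A.int_pow_mult additive_on_def)
  ultimately have "bilinear_map A L A (\<lambda>a l. a [^]\<^bsub>A\<^esub> \<kappa> l)"
    unfolding bilinear_map_def by blast
  from tensor_universal[OF A this] have "\<exists>h. h \<in> hom (tensor A L) A \<and>
     (\<forall>a\<in>carrier A. \<forall>l\<in>carrier L. h (pure A L a l) = a [^]\<^bsub>A\<^esub> \<kappa> l)"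
    by blast
  from someI_ex[OF this, folded tcontract_def] show "tcontract A L \<kappa> \<in> hom (tensor A L) A"
    "a \<in> carrier A \<Longrightarrow> l \<in> carrier L \<Longrightarrow> tcontract A L \<kappa> (pure A L a l) = a [^]\<^bsub>A\<^esub> \<kappa> l"
    by blast+
qed

lemma tcontract_closed: "additive_on L \<kappa> \<Longrightarrow> t \<in> carrier (tensor A L) \<Longrightarrow> tcontract A L \<kappa> t \<in> carrier A"
  using tcontract_hom hom_in_carrier by metis

lemma free_Abelian_group_expansion:
  assumes "Poly_Mapping.keys x \<subseteq> S"
  shows "x = finprod (free_Abelian_group S) (\<lambda>k. frag_of k [^]\<^bsub>free_Abelian_group S\<^esub> Poly_Mapping.lookup x k)
    (Poly_Mapping.keys x)"
proof -
  interpret F: comm_group "free_Abelian_group S" by (rule abelian_free_Abelian_group)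
  have "finprod (free_Abelian_group S) (\<lambda>k. frag_of k [^]\<^bsub>free_Abelian_group S\<^esub> Poly_Mapping.lookup x k) K
    = (\<Sum>k\<in>K. frag_cmul (Poly_Mapping.lookup x k) (frag_of k))" if "K \<subseteq> S" "finite K" for K
    using that(2,1)
  proof (induction K)
    case (insert k K)
    then have "frag_of i [^]\<^bsub>free_Abelian_group S\<^esub> Poly_Mapping.lookup x i \<in> carrier (free_Abelian_group S)"
      if "i \<in> insert k K" for i using that by (intro F.int_pow_closed) auto
    with insert show ?case
      by (subst F.finprod_insert) (auto simp: keys_frag_of)
  qed simp
  then show ?thesis
    using assms frag_expansion[of x] by (simp add: frag_extend_def)
qed

text \<open>Writes the class of a formal sum as a product of elementary tensors, so that any
  homomorphism can be evaluated on an arbitrary representative.\<close>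

lemma class_expansion:
  assumes "Poly_Mapping.keys x \<subseteq> carrier A \<times> carrier L"
  shows "tensor_rel A L #>\<^bsub>tensor_free A L\<^esub> x =
    finprod (tensor A L) (\<lambda>(a, l). pure A L a l [^]\<^bsub>tensor A L\<^esub> Poly_Mapping.lookup x (a, l)) (Poly_Mapping.keys x)"
proof -
  interpret F: comm_group "tensor_free A L" by (rule abelian_free_Abelian_group)
  have c: "frag_of k [^]\<^bsub>tensor_free A L\<^esub> Poly_Mapping.lookup x k \<in> carrier (tensor_free A L)"
    if "k \<in> Poly_Mapping.keys x" for k
    using assms that by (intro F.int_pow_closed) auto
  have "tensor_rel A L #>\<^bsub>tensor_free A L\<^esub> x = tensor_rel A L #>\<^bsub>tensor_free A L\<^esub>
      finprod (tensor_free A L) (\<lambda>k. frag_of k [^]\<^bsub>tensor_free A L\<^esub> Poly_Mapping.lookup x k) (Poly_Mapping.keys x)"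
    using free_Abelian_group_expansion[OF assms] by simp
  also have "\<dots> = finprod (tensor A L) (\<lambda>k. tensor_rel A L #>\<^bsub>tensor_free A L\<^esub>
      (frag_of k [^]\<^bsub>tensor_free A L\<^esub> Poly_Mapping.lookup x k)) (Poly_Mapping.keys x)"
    using c by (intro hom_finprod[OF class_hom F.comm_group_axioms T.comm_group_axioms]) auto
  also have "\<dots> = finprod (tensor A L) (\<lambda>(a, l). pure A L a l [^]\<^bsub>tensor A L\<^esub> Poly_Mapping.lookup x (a, l)) (Poly_Mapping.keys x)"
  proof (rule T.finprod_cong')
    fix k assume k: "k \<in> Poly_Mapping.keys x"
    then have "frag_of k \<in> carrier (tensor_free A L)" using assms by auto
    from hom_int_pow[OF class_hom this F.is_group T.is_group]
    show "tensor_rel A L #>\<^bsub>tensor_free A L\<^esub> (frag_of k [^]\<^bsub>tensor_free A L\<^esub> Poly_Mapping.lookup x k)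
      = (case k of (a, l) \<Rightarrow> pure A L a l [^]\<^bsub>tensor A L\<^esub> Poly_Mapping.lookup x (a, l))"
      by (cases k) (simp add: pure_def)
  qed (use assms in auto)
  finally show ?thesis .
qed

text \<open>The link with \<open>tensor_endo\<close>, which evaluates a formal sum: for \<kappa> the
  pairing with a fixed character the right-hand side is that expression, and the left-hand side
  shows its independence of the representative.\<close>

lemma tcontract_class:
  assumes "additive_on L \<kappa>" "t \<in> carrier (tensor A L)" "x \<in> t"
  shows "tcontract A L \<kappa> t = finprod A (\<lambda>(a, l). a [^]\<^bsub>A\<^esub> (Poly_Mapping.lookup x (a, l) * \<kappa> l)) (Poly_Mapping.keys x)"
proof -
  interpret F: comm_group "tensor_free A L" by (rule abelian_free_Abelian_group)
  obtain y where y: "y \<in> carrier (tensor_free A L)" "t = tensor_rel A L #>\<^bsub>tensor_free A L\<^esub> y"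
    using tensor_class[OF assms(2)] by metis
  have x: "x \<in> carrier (tensor_free A L)"
    using assms(3) y F.r_coset_subset_G subgroup.subset[OF tensor_rel_subgroup] by blast
  then have keys: "Poly_Mapping.keys x \<subseteq> carrier A \<times> carrier L" by simp
  have "t = tensor_rel A L #>\<^bsub>tensor_free A L\<^esub> x"
    using F.repr_independence[of x "tensor_rel A L" y] assms(3) x y tensor_rel_subgroup by auto
  also have "\<dots> = finprod (tensor A L) (\<lambda>(a, l). pure A L a l [^]\<^bsub>tensor A L\<^esub> Poly_Mapping.lookup x (a, l)) (Poly_Mapping.keys x)"
    by (rule class_expansion[OF keys])
  finally have "tcontract A L \<kappa> t = finprod A (\<lambda>k. tcontract A L \<kappa> (case k of (a, l) \<Rightarrow> pure A L a l [^]\<^bsub>tensor A L\<^esub> Poly_Mapping.lookup x (a, l))) (Poly_Mapping.keys x)"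
    using keys by (simp, intro hom_finprod[OF tcontract_hom[OF assms(1)] T.comm_group_axioms A]) auto
  also have "\<dots> = finprod A (\<lambda>(a, l). a [^]\<^bsub>A\<^esub> (Poly_Mapping.lookup x (a, l) * \<kappa> l)) (Poly_Mapping.keys x)"
  proof (rule A.finprod_cong')
    fix k assume "k \<in> Poly_Mapping.keys x"
    then obtain a l where k: "k = (a, l)" "a \<in> carrier A" "l \<in> carrier L" using keys by (cases k) auto
    then show "tcontract A L \<kappa> (case k of (a, l) \<Rightarrow> pure A L a l [^]\<^bsub>tensor A L\<^esub> Poly_Mapping.lookup x (a, l))
      = (case k of (a, l) \<Rightarrow> a [^]\<^bsub>A\<^esub> (Poly_Mapping.lookup x (a, l) * \<kappa> l))"
      using hom_int_pow[OF tcontract_hom[OF assms(1)] pure_closed[OF k(2,3)] T.is_group A.is_group]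
      by (simp add: tcontract_pure[OF assms(1)] A.int_pow_pow mult.commute)
  qed (use keys in auto)
  finally show ?thesis .
qed

end

text \<open>Used in two ways: with \<open>h\<close> the identity, to test tensors for exactness one
  contraction at a time, and with \<open>f\<close> and \<open>h\<close> the action of one Galois
  element, to see how contractions are permuted.\<close>

lemma tcontract_natural:
  assumes "comm_group A" "comm_group A'" "comm_group L" "comm_group L'" "f \<in> hom A A'" "h \<in> hom L L'"
    and "additive_on L \<kappa>" "additive_on L' \<kappa>'" "\<And>l. l \<in> carrier L \<Longrightarrow> \<kappa>' (h l) = \<kappa> l"
    and "t \<in> carrier (tensor A L)"
  shows "tcontract A' L' \<kappa>' (tensor_map A' L' f h t) = f (tcontract A L \<kappa> t)"
proof (rule tensor_hom_eqI2[OF assms(1,3,10)])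
  have A: "group A" "group A'" using assms by (simp_all add: comm_group_def)
  have fc: "f a \<in> carrier A'" if "a \<in> carrier A" for a using assms(5) that by (rule hom_in_carrier)
  have hc: "h a \<in> carrier L'" if "a \<in> carrier L" for a using assms(6) that by (rule hom_in_carrier)
  show "(\<lambda>t. tcontract A' L' \<kappa>' (tensor_map A' L' f h t)) \<in> hom (tensor A L) A'"
    using hom_compose[OF tensor_map_hom[OF assms(1,3,2,4,5,6)] tcontract_hom[OF assms(2,4,8)]]
    by (simp add: comp_def)
  show "(\<lambda>t. f (tcontract A L \<kappa> t)) \<in> hom (tensor A L) A'"
    using hom_compose[OF tcontract_hom[OF assms(1,3,7)] assms(5)] by (simp add: comp_def)
  show "tcontract A' L' \<kappa>' (tensor_map A' L' f h (pure A L a b)) = f (tcontract A L \<kappa> (pure A L a b))"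
    if "a \<in> carrier A" "b \<in> carrier L" for a b
    using that fc hc hom_int_pow[OF assms(5) that(1) A, of "\<kappa> b"]
    by (simp add: tensor_map_pure[OF assms(1,3,2,4,5,6)] tcontract_pure[OF assms(2,4,8)]
        tcontract_pure[OF assms(1,3,7)] assms(9))
qed (use assms in \<open>simp add: comm_group_def\<close>)

lemma hom_id: "(\<lambda>x. x) \<in> hom G G"
  by (simp add: hom_def)

text \<open>
  A group with dual bases is finitely generated projective.  Tensoring with it is exact because a
  tensor is recovered from its contractions with the functionals \<open>\<kappa> i\<close>, which are natural in the
  other factor.
\<close>

definition dual_bases :: "'d monoid \<Rightarrow> 'i set \<Rightarrow> ('i \<Rightarrow> 'd) \<Rightarrow> ('i \<Rightarrow> 'd \<Rightarrow> int) \<Rightarrow> bool" where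
  "dual_bases L I e \<kappa> \<longleftrightarrow> finite I \<and> e \<in> I \<rightarrow> carrier L \<and> (\<forall>i\<in>I. additive_on L (\<kappa> i)) \<and>
     (\<forall>l\<in>carrier L. l = finprod L (\<lambda>i. e i [^]\<^bsub>L\<^esub> \<kappa> i l) I)"

text \<open>Both sides are homomorphisms in \<open>t\<close>. On an elementary tensor one expands
  \<open>l\<close> in the dual bases and moves the integer exponents across the tensor sign to the
  first factor.\<close>

lemma tensor_dual_bases:
  assumes "comm_group A" "comm_group L" "dual_bases L I e \<kappa>" "t \<in> carrier (tensor A L)"
  shows "t = finprod (tensor A L) (\<lambda>i. pure A L (tcontract A L (\<kappa> i) t) (e i)) I"
proof -
  interpret tensor_groups A L using assms by (simp add: tensor_groups_def)
  have e: "e i \<in> carrier L" "additive_on L (\<kappa> i)" if "i \<in> I" for i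
    using assms(3) that by (auto simp: dual_bases_def)
  show ?thesis
  proof (rule tensor_hom_eqI[OF assms(4) hom_id _ T.is_group])
    have *: "(\<lambda>t. pure A L (tcontract A L (\<kappa> i) t) (e i)) \<in> hom (tensor A L) (tensor A L)" if "i \<in> I" for i
      using hom_compose[OF tcontract_hom[OF assms(1,2) e(2)] pure_hom_left[OF e(1)]] that
      by (simp add: comp_def)
    show "(\<lambda>t. finprod (tensor A L) (\<lambda>i. pure A L (tcontract A L (\<kappa> i) t) (e i)) I) \<in> hom (tensor A L) (tensor A L)"
      by (rule hom_finprod_fun[OF T.comm_group_axioms *])
    fix a l assume a: "a \<in> carrier A" and l: "l \<in> carrier L"
    have "pure A L a l = pure A L a (finprod L (\<lambda>i. e i [^]\<^bsub>L\<^esub> \<kappa> i l) I)"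
      using assms(3) l by (simp add: dual_bases_def)
    also have "\<dots> = finprod (tensor A L) (\<lambda>i. pure A L a (e i [^]\<^bsub>L\<^esub> \<kappa> i l)) I"
      using e by (intro hom_finprod[OF pure_hom_right[OF a] assms(2) T.comm_group_axioms]) auto
    also have "\<dots> = finprod (tensor A L) (\<lambda>i. pure A L (tcontract A L (\<kappa> i) (pure A L a l)) (e i)) I"
      using a l e by (intro T.finprod_cong') (auto simp: tcontract_pure[OF assms(1,2)] pure_int_pow)
    finally show "pure A L a l = finprod (tensor A L) (\<lambda>i. pure A L (tcontract A L (\<kappa> i) (pure A L a l)) (e i)) I" .
  qed
qed

context
  fixes A :: "'c monoid" and L :: "'d monoid" and I :: "'i set" and e \<kappa>
  assumes A: "comm_group A" and L: "comm_group L" and db: "dual_bases L I e \<kappa>"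
begin

interpretation tensor_groups A L
  using A L by (simp add: tensor_groups_def)

lemma tensor_eqI:
  assumes "t \<in> carrier (tensor A L)" "t' \<in> carrier (tensor A L)"
    "\<And>i. i \<in> I \<Longrightarrow> tcontract A L (\<kappa> i) t = tcontract A L (\<kappa> i) t'"
  shows "t = t'"
proof -
  have "t = finprod (tensor A L) (\<lambda>i. pure A L (tcontract A L (\<kappa> i) t) (e i)) I"
    by (rule tensor_dual_bases[OF A L db assms(1)])
  also have "\<dots> = finprod (tensor A L) (\<lambda>i. pure A L (tcontract A L (\<kappa> i) t') (e i)) I"
    using db assms(2,3) tcontract_closed[OF A L]
    by (intro T.finprod_cong') (auto simp: dual_bases_def Pi_iff)
  also have "\<dots> = t'" by (rule tensor_dual_bases[OF A L db assms(2), symmetric])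
  finally show ?thesis .
qed

text \<open>The contractions determine a tensor, and under contraction the tensored map turns into
  \<open>f\<close> itself.\<close>

lemma tensor_map_left_inj:
  assumes A': "comm_group A'" and f: "f \<in> hom A A'" "inj_on f (carrier A)"
  shows "inj_on (tensor_map A' L f (\<lambda>l. l)) (carrier (tensor A L))"
proof (rule inj_onI, rule tensor_eqI)
  fix t t' i assume t: "t \<in> carrier (tensor A L)" "t' \<in> carrier (tensor A L)" "i \<in> I"
    and eq: "tensor_map A' L f (\<lambda>l. l) t = tensor_map A' L f (\<lambda>l. l) t'"
  have \<kappa>: "additive_on L (\<kappa> i)" using db t by (simp add: dual_bases_def)
  have "f (tcontract A L (\<kappa> i) t) = f (tcontract A L (\<kappa> i) t')"
    using t eq tcontract_natural[OF A A' L L f(1) hom_id \<kappa> \<kappa>] by metis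
  then show "tcontract A L (\<kappa> i) t = tcontract A L (\<kappa> i) t'"
    using f(2) t tcontract_closed[OF A L \<kappa>] by (meson inj_onD)
qed

text \<open>Each contraction of \<open>t\<close> lies in the kernel of \<open>f\<close>, hence
  equals some \<open>k (b i)\<close>. Reassembling the elementary tensors of \<open>b i\<close> with
  \<open>e i\<close> gives a preimage of \<open>t\<close>.\<close>

lemma tensor_map_left_exact:
  assumes A': "comm_group A'" and f: "f \<in> hom A A'"
    and B: "comm_group B" "k \<in> hom B A"
    and ker: "\<And>a. a \<in> carrier A \<Longrightarrow> f a = \<one>\<^bsub>A'\<^esub> \<Longrightarrow> a \<in> k ` carrier B"
    and t: "t \<in> carrier (tensor A L)" "tensor_map A' L f (\<lambda>l. l) t = \<one>\<^bsub>tensor A' L\<^esub>"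
  shows "t \<in> tensor_map A L k (\<lambda>l. l) ` carrier (tensor B L)"
proof -
  interpret B: tensor_groups B L using B L by (simp add: tensor_groups_def)
  interpret A': tensor_groups A' L using A' L by (simp add: tensor_groups_def)
  have "\<exists>b. b \<in> carrier B \<and> tcontract A L (\<kappa> i) t = k b" if "i \<in> I" for i
  proof -
    have \<kappa>: "additive_on L (\<kappa> i)" using db that by (simp add: dual_bases_def)
    have "f (tcontract A L (\<kappa> i) t) = tcontract A' L (\<kappa> i) \<one>\<^bsub>tensor A' L\<^esub>"
      using t tcontract_natural[OF A A' L L f(1) hom_id \<kappa> \<kappa>] by metis
    also have "\<dots> = \<one>\<^bsub>A'\<^esub>"
      by (rule hom_one[OF tcontract_hom[OF A' L \<kappa>] A'.T.is_group A'.A.is_group])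
    finally show ?thesis using ker tcontract_closed[OF A L \<kappa> t(1)] by blast
  qed
  then obtain b where b: "\<And>i. i \<in> I \<Longrightarrow> b i \<in> carrier B \<and> tcontract A L (\<kappa> i) t = k (b i)" by metis
  have e: "e i \<in> carrier L" if "i \<in> I" for i using db that by (auto simp: dual_bases_def)
  have "tensor_map A L k (\<lambda>l. l) (finprod (tensor B L) (\<lambda>i. pure B L (b i) (e i)) I)
    = finprod (tensor A L) (\<lambda>i. tensor_map A L k (\<lambda>l. l) (pure B L (b i) (e i))) I"
    using b e by (intro hom_finprod[OF tensor_map_hom[OF B(1) L A L B(2) hom_id] B.T.comm_group_axioms T.comm_group_axioms]) auto
  also have "\<dots> = finprod (tensor A L) (\<lambda>i. pure A L (tcontract A L (\<kappa> i) t) (e i)) I"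
    using b e hom_in_carrier[OF B(2)]
    by (intro T.finprod_cong') (auto simp: tensor_map_pure[OF B(1) L A L B(2) hom_id])
  also have "\<dots> = t" by (rule tensor_dual_bases[OF A L db t(1), symmetric])
  finally show ?thesis
    using b e by (intro image_eqI[OF sym]) (auto intro!: B.T.finprod_closed)
qed

end

lemma tensor_map_surj:
  assumes "comm_group A" "comm_group A'" "comm_group L" "f \<in> hom A A'" "f ` carrier A = carrier A'"
    and "t \<in> carrier (tensor A' L)"
  shows "t \<in> tensor_map A' L f (\<lambda>l. l) ` carrier (tensor A L)"
proof -
  interpret A: tensor_groups A L using assms by (simp add: tensor_groups_def)
  interpret A': tensor_groups A' L using assms by (simp add: tensor_groups_def)
  note h = tensor_map_hom[OF assms(1,3,2,3,4) hom_id]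
  interpret h: group_hom "tensor A L" "tensor A' L" "tensor_map A' L f (\<lambda>l. l)"
    using h by unfold_locales
  show ?thesis
    using assms(6)
  proof (induction rule: A'.tensor_induct)
    case one then show ?case using h.hom_one A.T.one_closed by (metis imageI)
  next
    case (pure a b)
    then obtain a' where "a' \<in> carrier A" "a = f a'" using assms(5) by blast
    then show ?case using pure tensor_map_pure[OF assms(1,3,2,3,4) hom_id, of a' b]
      by (intro image_eqI[of _ _ "pure A L a' b"]) auto
  next
    case (diff s t)
    then obtain s' t' where "s' \<in> carrier (tensor A L)" "t' \<in> carrier (tensor A L)"
      "s = tensor_map A' L f (\<lambda>l. l) s'" "t = tensor_map A' L f (\<lambda>l. l) t'" by blast
    then show ?case
      by (intro image_eqI[of _ _ "s' \<otimes>\<^bsub>tensor A L\<^esub> inv\<^bsub>tensor A L\<^esub> t'"]) auto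
  qed
qed

text \<open>
  The functional \<open>w q\<close> contracts \<open>t \<in> A \<otimes> N\<close> to an element of \<open>A\<close> depending additively on \<open>q \<in> P\<close>.
  When \<open>N\<close> is dual to \<open>P\<close> this is the isomorphism \<open>A \<otimes> N = Hom(P, A)\<close>, and \<open>tcup\<close> is the product
  \<open>Hom(P, A) \<times> (P \<otimes> L) \<rightarrow> A \<otimes> L\<close>.
\<close>

definition tcup where
  "tcup A N L w t p = tensor_map A L (\<lambda>q. tcontract A N (w q) t) (\<lambda>l. l) p"

definition biadditive :: "'p monoid \<Rightarrow> 'd monoid \<Rightarrow> ('p \<Rightarrow> 'd \<Rightarrow> int) \<Rightarrow> bool" where
  "biadditive P N w \<longleftrightarrow> (\<forall>q\<in>carrier P. additive_on N (w q)) \<and>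
     (\<forall>q\<in>carrier P. \<forall>q'\<in>carrier P. \<forall>x\<in>carrier N. w (q \<otimes>\<^bsub>P\<^esub> q') x = w q x + w q' x)"

lemma biadditive_additive: "biadditive P N w \<Longrightarrow> q \<in> carrier P \<Longrightarrow> additive_on N (w q)"
  by (simp add: biadditive_def)

context
  fixes P :: "'p monoid" and N :: "'d monoid" and L :: "'l monoid" and w
  assumes P: "comm_group P" and N: "comm_group N" and L: "comm_group L" and w: "biadditive P N w"
begin

text \<open>Turns \<open>t\<close> into a genuine homomorphism from P to A, which is what allows
  \<open>tcup\<close> to be formed as a \<open>tensor_map\<close>. On elementary tensors, additivity
  in \<open>q\<close> is addition of exponents.\<close>

lemma tcontract_hom_pairing:
  assumes A: "comm_group A" and t: "t \<in> carrier (tensor A N)"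
  shows "(\<lambda>q. tcontract A N (w q) t) \<in> hom P A"
proof (rule homI)
  interpret A: comm_group A by fact
  interpret P: comm_group P by (rule P)
  fix q q' assume q: "q \<in> carrier P" "q' \<in> carrier P"
  note add = biadditive_additive[OF w q(1)] biadditive_additive[OF w q(2)]
    biadditive_additive[OF w P.m_closed[OF q]]
  show "tcontract A N (w (q \<otimes>\<^bsub>P\<^esub> q')) t = tcontract A N (w q) t \<otimes>\<^bsub>A\<^esub> tcontract A N (w q') t"
  proof (rule tensor_hom_eqI2[OF A N t _ _ A.is_group])
    show "tcontract A N (w (q \<otimes>\<^bsub>P\<^esub> q')) \<in> hom (tensor A N) A"
      "(\<lambda>t. tcontract A N (w q) t \<otimes>\<^bsub>A\<^esub> tcontract A N (w q') t) \<in> hom (tensor A N) A"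
      using add tcontract_hom[OF A N] by (auto intro!: hom_mult_fun[OF A])
    fix a b assume "a \<in> carrier A" "b \<in> carrier N"
    then show "tcontract A N (w (q \<otimes>\<^bsub>P\<^esub> q')) (pure A N a b) =
        tcontract A N (w q) (pure A N a b) \<otimes>\<^bsub>A\<^esub> tcontract A N (w q') (pure A N a b)"
      using add q w by (simp add: tcontract_pure[OF A N] biadditive_def A.int_pow_mult)
  qed
qed (use tcontract_closed[OF A N] t biadditive_additive[OF w] in blast)

lemma tcup_hom_right:
  assumes "comm_group A" "t \<in> carrier (tensor A N)"
  shows "tcup A N L w t \<in> hom (tensor P L) (tensor A L)"
  unfolding tcup_def[abs_def]
  by (rule tensor_map_hom[OF P L assms(1) L tcontract_hom_pairing[OF assms] hom_id])

lemma tcup_pure: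
  assumes "comm_group A" "t \<in> carrier (tensor A N)" "q \<in> carrier P" "l \<in> carrier L"
  shows "tcup A N L w t (pure P L q l) = pure A L (tcontract A N (w q) t) l"
  unfolding tcup_def
  by (rule tensor_map_pure[OF P L assms(1) L tcontract_hom_pairing[OF assms(1,2)] hom_id assms(3,4)])

lemma tcup_closed:
  assumes "comm_group A" "t \<in> carrier (tensor A N)" "p \<in> carrier (tensor P L)"
  shows "tcup A N L w t p \<in> carrier (tensor A L)"
  using tcup_hom_right[OF assms(1,2)] assms(3) by (rule hom_in_carrier)

lemma tcup_mult_left:
  assumes A: "comm_group A" and t: "t \<in> carrier (tensor A N)" "t' \<in> carrier (tensor A N)" and p: "p \<in> carrier (tensor P L)"
  shows "tcup A N L w (t \<otimes>\<^bsub>tensor A N\<^esub> t') p = tcup A N L w t p \<otimes>\<^bsub>tensor A L\<^esub> tcup A N L w t' p"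
proof -
  interpret AN: tensor_groups A N using A N by (simp add: tensor_groups_def)
  interpret AL: tensor_groups A L using A L by (simp add: tensor_groups_def)
  show ?thesis
  proof (rule tensor_hom_eqI2[OF P L p _ _ AL.T.is_group])
    show "tcup A N L w (t \<otimes>\<^bsub>tensor A N\<^esub> t') \<in> hom (tensor P L) (tensor A L)"
      using A t by (intro tcup_hom_right) auto
    show "(\<lambda>p. tcup A N L w t p \<otimes>\<^bsub>tensor A L\<^esub> tcup A N L w t' p) \<in> hom (tensor P L) (tensor A L)"
      using A t by (intro hom_mult_fun AL.T.comm_group_axioms tcup_hom_right) auto
    fix q l assume ql: "q \<in> carrier P" "l \<in> carrier L"
    note add = biadditive_additive[OF w ql(1)]
    show "tcup A N L w (t \<otimes>\<^bsub>tensor A N\<^esub> t') (pure P L q l) =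
        tcup A N L w t (pure P L q l) \<otimes>\<^bsub>tensor A L\<^esub> tcup A N L w t' (pure P L q l)"
      using t ql tcontract_closed[OF A N add] hom_mult[OF tcontract_hom[OF A N add]]
      by (simp add: tcup_pure[OF A] AL.pure_mult_left)
  qed
qed

text \<open>The four maps are kept independent so that one statement serves two purposes: with
  \<rho>, \<nu>, \<open>l\<close> identities it gives compatibility with the maps of the Picard
  sequence, and with all four the action of one group element it gives equivariance. The condition
  on \<open>w\<close> says that contracting the moved tensor at \<rho> q is \<open>f\<close> of the
  contraction at \<open>q\<close>.\<close>

lemma tcup_natural:
  assumes A: "comm_group A" and A': "comm_group A'" and f: "f \<in> hom A A'"
    and t: "t \<in> carrier (tensor A N)" and p: "p \<in> carrier (tensor P L)"
    and \<rho>: "\<rho> \<in> hom P P" and \<nu>: "\<nu> \<in> hom N N" and hl: "l \<in> hom L L"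
    and inv: "\<And>q x. q \<in> carrier P \<Longrightarrow> x \<in> carrier N \<Longrightarrow> w (\<rho> q) (\<nu> x) = w q x"
  shows "tensor_map A' L f l (tcup A N L w t p)
    = tcup A' N L w (tensor_map A' N f \<nu> t) (tensor_map P L \<rho> l p)"
proof -
  interpret AL: tensor_groups A' L using A' L by (simp add: tensor_groups_def)
  have t': "tensor_map A' N f \<nu> t \<in> carrier (tensor A' N)"
    using tensor_map_hom[OF A N A' N f \<nu>] t by (rule hom_in_carrier)
  show ?thesis
  proof (rule tensor_hom_eqI2[OF P L p _ _ AL.T.is_group])
    show "(\<lambda>p. tensor_map A' L f l (tcup A N L w t p)) \<in> hom (tensor P L) (tensor A' L)"
      using hom_compose[OF tcup_hom_right[OF A t] tensor_map_hom[OF A L A' L f hl]] by (simp add: comp_def)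
    show "(\<lambda>p. tcup A' N L w (tensor_map A' N f \<nu> t) (tensor_map P L \<rho> l p)) \<in> hom (tensor P L) (tensor A' L)"
      using hom_compose[OF tensor_map_hom[OF P L P L \<rho> hl] tcup_hom_right[OF A' t']] by (simp add: comp_def)
    fix q b assume qb: "q \<in> carrier P" "b \<in> carrier L"
    have q': "\<rho> q \<in> carrier P" using \<rho> qb(1) by (rule hom_in_carrier)
    have b': "l b \<in> carrier L" using hl qb(2) by (rule hom_in_carrier)
    note add = biadditive_additive[OF w qb(1)] and add' = biadditive_additive[OF w q']
    have "tcontract A' N (w (\<rho> q)) (tensor_map A' N f \<nu> t) = f (tcontract A N (w q) t)"
      by (rule tcontract_natural[OF A A' N N f \<nu> add add' inv[OF qb(1)] t])
    then show "tensor_map A' L f l (tcup A N L w t (pure P L q b)) =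
        tcup A' N L w (tensor_map A' N f \<nu> t) (tensor_map P L \<rho> l (pure P L q b))"
      using t t' qb q' b' tcontract_closed[OF A N add]
      by (simp add: tcup_pure A A' tensor_map_pure[OF P L P L \<rho> hl] tensor_map_pure[OF A L A' L f hl])
  qed
qed

text \<open>A tensor whose contractions are the identity of P acts on P \<otimes> L as the identity
  tensored with the identity. It later shows that the lift built from a lift of the identity really
  lifts the given cocycle.\<close>

lemma tcup_identity:
  assumes t: "t \<in> carrier (tensor P N)" and p: "p \<in> carrier (tensor P L)"
    and id: "\<And>q. q \<in> carrier P \<Longrightarrow> tcontract P N (w q) t = q"
  shows "tcup P N L w t p = p"
proof -
  interpret PL: tensor_groups P L using P L by (simp add: tensor_groups_def)
  show ?thesis
    by (rule PL.tensor_hom_eqI[OF p tcup_hom_right[OF P t] hom_id PL.T.is_group])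
       (simp add: tcup_pure[OF P t] id)
qed

end

section \<open>Continuous cochains\<close>

lemma hom_inv_image:
  assumes "h \<in> hom G H" "group G" "group H" "x \<in> carrier G"
  shows "h (inv\<^bsub>G\<^esub> x) = inv\<^bsub>H\<^esub> h x"
proof -
  interpret group_hom G H h
    using assms by (simp add: group_hom_def group_hom_axioms_def)
  show ?thesis using assms by simp
qed

section \<open>Tuples of group elements and their faces\<close>

lemma tuples_0 [simp]: "tuples G 0 = {[]}"
  by (auto simp: tuples_def)

lemma tuples_Suc: "gs \<in> tuples G (Suc n) \<longleftrightarrow> (\<exists>g hs. gs = g # hs \<and> g \<in> G \<and> hs \<in> tuples G n)"
  by (cases gs) (auto simp: tuples_def)

lemma tuples_length: "gs \<in> tuples G n \<Longrightarrow> length gs = n"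
  by (simp add: tuples_def)

lemma tuples_nth: "gs \<in> tuples G n \<Longrightarrow> i < n \<Longrightarrow> gs ! i \<in> G"
  by (auto simp: tuples_def)

lemma hd_tuples [simp]: "gs \<in> tuples G (Suc n) \<Longrightarrow> hd gs \<in> G"
  and tl_tuples [simp]: "gs \<in> tuples G (Suc n) \<Longrightarrow> tl gs \<in> tuples G n"
  by (auto simp: tuples_Suc)

lemma butlast_tuples [simp]: "gs \<in> tuples G (Suc n) \<Longrightarrow> butlast gs \<in> tuples G n"
  by (auto simp: tuples_def dest: in_set_butlastD)

lemma length_merge: "i \<ge> 1 \<Longrightarrow> i < length gs \<Longrightarrow> length (merge i gs) = length gs - 1"
  by (simp add: merge_def)

lemma nth_merge:
  assumes "i \<ge> 1" "i < length gs" "k < length gs - 1"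
  shows "merge i gs ! k =
    (if k < i - 1 then gs ! k else if k = i - 1 then gs ! (i - 1) \<circ> gs ! i else gs ! Suc k)"
proof -
  consider "k < i - 1" | "k = i - 1" | m where "k = i + m"
    by (metis One_nat_def Suc_pred assms(1) le_Suc_ex less_Suc_eq_le linorder_neqE_nat not_less not_less_eq le_neq_implies_less Suc_leI)
  then show ?thesis
    by cases (use assms in \<open>auto simp: merge_def nth_append nth_Cons Suc_diff_le split: nat.split\<close>)
qed

text \<open>The simplicial identity for two inner faces. Away from each other the two merges do not
  interact; for j = i + 1 three entries are composed and the claim is associativity.\<close>

lemma merge_merge:
  assumes "i \<ge> 1" "i < j" "j < length gs"
  shows "merge i (merge j gs) = merge (j - 1) (merge i gs)"
proof (rule nth_equalityI)
  show "length (merge i (merge j gs)) = length (merge (j - 1) (merge i gs))"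
    using assms by (simp add: length_merge)
  fix k assume "k < length (merge i (merge j gs))"
  then have k: "k < length gs - 2" using assms by (simp add: length_merge)
  have l: "length (merge i gs) = length gs - 1" "length (merge j gs) = length gs - 1"
    using assms by (simp_all add: length_merge)
  obtain a where a: "i = Suc a" using assms(1) by (cases i) auto
  obtain m where m: "j = Suc (Suc (a + m))" using assms(2) a less_imp_Suc_add by blast
  \<comment> \<open>Positions of an entry relative to the two merged places; \<open>m = 0\<close> is
    the case of overlapping merges.\<close>
  consider "k < a" | "k = a" "m = 0" | "k = a" "m > 0" | "a < k" "k < a + m" | "a < k" "k = a + m" | "a + m < k"
    by linarith
  then show "merge i (merge j gs) ! k = merge (j - 1) (merge i gs) ! k"
    using k assms(3) unfolding a m by cases (simp_all add: nth_merge length_merge comp_assoc)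
qed

lemma merge_butlast:
  assumes "i \<ge> 1" "Suc i < length gs"
  shows "merge i (butlast gs) = butlast (merge i gs)"
proof (rule nth_equalityI)
  fix k assume "k < length (merge i (butlast gs))"
  then have "k < length gs - 2" using assms by (simp add: length_merge)
  then show "merge i (butlast gs) ! k = butlast (merge i gs) ! k"
    using assms by (simp add: nth_merge length_merge nth_butlast)
qed (use assms in \<open>simp add: length_merge\<close>)

lemma butlast_merge:
  assumes "length gs = Suc (Suc n)"
  shows "butlast (merge (Suc n) gs) = butlast (butlast gs)"
proof (rule nth_equalityI)
  fix k assume "k < length (butlast (merge (Suc n) gs))"
  then have "k < n" using assms by (simp add: length_merge)
  then show "butlast (merge (Suc n) gs) ! k = butlast (butlast gs) ! k"
    using assms by (simp add: nth_merge length_merge nth_butlast)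
qed (use assms in \<open>simp add: length_merge\<close>)

lemma merge_tuples:
  assumes "\<And>g h. g \<in> G \<Longrightarrow> h \<in> G \<Longrightarrow> g \<circ> h \<in> G" "gs \<in> tuples G (Suc n)" "i \<ge> 1" "i \<le> n"
  shows "merge i gs \<in> tuples G n"
proof -
  have l: "length gs = Suc n" using assms by (simp add: tuples_def)
  have "merge i gs ! k \<in> G" if "k < n" for k
    using assms l that by (auto simp: nth_merge tuples_nth[OF assms(2)])
  then show ?thesis
    using l assms(3,4) by (auto simp: tuples_def length_merge in_set_conv_nth)
qed

text \<open>The continuity clause of \<open>cochains\<close>, separated from the target group and
  from extensionality so that it applies to functions with values in any type.\<close>

definition loc_const :: "('a \<Rightarrow> 'a) set \<Rightarrow> nat \<Rightarrow> (('a \<Rightarrow> 'a) list \<Rightarrow> 'c) \<Rightarrow> bool" where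
  "loc_const G n c \<longleftrightarrow> (\<forall>gs\<in>tuples G n. \<exists>F. finite F \<and>
     (\<forall>hs\<in>tuples G n. (\<forall>i<n. \<forall>x\<in>F. (hs ! i) x = (gs ! i) x) \<longrightarrow> c hs = c gs))"

lemma cochains_iff: "c \<in> cochains G n M \<longleftrightarrow> c \<in> tuples G n \<rightarrow>\<^sub>E carrier (grp M) \<and> loc_const G n c"
  by (simp add: cochains_def loc_const_def)

lemma loc_const_cong:
  assumes "loc_const G n c" "\<And>gs. gs \<in> tuples G n \<Longrightarrow> c gs = d gs"
  shows "loc_const G n d"
  using assms unfolding loc_const_def by metis

lemma loc_const_comp: "loc_const G n c \<Longrightarrow> loc_const G n (\<lambda>gs. \<phi> (c gs))"
  unfolding loc_const_def by metis

lemma loc_const_Pair: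
  assumes "loc_const G n c" "loc_const G n d"
  shows "loc_const G n (\<lambda>gs. (c gs, d gs))"
  unfolding loc_const_def
proof
  fix gs assume gs: "gs \<in> tuples G n"
  obtain E where E: "finite E" "\<And>hs. hs \<in> tuples G n \<Longrightarrow> \<forall>i<n. \<forall>x\<in>E. (hs ! i) x = (gs ! i) x \<Longrightarrow> c hs = c gs"
    using assms(1) gs unfolding loc_const_def by metis
  obtain F where F: "finite F" "\<And>hs. hs \<in> tuples G n \<Longrightarrow> \<forall>i<n. \<forall>x\<in>F. (hs ! i) x = (gs ! i) x \<Longrightarrow> d hs = d gs"
    using assms(2) gs unfolding loc_const_def by metis
  show "\<exists>F. finite F \<and> (\<forall>hs\<in>tuples G n. (\<forall>i<n. \<forall>x\<in>F. (hs ! i) x = (gs ! i) x) \<longrightarrow> (c hs, d hs) = (c gs, d gs))"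
    using E F by (intro exI[of _ "E \<union> F"]) auto
qed

lemma loc_const_comp2:
  assumes "loc_const G n c" "loc_const G n d"
  shows "loc_const G n (\<lambda>gs. \<phi> (c gs) (d gs))"
  using loc_const_comp[OF loc_const_Pair[OF assms], of "case_prod \<phi>"] by simp

text \<open>Packs finitely many locally constant functions, later the faces of a cochain, into a
  single one, to which an arbitrary function of the whole family can then be applied. The
  restriction to \<open>I\<close> makes the packed value depend on these members alone.\<close>

lemma loc_const_family:
  assumes "finite I" "\<And>i. i \<in> I \<Longrightarrow> loc_const G n (c i)"
  shows "loc_const G n (\<lambda>gs. \<lambda>i\<in>I. c i gs)"
  using assms
proof (induction I)
  case empty
  then show ?case by (simp add: loc_const_def) blast
next
  case (insert i I)
  have "loc_const G n (\<lambda>gs. (\<lambda>j\<in>I. c j gs)(i := c i gs))"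
    by (rule loc_const_comp2[where \<phi>="\<lambda>f x. f(i := x)", OF insert.IH insert.prems]) (simp_all add: insert.prems)
  then show ?case
    by (rule loc_const_cong) (auto simp: fun_eq_iff)
qed

text \<open>Precomposition with a continuous map of tuples; the last hypothesis is continuity of
  \<open>s\<close> in terms of the finite sets defining the Krull topology.\<close>

lemma loc_const_subst:
  assumes "loc_const G n c" "s \<in> tuples G m \<rightarrow> tuples G n"
    and "\<And>gs F. gs \<in> tuples G m \<Longrightarrow> finite F \<Longrightarrow> \<exists>F'. finite F' \<and> (\<forall>hs\<in>tuples G m.
      (\<forall>i<m. \<forall>x\<in>F'. (hs ! i) x = (gs ! i) x) \<longrightarrow> (\<forall>i<n. \<forall>x\<in>F. (s hs ! i) x = (s gs ! i) x))"
  shows "loc_const G m (\<lambda>gs. c (s gs))"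
  unfolding loc_const_def
proof
  fix gs assume gs: "gs \<in> tuples G m"
  then have sgs: "s gs \<in> tuples G n" using assms(2) by blast
  obtain F where F: "finite F" "\<And>hs. hs \<in> tuples G n \<Longrightarrow> \<forall>i<n. \<forall>x\<in>F. (hs ! i) x = (s gs ! i) x \<Longrightarrow> c hs = c (s gs)"
    using assms(1) sgs unfolding loc_const_def by metis
  obtain F' where "finite F'" "\<forall>hs\<in>tuples G m.
      (\<forall>i<m. \<forall>x\<in>F'. (hs ! i) x = (gs ! i) x) \<longrightarrow> (\<forall>i<n. \<forall>x\<in>F. (s hs ! i) x = (s gs ! i) x)"
    using assms(3)[OF gs F(1)] by blast
  then show "\<exists>F. finite F \<and> (\<forall>hs\<in>tuples G m. (\<forall>i<m. \<forall>x\<in>F. (hs ! i) x = (gs ! i) x) \<longrightarrow> c (s hs) = c (s gs))"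
    using F(2) assms(2) by (intro exI[of _ F']) blast
qed

lemma loc_const_tl:
  assumes "loc_const G n c"
  shows "loc_const G (Suc n) (\<lambda>gs. c (tl gs))"
proof (rule loc_const_subst[OF assms])
  fix gs :: "('a \<Rightarrow> 'a) list" and F :: "'a set" assume "gs \<in> tuples G (Suc n)" "finite F"
  then show "\<exists>F'. finite F' \<and> (\<forall>hs\<in>tuples G (Suc n).
      (\<forall>i<Suc n. \<forall>x\<in>F'. (hs ! i) x = (gs ! i) x) \<longrightarrow> (\<forall>i<n. \<forall>x\<in>F. (tl hs ! i) x = (tl gs ! i) x))"
    by (intro exI[of _ F]) (auto simp: nth_tl tuples_length)
qed auto

lemma loc_const_hd:
  assumes "loc_const G 1 c"
  shows "loc_const G (Suc n) (\<lambda>gs. c [hd gs])"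
proof (rule loc_const_subst[OF assms])
  fix gs :: "('a \<Rightarrow> 'a) list" and F :: "'a set" assume "gs \<in> tuples G (Suc n)" "finite F"
  then show "\<exists>F'. finite F' \<and> (\<forall>hs\<in>tuples G (Suc n).
      (\<forall>i<Suc n. \<forall>x\<in>F'. (hs ! i) x = (gs ! i) x) \<longrightarrow> (\<forall>i<1. \<forall>x\<in>F. ([hd hs] ! i) x = ([hd gs] ! i) x))"
    by (intro exI[of _ F]) (auto simp: tuples_Suc dest!: spec[where x=0])
qed (auto simp: tuples_def)

lemma loc_const_butlast:
  assumes "loc_const G n c"
  shows "loc_const G (Suc n) (\<lambda>gs. c (butlast gs))"
proof (rule loc_const_subst[OF assms])
  fix gs :: "('a \<Rightarrow> 'a) list" and F :: "'a set" assume "gs \<in> tuples G (Suc n)" "finite F"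
  then show "\<exists>F'. finite F' \<and> (\<forall>hs\<in>tuples G (Suc n).
      (\<forall>i<Suc n. \<forall>x\<in>F'. (hs ! i) x = (gs ! i) x) \<longrightarrow> (\<forall>i<n. \<forall>x\<in>F. (butlast hs ! i) x = (butlast gs ! i) x))"
    by (intro exI[of _ F]) (auto simp: nth_butlast tuples_length)
qed auto

lemma loc_const_merge:
  assumes "loc_const G n c" "\<And>g h. g \<in> G \<Longrightarrow> h \<in> G \<Longrightarrow> g \<circ> h \<in> G" "i \<ge> 1" "i \<le> n"
  shows "loc_const G (Suc n) (\<lambda>gs. c (merge i gs))"
proof (rule loc_const_subst[OF assms(1)])
  show "merge i \<in> tuples G (Suc n) \<rightarrow> tuples G n"
    using merge_tuples[of G] assms by blast
  fix gs :: "('a \<Rightarrow> 'a) list" and F :: "'a set" assume gs: "gs \<in> tuples G (Suc n)" "finite F"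
  show "\<exists>F'. finite F' \<and> (\<forall>hs\<in>tuples G (Suc n).
      (\<forall>i<Suc n. \<forall>x\<in>F'. (hs ! i) x = (gs ! i) x) \<longrightarrow> (\<forall>k<n. \<forall>x\<in>F. (merge i hs ! k) x = (merge i gs ! k) x))"
  \<comment> \<open>In a composite the outer factor is evaluated at the image of x under the inner
    factor. Agreement on \<open>F\<close> fixes the inner factor, and agreement on the translate of
    \<open>F\<close> by \<open>gs ! i\<close> fixes the outer one.\<close>
  proof (intro exI[of _ "F \<union> (gs ! i) ` F"] conjI ballI impI allI)
    fix hs k x assume hs: "hs \<in> tuples G (Suc n)" and *: "\<forall>k<Suc n. \<forall>x\<in>F \<union> (gs ! i) ` F. (hs ! k) x = (gs ! k) x"
      and k: "k < n" and x: "x \<in> F"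
    have l: "length gs = Suc n" "length hs = Suc n" using gs hs by (simp_all add: tuples_length)
    show "(merge i hs ! k) x = (merge i gs ! k) x"
      using * k x assms(3,4) l by (simp add: nth_merge)
  qed (use gs in auto)
qed

text \<open>Discreteness is expressed in the language of \<open>cochains\<close>: the orbit map of
  each element depends only on the values of the automorphism on a finite set.\<close>

locale galois_module = comm_group "grp M"
  for G :: "('a \<Rightarrow> 'a) set" and M :: "('a \<Rightarrow> 'a, 'c) gmodule" +
  assumes G_comp: "g \<in> G \<Longrightarrow> h \<in> G \<Longrightarrow> g \<circ> h \<in> G"
    and act_hom: "g \<in> G \<Longrightarrow> act M g \<in> hom (grp M) (grp M)"
    and act_comp: "g \<in> G \<Longrightarrow> h \<in> G \<Longrightarrow> x \<in> carrier (grp M) \<Longrightarrow> act M (g \<circ> h) x = act M g (act M h x)"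
    and act_discrete: "x \<in> carrier (grp M) \<Longrightarrow>
      \<exists>F. finite F \<and> (\<forall>g\<in>G. \<forall>h\<in>G. (\<forall>y\<in>F. g y = h y) \<longrightarrow> act M g x = act M h x)"
begin

lemma act_closed [simp]: "g \<in> G \<Longrightarrow> x \<in> carrier (grp M) \<Longrightarrow> act M g x \<in> carrier (grp M)"
  using act_hom hom_in_carrier by metis

text \<open>Near \<open>gs\<close> the argument of the action is already constant, so discreteness
  has to be invoked only for the single element \<open>c (tl gs)\<close>.\<close>

lemma loc_const_act:
  assumes "loc_const G n c" "\<And>gs. gs \<in> tuples G n \<Longrightarrow> c gs \<in> carrier (grp M)"
  shows "loc_const G (Suc n) (\<lambda>gs. act M (hd gs) (c (tl gs)))"
  unfolding loc_const_def
proof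
  fix gs assume gs: "gs \<in> tuples G (Suc n)"
  obtain E where E: "finite E" "\<And>hs. hs \<in> tuples G (Suc n) \<Longrightarrow>
      \<forall>i<Suc n. \<forall>x\<in>E. (hs ! i) x = (gs ! i) x \<Longrightarrow> c (tl hs) = c (tl gs)"
    using loc_const_tl[OF assms(1)] gs unfolding loc_const_def by metis
  obtain F where F: "finite F" "\<And>g h. g \<in> G \<Longrightarrow> h \<in> G \<Longrightarrow> \<forall>y\<in>F. g y = h y
      \<Longrightarrow> act M g (c (tl gs)) = act M h (c (tl gs))"
    using act_discrete[OF assms(2)[OF tl_tuples[OF gs]]] by metis
  have "act M (hd hs) (c (tl hs)) = act M (hd gs) (c (tl gs))"
    if hs: "hs \<in> tuples G (Suc n)" "\<forall>i<Suc n. \<forall>x\<in>E \<union> F. (hs ! i) x = (gs ! i) x" for hs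
  proof -
    have "c (tl hs) = c (tl gs)" using E(2) hs by simp
    moreover have "(hd hs) y = (hd gs) y" if "y \<in> F" for y
      using hs gs that by (auto simp: tuples_Suc)
    then have "act M (hd hs) (c (tl gs)) = act M (hd gs) (c (tl gs))"
      using F(2) hs gs by simp
    ultimately show ?thesis by simp
  qed
  then show "\<exists>F. finite F \<and> (\<forall>hs\<in>tuples G (Suc n). (\<forall>i<Suc n. \<forall>x\<in>F. (hs ! i) x = (gs ! i) x) \<longrightarrow>
      act M (hd hs) (c (tl hs)) = act M (hd gs) (c (tl gs)))"
    using E(1) F(1) by (intro exI[of _ "E \<union> F"]) simp
qed

text \<open>The faces of the inhomogeneous bar complex in a uniform indexing 0, ..., n + 1. The
  differential becomes one alternating product, and its square is governed by identities between
  faces.\<close>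

definition coface :: "nat \<Rightarrow> nat \<Rightarrow> (('a \<Rightarrow> 'a) list \<Rightarrow> 'c) \<Rightarrow> (('a \<Rightarrow> 'a) list \<Rightarrow> 'c)" where
  "coface n i c gs = (if i = 0 then act M (hd gs) (c (tl gs)) else if i \<le> n then c (merge i gs) else c (butlast gs))"

abbreviation sgn_pow :: "'c \<Rightarrow> nat \<Rightarrow> 'c" where
  "sgn_pow x i \<equiv> x [^]\<^bsub>grp M\<^esub> ((-1) ^ i :: int)"

lemma coface_closed:
  assumes "c \<in> tuples G n \<rightarrow> carrier (grp M)" "gs \<in> tuples G (Suc n)"
  shows "coface n i c gs \<in> carrier (grp M)"
proof -
  have *: "c hs \<in> carrier (grp M)" if "hs \<in> tuples G n" for hs using assms(1) that by blast
  show ?thesis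
    using assms(2) G_comp by (simp add: coface_def * merge_tuples)
qed

lemma coface_cong:
  assumes "gs \<in> tuples G (Suc n)" "\<And>hs. hs \<in> tuples G n \<Longrightarrow> c hs = d hs"
  shows "coface n i c gs = coface n i d gs"
  using assms G_comp by (simp add: coface_def merge_tuples)

lemma loc_const_coface:
  assumes "loc_const G n c" "c \<in> tuples G n \<rightarrow> carrier (grp M)"
  shows "loc_const G (Suc n) (coface n i c)"
proof -
  have "c hs \<in> carrier (grp M)" if "hs \<in> tuples G n" for hs using assms(2) that by blast
  then show ?thesis
    unfolding coface_def[abs_def]
    using loc_const_act[OF assms(1)] loc_const_merge[OF assms(1) G_comp] loc_const_butlast[OF assms(1)]
    by (cases "i = 0"; cases "i \<le> n") simp_all
qed

lemma cobd_eq: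
  assumes "c \<in> tuples G n \<rightarrow> carrier (grp M)" "gs \<in> tuples G (Suc n)"
  shows "cobd G n M c gs = finprod (grp M) (\<lambda>i. sgn_pow (coface n i c gs) i) {..Suc n}"
proof -
  note cl = coface_closed[OF assms]
  have "finprod (grp M) (\<lambda>i. sgn_pow (coface n i c gs) i) {..Suc n} =
      sgn_pow (coface n (Suc n) c gs) (Suc n) \<otimes>\<^bsub>grp M\<^esub> finprod (grp M) (\<lambda>i. sgn_pow (coface n i c gs) i) {..n}"
    by (rule finprod_Suc) (simp add: cl)
  also have "finprod (grp M) (\<lambda>i. sgn_pow (coface n i c gs) i) {..n} =
      sgn_pow (coface n 0 c gs) 0 \<otimes>\<^bsub>grp M\<^esub> finprod (grp M) (\<lambda>i. sgn_pow (coface n i c gs) i) {Suc 0..n}"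
    by (rule finprod_0'[symmetric]) (simp add: cl)
  also have "finprod (grp M) (\<lambda>i. sgn_pow (coface n i c gs) i) {Suc 0..n} =
      finprod (grp M) (\<lambda>i. sgn_pow (c (merge i gs)) i) {1..n}"
    using cl assms G_comp
    by (intro finprod_cong') (auto simp: coface_def intro!: int_pow_closed funcset_mem[OF assms(1)] merge_tuples)
  finally have "finprod (grp M) (\<lambda>i. sgn_pow (coface n i c gs) i) {..Suc n} =
    sgn_pow (c (butlast gs)) (Suc n) \<otimes>\<^bsub>grp M\<^esub> (act M (hd gs) (c (tl gs)) \<otimes>\<^bsub>grp M\<^esub>
      finprod (grp M) (\<lambda>i. sgn_pow (c (merge i gs)) i) {1..n})"
    using cl[of 0] by (simp add: coface_def)
  moreover have "finprod (grp M) (\<lambda>i. sgn_pow (c (merge i gs)) i) {1..n} \<in> carrier (grp M)"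
    using assms G_comp by (intro finprod_closed) (auto intro!: int_pow_closed funcset_mem[OF assms(1)] merge_tuples)
  moreover have "sgn_pow (c (butlast gs)) (Suc n) \<in> carrier (grp M)" "act M (hd gs) (c (tl gs)) \<in> carrier (grp M)"
    using cl[of "Suc n"] cl[of 0] by (simp_all add: coface_def)
  ultimately show ?thesis
    using assms(2) by (simp add: cobd_def m_comm m_assoc)
qed

text \<open>
  In the induction on \<open>N\<close> the new row \<open>j = N + 2\<close> cancels against the new column \<open>i = N + 1\<close>.
\<close>

lemma alternating_double_product:
  assumes "\<And>i j. i \<le> N \<Longrightarrow> j \<le> Suc N \<Longrightarrow> y j i \<in> carrier (grp M)"
    and "\<And>i j. i < j \<Longrightarrow> j \<le> Suc N \<Longrightarrow> y j i = y i (j - 1)"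
  shows "finprod (grp M) (\<lambda>j. sgn_pow (finprod (grp M) (\<lambda>i. sgn_pow (y j i) i) {..N}) j) {..Suc N} = \<one>\<^bsub>grp M\<^esub>"
  using assms
proof (induction N)
  case 0
  have c: "y 0 0 \<in> carrier (grp M)" "y 1 0 \<in> carrier (grp M)" using 0 by auto
  have "y 1 0 = y 0 0" using 0(2)[of 0 1] by simp
  have "finprod (grp M) (\<lambda>j. sgn_pow (finprod (grp M) (\<lambda>i. sgn_pow (y j i) i) {..0}) j) {..Suc 0}
    = finprod (grp M) (\<lambda>j. sgn_pow (y j 0) j) {..Suc 0}"
    using 0 by (intro finprod_cong') auto
  also have "\<dots> = inv\<^bsub>grp M\<^esub> y 1 0 \<otimes>\<^bsub>grp M\<^esub> y 0 0"
    using c 0 by (subst finprod_Suc) (auto simp: int_pow_neg)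
  finally show ?case using c \<open>y 1 0 = y 0 0\<close> by simp
next
  case (Suc N)
  let ?r = "\<lambda>K j. finprod (grp M) (\<lambda>i. sgn_pow (y j i) i) {..K}"
  let ?q = "finprod (grp M) (\<lambda>i. sgn_pow (y i (Suc N)) i) {..Suc N}"
  have yc: "y j i \<in> carrier (grp M)" if "i \<le> Suc N" "j \<le> Suc (Suc N)" for i j using Suc.prems(1) that .
  have rc: "?r K j \<in> carrier (grp M)" if "K \<le> Suc N" "j \<le> Suc (Suc N)" for K j
    using yc that by (intro finprod_closed) auto
  have qc: "?q \<in> carrier (grp M)" using yc by (intro finprod_closed) auto
  have IH: "finprod (grp M) (\<lambda>j. sgn_pow (?r N j) j) {..Suc N} = \<one>\<^bsub>grp M\<^esub>"
    using Suc.prems by (intro Suc.IH) auto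
  have last: "?r (Suc N) (Suc (Suc N)) = ?q"
  proof (rule finprod_cong')
    fix i assume "i \<in> {..Suc N}"
    then show "sgn_pow (y (Suc (Suc N)) i) i = sgn_pow (y i (Suc N)) i"
      using Suc.prems(2)[of i "Suc (Suc N)"] by simp
  qed (use yc in auto)
  have "finprod (grp M) (\<lambda>j. sgn_pow (?r (Suc N) j) j) {..Suc (Suc N)} =
     sgn_pow ?q (Suc (Suc N)) \<otimes>\<^bsub>grp M\<^esub> finprod (grp M) (\<lambda>j. sgn_pow (?r (Suc N) j) j) {..Suc N}"
    using rc by (subst finprod_Suc) (auto simp: last simp del: finprod_Suc power_Suc)
  also have "finprod (grp M) (\<lambda>j. sgn_pow (?r (Suc N) j) j) {..Suc N} =
     finprod (grp M) (\<lambda>j. sgn_pow (y j (Suc N)) j [^]\<^bsub>grp M\<^esub> ((-1) ^ Suc N :: int) \<otimes>\<^bsub>grp M\<^esub> sgn_pow (?r N j) j) {..Suc N}"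
  proof (rule finprod_cong')
    fix j assume j: "j \<in> {..Suc N}"
    then have "?r (Suc N) j = sgn_pow (y j (Suc N)) (Suc N) \<otimes>\<^bsub>grp M\<^esub> ?r N j"
      using yc by (intro finprod_Suc) auto
    then have "sgn_pow (?r (Suc N) j) j = sgn_pow (sgn_pow (y j (Suc N)) (Suc N)) j \<otimes>\<^bsub>grp M\<^esub> sgn_pow (?r N j) j"
      using j yc rc by (simp add: int_pow_distrib del: power_Suc)
    then show "sgn_pow (?r (Suc N) j) j = sgn_pow (y j (Suc N)) j [^]\<^bsub>grp M\<^esub> ((-1) ^ Suc N :: int) \<otimes>\<^bsub>grp M\<^esub> sgn_pow (?r N j) j"
      using j yc by (simp add: int_pow_pow mult.commute del: power_Suc)
  qed (use yc rc in auto)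
  also have "\<dots> = finprod (grp M) (\<lambda>j. sgn_pow (y j (Suc N)) j [^]\<^bsub>grp M\<^esub> ((-1) ^ Suc N :: int)) {..Suc N}
     \<otimes>\<^bsub>grp M\<^esub> finprod (grp M) (\<lambda>j. sgn_pow (?r N j) j) {..Suc N}"
    using yc rc by (intro finprod_multf) auto
  also have "finprod (grp M) (\<lambda>j. sgn_pow (y j (Suc N)) j [^]\<^bsub>grp M\<^esub> ((-1) ^ Suc N :: int)) {..Suc N} = sgn_pow ?q (Suc N)"
    using yc by (intro hom_finprod[OF hom_int_pow_fun[OF comm_group_axioms hom_id] comm_group_axioms comm_group_axioms, symmetric]) auto
  also have "sgn_pow ?q (Suc (Suc N)) \<otimes>\<^bsub>grp M\<^esub> (sgn_pow ?q (Suc N) \<otimes>\<^bsub>grp M\<^esub> finprod (grp M) (\<lambda>j. sgn_pow (?r N j) j) {..Suc N}) = \<one>\<^bsub>grp M\<^esub>"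
    using qc int_pow_mult[OF qc, of "(-1) ^ Suc (Suc N)" "(-1) ^ Suc N"] by (simp add: IH)
  finally show ?case .
qed

text \<open>The cosimplicial identity. For i = 0 and j = 1 it is the composition law of the action,
  for two inner faces it is \<open>merge_merge\<close>, and the last face commutes with merging
  except for the top pair of indices, where the merged entry itself is dropped.\<close>

lemma coface_coface:
  assumes "i < j" "j \<le> Suc (Suc n)" "gs \<in> tuples G (Suc (Suc n))" "c \<in> tuples G n \<rightarrow> carrier (grp M)"
  shows "coface (Suc n) j (coface n i c) gs = coface (Suc n) i (coface n (j - 1) c) gs"
proof -
  obtain g h ks where gs: "gs = g # h # ks" and g: "g \<in> G" "h \<in> G" "ks \<in> tuples G n"
    using assms(3) by (auto simp: tuples_Suc)
  have l: "length ks = n" using g by (simp add: tuples_length)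
  have cc: "c xs \<in> carrier (grp M)" if "xs \<in> tuples G n" for xs using assms(4) that by blast
  consider "i = 0" "j = 1" | "i = 0" "1 < j" "j \<le> Suc n" | "i = 0" "j = Suc (Suc n)"
    | "i \<ge> 1" "j \<le> Suc n" | "i \<ge> 1" "i \<le> n" "j = Suc (Suc n)" | "i = Suc n" "j = Suc (Suc n)"
    using assms(1,2) by linarith
  then show ?thesis
  proof cases
    case 1 then show ?thesis
      using g cc by (simp add: coface_def gs merge_def act_comp)
  next
    case 2
    then have "merge j gs = g # merge (j - 1) (h # ks)"
      by (cases j; cases "j - 1") (auto simp: merge_def gs)
    with 2 show ?thesis by (auto simp: coface_def gs)
  next
    case 3 then show ?thesis by (simp add: coface_def gs)
  next
    case 4
    have "merge i (merge j gs) = merge (j - 1) (merge i gs)"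
      using 4 assms(1) l by (intro merge_merge) (simp_all add: gs)
    then show ?thesis using 4 assms(1) by (auto simp: coface_def)
  next
    case 5
    have "merge i (butlast gs) = butlast (merge i gs)"
      using 5 l by (intro merge_butlast) (simp_all add: gs)
    then show ?thesis using 5 by (simp add: coface_def)
  next
    case 6
    have "butlast (merge (Suc n) gs) = butlast (butlast gs)"
      using l by (intro butlast_merge) (simp add: gs)
    then show ?thesis using 6 by (simp add: coface_def)
  qed
qed

lemma cobd_PiE: "c \<in> tuples G n \<rightarrow> carrier (grp M) \<Longrightarrow> cobd G n M c \<in> tuples G (Suc n) \<rightarrow>\<^sub>E carrier (grp M)"
  by (rule PiE_I) (simp_all add: cobd_eq coface_closed finprod_closed Pi_iff, simp add: cobd_def)

text \<open>Inner and last faces only change the argument of the function; the content is face 0,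
  where the action must be moved inside the product and the powers.\<close>

lemma coface_finprod:
  assumes "finite I" "\<And>i. i \<in> I \<Longrightarrow> c i \<in> tuples G n \<rightarrow> carrier (grp M)" "gs \<in> tuples G (Suc n)"
  shows "coface n j (\<lambda>gs. finprod (grp M) (\<lambda>i. sgn_pow (c i gs) (s i)) I) gs
    = finprod (grp M) (\<lambda>i. sgn_pow (coface n j (c i) gs) (s i)) I"
proof (cases "j = 0")
  case True
  have cl: "c i (tl gs) \<in> carrier (grp M)" if "i \<in> I" for i
    using assms(2)[OF that] tl_tuples[OF assms(3)] by blast
  note h = act_hom[OF hd_tuples[OF assms(3)]]
  have "act M (hd gs) (finprod (grp M) (\<lambda>i. sgn_pow (c i (tl gs)) (s i)) I) =
      finprod (grp M) (\<lambda>i. act M (hd gs) (sgn_pow (c i (tl gs)) (s i))) I"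
    using cl by (intro hom_finprod[OF h comm_group_axioms comm_group_axioms]) auto
  also have "\<dots> = finprod (grp M) (\<lambda>i. sgn_pow (act M (hd gs) (c i (tl gs))) (s i)) I"
    using cl hd_tuples[OF assms(3)] by (intro finprod_cong') (auto simp: hom_int_pow[OF h _ is_group is_group])
  finally show ?thesis using True by (simp add: coface_def)
qed (simp add: coface_def)

lemma cobd_cobd:
  assumes "c \<in> tuples G n \<rightarrow> carrier (grp M)"
  shows "cobd G (Suc n) M (cobd G n M c) = (\<lambda>gs\<in>tuples G (Suc (Suc n)). \<one>\<^bsub>grp M\<^esub>)"
proof
  fix gs
  show "cobd G (Suc n) M (cobd G n M c) gs = (\<lambda>gs\<in>tuples G (Suc (Suc n)). \<one>\<^bsub>grp M\<^esub>) gs"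
  proof (cases "gs \<in> tuples G (Suc (Suc n))")
    case gs: True
    have cl: "coface n i c \<in> tuples G (Suc n) \<rightarrow> carrier (grp M)" for i using coface_closed[OF assms] by blast
    have "cobd G (Suc n) M (cobd G n M c) gs =
      finprod (grp M) (\<lambda>j. sgn_pow (coface (Suc n) j (cobd G n M c) gs) j) {..Suc (Suc n)}"
      using cobd_PiE[OF assms] by (intro cobd_eq[OF _ gs]) (simp add: PiE_def)
    also have "\<dots> = finprod (grp M) (\<lambda>j. sgn_pow (finprod (grp M)
        (\<lambda>i. sgn_pow (coface (Suc n) j (coface n i c) gs) i) {..Suc n}) j) {..Suc (Suc n)}"
    proof (rule finprod_cong')
      fix j
      have "coface (Suc n) j (cobd G n M c) gs =
          coface (Suc n) j (\<lambda>gs. finprod (grp M) (\<lambda>i. sgn_pow (coface n i c gs) i) {..Suc n}) gs"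
        by (rule coface_cong[OF gs]) (rule cobd_eq[OF assms])
      also have "\<dots> = finprod (grp M) (\<lambda>i. sgn_pow (coface (Suc n) j (coface n i c) gs) i) {..Suc n}"
        by (rule coface_finprod[OF _ cl gs]) simp
      finally show "sgn_pow (coface (Suc n) j (cobd G n M c) gs) j = sgn_pow (finprod (grp M)
        (\<lambda>i. sgn_pow (coface (Suc n) j (coface n i c) gs) i) {..Suc n}) j" by simp
    qed (auto intro!: int_pow_closed finprod_closed coface_closed[OF cl gs])
    also have "\<dots> = \<one>\<^bsub>grp M\<^esub>"
    \<comment> \<open>The double array is formed by the iterated faces at \<open>gs\<close>; its
      symmetry hypothesis is exactly \<open>coface_coface\<close>.\<close>
    proof (rule alternating_double_product)
      show "coface (Suc n) j (coface n i c) gs \<in> carrier (grp M)" for i j by (rule coface_closed[OF cl gs])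
    qed (rule coface_coface[OF _ _ gs assms], auto)
    finally show ?thesis using gs by simp
  qed (simp add: cobd_def)
qed

lemma cochains_carrier: "c \<in> cochains G n M \<Longrightarrow> gs \<in> tuples G n \<Longrightarrow> c gs \<in> carrier (grp M)"
  by (auto simp: cochains_iff)

lemma cochains_Pi: "c \<in> cochains G n M \<Longrightarrow> c \<in> tuples G n \<rightarrow> carrier (grp M)"
  by (auto simp: cochains_iff)

lemma restrict_cochain:
  assumes "\<And>gs. gs \<in> tuples G n \<Longrightarrow> c gs \<in> carrier (grp M)" "loc_const G n c"
  shows "restrict c (tuples G n) \<in> cochains G n M"
  using assms loc_const_cong[of G n c "restrict c (tuples G n)"] by (simp add: cochains_iff)

lemma cobd_cochain:
  assumes "c \<in> cochains G n M"
  shows "cobd G n M c \<in> cochains G (Suc n) M"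
proof -
  note cP = cochains_Pi[OF assms]
  have "loc_const G (Suc n) (\<lambda>gs. \<lambda>i\<in>{..Suc n}. coface n i c gs)"
    using assms cP by (intro loc_const_family loc_const_coface) (auto simp: cochains_iff)
  from loc_const_comp[OF this, of "\<lambda>f. finprod (grp M) (\<lambda>i. sgn_pow (f i) i) {..Suc n}"]
  have "loc_const G (Suc n) (cobd G n M c)"
  proof (rule loc_const_cong)
    fix gs assume gs: "gs \<in> tuples G (Suc n)"
    show "finprod (grp M) (\<lambda>i. sgn_pow ((\<lambda>i\<in>{..Suc n}. coface n i c gs) i) i) {..Suc n} = cobd G n M c gs"
      unfolding cobd_eq[OF cP gs] using coface_closed[OF cP gs] by (intro finprod_cong') auto
  qed
  then show ?thesis using cobd_PiE[OF cP] by (simp add: cochains_iff)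
qed

end


section \<open>Groups of cochains, cocycles and cohomology classes\<close>

context galois_module
begin

text \<open>Exhibits the cochains as a subset of a full product group, so that the group axioms
  follow from closure under the operations.\<close>

lemma cochain_group_eq: "cochain_group G n M = (product_group (tuples G n) (\<lambda>_. grp M))\<lparr>carrier := cochains G n M\<rparr>"
  by (simp add: cochain_group_def product_group_def)

lemma cochains_subgroup: "subgroup (cochains G n M) (product_group (tuples G n) (\<lambda>_. grp M))"
proof -
  interpret P: group "product_group (tuples G n) (\<lambda>_. grp M)" by simp
  show ?thesis
  proof (rule P.subgroupI)
    have "(\<lambda>gs\<in>tuples G n. \<one>\<^bsub>grp M\<^esub>) \<in> cochains G n M"
      by (rule restrict_cochain) (auto simp: loc_const_def)
    then show "cochains G n M \<noteq> {}" by blast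
  next
    fix c assume c: "c \<in> cochains G n M"
    then have "(\<lambda>gs\<in>tuples G n. inv\<^bsub>grp M\<^esub> c gs) \<in> cochains G n M"
      by (intro restrict_cochain loc_const_comp[where \<phi>="m_inv (grp M)"]) (simp_all add: cochains_carrier, simp add: cochains_iff)
    then show "inv\<^bsub>product_group (tuples G n) (\<lambda>_. grp M)\<^esub> c \<in> cochains G n M"
      using c by (simp add: cochains_iff)
  next
    fix c d assume "c \<in> cochains G n M" "d \<in> cochains G n M"
    then show "c \<otimes>\<^bsub>product_group (tuples G n) (\<lambda>_. grp M)\<^esub> d \<in> cochains G n M"
      by (simp, intro restrict_cochain loc_const_comp2[where \<phi>="monoid.mult (grp M)"]) (simp_all add: cochains_carrier, simp_all add: cochains_iff)
  qed (auto simp: cochains_iff)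
qed

lemma cochain_group: "comm_group (cochain_group G n M)"
proof -
  interpret P: group "product_group (tuples G n) (\<lambda>_. grp M)" by simp
  have "group (cochain_group G n M)"
    unfolding cochain_group_eq by (rule subgroup.subgroup_is_group[OF cochains_subgroup P.is_group])
  then show ?thesis
    by (rule group.group_comm_groupI)
       (auto simp: cochain_group_def fun_eq_iff cochains_carrier m_comm)
qed

lemma carrier_cochain_group [simp]: "carrier (cochain_group G n M) = cochains G n M"
  and mult_cochain_group: "gs \<in> tuples G n \<Longrightarrow> (c \<otimes>\<^bsub>cochain_group G n M\<^esub> d) gs = c gs \<otimes>\<^bsub>grp M\<^esub> d gs"
  and one_cochain_group: "gs \<in> tuples G n \<Longrightarrow> \<one>\<^bsub>cochain_group G n M\<^esub> gs = \<one>\<^bsub>grp M\<^esub>"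
  by (simp_all add: cochain_group_def)

lemma cochain_eqI:
  assumes "c \<in> cochains G n M" "d \<in> cochains G n M" "\<And>gs. gs \<in> tuples G n \<Longrightarrow> c gs = d gs"
  shows "c = d"
  using assms by (intro PiE_ext[of _ "tuples G n"]) (auto simp: cochains_iff)

lemma inv_cochain_group:
  assumes "c \<in> cochains G n M" "gs \<in> tuples G n"
  shows "(inv\<^bsub>cochain_group G n M\<^esub> c) gs = inv\<^bsub>grp M\<^esub> c gs"
proof -
  interpret C: comm_group "cochain_group G n M" by (rule cochain_group)
  have i: "inv\<^bsub>cochain_group G n M\<^esub> c \<in> cochains G n M" using assms C.inv_closed by simp
  have "(inv\<^bsub>cochain_group G n M\<^esub> c) gs \<otimes>\<^bsub>grp M\<^esub> c gs = (inv\<^bsub>cochain_group G n M\<^esub> c \<otimes>\<^bsub>cochain_group G n M\<^esub> c) gs"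
    by (simp only: mult_cochain_group[OF assms(2)])
  also have "\<dots> = \<one>\<^bsub>grp M\<^esub>"
    using assms C.l_inv[of c] by (simp add: one_cochain_group)
  finally have "(inv\<^bsub>cochain_group G n M\<^esub> c) gs \<otimes>\<^bsub>grp M\<^esub> c gs = \<one>\<^bsub>grp M\<^esub>" .
  then show ?thesis
    using assms i by (intro inv_equality[symmetric]) (auto simp: cochains_carrier)
qed

lemma coface_mult:
  assumes "c \<in> cochains G n M" "d \<in> cochains G n M" "gs \<in> tuples G (Suc n)"
  shows "coface n i (c \<otimes>\<^bsub>cochain_group G n M\<^esub> d) gs = coface n i c gs \<otimes>\<^bsub>grp M\<^esub> coface n i d gs"
  using assms G_comp hom_mult[OF act_hom[OF hd_tuples[OF assms(3)]]]
  by (simp add: coface_def mult_cochain_group merge_tuples cochains_carrier)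

lemma cobd_hom: "cobd G n M \<in> hom (cochain_group G n M) (cochain_group G (Suc n) M)"
proof (rule homI)
  interpret C: comm_group "cochain_group G n M" by (rule cochain_group)
  interpret C': comm_group "cochain_group G (Suc n) M" by (rule cochain_group)
  fix c assume "c \<in> carrier (cochain_group G n M)"
  then show "cobd G n M c \<in> carrier (cochain_group G (Suc n) M)" using cobd_cochain by simp
  fix d assume "d \<in> carrier (cochain_group G n M)"
  with \<open>c \<in> _\<close> have c: "c \<in> cochains G n M" "d \<in> cochains G n M" "c \<otimes>\<^bsub>cochain_group G n M\<^esub> d \<in> cochains G n M"
    using C.m_closed by auto
  show "cobd G n M (c \<otimes>\<^bsub>cochain_group G n M\<^esub> d) = cobd G n M c \<otimes>\<^bsub>cochain_group G (Suc n) M\<^esub> cobd G n M d"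
  proof (rule cochain_eqI[where n="Suc n"])
    show "cobd G n M c \<otimes>\<^bsub>cochain_group G (Suc n) M\<^esub> cobd G n M d \<in> cochains G (Suc n) M"
      using c C'.m_closed cobd_cochain by simp
    fix gs assume gs: "gs \<in> tuples G (Suc n)"
    note cl = coface_closed[OF cochains_Pi[OF c(1)] gs] coface_closed[OF cochains_Pi[OF c(2)] gs]
    have "cobd G n M (c \<otimes>\<^bsub>cochain_group G n M\<^esub> d) gs =
      finprod (grp M) (\<lambda>i. sgn_pow (coface n i c gs) i \<otimes>\<^bsub>grp M\<^esub> sgn_pow (coface n i d gs) i) {..Suc n}"
      unfolding cobd_eq[OF cochains_Pi[OF c(3)] gs]
      using cl by (intro finprod_cong') (auto simp: coface_mult[OF c(1,2) gs] int_pow_distrib)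
    also have "\<dots> = cobd G n M c gs \<otimes>\<^bsub>grp M\<^esub> cobd G n M d gs"
      unfolding cobd_eq[OF cochains_Pi[OF c(1)] gs] cobd_eq[OF cochains_Pi[OF c(2)] gs]
      using cl by (intro finprod_multf) auto
    finally show "cobd G n M (c \<otimes>\<^bsub>cochain_group G n M\<^esub> d) gs = (cobd G n M c \<otimes>\<^bsub>cochain_group G (Suc n) M\<^esub> cobd G n M d) gs"
      using gs by (simp add: mult_cochain_group)
  qed (use c cobd_cochain in auto)
qed

lemma cobd_mult:
  assumes "c \<in> cochains G n M" "d \<in> cochains G n M"
  shows "cobd G n M (c \<otimes>\<^bsub>cochain_group G n M\<^esub> d) = cobd G n M c \<otimes>\<^bsub>cochain_group G (Suc n) M\<^esub> cobd G n M d"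
  using hom_mult[OF cobd_hom] assms by simp

lemma cobd_inv:
  assumes "c \<in> cochains G n M"
  shows "cobd G n M (inv\<^bsub>cochain_group G n M\<^esub> c) = inv\<^bsub>cochain_group G (Suc n) M\<^esub> cobd G n M c"
  using hom_inv_image[OF cobd_hom comm_group.axioms(2)[OF cochain_group] comm_group.axioms(2)[OF cochain_group]] assms by simp

lemma cobd_one: "cobd G n M \<one>\<^bsub>cochain_group G n M\<^esub> = \<one>\<^bsub>cochain_group G (Suc n) M\<^esub>"
  by (rule hom_one[OF cobd_hom comm_group.axioms(2)[OF cochain_group] comm_group.axioms(2)[OF cochain_group]])

lemma cocycles_iff: "c \<in> cocycles G n M \<longleftrightarrow> c \<in> cochains G n M \<and> (\<forall>gs\<in>tuples G (Suc n). cobd G n M c gs = \<one>\<^bsub>grp M\<^esub>)"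
proof -
  interpret C': comm_group "cochain_group G (Suc n) M" by (rule cochain_group)
  have "cobd G n M c = \<one>\<^bsub>cochain_group G (Suc n) M\<^esub>"
    if "c \<in> cochains G n M" "\<forall>gs\<in>tuples G (Suc n). cobd G n M c gs = \<one>\<^bsub>grp M\<^esub>"
    by (rule cochain_eqI[where n="Suc n"]) (use that cobd_cochain C'.one_closed in \<open>simp_all add: one_cochain_group\<close>)
  moreover have "\<forall>gs\<in>tuples G (Suc n). cobd G n M c gs = \<one>\<^bsub>grp M\<^esub>"
    if "cobd G n M c = \<one>\<^bsub>cochain_group G (Suc n) M\<^esub>"
    using that by (simp add: one_cochain_group)
  ultimately show ?thesis unfolding cocycles_def by blast
qed

lemma one_cocycle: "\<one>\<^bsub>cochain_group G n M\<^esub> \<in> cocycles G n M"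
  using monoid.one_closed[OF group.is_monoid[OF comm_group.axioms(2)[OF cochain_group[of n]]]]
  by (simp add: cocycles_def cobd_one)

lemma coboundaries_subgroup: "subgroup (coboundaries G n M) (cochain_group G n M)"
proof (cases n)
  case 0
  interpret C: comm_group "cochain_group G n M" by (rule cochain_group)
  show ?thesis using C.triv_subgroup 0 by (simp add: coboundaries_def)
next
  case (Suc m)
  interpret C: comm_group "cochain_group G n M" by (rule cochain_group)
  interpret C': comm_group "cochain_group G m M" by (rule cochain_group)
  have "group_hom (cochain_group G m M) (cochain_group G n M) (cobd G m M)"
    using cobd_hom[of m] C.is_group C'.is_group Suc by (simp add: group_hom_def group_hom_axioms_def)
  from group_hom.img_is_subgroup[OF this] show ?thesis using Suc by (simp add: coboundaries_def)
qed

lemma coboundaries_cochains: "c \<in> coboundaries G n M \<Longrightarrow> c \<in> cochains G n M"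
  using subgroup.mem_carrier[OF coboundaries_subgroup] by simp

lemma cls_memI: "c \<in> cochains G n M \<Longrightarrow> c \<in> cls G n M c"
  unfolding cls_def using group.rcos_self[OF comm_group.axioms(2)[OF cochain_group] _ coboundaries_subgroup] by simp

lemma cls_eqI:
  assumes "c \<in> cochains G n M" "d \<in> cochains G n M" "c \<otimes>\<^bsub>cochain_group G n M\<^esub> inv\<^bsub>cochain_group G n M\<^esub> d \<in> coboundaries G n M"
  shows "cls G n M c = cls G n M d"
proof -
  interpret C: comm_group "cochain_group G n M" by (rule cochain_group)
  show ?thesis
    unfolding cls_def
    using C.coset_mult_inv1[of "coboundaries G n M" c d] C.coset_join2[OF _ coboundaries_subgroup assms(3)]
      assms subgroup.subset[OF coboundaries_subgroup] coboundaries_cochains by simp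
qed

lemma cls_one: "cls G n M \<one>\<^bsub>cochain_group G n M\<^esub> = coboundaries G n M"
proof -
  interpret C: comm_group "cochain_group G n M" by (rule cochain_group)
  show ?thesis unfolding cls_def
    using C.coset_mult_one subgroup.subset[OF coboundaries_subgroup] by simp
qed

lemma carrier_cohomology: "carrier (cohomology G n M) = cls G n M ` cocycles G n M"
  by (auto simp: cohomology_def carrier_FactGroup cls_def r_coset_def)

end

section \<open>Equivariant homomorphisms acting on cochains\<close>

locale module_hom = A: galois_module G A + B: galois_module G B
  for G :: "('a \<Rightarrow> 'a) set" and A :: "('a \<Rightarrow> 'a, 'c) gmodule" and B :: "('a \<Rightarrow> 'a, 'd) gmodule" +
  fixes f :: "'c \<Rightarrow> 'd"
  assumes hom: "f \<in> hom (grp A) (grp B)"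
    and equivariant: "g \<in> G \<Longrightarrow> x \<in> carrier (grp A) \<Longrightarrow> f (act A g x) = act B g (f x)"
begin

lemma closed [simp]: "x \<in> carrier (grp A) \<Longrightarrow> f x \<in> carrier (grp B)"
  using hom hom_in_carrier by metis

definition push :: "nat \<Rightarrow> (('a \<Rightarrow> 'a) list \<Rightarrow> 'c) \<Rightarrow> (('a \<Rightarrow> 'a) list \<Rightarrow> 'd)" where
  "push n c = (\<lambda>gs\<in>tuples G n. f (c gs))"

lemma push_apply [simp]: "gs \<in> tuples G n \<Longrightarrow> push n c gs = f (c gs)"
  by (simp add: push_def)

lemma push_cochain: "c \<in> cochains G n A \<Longrightarrow> push n c \<in> cochains G n B"
  unfolding push_def by (intro B.restrict_cochain loc_const_comp[where \<phi>=f]) (simp_all add: A.cochains_carrier, simp add: cochains_iff)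

lemma cobd_push:
  assumes "c \<in> tuples G n \<rightarrow> carrier (grp A)" "gs \<in> tuples G (Suc n)"
    and "\<And>hs. hs \<in> tuples G n \<Longrightarrow> d hs = f (c hs)"
  shows "cobd G n B d gs = f (cobd G n A c gs)"
proof -
  have cl: "c hs \<in> carrier (grp A)" if "hs \<in> tuples G n" for hs using assms(1) that by blast
  have d: "d \<in> tuples G n \<rightarrow> carrier (grp B)" using assms(3) cl by simp
  note cA = A.coface_closed[OF assms(1,2)]
  have cof: "B.coface n i d gs = f (A.coface n i c gs)" for i
    using assms(2,3) A.G_comp cl by (simp add: A.coface_def B.coface_def merge_tuples equivariant)
  have "f (cobd G n A c gs) = finprod (grp B) (\<lambda>i. f (A.sgn_pow (A.coface n i c gs) i)) {..Suc n}"
    unfolding A.cobd_eq[OF assms(1,2)] using cA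
    by (intro hom_finprod[OF hom A.comm_group_axioms B.comm_group_axioms]) auto
  also have "\<dots> = cobd G n B d gs"
    unfolding B.cobd_eq[OF d assms(2)] using cA
    by (intro B.finprod_cong') (auto simp: cof hom_int_pow[OF hom _ A.is_group B.is_group])
  finally show ?thesis ..
qed

lemma cobd_push_eq: "c \<in> cochains G n A \<Longrightarrow> cobd G n B (push n c) = push (Suc n) (cobd G n A c)"
  using B.cobd_cochain[OF push_cochain, of c n] push_cochain[OF A.cobd_cochain, of c n]
  by (intro B.cochain_eqI[where n="Suc n"]) (simp_all add: cobd_push[OF A.cochains_Pi])

lemma push_mult:
  assumes "c \<in> cochains G n A" "d \<in> cochains G n A"
  shows "push n (c \<otimes>\<^bsub>cochain_group G n A\<^esub> d) = push n c \<otimes>\<^bsub>cochain_group G n B\<^esub> push n d"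
proof -
  interpret CA: comm_group "cochain_group G n A" by (rule A.cochain_group)
  interpret CB: comm_group "cochain_group G n B" by (rule B.cochain_group)
  show ?thesis
    using assms push_cochain CA.m_closed[of c d] CB.m_closed[of "push n c" "push n d"]
    by (intro B.cochain_eqI[where n=n])
       (simp_all add: A.mult_cochain_group B.mult_cochain_group hom_mult[OF hom] A.cochains_carrier)
qed

lemma push_hom: "push n \<in> hom (cochain_group G n A) (cochain_group G n B)"
  by (rule homI) (simp_all add: push_cochain push_mult)

lemma push_inv: "c \<in> cochains G n A \<Longrightarrow>
    push n (inv\<^bsub>cochain_group G n A\<^esub> c) = inv\<^bsub>cochain_group G n B\<^esub> push n c"
  using hom_inv_image[OF push_hom comm_group.axioms(2)[OF A.cochain_group] comm_group.axioms(2)[OF B.cochain_group]] by simp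

lemma push_one: "push n \<one>\<^bsub>cochain_group G n A\<^esub> = \<one>\<^bsub>cochain_group G n B\<^esub>"
  by (rule hom_one[OF push_hom comm_group.axioms(2)[OF A.cochain_group] comm_group.axioms(2)[OF B.cochain_group]])

text \<open>A locally constant function followed by any set-theoretic section is again locally
  constant, so continuity of the lift costs nothing; the section here is
  \<open>inv_into\<close>.\<close>

lemma lift_cochain:
  assumes "c \<in> cochains G n B" "\<And>gs. gs \<in> tuples G n \<Longrightarrow> c gs \<in> f ` carrier (grp A)"
  shows "\<exists>b\<in>cochains G n A. push n b = c"
proof (intro bexI)
  let ?b = "\<lambda>gs\<in>tuples G n. inv_into (carrier (grp A)) f (c gs)"
  show b: "?b \<in> cochains G n A"
    using assms by (intro A.restrict_cochain loc_const_comp[where \<phi>="inv_into (carrier (grp A)) f"] inv_into_into) (simp_all add: cochains_iff)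
  show "push n ?b = c"
    using assms push_cochain[OF b] by (intro B.cochain_eqI[where n=n]) (auto simp: f_inv_into_f)
qed

lemma push_inj:
  assumes "inj_on f (carrier (grp A))" "c \<in> cochains G n A" "d \<in> cochains G n A" "push n c = push n d"
  shows "c = d"
proof (rule A.cochain_eqI[OF assms(2,3)])
  fix gs assume gs: "gs \<in> tuples G n"
  then have "f (c gs) = f (d gs)" using assms(4) push_apply by metis
  then show "c gs = d gs" using assms(1-3) gs by (meson inj_onD A.cochains_carrier)
qed

end


section \<open>Connecting homomorphisms\<close>

locale short_exact = f: module_hom G A B f + g: module_hom G B C h
  for G :: "('a \<Rightarrow> 'a) set" and A :: "('a \<Rightarrow> 'a, 'c) gmodule" and B :: "('a \<Rightarrow> 'a, 'd) gmodule"
    and C :: "('a \<Rightarrow> 'a, 'e) gmodule" and f h +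
  assumes inj: "inj_on f (carrier (grp A))"
    and exact: "x \<in> carrier (grp B) \<Longrightarrow> h x = \<one>\<^bsub>grp C\<^esub> \<longleftrightarrow> x \<in> f ` carrier (grp A)"
    and surj: "h ` carrier (grp B) = carrier (grp C)"
begin

lemma push_exact:
  assumes "b \<in> cochains G n B" "g.push n b = \<one>\<^bsub>cochain_group G n C\<^esub>"
  shows "\<exists>a\<in>cochains G n A. f.push n a = b"
proof (rule f.lift_cochain[OF assms(1)])
  fix gs assume gs: "gs \<in> tuples G n"
  then have "h (b gs) = \<one>\<^bsub>grp C\<^esub>"
    using assms(2) g.push_apply g.B.one_cochain_group by metis
  then show "b gs \<in> f ` carrier (grp A)" using exact assms(1) gs by (simp add: f.B.cochains_carrier)
qed

lemma lift: "c \<in> cochains G n C \<Longrightarrow> \<exists>b\<in>cochains G n B. g.push n b = c"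
  using surj by (intro g.lift_cochain) (auto simp: g.B.cochains_carrier)

text \<open>After lifting \<open>c\<close> to \<open>b\<close>, the coboundary of \<open>b\<close>
  dies in C and so comes from A. The resulting cochain is a cocycle because its image in B is a
  coboundary of a coboundary and the map from A is injective.\<close>

lemma connecting_exists:
  assumes "c \<in> cocycles G n C"
  obtains b a where "b \<in> cochains G n B" "a \<in> cocycles G (Suc n) A"
    "g.push n b = c" "f.push (Suc n) a = cobd G n B b"
proof -
  have c: "c \<in> cochains G n C" "cobd G n C c = \<one>\<^bsub>cochain_group G (Suc n) C\<^esub>"
    using assms by (auto simp: cocycles_def)
  obtain b where b: "b \<in> cochains G n B" "g.push n b = c" using lift c by blast
  then have "g.push (Suc n) (cobd G n B b) = \<one>\<^bsub>cochain_group G (Suc n) C\<^esub>"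
    using g.cobd_push_eq[OF b(1)] c(2) by simp
  then obtain a where a: "a \<in> cochains G (Suc n) A" "f.push (Suc n) a = cobd G n B b"
    using push_exact[OF f.B.cobd_cochain[OF b(1)]] by blast
  have "f.push (Suc (Suc n)) (cobd G (Suc n) A a) = cobd G (Suc n) B (cobd G n B b)"
    using f.cobd_push_eq[OF a(1)] a(2) by simp
  also have "\<dots> = f.push (Suc (Suc n)) \<one>\<^bsub>cochain_group G (Suc (Suc n)) A\<^esub>"
    by (simp add: f.B.cobd_cobd[OF f.B.cochains_Pi[OF b(1)]] f.push_one) (simp add: cochain_group_def)
  finally have "cobd G (Suc n) A a = \<one>\<^bsub>cochain_group G (Suc (Suc n)) A\<^esub>"
    using f.push_inj[OF inj f.A.cobd_cochain[OF a(1)]] f.A.one_cocycle by (simp add: cocycles_def)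
  then have "a \<in> cocycles G (Suc n) A" using a(1) by (simp add: cocycles_def)
  then show ?thesis using that a b by blast
qed

text \<open>If \<open>c\<close> is \<open>e\<close> times \<open>c0\<close> and e' is a closed lift
  of \<open>e\<close>, then \<open>b\<close> and e' \<open>b0\<close> have the same image in C. They
  differ by the image of a cochain \<open>u\<close> of A, and the coboundary of \<open>u\<close> is
  the quotient of \<open>a\<close> by \<open>a0\<close>.\<close>

lemma connecting_unique:
  assumes c0: "c0 \<in> cochains G n C"
    and b0: "b0 \<in> cochains G n B" "a0 \<in> cochains G (Suc n) A" "g.push n b0 = c0" "f.push (Suc n) a0 = cobd G n B b0"
    and c: "c \<in> cls G n C c0"
    and b: "b \<in> cochains G n B" "a \<in> cochains G (Suc n) A" "g.push n b = c" "f.push (Suc n) a = cobd G n B b"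
  shows "cls G (Suc n) A a = cls G (Suc n) A a0"
proof -
  interpret CB: comm_group "cochain_group G n B" by (rule f.B.cochain_group)
  interpret CB': comm_group "cochain_group G (Suc n) B" by (rule f.B.cochain_group)
  interpret CC: comm_group "cochain_group G n C" by (rule g.B.cochain_group)
  interpret CA': comm_group "cochain_group G (Suc n) A" by (rule f.A.cochain_group)
  obtain e where e: "e \<in> coboundaries G n C" "c = e \<otimes>\<^bsub>cochain_group G n C\<^esub> c0"
    using c by (auto simp: cls_def r_coset_def)
  \<comment> \<open>In positive degree \<open>e\<close> is the coboundary of some \<open>k\<close>,
    and the coboundary of a lift of \<open>k\<close> is a closed lift of \<open>e\<close>. In degree
    0 the only coboundary is the neutral cochain.\<close>
  have "\<exists>e'\<in>cochains G n B. g.push n e' = e \<and> cobd G n B e' = \<one>\<^bsub>cochain_group G (Suc n) B\<^esub>"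
  proof (cases n)
    case 0
    then have "e = \<one>\<^bsub>cochain_group G n C\<^esub>" using e by (simp add: coboundaries_def)
    then show ?thesis using g.push_one f.B.cobd_one CB.one_closed by auto
  next
    case (Suc m)
    then obtain k where k: "k \<in> cochains G m C" "e = cobd G m C k" using e by (auto simp: coboundaries_def)
    then obtain k' where k': "k' \<in> cochains G m B" "g.push m k' = k" using lift by blast
    have "g.push n (cobd G m B k') = e" using g.cobd_push_eq[OF k'(1)] k k' Suc by simp
    moreover have "cobd G n B (cobd G m B k') = \<one>\<^bsub>cochain_group G (Suc n) B\<^esub>"
      using f.B.cobd_cobd[OF f.B.cochains_Pi[OF k'(1)]] Suc by (simp add: cochain_group_def)
    ultimately show ?thesis using f.B.cobd_cochain[OF k'(1)] Suc by blast
  qed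
  then obtain e' where e': "e' \<in> cochains G n B" "g.push n e' = e" "cobd G n B e' = \<one>\<^bsub>cochain_group G (Suc n) B\<^esub>"
    by blast
  define v where "v = b \<otimes>\<^bsub>cochain_group G n B\<^esub> inv\<^bsub>cochain_group G n B\<^esub> (e' \<otimes>\<^bsub>cochain_group G n B\<^esub> b0)"
  have eb: "e' \<otimes>\<^bsub>cochain_group G n B\<^esub> b0 \<in> cochains G n B" "inv\<^bsub>cochain_group G n B\<^esub> (e' \<otimes>\<^bsub>cochain_group G n B\<^esub> b0) \<in> cochains G n B"
    using CB.m_closed[of e' b0] CB.inv_closed[of "e' \<otimes>\<^bsub>cochain_group G n B\<^esub> b0"] e' b0 by auto
  have v: "v \<in> cochains G n B" using CB.m_closed[of b] b eb by (simp add: v_def)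
  have ec: "e \<in> cochains G n C" using e g.B.coboundaries_cochains by blast
  have "g.push n v = c \<otimes>\<^bsub>cochain_group G n C\<^esub> inv\<^bsub>cochain_group G n C\<^esub> c"
    using b b0 e' e eb by (simp add: v_def g.push_mult g.push_inv)
  also have "\<dots> = \<one>\<^bsub>cochain_group G n C\<^esub>"
    using CC.r_inv[of c] CC.m_closed[of e c0] ec c0 e(2) by simp
  finally obtain u where u: "u \<in> cochains G n A" "f.push n u = v" using push_exact[OF v] by blast
  have d: "cobd G n B b \<in> cochains G (Suc n) B" "cobd G n B b0 \<in> cochains G (Suc n) B" using b b0 f.B.cobd_cochain by auto
  have "f.push (Suc n) (cobd G n A u) = cobd G n B v" using f.cobd_push_eq[OF u(1)] u(2) by simp
  also have "\<dots> = cobd G n B b \<otimes>\<^bsub>cochain_group G (Suc n) B\<^esub> inv\<^bsub>cochain_group G (Suc n) B\<^esub> cobd G n B b0"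
    using b eb e' b0 d CB'.l_one by (simp add: v_def f.B.cobd_mult f.B.cobd_inv)
  also have "\<dots> = f.push (Suc n) (a \<otimes>\<^bsub>cochain_group G (Suc n) A\<^esub> inv\<^bsub>cochain_group G (Suc n) A\<^esub> a0)"
    using b b0 CA'.inv_closed[of a0] by (simp add: f.push_mult f.push_inv)
  finally have "cobd G n A u = a \<otimes>\<^bsub>cochain_group G (Suc n) A\<^esub> inv\<^bsub>cochain_group G (Suc n) A\<^esub> a0"
    using f.push_inj[OF inj f.A.cobd_cochain[OF u(1)]] b(2) b0(2) CA'.inv_closed[of a0] CA'.m_closed[of a] by simp
  then have "a \<otimes>\<^bsub>cochain_group G (Suc n) A\<^esub> inv\<^bsub>cochain_group G (Suc n) A\<^esub> a0 \<in> coboundaries G (Suc n) A"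
    using u(1) unfolding coboundaries_def by simp (metis imageI)
  then show ?thesis using f.A.cls_eqI b(2) b0(2) by blast
qed

text \<open>Evaluates the definite description in \<open>connecting\<close>: a single compatible
  choice of lifts suffices, since by \<open>connecting_unique\<close> every other choice has the
  same class.\<close>

lemma connecting_eq:
  assumes c: "c \<in> cochains G n C" and b: "b \<in> cochains G n B" "a \<in> cocycles G (Suc n) A"
    and eq: "g.push n b = c" "f.push (Suc n) a = cobd G n B b"
  shows "connecting G A B C f h n (cls G n C c) = cls G (Suc n) A a"
  unfolding connecting_def
proof (rule the_equality)
  have a: "a \<in> cochains G (Suc n) A" using b by (simp add: cocycles_def)
  have "\<forall>gs\<in>tuples G n. h (b gs) = c gs" using eq(1) g.push_apply by metis
  moreover have "\<forall>gs\<in>tuples G (Suc n). f (a gs) = cobd G n B b gs" using eq(2) f.push_apply by metis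
  ultimately show "\<exists>c\<in>cls G n C c. \<exists>b\<in>cochains G n B. \<exists>a'\<in>cocycles G (Suc n) A. (\<forall>gs\<in>tuples G n. h (b gs) = c gs) \<and>
     (\<forall>gs\<in>tuples G (Suc n). f (a' gs) = cobd G n B b gs) \<and> cls G (Suc n) A a = cls G (Suc n) A a'"
    using b g.B.cls_memI[OF c] by blast
  fix \<eta>
  assume "\<exists>c\<in>cls G n C c. \<exists>b\<in>cochains G n B. \<exists>a'\<in>cocycles G (Suc n) A. (\<forall>gs\<in>tuples G n. h (b gs) = c gs) \<and>
     (\<forall>gs\<in>tuples G (Suc n). f (a' gs) = cobd G n B b gs) \<and> \<eta> = cls G (Suc n) A a'"
  then obtain c' b' a' where *: "c' \<in> cls G n C c" "b' \<in> cochains G n B" "a' \<in> cocycles G (Suc n) A"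
    "\<forall>gs\<in>tuples G n. h (b' gs) = c' gs" "\<forall>gs\<in>tuples G (Suc n). f (a' gs) = cobd G n B b' gs"
    and \<eta>: "\<eta> = cls G (Suc n) A a'" by blast
  have a': "a' \<in> cochains G (Suc n) A" using * by (simp add: cocycles_def)
  have c': "c' \<in> cochains G n C"
  proof -
    interpret CC: comm_group "cochain_group G n C" by (rule g.B.cochain_group)
    obtain e where "e \<in> coboundaries G n C" "c' = e \<otimes>\<^bsub>cochain_group G n C\<^esub> c"
      using *(1) by (auto simp: cls_def r_coset_def)
    then show ?thesis using CC.m_closed[of e c] c g.B.coboundaries_cochains by simp
  qed
  have 1: "g.push n b' = c'"
    using * g.push_cochain[OF *(2)] c' by (intro g.B.cochain_eqI[where n=n]) auto
  have 2: "f.push (Suc n) a' = cobd G n B b'"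
    using * f.push_cochain[OF a'] f.B.cobd_cochain[OF *(2)] by (intro f.B.cochain_eqI[where n="Suc n"]) auto
  show "\<eta> = cls G (Suc n) A a"
    unfolding \<eta> by (rule connecting_unique[OF c b(1) a eq *(1,2) a' 1 2])
qed

end

lemma submodule:
  assumes D: "galois_module G D" and S: "subgroup S (grp D)"
    and act: "\<And>g x. g \<in> G \<Longrightarrow> x \<in> S \<Longrightarrow> act D g x \<in> S"
  shows "galois_module G \<lparr>grp = (grp D)\<lparr>carrier := S\<rparr>, act = act D\<rparr>"
proof -
  interpret D: galois_module G D by fact
  have "comm_group ((grp D)\<lparr>carrier := S\<rparr>)"
    by (rule group.group_comm_groupI[OF subgroup.subgroup_is_group[OF S D.is_group]])
       (simp add: D.m_comm subgroup.mem_carrier[OF S])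
  moreover have "act D g \<in> hom ((grp D)\<lparr>carrier := S\<rparr>) ((grp D)\<lparr>carrier := S\<rparr>)" if "g \<in> G" for g
    using that act subgroup.mem_carrier[OF S] hom_mult[OF D.act_hom] by (intro homI) auto
  ultimately show ?thesis
    using D.G_comp D.act_comp D.act_discrete subgroup.mem_carrier[OF S]
    by (simp add: galois_module_def galois_module_axioms_def)
qed

locale four_term = f: module_hom G A B f + g: module_hom G B D h + k: module_hom G D P k
  for G :: "('a \<Rightarrow> 'a) set" and A :: "('a \<Rightarrow> 'a, 'c) gmodule" and B :: "('a \<Rightarrow> 'a, 'd) gmodule"
    and D :: "('a \<Rightarrow> 'a, 'e) gmodule" and P :: "('a \<Rightarrow> 'a, 'f) gmodule" and f h k +
  assumes inj: "inj_on f (carrier (grp A))"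
    and exact_B: "x \<in> carrier (grp B) \<Longrightarrow> h x = \<one>\<^bsub>grp D\<^esub> \<longleftrightarrow> x \<in> f ` carrier (grp A)"
    and exact_D: "y \<in> carrier (grp D) \<Longrightarrow> k y = \<one>\<^bsub>grp P\<^esub> \<longleftrightarrow> y \<in> h ` carrier (grp B)"
    and surj: "k ` carrier (grp D) = carrier (grp P)"
begin

text \<open>The intermediate module that occurs anonymously inside \<open>double_connecting\<close>;
  a name allows the two short exact sequences to be set up as sublocales.\<close>

definition Q :: "('a \<Rightarrow> 'a, 'e) gmodule" where
  "Q = \<lparr>grp = (grp D)\<lparr>carrier := h ` carrier (grp B)\<rparr>, act = act D\<rparr>"

lemma Q_simps [simp]: "carrier (grp Q) = h ` carrier (grp B)" "monoid.mult (grp Q) = monoid.mult (grp D)"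
    "\<one>\<^bsub>grp Q\<^esub> = \<one>\<^bsub>grp D\<^esub>" "act Q = act D"
  by (simp_all add: Q_def)

lemma image_subgroup: "subgroup (h ` carrier (grp B)) (grp D)"
proof -
  interpret group_hom "grp B" "grp D" h
    using g.hom f.B.is_group g.B.is_group by (simp add: group_hom_def group_hom_axioms_def)
  show ?thesis by (rule img_is_subgroup)
qed

sublocale Q: galois_module G Q
  unfolding Q_def
  by (rule submodule[OF g.B.galois_module_axioms image_subgroup]) (auto simp: g.equivariant[symmetric])

sublocale incl: module_hom G Q D "\<lambda>x. x"
proof unfold_locales
  show "(\<lambda>x. x) \<in> hom (grp Q) (grp D)"
    using subgroup.mem_carrier[OF image_subgroup] by (intro homI) auto
qed simp

sublocale onto: module_hom G B Q h
proof unfold_locales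
  show "h \<in> hom (grp B) (grp Q)"
    using hom_mult[OF g.hom] by (intro homI) auto
qed (simp add: g.equivariant)

sublocale left: short_exact G A B Q f h
  by unfold_locales (use inj exact_B in auto)

sublocale right: short_exact G Q D P "\<lambda>x. x" k
  by unfold_locales (use exact_D surj in auto)

text \<open>Cochains are extensional functions, so a cochain in the image submodule is literally a
  cochain of D and pushing along the inclusion changes nothing.\<close>

lemma Q_cochain:
  assumes "q \<in> cochains G n Q" shows "incl.push n q = q" "q \<in> cochains G n D"
proof -
  show "incl.push n q = q"
    using assms by (auto simp: incl.push_def cochains_iff fun_eq_iff PiE_def extensional_def)
  then show "q \<in> cochains G n D" using incl.push_cochain[OF assms] by simp
qed

text \<open>A criterion in which the image module no longer appears: lift to D, lift the coboundary
  to B, lift its coboundary to A. The two applications of \<open>connecting_eq\<close> are glued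
  along the coboundary of \<open>d\<close>, read as a cocycle of \<open>Q\<close>.\<close>

lemma double_connecting_eq:
  assumes c: "c \<in> cocycles G n P" and d: "d \<in> cochains G n D" "k.push n d = c"
    and b: "b \<in> cochains G (Suc n) B" "g.push (Suc n) b = cobd G n D d"
    and a: "a \<in> cocycles G (Suc (Suc n)) A" "f.push (Suc (Suc n)) a = cobd G (Suc n) B b"
  shows "double_connecting G A B D P f h k n (cls G n P c) = cls G (Suc (Suc n)) A a"
proof -
  let ?q = "onto.push (Suc n) b"
  have q: "?q \<in> cochains G (Suc n) Q" by (rule onto.push_cochain[OF b(1)])
  have q_eq: "?q = cobd G n D d" using b(2) by (simp add: onto.push_def g.push_def)
  have "incl.push (Suc (Suc n)) (cobd G (Suc n) Q ?q) = cobd G (Suc n) D ?q"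
    using incl.cobd_push_eq[OF q] Q_cochain[OF q] by simp
  also have "\<dots> = \<one>\<^bsub>cochain_group G (Suc (Suc n)) D\<^esub>"
    unfolding q_eq using g.B.cobd_cobd[OF g.B.cochains_Pi[OF d(1)]] by (simp add: cochain_group_def)
  finally have "cobd G (Suc n) Q ?q = \<one>\<^bsub>cochain_group G (Suc (Suc n)) Q\<^esub>"
    using Q_cochain(1)[OF Q.cobd_cochain[OF q]] by (simp add: cochain_group_def)
  then have qc: "?q \<in> cocycles G (Suc n) Q" using q by (simp add: cocycles_def)
  have c': "c \<in> cochains G n P" using c by (simp add: cocycles_def)
  have "connecting G Q D P (\<lambda>x. x) k n (cls G n P c) = cls G (Suc n) Q ?q"
    by (rule right.connecting_eq[OF c' d(1) qc d(2) trans[OF Q_cochain(1)[OF q] q_eq]])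
  moreover have "connecting G A B Q f h (Suc n) (cls G (Suc n) Q ?q) = cls G (Suc (Suc n)) A a"
    by (rule left.connecting_eq[OF q b(1) a(1) refl a(2)])
  ultimately show ?thesis by (simp add: double_connecting_def Q_def)
qed

lemma double_connecting_exists:
  assumes "c \<in> cocycles G n P"
  obtains d b a where "d \<in> cochains G n D" "k.push n d = c"
    "b \<in> cochains G (Suc n) B" "g.push (Suc n) b = cobd G n D d"
    "a \<in> cocycles G (Suc (Suc n)) A" "f.push (Suc (Suc n)) a = cobd G (Suc n) B b"
proof -
  obtain d q where d: "d \<in> cochains G n D" "q \<in> cocycles G (Suc n) Q" "k.push n d = c" "incl.push (Suc n) q = cobd G n D d"
    using right.connecting_exists[OF assms] by metis
  obtain b a where b: "b \<in> cochains G (Suc n) B" "a \<in> cocycles G (Suc (Suc n)) A"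
    "onto.push (Suc n) b = q" "f.push (Suc (Suc n)) a = cobd G (Suc n) B b"
    using left.connecting_exists[OF d(2)] by metis
  have "q \<in> cochains G (Suc n) Q" using d(2) by (simp add: cocycles_def)
  then have "g.push (Suc n) b = cobd G n D d"
    using d(4) b(3) Q_cochain(1) by (simp add: onto.push_def g.push_def)
  then show ?thesis using that d b by blast
qed

end


section \<open>The cup product\<close>

text \<open>
  If \<open>d\<close> lifts \<open>ident\<close> and the 1-cocycle \<open>e\<close> lifts the coboundary of \<open>d\<close>, then the cochains
  \<open>cD d \<xi>\<close> and \<open>cB e \<xi>\<close> (the cup product of \<open>e\<close> and \<open>\<xi>\<close>) compute the double connecting homomorphism
  at \<open>\<xi>\<close>, and the latter is a cocycle.
\<close>

locale torsor_cup =
  X: four_term G A1 B1 D1 P1 f1 g1 h1 + Y: four_term G A2 B2 D2 P2 f2 g2 h2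
  for G :: "('a \<Rightarrow> 'a) set" and A1 :: "('a \<Rightarrow> 'a, 'c1) gmodule" and B1 :: "('a \<Rightarrow> 'a, 'd1) gmodule"
    and D1 :: "('a \<Rightarrow> 'a, 'e1) gmodule" and P1 :: "('a \<Rightarrow> 'a, 'f1) gmodule" and f1 g1 h1
    and A2 :: "('a \<Rightarrow> 'a, 'c2) gmodule" and B2 :: "('a \<Rightarrow> 'a, 'd2) gmodule"
    and D2 :: "('a \<Rightarrow> 'a, 'e2) gmodule" and P2 :: "('a \<Rightarrow> 'a, 'f2) gmodule" and f2 g2 h2 +
  fixes cB :: "'d1 \<Rightarrow> 'f2 \<Rightarrow> 'd2" and cD :: "'e1 \<Rightarrow> 'f2 \<Rightarrow> 'e2" and ident :: 'f1
  assumes cB_right: "b \<in> carrier (grp B1) \<Longrightarrow> cB b \<in> hom (grp P2) (grp B2)"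
    and cB_left: "p \<in> carrier (grp P2) \<Longrightarrow> (\<lambda>b. cB b p) \<in> hom (grp B1) (grp B2)"
    and cD_right: "d \<in> carrier (grp D1) \<Longrightarrow> cD d \<in> hom (grp P2) (grp D2)"
    and cD_left: "p \<in> carrier (grp P2) \<Longrightarrow> (\<lambda>d. cD d p) \<in> hom (grp D1) (grp D2)"
    and cB_act: "g \<in> G \<Longrightarrow> b \<in> carrier (grp B1) \<Longrightarrow> p \<in> carrier (grp P2) \<Longrightarrow>
      act B2 g (cB b p) = cB (act B1 g b) (act P2 g p)"
    and cD_act: "g \<in> G \<Longrightarrow> d \<in> carrier (grp D1) \<Longrightarrow> p \<in> carrier (grp P2) \<Longrightarrow>
      act D2 g (cD d p) = cD (act D1 g d) (act P2 g p)"
    and cD_g: "b \<in> carrier (grp B1) \<Longrightarrow> p \<in> carrier (grp P2) \<Longrightarrow> g2 (cB b p) = cD (g1 b) p"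
    and cD_h: "d \<in> carrier (grp D1) \<Longrightarrow> h1 d = ident \<Longrightarrow> p \<in> carrier (grp P2) \<Longrightarrow> h2 (cD d p) = p"
    and ident: "ident \<in> carrier (grp P1)" "g \<in> G \<Longrightarrow> act P1 g ident = ident"
    and obstruction: "double_connecting G A1 B1 D1 P1 f1 g1 h1 0 (cls G 0 P1 (\<lambda>gs\<in>tuples G 0. ident)) = coboundaries G 2 A1"
begin

lemma cB_closed [simp]: "b \<in> carrier (grp B1) \<Longrightarrow> p \<in> carrier (grp P2) \<Longrightarrow> cB b p \<in> carrier (grp B2)"
  using cB_right hom_in_carrier by metis

lemma cD_closed [simp]: "d \<in> carrier (grp D1) \<Longrightarrow> p \<in> carrier (grp P2) \<Longrightarrow> cD d p \<in> carrier (grp D2)"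
  using cD_right hom_in_carrier by metis

text \<open>The cocycle condition solved for its leading term, the only face that involves the
  action. Both coboundary computations below end in such a shifted alternating product and are
  collapsed by it.\<close>

lemma alternating_tail:
  assumes "\<xi> \<in> cocycles G n P2" "gs \<in> tuples G (Suc n)"
  shows "finprod (grp P2) (\<lambda>i. Y.k.B.sgn_pow (Y.k.B.coface n (Suc i) \<xi> gs) i) {..n} = act P2 (hd gs) (\<xi> (tl gs))"
proof -
  have \<xi>: "\<xi> \<in> tuples G n \<rightarrow> carrier (grp P2)" using assms(1) Y.k.B.cochains_Pi by (simp add: cocycles_def)
  note cl = Y.k.B.coface_closed[OF \<xi> assms(2)]
  let ?T = "finprod (grp P2) (\<lambda>i. Y.k.B.sgn_pow (Y.k.B.coface n (Suc i) \<xi> gs) i) {..n}"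
  have T: "?T \<in> carrier (grp P2)" using cl by (intro Y.k.B.finprod_closed) auto
  have "\<one>\<^bsub>grp P2\<^esub> = finprod (grp P2) (\<lambda>i. Y.k.B.sgn_pow (Y.k.B.coface n i \<xi> gs) i) {..Suc n}"
    using assms Y.k.B.cobd_eq[OF \<xi> assms(2)] by (simp add: Y.k.B.cocycles_iff)
  also have "\<dots> = finprod (grp P2) (\<lambda>i. Y.k.B.sgn_pow (Y.k.B.coface n (Suc i) \<xi> gs) (Suc i)) {..n}
      \<otimes>\<^bsub>grp P2\<^esub> Y.k.B.sgn_pow (Y.k.B.coface n 0 \<xi> gs) 0"
    using cl by (intro Y.k.B.finprod_Suc2) auto
  \<comment> \<open>Shifting the index by one contributes a sign to every factor; it is pulled out
    as an overall inverse.\<close>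
  also have "finprod (grp P2) (\<lambda>i. Y.k.B.sgn_pow (Y.k.B.coface n (Suc i) \<xi> gs) (Suc i)) {..n} =
      finprod (grp P2) (\<lambda>i. (Y.k.B.sgn_pow (Y.k.B.coface n (Suc i) \<xi> gs) i) [^]\<^bsub>grp P2\<^esub> (-1::int)) {..n}"
    using cl by (intro Y.k.B.finprod_cong') (auto simp: Y.k.B.int_pow_pow)
  also have "\<dots> = ?T [^]\<^bsub>grp P2\<^esub> (-1::int)"
    using cl by (intro hom_finprod[OF hom_int_pow_fun[OF Y.k.B.comm_group_axioms hom_id]
      Y.k.B.comm_group_axioms Y.k.B.comm_group_axioms, symmetric]) auto
  also have "\<dots> = inv\<^bsub>grp P2\<^esub> ?T" using T by (simp add: Y.k.B.int_pow_neg)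
  finally have "inv\<^bsub>grp P2\<^esub> ?T \<otimes>\<^bsub>grp P2\<^esub> act P2 (hd gs) (\<xi> (tl gs)) = \<one>\<^bsub>grp P2\<^esub>"
    using cl[of 0] by (simp add: Y.k.B.coface_def)
  moreover have y: "act P2 (hd gs) (\<xi> (tl gs)) \<in> carrier (grp P2)"
    using cl[of 0] by (simp add: Y.k.B.coface_def)
  ultimately have "inv\<^bsub>grp P2\<^esub> act P2 (hd gs) (\<xi> (tl gs)) = inv\<^bsub>grp P2\<^esub> ?T"
    using T by (intro Y.k.B.inv_equality) auto
  then have "inv\<^bsub>grp P2\<^esub> (inv\<^bsub>grp P2\<^esub> act P2 (hd gs) (\<xi> (tl gs))) = inv\<^bsub>grp P2\<^esub> (inv\<^bsub>grp P2\<^esub> ?T)"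
    by (rule arg_cong)
  then show ?thesis
    using T y by (simp only: Y.k.B.inv_inv)
qed

text \<open>Applied with \<phi> pairing by the lift of the identity, and with \<phi> acting by a
  group element and then pairing by a value of the 1-cocycle.\<close>

lemma hom_alternating_tail:
  assumes "comm_group H" "\<phi> \<in> hom (grp P2) H" "\<xi> \<in> cocycles G n P2" "gs \<in> tuples G (Suc n)"
  shows "finprod H (\<lambda>i. \<phi> (Y.k.B.coface n (Suc i) \<xi> gs) [^]\<^bsub>H\<^esub> ((-1) ^ i :: int)) {..n} = \<phi> (act P2 (hd gs) (\<xi> (tl gs)))"
proof -
  interpret H: comm_group H by fact
  have \<xi>: "\<xi> \<in> tuples G n \<rightarrow> carrier (grp P2)" using assms(3) Y.k.B.cochains_Pi by (simp add: cocycles_def)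
  note cl = Y.k.B.coface_closed[OF \<xi> assms(4)]
  have "finprod H (\<lambda>i. \<phi> (Y.k.B.coface n (Suc i) \<xi> gs) [^]\<^bsub>H\<^esub> ((-1) ^ i :: int)) {..n} =
      finprod H (\<lambda>i. \<phi> (Y.k.B.sgn_pow (Y.k.B.coface n (Suc i) \<xi> gs) i)) {..n}"
    using cl hom_in_carrier[OF assms(2) cl]
    by (intro H.finprod_cong') (auto simp: hom_int_pow[OF assms(2) cl Y.k.B.is_group H.is_group])
  also have "\<dots> = \<phi> (finprod (grp P2) (\<lambda>i. Y.k.B.sgn_pow (Y.k.B.coface n (Suc i) \<xi> gs) i) {..n})"
    using cl by (intro hom_finprod[OF assms(2) Y.k.B.comm_group_axioms assms(1), symmetric]) auto
  finally show ?thesis using alternating_tail[OF assms(3,4)] by simp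
qed

text \<open>Any chain of lifts dd, \<open>b\<close>, \<open>a\<close> of the constant cochain
  computes the obstruction. Its vanishing makes \<open>a\<close> a coboundary of some
  \<open>u\<close>, and dividing \<open>b\<close> by the image of \<open>u\<close> gives a closed
  cochain. The image of \<open>u\<close> is killed in D1, so the new cochain still lifts the
  coboundary of dd.\<close>

lemma obstruction_splitting:
  obtains d e where "d \<in> carrier (grp D1)" "h1 d = ident" "e \<in> cocycles G 1 B1"
    "\<And>g. g \<in> G \<Longrightarrow> g1 (e [g]) = act D1 g d \<otimes>\<^bsub>grp D1\<^esub> inv\<^bsub>grp D1\<^esub> d"
proof -
  let ?i = "\<lambda>gs\<in>tuples G 0. ident"
  have i: "?i \<in> cochains G 0 P1"
    using ident by (intro X.k.B.restrict_cochain) (auto simp: loc_const_def)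
  have "cobd G 0 P1 ?i gs = \<one>\<^bsub>grp P1\<^esub>" if "gs \<in> tuples G 1" for gs
    using that ident X.k.B.r_inv[OF ident(1)]
    by (auto simp: cobd_def tuples_Suc X.k.B.int_pow_neg)
  then have ic: "?i \<in> cocycles G 0 P1" using i by (simp add: X.k.B.cocycles_iff)
  obtain dd b a where dd: "dd \<in> cochains G 0 D1" "X.k.push 0 dd = ?i"
    and b: "b \<in> cochains G (Suc 0) B1" "X.g.push (Suc 0) b = cobd G 0 D1 dd"
    and a: "a \<in> cocycles G (Suc (Suc 0)) A1" "X.f.push (Suc (Suc 0)) a = cobd G (Suc 0) B1 b"
    using X.double_connecting_exists[OF ic] by metis
  have ac: "a \<in> cochains G 2 A1" using a by (simp add: cocycles_def numeral_2_eq_2)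
  have "cls G 2 A1 a = coboundaries G 2 A1"
    using X.double_connecting_eq[OF ic dd b a] obstruction by (simp add: numeral_2_eq_2)
  then have "a \<in> coboundaries G 2 A1" using X.f.A.cls_memI[OF ac] by simp
  then obtain u where u: "u \<in> cochains G 1 A1" "a = cobd G 1 A1 u"
    by (auto simp: coboundaries_def numeral_2_eq_2)
  interpret CB: comm_group "cochain_group G 1 B1" by (rule X.f.B.cochain_group)
  interpret CB2: comm_group "cochain_group G 2 B1" by (rule X.f.B.cochain_group)
  define e where "e = b \<otimes>\<^bsub>cochain_group G 1 B1\<^esub> inv\<^bsub>cochain_group G 1 B1\<^esub> X.f.push 1 u"
  have fu: "X.f.push 1 u \<in> cochains G 1 B1" by (rule X.f.push_cochain[OF u(1)])
  have b1: "b \<in> cochains G 1 B1" using b by simp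
  have ec: "e \<in> cochains G 1 B1" using CB.m_closed[of b] CB.inv_closed[of "X.f.push 1 u"] fu b1 by (simp add: e_def)
  have "cobd G 1 B1 e = cobd G 1 B1 b \<otimes>\<^bsub>cochain_group G 2 B1\<^esub> inv\<^bsub>cochain_group G 2 B1\<^esub> cobd G 1 B1 (X.f.push 1 u)"
    using b1 fu CB.inv_closed[of "X.f.push 1 u"]
    by (simp add: e_def X.f.B.cobd_mult X.f.B.cobd_inv numeral_2_eq_2)
  also have "cobd G 1 B1 (X.f.push 1 u) = cobd G 1 B1 b"
    using X.f.cobd_push_eq[OF u(1)] a(2) u(2) by simp
  also have "cobd G 1 B1 b \<otimes>\<^bsub>cochain_group G 2 B1\<^esub> inv\<^bsub>cochain_group G 2 B1\<^esub> cobd G 1 B1 b = \<one>\<^bsub>cochain_group G 2 B1\<^esub>"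
    using CB2.r_inv[of "cobd G 1 B1 b"] X.f.B.cobd_cochain[OF b1] by (simp add: numeral_2_eq_2)
  finally have ez: "e \<in> cocycles G 1 B1" using ec by (simp add: cocycles_def numeral_2_eq_2)
  let ?d = "dd []"
  have d: "?d \<in> carrier (grp D1)" using X.g.B.cochains_carrier[OF dd(1)] by simp
  have hd: "h1 ?d = ident" using fun_cong[OF dd(2), of "[]"] by simp
  have "g1 (e [g]) = act D1 g ?d \<otimes>\<^bsub>grp D1\<^esub> inv\<^bsub>grp D1\<^esub> ?d" if g: "g \<in> G" for g
  proof -
    have t: "[g] \<in> tuples G 1" using g by (simp add: tuples_def)
    have uc: "u [g] \<in> carrier (grp A1)" "b [g] \<in> carrier (grp B1)"
      using X.f.A.cochains_carrier[OF u(1) t] X.f.B.cochains_carrier[OF b1 t] .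
    have "e [g] = b [g] \<otimes>\<^bsub>grp B1\<^esub> inv\<^bsub>grp B1\<^esub> f1 (u [g])"
      using t fu by (simp add: e_def X.f.B.mult_cochain_group X.f.B.inv_cochain_group)
    then have "g1 (e [g]) = g1 (b [g]) \<otimes>\<^bsub>grp D1\<^esub> inv\<^bsub>grp D1\<^esub> g1 (f1 (u [g]))"
      using uc hom_mult[OF X.g.hom] hom_inv_image[OF X.g.hom X.f.B.is_group X.g.B.is_group] by simp
    also have "g1 (f1 (u [g])) = \<one>\<^bsub>grp D1\<^esub>" using X.exact_B[of "f1 (u [g])"] uc by simp
    also have "g1 (b [g]) = cobd G 0 D1 dd [g]"
      using fun_cong[OF b(2), of "[g]"] t by simp
    also have "\<dots> = act D1 g ?d \<otimes>\<^bsub>grp D1\<^esub> inv\<^bsub>grp D1\<^esub> ?d"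
      using t d g by (simp add: cobd_def X.g.B.int_pow_neg)
    finally show ?thesis using d g by simp
  qed
  then show ?thesis using that[of ?d e] d hd ez by blast
qed

text \<open>The chain of lifts is d cup xi, then e cup xi, then the neutral cochain. The last entry
  is allowed because e cup xi is closed when both factors are, and it makes the class
  trivial.\<close>

theorem double_connecting_trivial:
  assumes \<xi>: "\<xi> \<in> cocycles G n P2"
  shows "double_connecting G A2 B2 D2 P2 f2 g2 h2 n (cls G n P2 \<xi>) = coboundaries G (Suc (Suc n)) A2"
proof -
  obtain d e where d: "d \<in> carrier (grp D1)" "h1 d = ident" and e: "e \<in> cocycles G 1 B1"
    and ge: "\<And>g. g \<in> G \<Longrightarrow> g1 (e [g]) = act D1 g d \<otimes>\<^bsub>grp D1\<^esub> inv\<^bsub>grp D1\<^esub> d"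
    using obstruction_splitting by metis
  have \<xi>c: "\<xi> \<in> cochains G n P2" using \<xi> by (simp add: cocycles_def)
  have ec: "e \<in> cochains G 1 B1" using e by (simp add: cocycles_def)
  have e1: "e [g] \<in> carrier (grp B1)" if "g \<in> G" for g
    using X.f.B.cochains_carrier[OF ec, of "[g]"] that by (simp add: tuples_def)
  note \<xi>1 = Y.k.B.cochains_carrier[OF \<xi>c]
  have \<xi>a: "act P2 (hd gs) (\<xi> (tl gs)) \<in> carrier (grp P2)" if "gs \<in> tuples G (Suc n)" for gs
    using that by (simp add: \<xi>1)
  define dd where "dd = (\<lambda>gs\<in>tuples G n. cD d (\<xi> gs))"
  \<comment> \<open>The cup product in bidegree (1, n): the right factor is translated by the group
    element consumed by the left one.\<close>
  define E where "E = (\<lambda>gs\<in>tuples G (Suc n). cB (e [hd gs]) (act P2 (hd gs) (\<xi> (tl gs))))"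
  have dd: "dd \<in> cochains G n D2"
    unfolding dd_def using \<xi>c
    by (intro Y.g.B.restrict_cochain loc_const_comp[where \<phi>="cD d"]) (simp_all add: d \<xi>1, simp add: cochains_iff)
  have E: "E \<in> cochains G (Suc n) B2"
    unfolding E_def using \<xi>c ec
    by (intro Y.f.B.restrict_cochain loc_const_comp2[where \<phi>=cB] loc_const_hd Y.k.B.loc_const_act)
       (simp_all add: e1 \<xi>1 cochains_iff)
  have push_dd: "Y.k.push n dd = \<xi>"
    using Y.k.push_cochain[OF dd] \<xi>c
    by (intro Y.k.B.cochain_eqI[where n=n]) (simp_all add: dd_def cD_h d \<xi>1)
  \<comment> \<open>Face 0 of dd pairs the translate of \<open>d\<close> with g xi, while all other
    faces together collapse to \<open>d\<close> paired with the same g xi. The quotient is the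
    coboundary of \<open>d\<close> paired with g xi, and the coboundary of \<open>d\<close> is the
    image of \<open>e\<close>.\<close>
  have push_E: "Y.g.push (Suc n) E = cobd G n D2 dd"
  proof (rule Y.g.B.cochain_eqI[where n="Suc n", OF Y.g.push_cochain[OF E] Y.g.B.cobd_cochain[OF dd]])
    fix gs assume gs: "gs \<in> tuples G (Suc n)"
    let ?y = "act P2 (hd gs) (\<xi> (tl gs))" and ?C = "Y.g.B.coface n"
    note y = \<xi>a[OF gs]
    note cl = Y.g.B.coface_closed[OF Y.g.B.cochains_Pi[OF dd] gs]
    have c0: "?C 0 dd gs = cD (act D1 (hd gs) d) ?y"
      using gs d by (simp add: Y.g.B.coface_def dd_def cD_act \<xi>1)
    have cS: "?C (Suc i) dd gs = cD d (Y.k.B.coface n (Suc i) \<xi> gs)" for i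
      using gs Y.f.A.G_comp by (simp add: Y.g.B.coface_def Y.k.B.coface_def dd_def merge_tuples)
    have z: "cD d (Y.k.B.coface n i \<xi> gs) \<in> carrier (grp D2)" for i
      using d Y.k.B.coface_closed[OF Y.k.B.cochains_Pi[OF \<xi>c] gs] by simp
    have "cobd G n D2 dd gs = finprod (grp D2) (\<lambda>i. Y.g.B.sgn_pow (?C (Suc i) dd gs) (Suc i)) {..n}
        \<otimes>\<^bsub>grp D2\<^esub> Y.g.B.sgn_pow (?C 0 dd gs) 0"
      unfolding Y.g.B.cobd_eq[OF Y.g.B.cochains_Pi[OF dd] gs] using cl by (intro Y.g.B.finprod_Suc2) auto
    also have "finprod (grp D2) (\<lambda>i. Y.g.B.sgn_pow (?C (Suc i) dd gs) (Suc i)) {..n} =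
        finprod (grp D2) (\<lambda>i. (Y.g.B.sgn_pow (cD d (Y.k.B.coface n (Suc i) \<xi> gs)) i) [^]\<^bsub>grp D2\<^esub> (-1::int)) {..n}"
      using z by (intro Y.g.B.finprod_cong') (auto simp: Y.g.B.int_pow_pow cS)
    also have "\<dots> = finprod (grp D2) (\<lambda>i. Y.g.B.sgn_pow (cD d (Y.k.B.coface n (Suc i) \<xi> gs)) i) {..n} [^]\<^bsub>grp D2\<^esub> (-1::int)"
      using z by (intro hom_finprod[OF hom_int_pow_fun[OF Y.g.B.comm_group_axioms hom_id]
        Y.g.B.comm_group_axioms Y.g.B.comm_group_axioms, symmetric]) auto
    also have "finprod (grp D2) (\<lambda>i. Y.g.B.sgn_pow (cD d (Y.k.B.coface n (Suc i) \<xi> gs)) i) {..n} = cD d ?y"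
      by (rule hom_alternating_tail[OF Y.g.B.comm_group_axioms cD_right[OF d(1)] \<xi> gs])
    also have "cD d ?y [^]\<^bsub>grp D2\<^esub> (-1::int) = inv\<^bsub>grp D2\<^esub> cD d ?y"
      using y d by (simp add: Y.g.B.int_pow_neg)
    finally have "cobd G n D2 dd gs = inv\<^bsub>grp D2\<^esub> cD d ?y \<otimes>\<^bsub>grp D2\<^esub> cD (act D1 (hd gs) d) ?y"
      using c0 y d gs by simp
    also have "\<dots> = cD (act D1 (hd gs) d \<otimes>\<^bsub>grp D1\<^esub> inv\<^bsub>grp D1\<^esub> d) ?y"
      using y d gs hom_mult[OF cD_left[OF y]] hom_inv_image[OF cD_left[OF y] X.g.B.is_group Y.g.B.is_group]
      by (simp add: Y.g.B.m_comm)
    also have "\<dots> = cD (g1 (e [hd gs])) ?y" using gs by (simp add: ge)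
    also have "\<dots> = g2 (E gs)" using gs y by (simp add: E_def cD_g e1)
    finally show "Y.g.push (Suc n) E gs = cobd G n D2 dd gs" using gs by simp
  qed
  \<comment> \<open>Faces 0 and 1 carry the left factors g e(h) and e(gh); the remaining faces
    collapse to the left factor e(g). All are paired with gh xi, so together they form the
    coboundary of \<open>e\<close> at (g, h), which is trivial.\<close>
  have "cobd G (Suc n) B2 E = \<one>\<^bsub>cochain_group G (Suc (Suc n)) B2\<^esub>"
  proof (rule Y.f.B.cochain_eqI[where n="Suc (Suc n)", OF Y.f.B.cobd_cochain[OF E]])
    show "\<one>\<^bsub>cochain_group G (Suc (Suc n)) B2\<^esub> \<in> cochains G (Suc (Suc n)) B2"
      using Y.f.B.one_cocycle by (simp add: cocycles_def)
    fix gs assume gs: "gs \<in> tuples G (Suc (Suc n))"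
    obtain g h ks where gs_eq: "gs = g # h # ks" and g: "g \<in> G" "h \<in> G" and ks: "ks \<in> tuples G n"
      using gs by (auto simp: tuples_Suc)
    have hks: "h # ks \<in> tuples G (Suc n)" using g ks by (simp add: tuples_def)
    let ?z = "act P2 g (act P2 h (\<xi> ks))" and ?C = "Y.f.B.coface (Suc n)"
    have z: "?z \<in> carrier (grp P2)" using g \<xi>1[OF ks] by simp
    note cl = Y.f.B.coface_closed[OF Y.f.B.cochains_Pi[OF E] gs]
    have c0: "?C 0 E gs = cB (act B1 g (e [h])) ?z"
      using gs_eq hks g \<xi>1[OF ks] by (simp add: Y.f.B.coface_def E_def cB_act e1)
    have "merge 1 gs = (g \<circ> h) # ks" by (simp add: gs_eq merge_def)
    moreover have "(g \<circ> h) # ks \<in> tuples G (Suc n)" using Y.f.A.G_comp[OF g] ks by (simp add: tuples_def)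
    ultimately have c1: "?C (Suc 0) E gs = cB (e [g \<circ> h]) ?z"
      using g \<xi>1[OF ks] by (simp add: Y.f.B.coface_def E_def Y.k.B.act_comp)
    define \<phi> where "\<phi> = (\<lambda>p. cB (e [g]) (act P2 g p))"
    have \<phi>: "\<phi> \<in> hom (grp P2) (grp B2)"
      using hom_compose[OF Y.k.B.act_hom[OF g(1)] cB_right[OF e1[OF g(1)]]] by (simp add: \<phi>_def comp_def)
    have cS: "?C (Suc (Suc i)) E gs = \<phi> (Y.k.B.coface n (Suc i) \<xi> (h # ks))" for i
    proof (cases "Suc i \<le> n")
      case True
      have m: "merge (Suc (Suc i)) gs = g # merge (Suc i) (h # ks)"
        by (simp add: gs_eq merge_def)
      have "merge (Suc i) (h # ks) \<in> tuples G n"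
        using True by (intro merge_tuples[OF Y.f.A.G_comp hks]) auto
      then have "g # merge (Suc i) (h # ks) \<in> tuples G (Suc n)" using g by (simp add: tuples_def)
      then show ?thesis using True by (simp add: Y.f.B.coface_def Y.k.B.coface_def E_def m \<phi>_def)
    next
      case False
      have "butlast (h # ks) \<in> tuples G n" using hks by (rule butlast_tuples)
      then have "g # butlast (h # ks) \<in> tuples G (Suc n)" using g by (simp add: tuples_def)
      then show ?thesis using False by (simp add: Y.f.B.coface_def Y.k.B.coface_def E_def gs_eq \<phi>_def)
    qed
    \<comment> \<open>The faces from index 2 on. A shift by two leaves the signs unchanged, so the
      collapse by \<open>hom_alternating_tail\<close> involves no inverse.\<close>
    let ?S = "finprod (grp B2) (\<lambda>i. Y.f.B.sgn_pow (?C (Suc (Suc i)) E gs) (Suc (Suc i))) {..n}"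
    have "cobd G (Suc n) B2 E gs = finprod (grp B2) (\<lambda>i. Y.f.B.sgn_pow (?C (Suc i) E gs) (Suc i)) {..Suc n}
        \<otimes>\<^bsub>grp B2\<^esub> Y.f.B.sgn_pow (?C 0 E gs) 0"
      unfolding Y.f.B.cobd_eq[OF Y.f.B.cochains_Pi[OF E] gs] using cl by (intro Y.f.B.finprod_Suc2) auto
    also have "finprod (grp B2) (\<lambda>i. Y.f.B.sgn_pow (?C (Suc i) E gs) (Suc i)) {..Suc n} =
        ?S \<otimes>\<^bsub>grp B2\<^esub> Y.f.B.sgn_pow (?C (Suc 0) E gs) (Suc 0)"
      using cl by (intro Y.f.B.finprod_Suc2) auto
    also have "?S = finprod (grp B2) (\<lambda>i. Y.f.B.sgn_pow (\<phi> (Y.k.B.coface n (Suc i) \<xi> (h # ks))) i) {..n}"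
      by (simp add: cS)
    also have "\<dots> = \<phi> (act P2 (hd (h # ks)) (\<xi> (tl (h # ks))))"
      by (rule hom_alternating_tail[OF Y.f.B.comm_group_axioms \<phi> \<xi> hks])
    also have "\<dots> = cB (e [g]) ?z" by (simp add: \<phi>_def)
    finally have "cobd G (Suc n) B2 E gs =
        cB (e [g]) ?z \<otimes>\<^bsub>grp B2\<^esub> inv\<^bsub>grp B2\<^esub> cB (e [g \<circ> h]) ?z \<otimes>\<^bsub>grp B2\<^esub> cB (act B1 g (e [h])) ?z"
      using c0 c1 cl[of 1] cl[of 0] by (simp add: Y.f.B.int_pow_neg)
    also have "\<dots> = cB (e [g] \<otimes>\<^bsub>grp B1\<^esub> inv\<^bsub>grp B1\<^esub> e [g \<circ> h] \<otimes>\<^bsub>grp B1\<^esub> act B1 g (e [h])) ?z"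
      using hom_mult[OF cB_left[OF z]] hom_inv_image[OF cB_left[OF z] X.f.B.is_group Y.f.B.is_group]
        e1 g Y.f.A.G_comp[OF g] by simp
    also have "e [g] \<otimes>\<^bsub>grp B1\<^esub> inv\<^bsub>grp B1\<^esub> e [g \<circ> h] \<otimes>\<^bsub>grp B1\<^esub> act B1 g (e [h]) = cobd G 1 B1 e [g, h]"
    proof -
      have "[g, h] \<in> tuples G 2" using g by (simp add: tuples_def)
      then show ?thesis
        using e1[OF g(1)] e1[OF Y.f.A.G_comp[OF g]] X.f.B.act_closed[OF g(1) e1[OF g(2)]]
        by (simp add: cobd_def numeral_2_eq_2 merge_def X.f.B.int_pow_neg X.f.B.m_ac)
    qed
    also have "\<dots> = \<one>\<^bsub>grp B1\<^esub>"
      using e g by (simp add: X.f.B.cocycles_iff tuples_def)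
    also have "cB \<one>\<^bsub>grp B1\<^esub> ?z = \<one>\<^bsub>grp B2\<^esub>"
      by (rule hom_one[OF cB_left[OF z] X.f.B.is_group Y.f.B.is_group])
    finally show "cobd G (Suc n) B2 E gs = \<one>\<^bsub>cochain_group G (Suc (Suc n)) B2\<^esub> gs"
      using gs by (simp add: Y.f.B.one_cochain_group)
  qed
  then have "Y.f.push (Suc (Suc n)) \<one>\<^bsub>cochain_group G (Suc (Suc n)) A2\<^esub> = cobd G (Suc n) B2 E"
    by (simp add: Y.f.push_one)
  from Y.double_connecting_eq[OF \<xi> dd push_dd E push_E Y.f.A.one_cocycle this]
  show ?thesis by (simp add: Y.f.A.cls_one)
qed

end

section \<open>Monoid algebras\<close>

lemma poly_mapping_sum_single:
  "p = (\<Sum>e\<in>Poly_Mapping.keys p. Poly_Mapping.single e (Poly_Mapping.lookup p e))"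
proof (rule poly_mapping_eqI)
  fix k
  have "(\<Sum>e\<in>Poly_Mapping.keys p. Poly_Mapping.lookup (Poly_Mapping.single e (Poly_Mapping.lookup p e)) k) =
    (\<Sum>e\<in>Poly_Mapping.keys p. if e = k then Poly_Mapping.lookup p k else 0)"
    by (rule sum.cong) (auto simp: lookup_single when_def)
  then show "Poly_Mapping.lookup p k =
      Poly_Mapping.lookup (\<Sum>e\<in>Poly_Mapping.keys p. Poly_Mapping.single e (Poly_Mapping.lookup p e)) k"
    by (simp add: lookup_sum in_keys_iff)
qed

lemma poly_mapping_additive_induct [case_names single add]:
  assumes "\<And>e c. P (Poly_Mapping.single e c)" "\<And>p q. P p \<Longrightarrow> P q \<Longrightarrow> P (p + q)"
  shows "P (p :: 'e \<Rightarrow>\<^sub>0 'k::comm_monoid_add)"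
proof -
  have "P (\<Sum>e\<in>K. Poly_Mapping.single e (f e))" if "finite K" for K :: "'e set" and f
    using that
  proof (induction K)
    case empty
    then show ?case using assms(1)[of undefined 0] by simp
  qed (simp add: assms)
  from this[OF finite_keys, of "Poly_Mapping.lookup p" p] show ?thesis
    by (simp only: poly_mapping_sum_single[symmetric])
qed

text \<open>The common shape of \<open>meval\<close>, \<open>map_exp\<close> and the coefficientwise
  map. Additivity and multiplicativity are proved once here and specialised afterwards.\<close>

definition lin_ext :: "('e \<Rightarrow> 'k \<Rightarrow> 'r::comm_monoid_add) \<Rightarrow> ('e \<Rightarrow>\<^sub>0 'k::zero) \<Rightarrow> 'r" where
  "lin_ext F p = (\<Sum>e\<in>Poly_Mapping.keys p. F e (Poly_Mapping.lookup p e))"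

lemma lin_ext_superset:
  assumes "\<And>e. F e 0 = 0" "finite S" "Poly_Mapping.keys p \<subseteq> S"
  shows "lin_ext F p = (\<Sum>e\<in>S. F e (Poly_Mapping.lookup p e))"
  unfolding lin_ext_def using assms by (intro sum.mono_neutral_left) (auto simp: in_keys_iff)

lemma lin_ext_zero [simp]: "lin_ext F 0 = 0"
  by (simp add: lin_ext_def)

lemma lin_ext_single:
  assumes "\<And>e. F e 0 = 0"
  shows "lin_ext F (Poly_Mapping.single e c) = F e c"
  using assms by (simp add: lin_ext_def)

text \<open>Cancellation may shrink the support of a sum, so all three expressions are first written
  over the union of the two supports.\<close>

lemma lin_ext_add:
  fixes F :: "'e \<Rightarrow> 'k::comm_monoid_add \<Rightarrow> 'r::comm_monoid_add"
  assumes "\<And>e. F e 0 = 0" "\<And>e a b. F e (a + b) = F e a + F e b"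
  shows "lin_ext F (p + q) = lin_ext F p + lin_ext F q"
proof -
  let ?S = "Poly_Mapping.keys p \<union> Poly_Mapping.keys q"
  have "lin_ext F (p + q) = (\<Sum>e\<in>?S. F e (Poly_Mapping.lookup (p + q) e))"
    by (rule lin_ext_superset) (auto simp: assms keys_add)
  also have "\<dots> = (\<Sum>e\<in>?S. F e (Poly_Mapping.lookup p e)) + (\<Sum>e\<in>?S. F e (Poly_Mapping.lookup q e))"
    by (simp add: lookup_add assms sum.distrib)
  also have "\<dots> = lin_ext F p + lin_ext F q"
    by (simp add: lin_ext_superset[of F ?S p] lin_ext_superset[of F ?S q] assms)
  finally show ?thesis .
qed

text \<open>Membership in \<open>ring_hom rng rng\<close> restated as unconditional equations on
  types, which avoids carrier conditions; \<open>rhom_ring_hom\<close> translates between the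
  two.\<close>

definition rhom :: "('a::comm_ring_1 \<Rightarrow> 'b::comm_ring_1) \<Rightarrow> bool" where
  "rhom \<phi> \<longleftrightarrow> \<phi> 1 = 1 \<and> (\<forall>a b. \<phi> (a + b) = \<phi> a + \<phi> b) \<and> (\<forall>a b. \<phi> (a * b) = \<phi> a * \<phi> b)"

lemma rhomI: "\<phi> 1 = 1 \<Longrightarrow> (\<And>a b. \<phi> (a + b) = \<phi> a + \<phi> b) \<Longrightarrow> (\<And>a b. \<phi> (a * b) = \<phi> a * \<phi> b) \<Longrightarrow> rhom \<phi>"
  by (simp add: rhom_def)

lemma rhom_one: "rhom \<phi> \<Longrightarrow> \<phi> 1 = 1"
  and rhom_add: "rhom \<phi> \<Longrightarrow> \<phi> (a + b) = \<phi> a + \<phi> b"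
  and rhom_mult: "rhom \<phi> \<Longrightarrow> \<phi> (a * b) = \<phi> a * \<phi> b"
  by (simp_all add: rhom_def)

lemma rhom_zero: "rhom \<phi> \<Longrightarrow> \<phi> 0 = 0"
  using rhom_add[of \<phi> 0 0] by simp

lemma rhom_diff: "rhom \<phi> \<Longrightarrow> \<phi> (a - b) = \<phi> a - \<phi> b"
  using rhom_add[of \<phi> "a - b" b] by (simp add: algebra_simps)

lemma rhom_power: "rhom \<phi> \<Longrightarrow> \<phi> (a ^ n) = \<phi> a ^ n"
  by (induction n) (simp_all add: rhom_one rhom_mult)

lemma rhom_sum: "rhom \<phi> \<Longrightarrow> \<phi> (sum f A) = (\<Sum>x\<in>A. \<phi> (f x))"
  by (induction A rule: infinite_finite_induct) (simp_all add: rhom_zero rhom_add)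

lemma rhom_prod: "rhom \<phi> \<Longrightarrow> \<phi> (prod f A) = (\<Prod>x\<in>A. \<phi> (f x))"
  by (induction A rule: infinite_finite_induct) (simp_all add: rhom_one rhom_mult)

lemma rhom_comp: "rhom \<phi> \<Longrightarrow> rhom \<psi> \<Longrightarrow> rhom (\<lambda>x. \<phi> (\<psi> x))"
  by (simp add: rhom_def)

lemma rhom_ring_hom: "\<phi> \<in> ring_hom rng rng \<longleftrightarrow> rhom \<phi>"
  by (auto simp: ring_hom_def ring_of_type_algebra_def rhom_def)

lemma rhom_lin_ext:
  fixes F :: "'e::comm_monoid_add \<Rightarrow> 'k::comm_ring_1 \<Rightarrow> 'r::comm_ring_1"
  assumes "F 0 1 = 1" "\<And>e a b. F e (a + b) = F e a + F e b"
    and "\<And>e f a b. F (e + f) (a * b) = F e a * F f b"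
  shows "rhom (lin_ext F)"
proof (rule rhomI)
  have F0: "F e 0 = 0" for e using assms(2)[of e 0 0] by simp
  show "lin_ext F 1 = 1"
    using lin_ext_single[of F 0 1, OF F0] assms(1) by simp
  show add: "lin_ext F (a + b) = lin_ext F a + lin_ext F b" for a b
    by (rule lin_ext_add[OF F0 assms(2)])
  show "lin_ext F (a * b) = lin_ext F a * lin_ext F b" for a b
  proof (induction a rule: poly_mapping_additive_induct)
    case (single e c)
    show ?case
    proof (induction b rule: poly_mapping_additive_induct)
      case (single e' c')
      then show ?case by (simp add: mult_single lin_ext_single F0 assms(3))
    qed (simp add: distrib_left add)
  qed (simp add: distrib_right add)
qed

lemma map_lookup: "\<sigma> 0 = 0 \<Longrightarrow> Poly_Mapping.lookup (Poly_Mapping.map \<sigma> p) e = \<sigma> (Poly_Mapping.lookup p e)"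
  by (simp add: Poly_Mapping.map.rep_eq when_def)

lemma rhom_poly_mapping_map:
  assumes "rhom \<sigma>"
  shows "rhom (Poly_Mapping.map \<sigma> :: ('e::comm_monoid_add \<Rightarrow>\<^sub>0 'k::comm_ring_1) \<Rightarrow> ('e \<Rightarrow>\<^sub>0 'l::comm_ring_1))"
proof -
  note s = rhom_zero[OF assms] rhom_add[OF assms] rhom_mult[OF assms] rhom_one[OF assms]
  have "rhom (lin_ext (\<lambda>e c. Poly_Mapping.single e (\<sigma> c)) :: ('e \<Rightarrow>\<^sub>0 'k) \<Rightarrow> ('e \<Rightarrow>\<^sub>0 'l))"
    by (rule rhom_lin_ext) (simp_all add: s single_add mult_single)
  moreover have "lin_ext (\<lambda>e c. Poly_Mapping.single e (\<sigma> c)) = (Poly_Mapping.map \<sigma> :: ('e \<Rightarrow>\<^sub>0 'k) \<Rightarrow> _)"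
  proof
    fix p :: "'e \<Rightarrow>\<^sub>0 'k"
    show "lin_ext (\<lambda>e c. Poly_Mapping.single e (\<sigma> c)) p = Poly_Mapping.map \<sigma> p"
    proof (induction p rule: poly_mapping_additive_induct)
      case (single e c)
      then show ?case
        by (intro poly_mapping_eqI) (simp add: lin_ext_single s map_lookup lookup_single when_def)
    next
      case (add p q)
      then show ?case
        by (intro poly_mapping_eqI) (simp add: lin_ext_add s single_add map_lookup lookup_add)
    qed
  qed
  ultimately show ?thesis by simp
qed

lemma map_map: "\<sigma> 0 = 0 \<Longrightarrow> \<tau> 0 = 0 \<Longrightarrow>
    Poly_Mapping.map \<sigma> (Poly_Mapping.map \<tau> p) = Poly_Mapping.map (\<lambda>x. \<sigma> (\<tau> x)) p"
  by (rule poly_mapping_eqI) (simp add: map_lookup)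

lemma map_id: "(\<And>x. \<sigma> x = x) \<Longrightarrow> Poly_Mapping.map \<sigma> p = p"
  by (rule poly_mapping_eqI) (simp add: map_lookup)

lemma map_mvar: "rhom \<sigma> \<Longrightarrow> Poly_Mapping.map \<sigma> (mvar i) = mvar i"
  by (simp add: mvar_def rhom_zero rhom_one)

text \<open>The source of all discreteness statements below: the effect of an automorphism on a
  polynomial depends only on its values at finitely many coefficients.\<close>

lemma map_cong_coeffs:
  assumes "\<sigma> 0 = 0" "\<tau> 0 = 0" "\<And>e. e \<in> Poly_Mapping.keys p \<Longrightarrow> \<sigma> (Poly_Mapping.lookup p e) = \<tau> (Poly_Mapping.lookup p e)"
  shows "Poly_Mapping.map \<sigma> p = Poly_Mapping.map \<tau> p"
proof (rule poly_mapping_eqI)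
  fix e
  show "Poly_Mapping.lookup (Poly_Mapping.map \<sigma> p) e = Poly_Mapping.lookup (Poly_Mapping.map \<tau> p) e"
    using assms by (cases "e \<in> Poly_Mapping.keys p") (simp_all add: map_lookup in_keys_iff)
qed

lemma map_exp_eq: "map_exp h = lin_ext (\<lambda>e. Poly_Mapping.single (h e))"
  by (simp add: fun_eq_iff map_exp_def lin_ext_def)

lemma map_exp_add: "map_exp h (p + q) = map_exp h p + map_exp h q"
  unfolding map_exp_eq by (rule lin_ext_add) (simp_all add: single_add)

lemma map_exp_single [simp]: "map_exp h (Poly_Mapping.single e c) = Poly_Mapping.single (h e) c"
  unfolding map_exp_eq by (rule lin_ext_single) simp

lemma map_exp_zero [simp]: "map_exp h 0 = 0"
  by (simp add: map_exp_def)

lemma single_one_inj: "Poly_Mapping.single a (1::'k::zero_neq_one) = Poly_Mapping.single b 1 \<longleftrightarrow> a = b"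
  by (metis lookup_single_eq lookup_single_not_eq zero_neq_one)

lemma rhom_map_exp:
  assumes "h 0 = 0" "\<And>a b. h (a + b) = h a + h b"
  shows "rhom (map_exp h :: ('e::comm_monoid_add \<Rightarrow>\<^sub>0 'k::comm_ring_1) \<Rightarrow> ('f::comm_monoid_add \<Rightarrow>\<^sub>0 'k))"
  unfolding map_exp_eq by (rule rhom_lin_ext) (simp_all add: assms single_add mult_single)

lemma map_exp_map_exp: "map_exp h (map_exp k p) = map_exp (\<lambda>e. h (k e)) p"
  by (induction p rule: poly_mapping_additive_induct) (simp_all add: map_exp_add)

lemma map_exp_cong: "(\<And>e. e \<in> Poly_Mapping.keys p \<Longrightarrow> h e = k e) \<Longrightarrow> map_exp h p = map_exp k p"
  by (simp add: map_exp_def)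

lemma map_map_exp:
  fixes p :: "'e \<Rightarrow>\<^sub>0 'k::comm_ring_1" and h :: "'e \<Rightarrow> 'f"
  assumes "rhom \<sigma>"
  shows "Poly_Mapping.map \<sigma> (map_exp h p) = map_exp h (Poly_Mapping.map \<sigma> p)"
proof (induction p rule: poly_mapping_additive_induct)
  case (single e c)
  then show ?case by (simp add: rhom_zero[OF assms])
next
  case (add p q)
  have "Poly_Mapping.map \<sigma> (a + b) = Poly_Mapping.map \<sigma> a + Poly_Mapping.map \<sigma> b" for a b :: "'e \<Rightarrow>\<^sub>0 'k"
    by (rule poly_mapping_eqI) (simp add: map_lookup lookup_add rhom_zero[OF assms] rhom_add[OF assms])
  moreover have "Poly_Mapping.map \<sigma> (a + b) = Poly_Mapping.map \<sigma> a + Poly_Mapping.map \<sigma> b" for a b :: "'f \<Rightarrow>\<^sub>0 'k"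
    by (rule poly_mapping_eqI) (simp add: map_lookup lookup_add rhom_zero[OF assms] rhom_add[OF assms])
  ultimately show ?case using add by (simp add: map_exp_add)
qed

lemma mconst_mult: "mconst (a * b) = mconst a * mconst b"
  by (simp add: mult_single)

lemma rhom_mconst: "rhom (mconst :: 'k::comm_ring_1 \<Rightarrow> ('e::comm_monoid_add \<Rightarrow>\<^sub>0 'k))"
  by (rule rhomI) (simp_all add: single_add mult_single)

definition monomial_eval :: "('v \<Rightarrow> 'r::comm_ring_1) \<Rightarrow> ('v \<Rightarrow>\<^sub>0 nat) \<Rightarrow> 'r" where
  "monomial_eval v e = (\<Prod>i\<in>Poly_Mapping.keys e. v i ^ Poly_Mapping.lookup e i)"

lemma monomial_eval_superset:
  "finite S \<Longrightarrow> Poly_Mapping.keys e \<subseteq> S \<Longrightarrow> monomial_eval v e = (\<Prod>i\<in>S. v i ^ Poly_Mapping.lookup e i)"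
  unfolding monomial_eval_def by (rule prod.mono_neutral_left) (auto simp: in_keys_iff)

lemma monomial_eval_add: "monomial_eval v (e + f) = monomial_eval v e * monomial_eval v f"
proof -
  let ?S = "Poly_Mapping.keys e \<union> Poly_Mapping.keys f"
  have "monomial_eval v (e + f) = (\<Prod>i\<in>?S. v i ^ Poly_Mapping.lookup (e + f) i)"
    by (rule monomial_eval_superset) (auto simp: keys_add)
  then show ?thesis
    by (simp add: lookup_add power_add prod.distrib monomial_eval_superset[of ?S e] monomial_eval_superset[of ?S f])
qed

lemma meval_eq: "meval s v = lin_ext (\<lambda>e c. s c * monomial_eval v e)"
  by (simp add: fun_eq_iff meval_def lin_ext_def monomial_eval_def)

lemma rhom_meval: "rhom s \<Longrightarrow> rhom (meval s v)"
  unfolding meval_eq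
  by (rule rhom_lin_ext)
     (simp_all add: rhom_one rhom_add rhom_mult monomial_eval_add algebra_simps, simp add: monomial_eval_def)

lemma meval_single: "rhom s \<Longrightarrow> meval s v (Poly_Mapping.single e c) = s c * monomial_eval v e"
  unfolding meval_eq by (rule lin_ext_single) (simp add: rhom_zero)

lemma meval_mconst: "rhom s \<Longrightarrow> meval s v (mconst c) = s c"
  by (simp add: meval_single monomial_eval_def)

lemma meval_mvar: "rhom s \<Longrightarrow> meval s v (mvar i) = v i"
  by (simp add: mvar_def meval_single monomial_eval_def rhom_one)

lemma rhom_meval_comp:
  assumes "rhom \<phi>" "rhom s"
  shows "\<phi> (meval s v f) = meval (\<lambda>c. \<phi> (s c)) (\<lambda>i. \<phi> (v i)) f"
  by (simp add: meval_def rhom_sum[OF assms(1)] rhom_mult[OF assms(1)] rhom_prod[OF assms(1)] rhom_power[OF assms(1)])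

lemma meval_map:
  assumes "rhom \<sigma>" "rhom s"
  shows "meval s v (Poly_Mapping.map \<sigma> f) = meval (\<lambda>c. s (\<sigma> c)) v f"
proof (induction f rule: poly_mapping_additive_induct)
  case (single e c)
  then show ?case
    by (simp add: rhom_zero[OF assms(1)] meval_single assms rhom_comp[OF assms(2,1)])
next
  case (add p q)
  then show ?case
    by (simp add: rhom_add[OF rhom_poly_mapping_map[OF assms(1)]] rhom_add[OF rhom_meval[OF assms(2)]]
        rhom_add[OF rhom_meval[OF rhom_comp[OF assms(2,1)]]])
qed

lemma mpoly_induct [case_names const var add]:
  fixes p :: "('v, 'k::comm_ring_1) mpoly"
  assumes "\<And>c. P (mconst c)" "\<And>p i. P p \<Longrightarrow> P (p * mvar i)" "\<And>p q. P p \<Longrightarrow> P q \<Longrightarrow> P (p + q)"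
  shows "P p"
proof (induction p rule: poly_mapping_additive_induct)
  case (single e c)
  \<comment> \<open>Stated for every multiplier \<open>q\<close> so that a monomial can be built up
    one variable at a time.\<close>
  have "P q \<Longrightarrow> P (q * Poly_Mapping.single e 1)" for q
  proof (induction e arbitrary: q rule: poly_mapping_additive_induct)
    case (single i n)
    have "Poly_Mapping.single (Poly_Mapping.single i n) 1 = (mvar i ^ n :: ('v, 'k) mpoly)"
    proof (induction n)
      case (Suc n)
      have "Poly_Mapping.single i (Suc n) = Poly_Mapping.single i 1 + Poly_Mapping.single i n"
        by (simp flip: single_add)
      then have "Poly_Mapping.single (Poly_Mapping.single i (Suc n)) 1 =
          (mvar i * Poly_Mapping.single (Poly_Mapping.single i n) 1 :: ('v, 'k) mpoly)"
        by (simp add: mvar_def mult_single)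
      then show ?case using Suc by simp
    qed simp
    moreover have "P (q * mvar i ^ n)"
    proof (induction n)
      case (Suc n)
      then show ?case using assms(2)[of "q * mvar i ^ n" i] by (simp add: ac_simps)
    qed (use single in simp)
    ultimately show ?case by simp
  next
    case (add e f)
    then have "P (q * Poly_Mapping.single e 1 * Poly_Mapping.single f 1)" by blast
    then show ?case by (simp add: mult.assoc mult_single)
  qed
  from this[OF assms(1)[of c]] show ?case by (simp add: mult_single)
qed (use assms in blast)

lemma meval_meval:
  assumes "rhom s"
  shows "meval s v (meval mconst w f) = meval s (\<lambda>i. meval s v (w i)) f"
  using rhom_meval_comp[OF rhom_meval[OF assms, of v] rhom_mconst, of w f] by (simp add: meval_mconst assms)

section \<open>Ideals of type-class rings\<close>

lemma rng_simps [simp]: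
  "carrier rng = UNIV" "monoid.mult rng = (*)" "add rng = (+)" "\<one>\<^bsub>rng\<^esub> = 1" "\<zero>\<^bsub>rng\<^esub> = 0"
  by (simp_all add: ring_of_type_algebra_def fun_eq_iff)

lemma cring_rng: "cring (rng :: 'a::comm_ring_1 ring)"
  by (rule cring_from_type_algebra)

lemma ideal_rng_iff:
  "ideal I (rng :: 'a::comm_ring_1 ring) \<longleftrightarrow>
    0 \<in> I \<and> (\<forall>a\<in>I. \<forall>b\<in>I. a + b \<in> I) \<and> (\<forall>a\<in>I. \<forall>r. r * a \<in> I)" (is "_ \<longleftrightarrow> ?R")
proof
  assume "ideal I (rng :: 'a ring)"
  then interpret ideal I "rng :: 'a ring" .
  show ?R
    using additive_subgroup.zero_closed[OF is_additive_subgroup]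
      additive_subgroup.a_closed[OF is_additive_subgroup] I_l_closed by simp
next
  assume R: ?R
  have neg: "- a \<in> I" if "a \<in> I" for a using R that by (metis mult_minus1)
  interpret cring "rng :: 'a ring" by (rule cring_rng)
  have inv: "inv\<^bsub>add_monoid (rng :: 'a ring)\<^esub> a = - a" for a
    using minus_equality[of "- a" a] by (simp add: a_inv_def)
  show "ideal I (rng :: 'a ring)"
  proof (rule idealI[OF ring_axioms])
    show "subgroup I (add_monoid (rng :: 'a ring))"
    proof (rule group.subgroupI[OF a_group])
      show "inv\<^bsub>add_monoid (rng :: 'a ring)\<^esub> a \<in> I" if "a \<in> I" for a
        by (simp only: inv neg that)
    qed (use R in auto)
  qed (use R in \<open>auto simp: mult.commute\<close>)
qed

lemma ideal_rngD:
  assumes "ideal I (rng :: 'a::comm_ring_1 ring)"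
  shows "0 \<in> I" "a \<in> I \<Longrightarrow> b \<in> I \<Longrightarrow> a + b \<in> I" "a \<in> I \<Longrightarrow> r * a \<in> I" "a \<in> I \<Longrightarrow> a * r \<in> I"
    "a \<in> I \<Longrightarrow> - a \<in> I" "a \<in> I \<Longrightarrow> b \<in> I \<Longrightarrow> a - b \<in> I"
proof -
  note R = assms[unfolded ideal_rng_iff]
  show "0 \<in> I" "a \<in> I \<Longrightarrow> b \<in> I \<Longrightarrow> a + b \<in> I" "a \<in> I \<Longrightarrow> r * a \<in> I" "a \<in> I \<Longrightarrow> a * r \<in> I"
    using R by (auto simp: mult.commute)
  show neg: "a \<in> I \<Longrightarrow> - a \<in> I" for a using R by (metis mult_minus1)
  show "a \<in> I \<Longrightarrow> b \<in> I \<Longrightarrow> a - b \<in> I" using R neg[of b] by (metis diff_conv_add_uminus)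
qed

lemma Idl_ideal: "ideal (Idl\<^bsub>rng\<^esub> S) (rng :: 'a::comm_ring_1 ring)"
  by (rule ring.genideal_ideal[OF cring.axioms(1)[OF cring_rng]]) simp

lemma Idl_self: "s \<in> S \<Longrightarrow> s \<in> Idl\<^bsub>rng :: 'a::comm_ring_1 ring\<^esub> S"
  using ring.genideal_self[OF cring.axioms(1)[OF cring_rng], of S] by auto

lemma Idl_minimal: "ideal I (rng :: 'a::comm_ring_1 ring) \<Longrightarrow> S \<subseteq> I \<Longrightarrow> Idl\<^bsub>rng\<^esub> S \<subseteq> I"
  by (rule ring.genideal_minimal[OF cring.axioms(1)[OF cring_rng]])

lemma ideal_vimage:
  assumes "rhom \<phi>" "ideal I rng"
  shows "ideal (\<phi> -` I) rng"
  using assms(1) ideal_rngD[OF assms(2)] by (simp add: ideal_rng_iff rhom_zero rhom_add rhom_mult)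

lemma ideal_zero: "ideal {0} (rng :: 'a::comm_ring_1 ring)"
  by (simp add: ideal_rng_iff)

text \<open>The preimage of an ideal is an ideal, so membership of the image only has to be checked
  on generators.\<close>

lemma rhom_Idl:
  assumes "rhom \<phi>" "ideal I rng" "\<And>s. s \<in> S \<Longrightarrow> \<phi> s \<in> I" "x \<in> Idl\<^bsub>rng\<^esub> S"
  shows "\<phi> x \<in> I"
  using Idl_minimal[OF ideal_vimage[OF assms(1,2)], of S] assms(3,4) by auto

lemma rhom_Idl_zero:
  assumes "rhom \<phi>" "\<And>s. s \<in> S \<Longrightarrow> \<phi> s = 0" "x \<in> Idl\<^bsub>rng\<^esub> S"
  shows "\<phi> x = 0"
  using rhom_Idl[OF assms(1) ideal_zero, of S x] assms(2,3) by simp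

lemma ext_ideal_ideal: "ideal (ext_ideal \<iota> I) rng"
  unfolding ext_ideal_def by (rule Idl_ideal)

text \<open>The generators have coefficients in the image of \<iota>, and \<sigma> fixes
  these.\<close>

lemma map_ext_ideal:
  assumes "rhom \<sigma>" "rhom \<iota>" "\<And>x. \<sigma> (\<iota> x) = \<iota> x" "f \<in> ext_ideal \<iota> I"
  shows "Poly_Mapping.map \<sigma> f \<in> ext_ideal \<iota> I"
proof (rule rhom_Idl[OF rhom_poly_mapping_map[OF assms(1)] ext_ideal_ideal _ assms(4)[unfolded ext_ideal_def]])
  fix s assume s: "s \<in> Poly_Mapping.map \<iota> ` I"
  then have "Poly_Mapping.map \<sigma> s = s"
    using assms(1-3) by (auto simp: map_map rhom_zero)
  then show "Poly_Mapping.map \<sigma> s \<in> ext_ideal \<iota> I"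
    unfolding ext_ideal_def using Idl_self[OF s] by simp
qed

section \<open>Points of group schemes\<close>

lemma pt_mult_rhom:
  assumes "rhom \<phi>" "rhom s"
  shows "\<phi> (pt_mult T s v w i) = pt_mult T (\<lambda>c. \<phi> (s c)) (\<lambda>j. \<phi> (v j)) (\<lambda>j. \<phi> (w j)) i"
proof -
  have "(\<lambda>x. \<phi> (case_sum v w x)) = case_sum (\<lambda>j. \<phi> (v j)) (\<lambda>j. \<phi> (w j))"
    by (simp add: fun_eq_iff split: sum.split)
  then show ?thesis
    unfolding pt_mult_def rhom_meval_comp[OF assms] by (rule arg_cong)
qed

lemma pt_mult_base_change:
  assumes "rhom \<iota>" "rhom s"
  shows "pt_mult (base_change \<iota> T) s v w = pt_mult T (\<lambda>c. s (\<iota> c)) v w"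
  by (simp add: pt_mult_def base_change_def meval_map[OF assms] fun_eq_iff)

text \<open>Points of a base change with values in an algebra are points of the original scheme, the
  algebra being viewed over the small field through \<iota>. The group axioms, stated over the small
  field, thus become available for points over the large one.\<close>

lemma ext_ideal_zero_iff:
  assumes "rhom \<iota>" "rhom s"
  shows "(\<forall>f\<in>ext_ideal \<iota> I. meval s v f = 0) \<longleftrightarrow> (\<forall>f\<in>I. meval (\<lambda>c. s (\<iota> c)) v f = 0)"
proof
  assume L: "\<forall>f\<in>ext_ideal \<iota> I. meval s v f = 0"
  show "\<forall>f\<in>I. meval (\<lambda>c. s (\<iota> c)) v f = 0"
  proof
    fix f assume "f \<in> I"
    then have "Poly_Mapping.map \<iota> f \<in> ext_ideal \<iota> I" unfolding ext_ideal_def by (intro Idl_self) simp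
    then show "meval (\<lambda>c. s (\<iota> c)) v f = 0" using L by (simp flip: meval_map[OF assms])
  qed
next
  assume R: "\<forall>f\<in>I. meval (\<lambda>c. s (\<iota> c)) v f = 0"
  show "\<forall>f\<in>ext_ideal \<iota> I. meval s v f = 0"
  proof
    fix f assume "f \<in> ext_ideal \<iota> I"
    then have f: "f \<in> Idl\<^bsub>rng\<^esub> (Poly_Mapping.map \<iota> ` I)" by (simp add: ext_ideal_def)
    show "meval s v f = 0"
    proof (rule rhom_Idl_zero[OF rhom_meval[OF assms(2)] _ f])
      fix g assume "g \<in> Poly_Mapping.map \<iota> ` I"
      then obtain h where "h \<in> I" "g = Poly_Mapping.map \<iota> h" by blast
      then show "meval s v g = 0" using R by (simp add: meval_map[OF assms])
    qed
  qed
qed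

text \<open>
  \<open>v = 1v = (v\<^sup>-\<^sup>1v)v = v\<^sup>-\<^sup>1(vv) = v\<^sup>-\<^sup>1v = 1\<close>
\<close>

lemma idempotent_point:
  assumes T: "is_group_scheme T" and s: "rhom s"
    and v: "\<And>f. f \<in> ideal_of T \<Longrightarrow> meval s v f = 0" and vv: "pt_mult T s v v = v"
  shows "v i = s (unit_of T i)"
proof -
  define w where "w = (\<lambda>i. meval s v (inv_of T i))"
  define u where "u = (\<lambda>i. s (unit_of T i))"
  have w: "meval s w f = 0" if "f \<in> ideal_of T" for f
    using T v that by (simp add: w_def is_group_scheme_def flip: meval_meval[OF s])
  have ev: "meval s v (pt_mult T mconst a b i) = pt_mult T s (\<lambda>j. meval s v (a j)) (\<lambda>j. meval s v (b j)) i" for a b i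
    using pt_mult_rhom[OF rhom_meval[OF s] rhom_mconst, of v T a b i] by (simp add: meval_mconst[OF s])
  have unit: "pt_mult T s u v i = v i" for i
  proof -
    have "pt_mult T mconst (\<lambda>j. mconst (unit_of T j)) mvar i - mvar i \<in> ideal_of T"
      using T by (simp add: is_group_scheme_def)
    from v[OF this] show ?thesis
      by (simp add: rhom_diff[OF rhom_meval[OF s]] ev meval_mconst[OF s] meval_mvar[OF s] u_def)
  qed
  have inv: "pt_mult T s w v i = u i" for i
  proof -
    have "pt_mult T mconst (inv_of T) mvar i - mconst (unit_of T i) \<in> ideal_of T"
      using T by (simp add: is_group_scheme_def)
    from v[OF this] show ?thesis
      by (simp add: rhom_diff[OF rhom_meval[OF s]] ev meval_mconst[OF s] meval_mvar[OF s] u_def w_def)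
  qed
  have assoc: "pt_mult T s (pt_mult T s w v) v i = pt_mult T s w (pt_mult T s v v) i" for i
  proof -
    \<comment> \<open>Associativity holds modulo \<open>ideal3\<close> only. Evaluation at the three
      points w, v, v annihilates this ideal, since each of them satisfies the equations of
      \<open>T\<close>.\<close>
    let ?\<phi> = "meval s (case_sum w (case_sum v v))"
    let ?x = "\<lambda>i. mvar (Inl i)" and ?y = "\<lambda>i. mvar (Inr (Inl i))" and ?z = "\<lambda>i. mvar (Inr (Inr i))"
    have \<phi>: "rhom ?\<phi>" by (rule rhom_meval[OF s])
    have "pt_mult T mconst (pt_mult T mconst ?x ?y) ?z i - pt_mult T mconst ?x (pt_mult T mconst ?y ?z) i \<in> ideal3 T"
      using T by (simp add: is_group_scheme_def Let_def)
    then have "?\<phi> (pt_mult T mconst (pt_mult T mconst ?x ?y) ?z i - pt_mult T mconst ?x (pt_mult T mconst ?y ?z) i) = 0"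
      unfolding ideal3_def
    proof (rule rhom_Idl_zero[OF \<phi>, rotated])
      show "?\<phi> f = 0" if "f \<in> meval mconst ?x ` ideal_of T \<union> meval mconst ?y ` ideal_of T \<union> meval mconst ?z ` ideal_of T" for f
        using that v w by (auto simp: meval_meval[OF s] meval_mvar[OF s])
    qed
    then show ?thesis
      by (simp add: rhom_diff[OF \<phi>] pt_mult_rhom[OF \<phi> rhom_mconst] meval_mconst[OF s] meval_mvar[OF s])
  qed
  have "pt_mult T s w v = u" using inv by (simp add: fun_eq_iff)
  then have "v i = u i" using assoc[of i] unit[of i] inv[of i] vv by simp
  then show ?thesis by (simp add: u_def)
qed

section \<open>Characters and cocharacters of tori\<close>

lemma lookup_map_exp_tensor:
  "Poly_Mapping.lookup (map_exp (\<lambda>e. (e, 0)) u * map_exp (\<lambda>e. (0, e)) v :: 'e::monoid_add \<times> 'f::monoid_add \<Rightarrow>\<^sub>0 'k::comm_ring_1) (a, b)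
    = Poly_Mapping.lookup u a * Poly_Mapping.lookup v b"
proof (induction u rule: poly_mapping_additive_induct)
  case (single e c)
  show ?case
    by (induction v rule: poly_mapping_additive_induct)
       (simp_all add: mult_single lookup_single when_def map_exp_add lookup_add distrib_left)
qed (simp add: map_exp_add distrib_right lookup_add)

lemma lookup_map_exp_diag:
  "Poly_Mapping.lookup (map_exp (\<lambda>e. (e, e)) u) (a, b) = (if a = b then Poly_Mapping.lookup u a else 0)"
  by (induction u rule: poly_mapping_additive_induct)
     (auto simp: map_exp_add lookup_add lookup_single when_def)

text \<open>Comparing coefficients, distinct coefficients of \<open>u\<close> have product 0 and
  each coefficient is idempotent. In a field this leaves a single nonzero coefficient, equal to
  1.\<close>

lemma grouplike:
  fixes u :: "'e::monoid_add \<Rightarrow>\<^sub>0 'k::field"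
  assumes "map_exp (\<lambda>e. (e, e)) u = map_exp (\<lambda>e. (e, 0)) u * map_exp (\<lambda>e. (0, e)) u" "u \<noteq> 0"
  shows "\<exists>e. u = Poly_Mapping.single e 1"
proof -
  have m: "Poly_Mapping.lookup u a * Poly_Mapping.lookup u b = (if a = b then Poly_Mapping.lookup u a else 0)" for a b
    using lookup_map_exp_tensor[of u u a b] lookup_map_exp_diag[of u a b] assms(1) by simp
  obtain e where e: "Poly_Mapping.lookup u e \<noteq> 0"
    using assms(2) by (metis poly_mapping_eqI lookup_zero)
  have "Poly_Mapping.lookup u e = 1" using m[of e e] e by simp
  moreover have "Poly_Mapping.lookup u a = 0" if "a \<noteq> e" for a using m[of e a] e that by simp
  ultimately have "u = Poly_Mapping.single e 1"
    by (intro poly_mapping_eqI) (auto simp: lookup_single when_def)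
  then show ?thesis by blast
qed

text \<open>Fixes one splitting \<psi> out of the existential statement in \<open>is_torus\<close>.
  Through it the coordinate ring over the separable closure becomes the ring of Laurent polynomials
  in \<open>r\<close> variables.\<close>

locale split_torus =
  fixes \<iota> :: "'k::field \<Rightarrow> 'a::field" and T :: "('m::finite, 'k) affine_group"
    and r :: nat and \<psi> :: "'m \<Rightarrow> ((nat \<Rightarrow>\<^sub>0 int) \<Rightarrow>\<^sub>0 'a)"
  assumes \<iota>: "rhom \<iota>"
    and group_scheme: "is_group_scheme T"
    and hom: "is_hom_from_diag (base_change \<iota> T) \<psi>"
    and range: "range (meval mconst \<psi>) = {p. \<forall>e\<in>Poly_Mapping.keys p. Poly_Mapping.keys e \<subseteq> {..<r}}"
    and ker: "\<And>f. meval mconst \<psi> f = 0 \<Longrightarrow> f \<in> ideal_of (base_change \<iota> T)"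
begin

abbreviation "TT \<equiv> base_change \<iota> T"
abbreviation "J \<equiv> ideal_of TT"
abbreviation "ev \<equiv> meval mconst \<psi>"
abbreviation pX :: "('m, 'a) mpoly \<Rightarrow> ('m + 'm, 'a) mpoly" where
  "pX \<equiv> meval mconst (\<lambda>i. mvar (Inl i))"
abbreviation pY :: "('m, 'a) mpoly \<Rightarrow> ('m + 'm, 'a) mpoly" where
  "pY \<equiv> meval mconst (\<lambda>i. mvar (Inr i))"
abbreviation "comul \<equiv> meval mconst (mult_of TT)"
abbreviation ev2 :: "('m \<Rightarrow> ('e::ab_group_add \<Rightarrow>\<^sub>0 'a)) \<Rightarrow> ('m + 'm, 'a) mpoly \<Rightarrow> ('e \<times> 'e \<Rightarrow>\<^sub>0 'a)" where
  "ev2 v \<equiv> meval mconst (case_sum (\<lambda>j. map_exp (\<lambda>e. (e, 0)) (v j)) (\<lambda>j. map_exp (\<lambda>e. (0, e)) (v j)))"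

definition exps :: "(nat \<Rightarrow>\<^sub>0 int) set" where
  "exps = {e. Poly_Mapping.keys e \<subseteq> {..<r}}"

text \<open>A polynomial function on the torus that becomes the monomial \<open>e\<close> under the
  splitting. It exists for \<open>e\<close> in \<open>exps\<close> and is then unique modulo
  \<open>J\<close>.\<close>

definition rep :: "(nat \<Rightarrow>\<^sub>0 int) \<Rightarrow> ('m, 'a) mpoly" where
  "rep e = (SOME f. ev f = Poly_Mapping.single e 1)"

lemma rhoms: "rhom ev" "rhom pX" "rhom pY" "rhom comul" "rhom (ev2 v)" "rhom (meval mconst l)"
  by (rule rhom_meval[OF rhom_mconst])+

lemma J_ideal: "ideal J rng"
  by (simp add: base_change_def ext_ideal_ideal)

lemma ev_eq_0_iff: "ev f = 0 \<longleftrightarrow> f \<in> J"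
  using hom ker by (auto simp: is_hom_from_diag_def)

lemma ev_eq_iff: "ev f = ev g \<longleftrightarrow> f - g \<in> J"
  by (simp flip: ev_eq_0_iff add: rhom_diff[OF rhoms(1)])

lemma ev_rep: "e \<in> exps \<Longrightarrow> ev (rep e) = Poly_Mapping.single e 1"
proof -
  assume "e \<in> exps"
  then have "Poly_Mapping.single e 1 \<in> range ev" by (simp add: range exps_def)
  then have "\<exists>f. ev f = Poly_Mapping.single e 1" by (metis imageE)
  then show ?thesis unfolding rep_def by (rule someI_ex)
qed

lemma keys_ev: "e \<in> Poly_Mapping.keys (ev f) \<Longrightarrow> e \<in> exps"
  using range by (auto simp: exps_def)

lemma exps_closed: "0 \<in> exps" "e \<in> exps \<Longrightarrow> f \<in> exps \<Longrightarrow> e + f \<in> exps" "e \<in> exps \<Longrightarrow> - e \<in> exps"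
  "i < r \<Longrightarrow> Poly_Mapping.single i c \<in> exps"
  using keys_add[of e f] by (auto simp: exps_def)

lemma expand: "(\<Sum>e\<in>Poly_Mapping.keys (ev f). mconst (Poly_Mapping.lookup (ev f) e) * rep e) - f \<in> J"
proof -
  have "ev (\<Sum>e\<in>Poly_Mapping.keys (ev f). mconst (Poly_Mapping.lookup (ev f) e) * rep e)
    = (\<Sum>e\<in>Poly_Mapping.keys (ev f). Poly_Mapping.single e (Poly_Mapping.lookup (ev f) e))"
    using keys_ev[of _ f]
    by (simp add: rhom_sum[OF rhoms(1)] rhom_mult[OF rhoms(1)] meval_mconst[OF rhom_mconst] ev_rep mult_single)
  also have "\<dots> = ev f" by (rule poly_mapping_sum_single[symmetric])
  finally show ?thesis by (simp add: ev_eq_iff)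
qed

lemma map_exp_meval:
  fixes h :: "'e::ab_group_add \<Rightarrow> 'f::ab_group_add"
  assumes "h 0 = 0" "\<And>a b. h (a + b) = h a + h b"
  shows "map_exp h (meval mconst v f) = meval mconst (\<lambda>i. map_exp h (v i)) f"
  using rhom_meval_comp[OF rhom_map_exp[OF assms] rhom_mconst, of v f] assms(1) by simp

lemma ev2_X: "ev2 v (pX f) = map_exp (\<lambda>e. (e, 0)) (meval mconst v f)"
  and ev2_Y: "ev2 v (pY f) = map_exp (\<lambda>e. (0, e)) (meval mconst v f)"
  by (simp_all add: meval_meval[OF rhom_mconst] meval_mvar[OF rhom_mconst] map_exp_meval zero_prod_def[symmetric])

lemma ev2_comul:
  assumes "is_hom_from_diag TT v"
  shows "ev2 v (comul f) = map_exp (\<lambda>e. (e, e)) (meval mconst v f)"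
  using assms
  by (simp add: meval_meval[OF rhom_mconst] map_exp_meval zero_prod_def[symmetric] is_hom_from_diag_def pt_mult_def)

lemma ev2_ideal2:
  assumes "is_hom_from_diag TT v" "F \<in> ideal2 TT"
  shows "ev2 v F = 0"
proof (rule rhom_Idl_zero[OF rhoms(5) _ assms(2)[unfolded ideal2_def]])
  have "meval mconst v f = 0" if "f \<in> J" for f using assms(1) that by (simp add: is_hom_from_diag_def)
  then show "ev2 v s = 0" if "s \<in> pX ` J \<union> pY ` J" for s
    using that by (auto simp: ev2_X ev2_Y)
qed

lemma XY_ideal2: "f \<in> J \<Longrightarrow> pX f \<in> ideal2 TT" "f \<in> J \<Longrightarrow> pY f \<in> ideal2 TT"
  unfolding ideal2_def by (auto intro: Idl_self)

lemma ideal2_ideal: "ideal (ideal2 TT) rng"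
  unfolding ideal2_def by (rule Idl_ideal)

text \<open>A linear section of \<open>ev\<close> on monomials from \<open>exps\<close>;
  \<open>lift2\<close> plays the same role for two sets of variables.\<close>

definition lift1 :: "((nat \<Rightarrow>\<^sub>0 int) \<Rightarrow>\<^sub>0 'a) \<Rightarrow> ('m, 'a) mpoly" where
  "lift1 = lin_ext (\<lambda>e c. mconst c * rep e)"

definition lift2 :: "((nat \<Rightarrow>\<^sub>0 int) \<times> (nat \<Rightarrow>\<^sub>0 int) \<Rightarrow>\<^sub>0 'a) \<Rightarrow> ('m + 'm, 'a) mpoly" where
  "lift2 = lin_ext (\<lambda>(e, e') c. mconst c * (pX (rep e) * pY (rep e')))"

lemma lift1_add: "lift1 (u + v) = lift1 u + lift1 v"
  unfolding lift1_def by (rule lin_ext_add) (simp_all add: single_add distrib_right)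

lemma lift2_add: "lift2 (u + v) = lift2 u + lift2 v"
  unfolding lift2_def by (rule lin_ext_add) (auto simp: single_add distrib_right)

lemma lift2_tensor: "lift2 (map_exp (\<lambda>e. (e, 0)) u * map_exp (\<lambda>e. (0, e)) v) = pX (lift1 u) * pY (lift1 v)"
proof (induction u rule: poly_mapping_additive_induct)
  case (single e c)
  show ?case
  proof (induction v rule: poly_mapping_additive_induct)
    case (single e' c')
    have "map_exp (\<lambda>e. (e, 0)) (Poly_Mapping.single e c) * map_exp (\<lambda>e. (0, e)) (Poly_Mapping.single e' c')
        = Poly_Mapping.single (e, e') (c * c')"
      by (simp add: mult_single)
    moreover have "lift2 (Poly_Mapping.single (e, e') (c * c')) = mconst (c * c') * (pX (rep e) * pY (rep e'))"
      unfolding lift2_def by (subst lin_ext_single) auto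
    moreover have "lift1 (Poly_Mapping.single e c) = mconst c * rep e" for e c
      unfolding lift1_def by (subst lin_ext_single) auto
    ultimately show ?case
      by (simp only: mconst_mult rhom_mult[OF rhoms(2)] rhom_mult[OF rhoms(3)] meval_mconst[OF rhom_mconst] ac_simps)
  qed (simp add: map_exp_add distrib_left lift1_add lift2_add rhom_add[OF rhoms(3)])
qed (simp add: map_exp_add distrib_right lift1_add lift2_add rhom_add[OF rhoms(2)])

text \<open>
  Modulo \<open>ideal2\<close> the products \<open>rep e(x) rep e'(y)\<close> span the polynomials in two sets of variables, and
  \<open>ev2 \<psi>\<close> maps them to the basis of monomials; hence its kernel is \<open>ideal2\<close>.
\<close>

lemma lift2_ev2: "F - lift2 (ev2 \<psi> F) \<in> ideal2 TT"
proof -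
  note I = ideal_rngD[OF ideal2_ideal]
  \<comment> \<open>For a product with separated variables, \<open>lift2\<close> splits as a product
    of two copies of \<open>lift1\<close>, and each of these recovers its argument modulo
    \<open>J\<close>.\<close>
  have prod: "pX p * pY q - lift2 (ev2 \<psi> (pX p * pY q)) \<in> ideal2 TT" for p q
  proof -
    have l: "lift1 (ev f) - f \<in> J" for f using expand[of f] by (simp add: lift1_def lin_ext_def)
    have "pX p * pY q - lift2 (ev2 \<psi> (pX p * pY q)) = pX p * pY q - pX (lift1 (ev p)) * pY (lift1 (ev q))"
      by (simp add: rhom_mult[OF rhoms(5)] ev2_X ev2_Y lift2_tensor)
    also have "\<dots> = - (pX (lift1 (ev p) - p) * pY (lift1 (ev q))) - pX p * pY (lift1 (ev q) - q)"
      by (simp add: rhom_diff[OF rhoms(2)] rhom_diff[OF rhoms(3)] algebra_simps)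
    also have "\<dots> \<in> ideal2 TT"
      using XY_ideal2 l by (intro I) auto
    finally show ?thesis .
  qed
  \<comment> \<open>The separated factor strengthens the induction: a new variable belongs to one of
    the two sets and is absorbed into \<open>p\<close> or \<open>q\<close>. The claim itself is the
    case p = q = 1.\<close>
  have "\<forall>p q. F * (pX p * pY q) - lift2 (ev2 \<psi> (F * (pX p * pY q))) \<in> ideal2 TT"
  proof (induction F rule: mpoly_induct)
    case (const c)
    have "mconst c * (pX p * pY q) = pX (mconst c * p) * pY q" for p q
      by (simp add: rhom_mult[OF rhoms(2)] meval_mconst[OF rhom_mconst] mult.assoc)
    then show ?case using prod by simp
  next
    case (var F i)
    have "\<exists>p' q'. mvar i * (pX p * pY q) = pX p' * pY q'" for p q
    proof (cases i)
      case (Inl k)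
      then have "mvar i * (pX p * pY q) = pX (mvar k * p) * pY q"
        by (simp add: rhom_mult[OF rhoms(2)] meval_mvar[OF rhom_mconst] mult.assoc)
      then show ?thesis by blast
    next
      case (Inr k)
      then have "mvar i * (pX p * pY q) = pX p * pY (mvar k * q)"
        by (simp add: rhom_mult[OF rhoms(3)] meval_mvar[OF rhom_mconst] mult.left_commute)
      then show ?thesis by blast
    qed
    then have *: "\<exists>p' q'. F * mvar i * (pX p * pY q) = F * (pX p' * pY q')" for p q
      unfolding mult.assoc[of F] by metis
    show ?case
    proof (intro allI)
      fix p q
      obtain p' q' where "F * mvar i * (pX p * pY q) = F * (pX p' * pY q')" using * by blast
      then show "F * mvar i * (pX p * pY q) - lift2 (ev2 \<psi> (F * mvar i * (pX p * pY q))) \<in> ideal2 TT"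
        using var by simp
    qed
  next
    case (add F H)
    have "(F + H) * (pX p * pY q) - lift2 (ev2 \<psi> ((F + H) * (pX p * pY q))) =
       (F * (pX p * pY q) - lift2 (ev2 \<psi> (F * (pX p * pY q)))) + (H * (pX p * pY q) - lift2 (ev2 \<psi> (H * (pX p * pY q))))" for p q
      by (simp add: distrib_right rhom_add[OF rhoms(5)] lift2_add)
    then show ?case using add I(2) by simp
  qed
  from this[rule_format, of 1 1] show ?thesis by (simp add: rhom_one[OF rhoms(2)] rhom_one[OF rhoms(3)])
qed

lemma ev2_eq_0: "ev2 \<psi> F = 0 \<Longrightarrow> F \<in> ideal2 TT"
  using lift2_ev2[of F] by (simp add: lift2_def)

text \<open>Monomials are grouplike in the Laurent ring, and \<open>ev2_eq_0\<close> carries this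
  identity back to polynomials modulo \<open>ideal2\<close>.\<close>

lemma rep_comult:
  assumes "ev f = Poly_Mapping.single e 1"
  shows "comul f - pX f * pY f \<in> ideal2 TT"
  by (rule ev2_eq_0)
     (simp add: rhom_diff[OF rhoms(5)] rhom_mult[OF rhoms(5)] ev2_X ev2_Y ev2_comul[OF hom] assms mult_single)

section \<open>Cocharacters as integer vectors\<close>

definition pr :: "(nat \<Rightarrow> int) \<Rightarrow> (nat \<Rightarrow>\<^sub>0 int) \<Rightarrow> int" where
  "pr m e = (\<Sum>i<r. m i * Poly_Mapping.lookup e i)"

lemma pr_0 [simp]: "pr m 0 = 0" and pr_add: "pr m (e + f) = pr m e + pr m f"
  and pr_add_left: "pr (\<lambda>i. m i + m' i) e = pr m e + pr m' e"
  by (simp_all add: pr_def lookup_add algebra_simps sum.distrib)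

lemma pr_single: "i < r \<Longrightarrow> pr m (Poly_Mapping.single i c) = m i * c"
proof -
  assume "i < r"
  have "(\<Sum>k<r. m k * Poly_Mapping.lookup (Poly_Mapping.single i c) k) = (\<Sum>k<r. if k = i then m i * c else 0)"
    by (rule sum.cong) (auto simp: lookup_single when_def)
  then show ?thesis using \<open>i < r\<close> by (simp add: pr_def)
qed

text \<open>The cocharacter of the split torus with exponent vector \<open>m\<close>, composed with
  the splitting: on coordinate rings a monomial \<open>e\<close> goes to the power
  \<open>pr m e\<close> of the parameter.\<close>

definition cochar :: "(nat \<Rightarrow> int) \<Rightarrow> 'm \<Rightarrow> (int \<Rightarrow>\<^sub>0 'a)" where
  "cochar m i = map_exp (pr m) (\<psi> i)"

lemma meval_cochar: "meval mconst (cochar m) f = map_exp (pr m) (ev f)"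
  by (simp add: map_exp_meval pr_add cochar_def[abs_def])

text \<open>The homomorphism property of \<psi> is an identity in the group algebra of pairs of
  exponents. Applying the exponent map that adds the two pairings turns the diagonal into the sum of
  the vectors and the two factors into the given cocharacters.\<close>

lemma pt_mult_cochar: "pt_mult TT mconst (cochar m) (cochar m') = cochar (\<lambda>i. m i + m' i)"
proof
  fix i
  let ?h = "\<lambda>(e, e'). pr m e + pr m' e'"
  have h: "?h 0 = 0" "?h (a + b) = ?h a + ?h b" for a b
    by (auto simp: zero_prod_def pr_add split: prod.split)
  have "cochar (\<lambda>i. m i + m' i) i = map_exp ?h (map_exp (\<lambda>e. (e, e)) (\<psi> i))"
    by (simp add: cochar_def map_exp_map_exp pr_add_left[abs_def])
  also have "\<dots> = map_exp ?h (ev2 \<psi> (mult_of TT i))"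
    using hom by (simp add: is_hom_from_diag_def pt_mult_def)
  also have "\<dots> = meval mconst (\<lambda>j. map_exp ?h (case_sum (\<lambda>j. map_exp (\<lambda>e. (e, 0)) (\<psi> j)) (\<lambda>j. map_exp (\<lambda>e. (0, e)) (\<psi> j)) j)) (mult_of TT i)"
    by (rule map_exp_meval[OF h])
  also have "(\<lambda>j. map_exp ?h (case_sum (\<lambda>j. map_exp (\<lambda>e. (e, 0)) (\<psi> j)) (\<lambda>j. map_exp (\<lambda>e. (0, e)) (\<psi> j)) j))
      = case_sum (cochar m) (cochar m')"
    by (auto simp: fun_eq_iff cochar_def map_exp_map_exp split: sum.split)
  finally show "pt_mult TT mconst (cochar m) (cochar m') i = cochar (\<lambda>i. m i + m' i) i"
    by (simp add: pt_mult_def)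
qed

lemma cochar_hom: "is_hom_from_diag TT (cochar m)"
  unfolding is_hom_from_diag_def
proof (intro conjI ballI allI)
  show "meval mconst (cochar m) f = 0" if "f \<in> J" for f
    using that by (simp add: meval_cochar ev_eq_0_iff[symmetric])
  fix i
  let ?h = "\<lambda>(e, e'). (pr m e, pr m e')"
  have h: "?h 0 = 0" "?h (a + b) = ?h a + ?h b" for a b
    by (auto simp: zero_prod_def pr_add split: prod.split)
  have "map_exp (\<lambda>e. (e, e)) (cochar m i) = map_exp ?h (map_exp (\<lambda>e. (e, e)) (\<psi> i))"
    by (simp add: cochar_def map_exp_map_exp)
  also have "\<dots> = map_exp ?h (ev2 \<psi> (mult_of TT i))"
    using hom by (simp add: is_hom_from_diag_def pt_mult_def)
  also have "\<dots> = meval mconst (\<lambda>j. map_exp ?h (case_sum (\<lambda>j. map_exp (\<lambda>e. (e, 0)) (\<psi> j)) (\<lambda>j. map_exp (\<lambda>e. (0, e)) (\<psi> j)) j)) (mult_of TT i)"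
    by (rule map_exp_meval[OF h])
  also have "(\<lambda>j. map_exp ?h (case_sum (\<lambda>j. map_exp (\<lambda>e. (e, 0)) (\<psi> j)) (\<lambda>j. map_exp (\<lambda>e. (0, e)) (\<psi> j)) j))
      = case_sum (\<lambda>j. map_exp (\<lambda>e. (e, 0)) (cochar m j)) (\<lambda>j. map_exp (\<lambda>e. (0, e)) (cochar m j))"
    by (auto simp: fun_eq_iff cochar_def map_exp_map_exp split: sum.split)
  finally show "map_exp (\<lambda>e. (e, e)) (cochar m i) =
      pt_mult TT mconst (\<lambda>j. map_exp (\<lambda>e. (e, 0)) (cochar m j)) (\<lambda>j. map_exp (\<lambda>e. (0, e)) (cochar m j)) i"
    by (simp add: pt_mult_def)
qed

text \<open>A homomorphism is recorded only as multiplicative, so preservation of the unit needs an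
  argument: this point is idempotent by \<open>pt_mult_cochar\<close>, and
  \<open>idempotent_point\<close> applies once it is viewed as a point of \<open>T\<close> through
  \<iota>.\<close>

lemma cochar_zero: "cochar (\<lambda>_. 0) i = mconst (unit_of TT i)"
proof -
  let ?s = "\<lambda>c. mconst (\<iota> c) :: int \<Rightarrow>\<^sub>0 'a"
  have s: "rhom ?s" by (rule rhom_comp[OF rhom_mconst \<iota>])
  have "pt_mult T ?s (cochar (\<lambda>_. 0)) (cochar (\<lambda>_. 0)) = cochar (\<lambda>_. 0)"
    using pt_mult_cochar[of "\<lambda>_. 0" "\<lambda>_. 0"] by (simp add: pt_mult_base_change[OF \<iota> rhom_mconst])
  moreover have "\<forall>f\<in>ideal_of T. meval ?s (cochar (\<lambda>_. 0)) f = 0"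
    using cochar_hom[of "\<lambda>_. 0"] ext_ideal_zero_iff[OF \<iota> rhom_mconst, of "ideal_of T" "cochar (\<lambda>_. 0)"]
    by (simp add: is_hom_from_diag_def base_change_def)
  ultimately show ?thesis
    using idempotent_point[OF group_scheme s] by (simp add: base_change_def)
qed

lemma additive_exps:
  fixes \<nu> :: "(nat \<Rightarrow>\<^sub>0 int) \<Rightarrow> int"
  assumes "\<And>e f. e \<in> exps \<Longrightarrow> f \<in> exps \<Longrightarrow> \<nu> (e + f) = \<nu> e + \<nu> f" "e \<in> exps"
  shows "\<nu> e = pr (\<lambda>i. \<nu> (Poly_Mapping.single i 1)) e"
proof -
  have 0: "\<nu> 0 = 0" using assms(1)[of 0 0] exps_closed(1) by simp
  have single: "\<nu> (Poly_Mapping.single i c) = \<nu> (Poly_Mapping.single i 1) * c" if "i < r" for i c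
  proof (induction c rule: int_induct[where k=0])
    case (step1 c)
    then show ?case
      using assms(1)[of "Poly_Mapping.single i c" "Poly_Mapping.single i 1"] exps_closed(4)[OF that]
      by (simp add: single_add algebra_simps)
  next
    case (step2 c)
    have "Poly_Mapping.single i c = Poly_Mapping.single i (c - 1) + Poly_Mapping.single i 1"
      by (simp flip: single_add)
    then show ?case
      using step2 assms(1)[of "Poly_Mapping.single i (c - 1)" "Poly_Mapping.single i 1"] exps_closed(4)[OF that]
      by (simp add: algebra_simps)
  qed (simp add: 0)
  \<comment> \<open>Additivity of \<nu> is available only inside \<open>exps\<close>, so membership
    of the partial sums is carried along in the induction.\<close>
  have "\<nu> (\<Sum>i\<in>K. Poly_Mapping.single i (a i)) = pr (\<lambda>i. \<nu> (Poly_Mapping.single i 1)) (\<Sum>i\<in>K. Poly_Mapping.single i (a i))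
      \<and> (\<Sum>i\<in>K. Poly_Mapping.single i (a i)) \<in> exps"
    if "finite K" "K \<subseteq> {..<r}" for K a
    using that
  proof (induction K)
    case (insert i K)
    then have "i < r" "K \<subseteq> {..<r}" by auto
    let ?s = "Poly_Mapping.single i (a i)" and ?S = "\<Sum>i\<in>K. Poly_Mapping.single i (a i)"
    have S: "?s \<in> exps" "?S \<in> exps" using insert.IH \<open>K \<subseteq> {..<r}\<close> exps_closed(4)[OF \<open>i < r\<close>] by auto
    have "(\<Sum>i\<in>insert i K. Poly_Mapping.single i (a i)) = ?s + ?S"
      using insert.hyps by simp
    moreover have "\<nu> (?s + ?S) = pr (\<lambda>i. \<nu> (Poly_Mapping.single i 1)) (?s + ?S)"
    proof -
      have "\<nu> ?S = pr (\<lambda>i. \<nu> (Poly_Mapping.single i 1)) ?S" using insert.IH \<open>K \<subseteq> {..<r}\<close> by blast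
      moreover have "\<nu> ?s = pr (\<lambda>i. \<nu> (Poly_Mapping.single i 1)) ?s"
        using single[OF \<open>i < r\<close>, of "a i"] by (simp add: pr_single[OF \<open>i < r\<close>])
      ultimately show ?thesis by (simp only: assms(1)[OF S] pr_add)
    qed
    ultimately show ?case using exps_closed(2)[OF S] by simp
  qed (simp add: 0 exps_closed)
  from this[of "Poly_Mapping.keys e" "Poly_Mapping.lookup e"] assms(2)
  show ?thesis using poly_mapping_sum_single[of e] by (simp add: exps_def)
qed

text \<open>
  A homomorphism \<open>l\<close> maps the basis elements \<open>rep e\<close> to grouplike Laurent polynomials, i.e. to
  monomials, whose exponents depend additively on \<open>e\<close>.
\<close>

lemma cochar_surj:
  assumes l: "is_hom_from_diag TT l"
  shows "\<exists>m. l = cochar m"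
proof -
  let ?lev = "meval mconst l"
  have lJ: "?lev f = 0" if "f \<in> J" for f using l that by (simp add: is_hom_from_diag_def)
  have leq: "?lev f = ?lev g" if "ev f = ev g" for f g
    using lJ[of "f - g"] that ev_eq_iff by (simp add: rhom_diff[OF rhoms(6)])
  have unit: "?lev (rep e) * ?lev (rep f) = ?lev (rep (e + f))" if "e \<in> exps" "f \<in> exps" for e f
    using leq[of "rep e * rep f" "rep (e + f)"] that exps_closed(2)[OF that]
    by (simp add: rhom_mult[OF rhoms(1)] rhom_mult[OF rhoms(6)] ev_rep mult_single)
  have one: "?lev (rep 0) = 1"
    using leq[of "rep 0" 1] exps_closed(1) by (simp add: ev_rep rhom_one[OF rhoms(1)] rhom_one[OF rhoms(6)])
  have "\<exists>n. ?lev (rep e) = Poly_Mapping.single n 1" if e: "e \<in> exps" for e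
  proof (rule grouplike)
    \<comment> \<open>The image of \<open>rep e\<close> is a unit, with inverse the image of
      \<open>rep (- e)\<close>.\<close>
    show "?lev (rep e) \<noteq> 0"
      using unit[OF e exps_closed(3)[OF e]] one by auto
    have "ev2 l (comul (rep e) - pX (rep e) * pY (rep e)) = 0"
      by (rule ev2_ideal2[OF l rep_comult[OF ev_rep[OF e]]])
    then show "map_exp (\<lambda>e. (e, e)) (?lev (rep e)) =
        map_exp (\<lambda>e. (e, 0)) (?lev (rep e)) * map_exp (\<lambda>e. (0, e)) (?lev (rep e))"
      by (simp add: rhom_diff[OF rhoms(5)] rhom_mult[OF rhoms(5)] ev2_X ev2_Y ev2_comul[OF l])
  qed
  then obtain \<nu> where \<nu>: "\<And>e. e \<in> exps \<Longrightarrow> ?lev (rep e) = Poly_Mapping.single (\<nu> e) 1" by metis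
  have \<nu>_add: "\<nu> (e + f) = \<nu> e + \<nu> f" if "e \<in> exps" "f \<in> exps" for e f
    using unit[OF that] by (simp add: \<nu> that exps_closed(2) mult_single single_one_inj)
  define m where "m = (\<lambda>i. \<nu> (Poly_Mapping.single i 1))"
  have "l i = cochar m i" for i
  proof -
    let ?K = "Poly_Mapping.keys (ev (mvar i))" and ?c = "Poly_Mapping.lookup (ev (mvar i))"
    have "l i = ?lev (mvar i)" by (simp add: meval_mvar[OF rhom_mconst])
    also have "\<dots> = ?lev (\<Sum>e\<in>?K. mconst (?c e) * rep e)"
      using expand[of "mvar i"] by (intro leq) (simp add: ev_eq_iff[symmetric])
    also have "\<dots> = (\<Sum>e\<in>?K. Poly_Mapping.single (pr m e) (?c e))"
      using keys_ev[of _ "mvar i"]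
      by (simp add: rhom_sum[OF rhoms(6)] rhom_mult[OF rhoms(6)] meval_mconst[OF rhom_mconst] \<nu> mult_single
          additive_exps[OF \<nu>_add] m_def)
    also have "\<dots> = cochar m i"
      by (simp add: cochar_def map_exp_def meval_mvar[OF rhom_mconst])
    finally show ?thesis .
  qed
  then show ?thesis by blast
qed

abbreviation "L \<equiv> grp (cochar_module TT)"
abbreviation "C \<equiv> grp (char_module TT)"

lemma carrier_L: "carrier L = range cochar"
  using cochar_surj cochar_hom by (auto simp: cochar_module_def)

lemma mult_L: "cochar m \<otimes>\<^bsub>L\<^esub> cochar m' = cochar (\<lambda>i. m i + m' i)"
  by (simp add: cochar_module_def pt_mult_cochar)

lemma one_L: "\<one>\<^bsub>L\<^esub> = cochar (\<lambda>_. 0)"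
  by (simp add: cochar_module_def cochar_zero fun_eq_iff)

lemma comm_group_L: "comm_group L"
proof (rule comm_groupI)
  show "\<exists>y\<in>carrier L. y \<otimes>\<^bsub>L\<^esub> x = \<one>\<^bsub>L\<^esub>" if x: "x \<in> carrier L" for x
  proof -
    obtain m where "x = cochar m" using x by (auto simp: carrier_L)
    then have "cochar (\<lambda>i. - m i) \<otimes>\<^bsub>L\<^esub> x = \<one>\<^bsub>L\<^esub>" by (simp add: mult_L one_L)
    then show ?thesis by (auto simp: carrier_L)
  qed
qed (auto simp: carrier_L mult_L one_L ac_simps)

lemma cochar_cong: "(\<And>i. i < r \<Longrightarrow> m i = m' i) \<Longrightarrow> cochar m = cochar m'"
  by (simp add: fun_eq_iff cochar_def pr_def cong: map_exp_cong)

section \<open>Characters as exponent vectors\<close>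

definition coset :: "('m, 'a) mpoly \<Rightarrow> ('m, 'a) mpoly set" where
  "coset f = J +>\<^bsub>rng\<^esub> f"

lemma mem_coset: "g \<in> coset f \<longleftrightarrow> ev g = ev f"
proof -
  have "g \<in> coset f \<longleftrightarrow> (\<exists>h\<in>J. g = h + f)" by (simp add: coset_def a_r_coset_def')
  also have "\<dots> \<longleftrightarrow> g - f \<in> J" by (metis diff_add_cancel add_diff_cancel_right')
  finally show ?thesis by (simp add: ev_eq_iff)
qed

lemma Quot_simps: "carrier (rng Quot J) = range coset" "coset f \<otimes>\<^bsub>rng Quot J\<^esub> coset g = coset (f * g)"
  "\<one>\<^bsub>rng Quot J\<^esub> = coset 1"
proof -
  interpret ideal J rng by (rule J_ideal)
  show "carrier (rng Quot J) = range coset"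
    by (auto simp: FactRing_def A_RCOSETS_def' coset_def)
  show "coset f \<otimes>\<^bsub>rng Quot J\<^esub> coset g = coset (f * g)"
    by (simp add: FactRing_def coset_def rcoset_mult_add)
  show "\<one>\<^bsub>rng Quot J\<^esub> = coset 1"
    by (simp add: FactRing_def coset_def)
qed

text \<open>A character is a grouplike unit of the coordinate ring, and its image under the
  splitting is a grouplike Laurent polynomial, hence a monomial. Conversely a monomial is inverted
  by \<open>rep (- e)\<close> and is grouplike by \<open>rep_comult\<close>.\<close>

lemma carrier_C: "carrier C = {coset f | f. \<exists>e\<in>exps. ev f = Poly_Mapping.single e 1}" (is "_ = ?R")
proof (intro Set.equalityI subsetI)
  fix c assume "c \<in> carrier C"
  then have unit: "c \<in> Units (rng Quot J)" and comult: "\<And>f. f \<in> c \<Longrightarrow> comul f - pX f * pY f \<in> ideal2 TT"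
    by (auto simp: char_module_def)
  obtain f where f: "c = coset f" using unit by (auto simp: Units_def Quot_simps)
  obtain g where "coset f \<otimes>\<^bsub>rng Quot J\<^esub> coset g = \<one>\<^bsub>rng Quot J\<^esub>"
    using unit f by (auto simp: Units_def Quot_simps)
  then have "coset (f * g) = coset 1" by (simp add: Quot_simps)
  then have "ev f * ev g = 1"
    using mem_coset[of "f * g" "f * g"] mem_coset[of "f * g" 1] rhom_mult[OF rhoms(1)] rhom_one[OF rhoms(1)] by metis
  then have "ev f \<noteq> 0" by auto
  have "ev2 \<psi> (comul f - pX f * pY f) = 0"
    using comult[of f] f mem_coset by (intro ev2_ideal2[OF hom]) simp
  then have "map_exp (\<lambda>e. (e, e)) (ev f) = map_exp (\<lambda>e. (e, 0)) (ev f) * map_exp (\<lambda>e. (0, e)) (ev f)"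
    by (simp add: rhom_diff[OF rhoms(5)] rhom_mult[OF rhoms(5)] ev2_X ev2_Y ev2_comul[OF hom])
  from grouplike[OF this \<open>ev f \<noteq> 0\<close>] obtain e where e: "ev f = Poly_Mapping.single e 1" by blast
  then have "e \<in> exps" using keys_ev[of e f] by simp
  then show "c \<in> ?R" using f e by blast
next
  fix c assume "c \<in> ?R"
  then obtain f e where f: "c = coset f" "e \<in> exps" "ev f = Poly_Mapping.single e 1" by blast
  have "coset (f * rep (- e)) = coset 1" "coset (rep (- e) * f) = coset 1"
    using f exps_closed(3)[OF f(2)]
    by (auto simp: mem_coset rhom_mult[OF rhoms(1)] ev_rep mult_single rhom_one[OF rhoms(1)])
  then have "c \<in> Units (rng Quot J)"
    using f(1) by (auto simp: Units_def Quot_simps intro!: exI[of _ "rep (- e)"])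
  moreover have "comul g - pX g * pY g \<in> ideal2 TT" if "g \<in> c" for g
    using that f by (intro rep_comult) (simp add: mem_coset)
  ultimately show "c \<in> carrier C" by (simp add: char_module_def)
qed

lemma mult_C: "coset f \<otimes>\<^bsub>C\<^esub> coset g = coset (f * g)"
  by (simp add: char_module_def units_of_def Quot_simps)

lemma pairing:
  assumes "ev f = Poly_Mapping.single e 1"
  shows "char_pairing (coset f) (cochar m) = pr m e"
proof -
  have *: "meval mconst (cochar m) g = Poly_Mapping.single (pr m e) 1" if "g \<in> coset f" for g
    using that assms by (simp add: mem_coset meval_cochar)
  show ?thesis
    unfolding char_pairing_def
  proof (rule the_equality)
    fix n assume "\<forall>g\<in>coset f. meval mconst (cochar m) g = Poly_Mapping.single n 1"
    then have "Poly_Mapping.single n 1 = (Poly_Mapping.single (pr m e) 1 :: int \<Rightarrow>\<^sub>0 'a)"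
      using * mem_coset[of f f] by metis
    then show "n = pr m e" by (simp add: single_one_inj)
  qed (use * in blast)
qed

lemma pairing_add_left:
  assumes "c \<in> carrier C" "c' \<in> carrier C" "l \<in> carrier L"
  shows "char_pairing (c \<otimes>\<^bsub>C\<^esub> c') l = char_pairing c l + char_pairing c' l"
proof -
  obtain f e where f: "c = coset f" "ev f = Poly_Mapping.single e 1" using assms(1) carrier_C by blast
  obtain g e' where g: "c' = coset g" "ev g = Poly_Mapping.single e' 1" using assms(2) carrier_C by blast
  obtain m where m: "l = cochar m" using assms(3) carrier_L by blast
  have "ev (f * g) = Poly_Mapping.single (e + e') 1"
    by (simp add: rhom_mult[OF rhoms(1)] f g mult_single)
  then show ?thesis by (simp add: f(1) g(1) m mult_C pairing[OF f(2)] pairing[OF g(2)] pairing pr_add)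
qed

lemma pairing_add_right: "c \<in> carrier C \<Longrightarrow> additive_on L (char_pairing c)"
  by (auto simp: carrier_C carrier_L additive_on_def mult_L pairing pr_add_left)

definition basis :: "nat \<Rightarrow> 'm \<Rightarrow> (int \<Rightarrow>\<^sub>0 'a)" where
  "basis i = cochar (\<lambda>k. if k = i then 1 else 0)"

definition dual_basis :: "nat \<Rightarrow> ('m, 'a) mpoly set" where
  "dual_basis i = coset (rep (Poly_Mapping.single i 1))"

lemma dual_basis_closed: "i < r \<Longrightarrow> dual_basis i \<in> carrier C"
  using exps_closed(4) ev_rep unfolding carrier_C dual_basis_def by blast

lemma basis_closed: "basis i \<in> carrier L"
  by (simp add: basis_def carrier_L)

lemma pairing_dual_basis: "i < r \<Longrightarrow> char_pairing (dual_basis i) (cochar m) = m i"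
  unfolding dual_basis_def using exps_closed(4) by (subst pairing[OF ev_rep]) (auto simp: pr_single)

text \<open>Pairing with the i-th basis cocharacter reads off the i-th exponent of a
  character.\<close>

lemma chars_separated:
  assumes "c \<in> carrier C" "c' \<in> carrier C" "\<And>i. i < r \<Longrightarrow> char_pairing c (basis i) = char_pairing c' (basis i)"
  shows "c = c'"
proof -
  obtain f e where f: "c = coset f" "ev f = Poly_Mapping.single e 1" "e \<in> exps" using assms(1) carrier_C by blast
  obtain g e' where g: "c' = coset g" "ev g = Poly_Mapping.single e' 1" "e' \<in> exps" using assms(2) carrier_C by blast
  have d: "pr (\<lambda>k. if k = i then 1 else 0) e = Poly_Mapping.lookup e i" if "i < r" for i e
  proof -
    have "pr (\<lambda>k. if k = i then 1 else 0) e = (\<Sum>k<r. if k = i then Poly_Mapping.lookup e i else 0)"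
      unfolding pr_def by (rule sum.cong) auto
    then show ?thesis using that by simp
  qed
  have "e = e'"
  proof (rule poly_mapping_eqI)
    fix i
    show "Poly_Mapping.lookup e i = Poly_Mapping.lookup e' i"
    proof (cases "i < r")
      case True
      then show ?thesis using assms(3)[OF True] d by (simp add: basis_def f(1) g(1) pairing[OF f(2)] pairing[OF g(2)])
    next
      case False
      then have "i \<notin> Poly_Mapping.keys e" "i \<notin> Poly_Mapping.keys e'" using f g by (auto simp: exps_def)
      then show ?thesis by (simp add: in_keys_iff)
    qed
  qed
  then show ?thesis using f g by (auto simp: mem_coset)
qed

lemma cochar_int_pow: "cochar m [^]\<^bsub>L\<^esub> (n::int) = cochar (\<lambda>i. n * m i)"
proof -
  interpret L: comm_group L by (rule comm_group_L)
  have c: "cochar m \<in> carrier L" for m by (simp add: carrier_L)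
  have nat: "cochar m [^]\<^bsub>L\<^esub> (k::nat) = cochar (\<lambda>i. int k * m i)" for k
  proof (induction k)
    case (Suc k)
    have "cochar m [^]\<^bsub>L\<^esub> Suc k = cochar (\<lambda>i. int k * m i) \<otimes>\<^bsub>L\<^esub> cochar m" using Suc by simp
    then show ?case by (simp only: mult_L) (simp add: algebra_simps)
  qed (simp add: one_L[symmetric])
  show ?thesis
  proof (cases n rule: int_cases2)
    case (nonneg k) then show ?thesis using nat by (simp add: int_pow_int)
  next
    case (nonpos k)
    have "cochar (\<lambda>i. n * m i) \<otimes>\<^bsub>L\<^esub> cochar (\<lambda>i. int k * m i) = \<one>\<^bsub>L\<^esub>"
      by (simp add: mult_L one_L nonpos)
    from L.inv_equality[OF this c c] show ?thesis
      using nonpos nat c by (simp add: L.int_pow_neg_int)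
  qed
qed

lemma dual_bases_L: "dual_bases L {..<r} basis (\<lambda>i. char_pairing (dual_basis i))"
  unfolding dual_bases_def
proof (intro conjI ballI)
  interpret L: comm_group L by (rule comm_group_L)
  fix l assume "l \<in> carrier L"
  then obtain m where m: "l = cochar m" by (auto simp: carrier_L)
  \<comment> \<open>Prefix products are vectors truncated at \<open>k\<close>; at k = r truncation
    is invisible because \<open>cochar\<close> looks only at the first \<open>r\<close>
    entries.\<close>
  have "finprod L (\<lambda>i. basis i [^]\<^bsub>L\<^esub> m i) {..<k} = cochar (\<lambda>i. if i < k then m i else 0)" for k
  proof (induction k)
    case (Suc k)
    have "finprod L (\<lambda>i. basis i [^]\<^bsub>L\<^esub> m i) {..<Suc k} = basis k [^]\<^bsub>L\<^esub> m k \<otimes>\<^bsub>L\<^esub> finprod L (\<lambda>i. basis i [^]\<^bsub>L\<^esub> m i) {..<k}"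
      unfolding lessThan_Suc using basis_closed by (intro L.finprod_insert) auto
    then show ?case
      using Suc by (simp add: basis_def cochar_int_pow mult_L) (rule cochar_cong, auto simp: less_Suc_eq)
  qed (simp add: one_L)
  then have "finprod L (\<lambda>i. basis i [^]\<^bsub>L\<^esub> m i) {..<r} = l"
    unfolding m by (simp cong: cochar_cong)
  moreover have "finprod L (\<lambda>i. basis i [^]\<^bsub>L\<^esub> char_pairing (dual_basis i) l) {..<r} = finprod L (\<lambda>i. basis i [^]\<^bsub>L\<^esub> m i) {..<r}"
    using basis_closed by (intro L.finprod_cong') (auto simp: m pairing_dual_basis)
  ultimately show "l = finprod L (\<lambda>i. basis i [^]\<^bsub>L\<^esub> char_pairing (dual_basis i) l) {..<r}" by simp
qed (auto simp: basis_closed intro!: pairing_add_right dual_basis_closed)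

end

section \<open>Galois action on characters and cocharacters\<close>

lemma gal_rhom: "\<sigma> \<in> gal \<iota> \<Longrightarrow> rhom \<sigma>"
  by (simp add: gal_def rhom_ring_hom)

lemma gal_fix: "\<sigma> \<in> gal \<iota> \<Longrightarrow> \<sigma> (\<iota> x) = \<iota> x"
  by (simp add: gal_def fun_eq_iff)

lemma gal_comp: "\<sigma> \<in> gal \<iota> \<Longrightarrow> \<tau> \<in> gal \<iota> \<Longrightarrow> \<sigma> \<circ> \<tau> \<in> gal \<iota>"
  by (auto simp: gal_def rhom_ring_hom comp_def fun_eq_iff intro: rhom_comp bij_comp[unfolded comp_def])

lemma gal_inv:
  assumes "\<sigma> \<in> gal \<iota>"
  obtains \<tau> where "\<tau> \<in> gal \<iota>" "\<And>x. \<sigma> (\<tau> x) = x" "\<And>x. \<tau> (\<sigma> x) = x"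
proof -
  have b: "bij \<sigma>" using assms by (simp add: gal_def)
  note s = gal_rhom[OF assms]
  have 1: "\<sigma> (inv_into UNIV \<sigma> x) = x" "inv_into UNIV \<sigma> (\<sigma> x) = x" for x
    using b by (simp_all add: bij_def surj_f_inv_f)
  have "rhom (inv_into UNIV \<sigma>)"
    by (rule rhomI) (metis 1 rhom_one[OF s], metis 1 rhom_add[OF s], metis 1 rhom_mult[OF s])
  moreover have "inv_into UNIV \<sigma> (\<iota> x) = \<iota> x" for x using 1 gal_fix[OF assms] by metis
  ultimately have "inv_into UNIV \<sigma> \<in> gal \<iota>"
    using bij_imp_bij_inv[OF b] by (simp add: gal_def rhom_ring_hom fun_eq_iff)
  then show ?thesis using that 1 by blast
qed

context split_torus
begin

lemma map_meval:
  assumes "\<sigma> \<in> gal \<iota>"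
  shows "Poly_Mapping.map \<sigma> (meval mconst v g :: 'e::ab_group_add \<Rightarrow>\<^sub>0 'a) = meval mconst (\<lambda>i. Poly_Mapping.map \<sigma> (v i)) (Poly_Mapping.map \<sigma> g)"
proof -
  note s = gal_rhom[OF assms]
  show ?thesis
    using rhom_meval_comp[OF rhom_poly_mapping_map[OF s] rhom_mconst, of v g]
    by (simp add: rhom_zero[OF s] meval_map[OF s rhom_mconst])
qed

lemma map_mult_of: "\<sigma> \<in> gal \<iota> \<Longrightarrow> Poly_Mapping.map \<sigma> (mult_of TT i) = mult_of TT i"
  by (simp add: base_change_def map_map rhom_zero[OF gal_rhom] rhom_zero[OF \<iota>] gal_fix)

lemma map_J: assumes "\<sigma> \<in> gal \<iota>" "f \<in> J" shows "Poly_Mapping.map \<sigma> f \<in> J"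
  using assms(2)
  unfolding base_change_def affine_group.simps by (rule map_ext_ideal[OF gal_rhom[OF assms(1)] \<iota> gal_fix[OF assms(1)]])

lemma pt_mult_map:
  assumes "\<sigma> \<in> gal \<iota>"
  shows "Poly_Mapping.map \<sigma> (pt_mult TT mconst v w i :: 'e::ab_group_add \<Rightarrow>\<^sub>0 'a) =
    pt_mult TT mconst (\<lambda>j. Poly_Mapping.map \<sigma> (v j)) (\<lambda>j. Poly_Mapping.map \<sigma> (w j)) i"
proof -
  have "(\<lambda>x. Poly_Mapping.map \<sigma> (case_sum v w x)) = case_sum (\<lambda>j. Poly_Mapping.map \<sigma> (v j)) (\<lambda>j. Poly_Mapping.map \<sigma> (w j))"
    by (simp add: fun_eq_iff split: sum.split)
  then show ?thesis
    by (simp add: pt_mult_def map_meval[OF assms] map_mult_of[OF assms])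
qed

text \<open>Evaluating the moved cocharacter at \<open>f\<close> is \<sigma> applied to the value of
  \<open>l\<close> at the inverse translate of \<open>f\<close>, and \<open>J\<close> is stable
  under translation. The group law has coefficients fixed by \<sigma>.\<close>

lemma act_L_closed:
  assumes \<sigma>: "\<sigma> \<in> gal \<iota>" and l: "l \<in> carrier L"
  shows "act (cochar_module TT) \<sigma> l \<in> carrier L"
proof -
  have l: "is_hom_from_diag TT l" using l by (simp add: cochar_module_def)
  note s = gal_rhom[OF \<sigma>]
  obtain \<tau> where \<tau>: "\<tau> \<in> gal \<iota>" "\<And>x. \<sigma> (\<tau> x) = x" using gal_inv[OF \<sigma>] by metis
  have "meval mconst (\<lambda>i. Poly_Mapping.map \<sigma> (l i)) f = 0" if "f \<in> J" for f
  proof -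
    have "f = Poly_Mapping.map \<sigma> (Poly_Mapping.map \<tau> f)"
      using \<tau> by (simp add: map_map rhom_zero[OF s] rhom_zero[OF gal_rhom] map_id)
    then have "meval mconst (\<lambda>i. Poly_Mapping.map \<sigma> (l i)) f = Poly_Mapping.map \<sigma> (meval mconst l (Poly_Mapping.map \<tau> f))"
      using map_meval[OF \<sigma>, of l "Poly_Mapping.map \<tau> f"] by simp
    also have "meval mconst l (Poly_Mapping.map \<tau> f) = 0"
      using l map_J[OF \<tau>(1) that] by (simp add: is_hom_from_diag_def)
    finally show ?thesis by (simp add: rhom_zero[OF rhom_poly_mapping_map[OF s]])
  qed
  moreover have "map_exp (\<lambda>e. (e, e)) (Poly_Mapping.map \<sigma> (l i)) =
      pt_mult TT mconst (\<lambda>j. map_exp (\<lambda>e. (e, 0)) (Poly_Mapping.map \<sigma> (l j))) (\<lambda>j. map_exp (\<lambda>e. (0, e)) (Poly_Mapping.map \<sigma> (l j))) i" for i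
    using l by (simp add: is_hom_from_diag_def pt_mult_map[OF \<sigma>] flip: map_map_exp[OF s])
  ultimately show ?thesis by (simp add: cochar_module_def is_hom_from_diag_def)
qed

lemma cochar_galois_module: "galois_module (gal \<iota>) (cochar_module TT)"
proof -
  interpret L: comm_group L by (rule comm_group_L)
  have "act (cochar_module TT) \<sigma> \<in> hom L L" if "\<sigma> \<in> gal \<iota>" for \<sigma>
    using act_L_closed[OF that] by (intro homI) (simp_all add: cochar_module_def fun_eq_iff pt_mult_map[OF that])
  moreover have "act (cochar_module TT) (\<sigma> \<circ> \<tau>) l = act (cochar_module TT) \<sigma> (act (cochar_module TT) \<tau> l)"
    if "\<sigma> \<in> gal \<iota>" "\<tau> \<in> gal \<iota>" for \<sigma> \<tau> l
    using that by (simp add: cochar_module_def map_map rhom_zero[OF gal_rhom] comp_def)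
  moreover have "\<exists>F. finite F \<and> (\<forall>g\<in>gal \<iota>. \<forall>h\<in>gal \<iota>. (\<forall>y\<in>F. g y = h y) \<longrightarrow>
      act (cochar_module TT) g l = act (cochar_module TT) h l)" for l
  \<comment> \<open>All coefficients of all coordinates of \<open>l\<close>: finitely many, since
    there are finitely many coordinates.\<close>
  proof (intro exI[of _ "\<Union>i. Poly_Mapping.lookup (l i) ` Poly_Mapping.keys (l i)"] conjI ballI impI)
    fix g h assume gh: "g \<in> gal \<iota>" "h \<in> gal \<iota>" "\<forall>y\<in>\<Union>i. Poly_Mapping.lookup (l i) ` Poly_Mapping.keys (l i). g y = h y"
    then have "Poly_Mapping.map g (l i) = Poly_Mapping.map h (l i)" for i
      by (intro map_cong_coeffs) (auto simp: rhom_zero[OF gal_rhom])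
    then show "act (cochar_module TT) g l = act (cochar_module TT) h l" by (simp add: cochar_module_def)
  qed simp
  ultimately show ?thesis
    using gal_comp[where \<iota>=\<iota>] by (simp add: galois_module_def galois_module_axioms_def comm_group_L)
qed

text \<open>Moving both arguments applies \<sigma> to the coefficients of the composite, which is a
  monomial with coefficient 1; its exponent does not change.\<close>

lemma pairing_invariant:
  assumes \<sigma>: "\<sigma> \<in> gal \<iota>" and c: "c \<in> carrier C" and l: "l \<in> carrier L"
  shows "char_pairing (act (char_module TT) \<sigma> c) (act (cochar_module TT) \<sigma> l) = char_pairing c l"
proof -
  obtain f e where f: "c = coset f" "ev f = Poly_Mapping.single e 1" using c carrier_C by blast
  obtain m where m: "l = cochar m" using l carrier_L by blast
  note s = gal_rhom[OF \<sigma>]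
  have *: "meval mconst (\<lambda>i. Poly_Mapping.map \<sigma> (l i)) (Poly_Mapping.map \<sigma> g) = Poly_Mapping.single (pr m e) 1" if "g \<in> c" for g
    using that f by (simp add: m mem_coset meval_cochar rhom_zero[OF s] rhom_one[OF s] flip: map_meval[OF \<sigma>])
  have "char_pairing (act (char_module TT) \<sigma> c) (act (cochar_module TT) \<sigma> l) = pr m e"
    unfolding char_pairing_def
  proof (rule the_equality)
    show "\<forall>f\<in>act (char_module TT) \<sigma> c. meval mconst (act (cochar_module TT) \<sigma> l) f = Poly_Mapping.single (pr m e) 1"
      using * by (simp add: char_module_def cochar_module_def)
    fix n assume "\<forall>f\<in>act (char_module TT) \<sigma> c. meval mconst (act (cochar_module TT) \<sigma> l) f = Poly_Mapping.single n 1"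
    then have "Poly_Mapping.single n 1 = (Poly_Mapping.single (pr m e) 1 :: int \<Rightarrow>\<^sub>0 'a)"
      using *[of f] f(1) mem_coset[of f f] by (simp add: char_module_def cochar_module_def)
    then show "n = pr m e" by (simp add: single_one_inj)
  qed
  then show ?thesis using f(1) m pairing[OF f(2)] by simp
qed

end

lemma torus_split:
  assumes "is_torus \<iota> T" "rhom \<iota>"
  obtains r \<psi> where "split_torus \<iota> T r \<psi>"
  using assms unfolding is_torus_def split_torus_def by blast

section \<open>Rational functions and divisors\<close>

text \<open>The local rings and the ring of regular functions share the multiplication of the
  function field, so their units are all obtained from this statement about submonoids.\<close>

lemma submonoid_units:
  fixes M (structure)
  assumes "comm_monoid M" "S \<subseteq> carrier M" "\<one> \<in> S" "\<And>x y. x \<in> S \<Longrightarrow> y \<in> S \<Longrightarrow> x \<otimes> y \<in> S"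
  shows Units_submonoid_iff: "u \<in> Units (M\<lparr>carrier := S\<rparr>) \<longleftrightarrow> u \<in> Units M \<and> u \<in> S \<and> inv u \<in> S"
    and Units_submonoid_subgroup: "subgroup (Units (M\<lparr>carrier := S\<rparr>)) (units_of M)"
proof -
  interpret comm_monoid M by fact
  have iff: "u \<in> Units (M\<lparr>carrier := S\<rparr>) \<longleftrightarrow> u \<in> Units M \<and> u \<in> S \<and> inv u \<in> S" for u
  proof
    assume "u \<in> Units (M\<lparr>carrier := S\<rparr>)"
    then obtain v where v: "u \<in> S" "v \<in> S" "v \<otimes> u = \<one>" "u \<otimes> v = \<one>" by (auto simp: Units_def)
    then have "u \<in> Units M" using assms(2) by (auto simp: Units_def)
    moreover have "inv u = v" using v assms(2) by (intro inv_char) auto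
    ultimately show "u \<in> Units M \<and> u \<in> S \<and> inv u \<in> S" using v by simp
  next
    assume u: "u \<in> Units M \<and> u \<in> S \<and> inv u \<in> S"
    then have "\<exists>x\<in>carrier (M\<lparr>carrier := S\<rparr>). x \<otimes>\<^bsub>M\<lparr>carrier := S\<rparr>\<^esub> u = \<one>\<^bsub>M\<lparr>carrier := S\<rparr>\<^esub> \<and>
        u \<otimes>\<^bsub>M\<lparr>carrier := S\<rparr>\<^esub> x = \<one>\<^bsub>M\<lparr>carrier := S\<rparr>\<^esub>"
      by (intro bexI[of _ "inv u"]) simp_all
    moreover have "u \<in> carrier (M\<lparr>carrier := S\<rparr>)" using u by simp
    ultimately show "u \<in> Units (M\<lparr>carrier := S\<rparr>)" unfolding Units_def by blast
  qed
  show "u \<in> Units (M\<lparr>carrier := S\<rparr>) \<longleftrightarrow> u \<in> Units M \<and> u \<in> S \<and> inv u \<in> S" by (rule iff)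
  interpret U: comm_group "units_of M" by (rule units_comm_group)
  show "subgroup (Units (M\<lparr>carrier := S\<rparr>)) (units_of M)"
  proof (rule U.subgroupI)
    show "Units (M\<lparr>carrier := S\<rparr>) \<subseteq> carrier (units_of M)" by (auto simp: iff units_of_carrier)
    have "\<one> \<in> Units (M\<lparr>carrier := S\<rparr>)" using assms(3) by (simp add: iff)
    then show "Units (M\<lparr>carrier := S\<rparr>) \<noteq> {}" by blast
  next
    fix u assume "u \<in> Units (M\<lparr>carrier := S\<rparr>)"
    then show "inv\<^bsub>units_of M\<^esub> u \<in> Units (M\<lparr>carrier := S\<rparr>)"
      by (simp add: iff units_of_inv)
  next
    fix u v assume uv: "u \<in> Units (M\<lparr>carrier := S\<rparr>)" "v \<in> Units (M\<lparr>carrier := S\<rparr>)"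
    then have "inv (u \<otimes> v) = inv v \<otimes> inv u"
      using U.inv_mult_group[of u v] by (simp add: iff units_of_inv units_of_mult units_of_carrier)
    with uv show "u \<otimes>\<^bsub>units_of M\<^esub> v \<in> Units (M\<lparr>carrier := S\<rparr>)"
      using assms(4) by (simp add: iff units_of_mult)
  qed
qed

lemma primeideal_rng_iff:
  "primeideal x (rng :: 'a::comm_ring_1 ring) \<longleftrightarrow>
    ideal x rng \<and> 1 \<notin> x \<and> (\<forall>a b. a * b \<in> x \<longrightarrow> a \<in> x \<or> b \<in> x)" (is "_ \<longleftrightarrow> ?R")
proof
  assume "primeideal x (rng :: 'a ring)"
  then interpret primeideal x "rng :: 'a ring" .
  have "x \<noteq> UNIV" using I_notcarr by simp
  moreover have "x = UNIV" if "1 \<in> x"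
  proof -
    have "a \<in> x" for a using ideal_rngD(3)[OF ideal_axioms that, of a] by simp
    then show ?thesis by blast
  qed
  ultimately show ?R using I_prime ideal_axioms by auto
next
  assume R: ?R
  then show "primeideal x (rng :: 'a ring)"
    by (intro primeidealI cring_rng) auto
qed

lemma homog_mult:
  assumes "homog d p" "homog d' q"
  shows "homog (d + d') (p * q)"
  unfolding homog_def
proof
  fix e assume "e \<in> Poly_Mapping.keys (p * q)"
  then obtain a b where "e = a + b" "a \<in> Poly_Mapping.keys p" "b \<in> Poly_Mapping.keys q"
    using keys_mult by blast
  then show "(\<Sum>i\<in>UNIV. Poly_Mapping.lookup e i) = d + d'"
    using assms by (simp add: homog_def lookup_add sum.distrib)
qed

lemma homog_one: "homog 0 1"
  by (simp add: homog_def)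

lemma homog_map:
  assumes "\<sigma> 0 = 0" "homog d p"
  shows "homog d (Poly_Mapping.map \<sigma> p)"
proof -
  have "Poly_Mapping.keys (Poly_Mapping.map \<sigma> p) \<subseteq> Poly_Mapping.keys p"
    by (auto simp: in_keys_iff map_lookup[of \<sigma>, OF assms(1)] assms(1))
  then show ?thesis using assms(2) by (auto simp: homog_def)
qed

section \<open>The multiplicative group of the function field, its local units, and Cartier
  divisors\<close>

locale fraction_ideal =
  fixes I :: "('n::finite, 'a::field) mpoly set"
  assumes ideal: "ideal I rng"
begin

abbreviation "K \<equiv> function_field I"
abbreviation "LR \<equiv> local_ring I"
abbreviation "Rg \<equiv> regular_functions I"
abbreviation "PP \<equiv> proj_points I"
abbreviation "UK \<equiv> units_of K"

lemmas idl = ideal_rngD[OF ideal]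

lemma fracs_mult:
  assumes "(a, b) \<in> fracs I" "(c, d) \<in> fracs I"
  shows "(a * c, b * d) \<in> fracs I"
proof -
  obtain k l where "homog k a" "homog k b" "homog l c" "homog l d"
    using assms by (auto simp: fracs_def)
  then have "homog (k + l) (a * c)" "homog (k + l) (b * d)" by (simp_all add: homog_mult)
  moreover have "f \<in> I" if "b * d * f \<in> I" for f
  proof -
    have "g \<in> I" if "b * g \<in> I" for g using that assms(1) unfolding fracs_def by blast
    moreover have "b * (d * f) \<in> I" using that by (simp only: mult.assoc)
    ultimately have "d * f \<in> I" by blast
    then show ?thesis using assms(2) unfolding fracs_def by blast
  qed
  ultimately show ?thesis unfolding fracs_def by blast
qed

lemma fracs_one: "(1, 1) \<in> fracs I"
  using homog_one by (auto simp: fracs_def)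

lemma frac_class_refl: "(a, b) \<in> fracs I \<Longrightarrow> (a, b) \<in> frac_class I a b"
  by (simp add: frac_class_def idl)

text \<open>The difference in question multiplied by \<open>d\<close> is a combination of the two
  given ones, and \<open>d\<close> is a non-zero-divisor modulo \<open>I\<close>.\<close>

lemma frac_trans:
  assumes "(c, d) \<in> fracs I" "a * d - c * b \<in> I" "c * f - e * d \<in> I"
  shows "a * f - e * b \<in> I"
proof -
  have "d * (a * f - e * b) = f * (a * d - c * b) + b * (c * f - e * d)" by (simp add: algebra_simps)
  also have "\<dots> \<in> I" using assms by (intro idl(2,3))
  finally show ?thesis using assms(1) by (simp add: fracs_def)
qed

lemma frac_sym: "a * d - c * b \<in> I \<Longrightarrow> c * b - a * d \<in> I"
  using idl(5)[of "a * d - c * b"] by simp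

lemma frac_class_eq:
  assumes "(a, b) \<in> fracs I" "(c, d) \<in> fracs I"
  shows "frac_class I a b = frac_class I c d \<longleftrightarrow> a * d - c * b \<in> I"
proof
  assume "frac_class I a b = frac_class I c d"
  then have "(c, d) \<in> frac_class I a b" using frac_class_refl[OF assms(2)] by simp
  then show "a * d - c * b \<in> I" by (simp add: frac_class_def)
next
  assume 1: "a * d - c * b \<in> I"
  show "frac_class I a b = frac_class I c d"
    unfolding frac_class_def using frac_trans[OF assms(1) frac_sym[OF 1]] frac_trans[OF assms(2) 1] by blast
qed

lemma frac_class_mem_eq:
  assumes "(a, b) \<in> fracs I" "(c, d) \<in> frac_class I a b"
  shows "(c, d) \<in> fracs I" "frac_class I c d = frac_class I a b"
  using assms frac_class_eq[OF assms(1), of c d] by (auto simp: frac_class_def)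

lemma frac_class_mult_cong:
  assumes "(a, b) \<in> fracs I" "(c, d) \<in> fracs I" "(a', b') \<in> frac_class I a b" "(c', d') \<in> frac_class I c d"
  shows "frac_class I (a' * c') (b' * d') = frac_class I (a * c) (b * d)"
proof -
  have *: "(a', b') \<in> fracs I" "a * b' - a' * b \<in> I" "(c', d') \<in> fracs I" "c * d' - c' * d \<in> I"
    using assms by (auto simp: frac_class_def)
  have "(a' * c') * (b * d) - (a * c) * (b' * d') =
      (c' * d) * (- (a * b' - a' * b)) - (a * b') * (c * d' - c' * d)"
    by (simp add: algebra_simps)
  also have "\<dots> \<in> I" by (rule idl(6)[OF idl(3)[OF idl(5)[OF *(2)]] idl(3)[OF *(4)]])
  finally show ?thesis
    using * assms by (subst frac_class_eq) (auto intro: fracs_mult)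
qed

text \<open>The union over pairs of representatives in \<open>function_field\<close> is a union of
  one and the same class, by \<open>frac_class_mult_cong\<close>.\<close>

lemma mult_K:
  assumes "(a, b) \<in> fracs I" "(c, d) \<in> fracs I"
  shows "frac_class I a b \<otimes>\<^bsub>K\<^esub> frac_class I c d = frac_class I (a * c) (b * d)"
proof -
  have "(\<Union>(a', b')\<in>frac_class I a b. \<Union>(c', d')\<in>frac_class I c d. frac_class I (a' * c') (b' * d'))
      = (\<Union>(a', b')\<in>frac_class I a b. \<Union>(c', d')\<in>frac_class I c d. frac_class I (a * c) (b * d))"
    using frac_class_mult_cong[OF assms] by (intro SUP_cong refl) (auto split: prod.splits)
  also have "\<dots> = frac_class I (a * c) (b * d)"
    using frac_class_refl[OF assms(1)] frac_class_refl[OF assms(2)] by auto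
  finally show ?thesis by (simp add: function_field_def)
qed

lemma carrier_K: "u \<in> carrier K \<longleftrightarrow> (\<exists>a b. (a, b) \<in> fracs I \<and> u = frac_class I a b)"
  by (auto simp: function_field_def image_iff)

lemma one_K: "\<one>\<^bsub>K\<^esub> = frac_class I 1 1"
  by (simp add: function_field_def)

sublocale K: comm_monoid K
proof (rule comm_monoidI)
  show "x \<otimes>\<^bsub>K\<^esub> y \<in> carrier K" if "x \<in> carrier K" "y \<in> carrier K" for x y
    using that fracs_mult unfolding carrier_K by (metis mult_K)
  show "\<one>\<^bsub>K\<^esub> \<in> carrier K" using fracs_one by (auto simp: carrier_K one_K)
  show "x \<otimes>\<^bsub>K\<^esub> y \<otimes>\<^bsub>K\<^esub> z = x \<otimes>\<^bsub>K\<^esub> (y \<otimes>\<^bsub>K\<^esub> z)"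
    if xyz: "x \<in> carrier K" "y \<in> carrier K" "z \<in> carrier K" for x y z
  proof -
    obtain a b c d e f where "(a, b) \<in> fracs I" "(c, d) \<in> fracs I" "(e, f) \<in> fracs I"
      "x = frac_class I a b" "y = frac_class I c d" "z = frac_class I e f"
      using xyz unfolding carrier_K by blast
    then show ?thesis by (simp add: mult_K fracs_mult mult.assoc)
  qed
  show "\<one>\<^bsub>K\<^esub> \<otimes>\<^bsub>K\<^esub> x = x" if x: "x \<in> carrier K" for x
  proof -
    obtain a b where "(a, b) \<in> fracs I" "x = frac_class I a b" using x unfolding carrier_K by blast
    then show ?thesis by (simp add: one_K mult_K fracs_one)
  qed
  show "x \<otimes>\<^bsub>K\<^esub> y = y \<otimes>\<^bsub>K\<^esub> x" if xy: "x \<in> carrier K" "y \<in> carrier K" for x y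
  proof -
    obtain a b c d where "(a, b) \<in> fracs I" "(c, d) \<in> fracs I" "x = frac_class I a b" "y = frac_class I c d"
      using xy unfolding carrier_K by blast
    then show ?thesis by (simp add: mult_K mult.commute)
  qed
qed

sublocale UK: comm_group UK
  by (rule K.units_comm_group)

lemma UK_simps [simp]: "carrier UK = Units K" "monoid.mult UK = monoid.mult K" "\<one>\<^bsub>UK\<^esub> = \<one>\<^bsub>K\<^esub>"
  by (simp_all add: units_of_def)

lemma PP_prime:
  assumes "x \<in> PP"
  shows "1 \<notin> x" "a * b \<in> x \<longleftrightarrow> a \<in> x \<or> b \<in> x"
  using assms ideal_rngD(3,4)[of x] by (auto simp: proj_points_def primeideal_rng_iff)

lemma local_ring_submonoid:
  assumes "x \<in> PP"
  shows "carrier (LR x) \<subseteq> carrier K" "\<one>\<^bsub>K\<^esub> \<in> carrier (LR x)"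
    "u \<in> carrier (LR x) \<Longrightarrow> v \<in> carrier (LR x) \<Longrightarrow> u \<otimes>\<^bsub>K\<^esub> v \<in> carrier (LR x)"
proof -
  show "carrier (LR x) \<subseteq> carrier K" by (auto simp: local_ring_def)
  show "\<one>\<^bsub>K\<^esub> \<in> carrier (LR x)"
    using K.one_closed frac_class_refl[OF fracs_one] PP_prime(1)[OF assms] by (auto simp: local_ring_def one_K)
  assume u: "u \<in> carrier (LR x)" and v: "v \<in> carrier (LR x)"
  obtain a b where a: "u \<in> carrier K" "(a, b) \<in> u" "b \<notin> x" using u by (auto simp: local_ring_def)
  obtain c d where c: "v \<in> carrier K" "(c, d) \<in> v" "d \<notin> x" using v by (auto simp: local_ring_def)
  have a': "(a, b) \<in> fracs I" "u = frac_class I a b" using a frac_class_mem_eq unfolding carrier_K by metis+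
  have c': "(c, d) \<in> fracs I" "v = frac_class I c d" using c frac_class_mem_eq unfolding carrier_K by metis+
  have "(a * c, b * d) \<in> u \<otimes>\<^bsub>K\<^esub> v"
    using a' c' by (simp add: mult_K frac_class_refl fracs_mult)
  moreover have "b * d \<notin> x" using a c PP_prime[OF assms] by simp
  ultimately show "u \<otimes>\<^bsub>K\<^esub> v \<in> carrier (LR x)" using a c by (auto simp: local_ring_def)
qed

lemma local_ring_eq: "LR x = K\<lparr>carrier := carrier (LR x)\<rparr>"
  by (simp add: local_ring_def)

lemma regular_eq: "Rg = K\<lparr>carrier := carrier Rg\<rparr>"
  by (simp add: regular_functions_def)

lemma carrier_regular: "u \<in> carrier Rg \<longleftrightarrow> u \<in> carrier K \<and> (\<forall>x\<in>PP. u \<in> carrier (LR x))"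
  by (simp add: regular_functions_def)

lemma regular_submonoid: "carrier Rg \<subseteq> carrier K" "\<one>\<^bsub>K\<^esub> \<in> carrier Rg"
    "u \<in> carrier Rg \<Longrightarrow> v \<in> carrier Rg \<Longrightarrow> u \<otimes>\<^bsub>K\<^esub> v \<in> carrier Rg"
  using local_ring_submonoid by (auto simp: carrier_regular)

lemma Units_local_iff:
  "x \<in> PP \<Longrightarrow> u \<in> Units (LR x) \<longleftrightarrow> u \<in> Units K \<and> u \<in> carrier (LR x) \<and> inv\<^bsub>K\<^esub> u \<in> carrier (LR x)"
  by (subst local_ring_eq) (rule Units_submonoid_iff[OF K.comm_monoid_axioms local_ring_submonoid])

lemma Units_regular_iff':
  "u \<in> Units Rg \<longleftrightarrow> u \<in> Units K \<and> u \<in> carrier Rg \<and> inv\<^bsub>K\<^esub> u \<in> carrier Rg"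
  by (subst regular_eq) (rule Units_submonoid_iff[OF K.comm_monoid_axioms regular_submonoid])

lemma Units_regular_iff: "u \<in> Units Rg \<longleftrightarrow> u \<in> Units K \<and> (\<forall>x\<in>PP. u \<in> Units (LR x))"
  by (auto simp: Units_regular_iff' Units_local_iff carrier_regular)

lemma local_units_subgroup: "x \<in> PP \<Longrightarrow> subgroup (Units (LR x)) UK"
  by (subst local_ring_eq) (rule Units_submonoid_subgroup[OF K.comm_monoid_axioms local_ring_submonoid])

lemma regular_units_subgroup: "subgroup (Units Rg) UK"
  by (subst regular_eq) (rule Units_submonoid_subgroup[OF K.comm_monoid_axioms regular_submonoid])

lemma regular_units_eq: "units_of Rg = UK\<lparr>carrier := Units Rg\<rparr>"
  by (subst regular_eq) (simp add: units_of_def regular_functions_def)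

abbreviation "cs x u \<equiv> Units (LR x) #>\<^bsub>UK\<^esub> u"

lemma cs_normal: "x \<in> PP \<Longrightarrow> Units (LR x) \<lhd> UK"
  using UK.normal_iff_subgroup local_units_subgroup by blast

lemma cs_mult: "x \<in> PP \<Longrightarrow> u \<in> Units K \<Longrightarrow> v \<in> Units K \<Longrightarrow> cs x u <#>\<^bsub>UK\<^esub> cs x v = cs x (u \<otimes>\<^bsub>K\<^esub> v)"
  using normal.rcos_sum[OF cs_normal, of x u v] by simp

lemma cs_eq_one: "x \<in> PP \<Longrightarrow> u \<in> Units K \<Longrightarrow> cs x u = Units (LR x) \<longleftrightarrow> u \<in> Units (LR x)"
  using UK.coset_join1[of "Units (LR x)" u] UK.coset_join2[of u "Units (LR x)"] local_units_subgroup
    subgroup.subset by auto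

abbreviation "PG \<equiv> product_group PP (\<lambda>x. UK Mod Units (LR x))"
abbreviation "DD \<equiv> divisor_group I"

text \<open>The witness hidden in \<open>divisor_group\<close>, a finite cover by basic open sets
  with local equations. It is named because it has to be transported along products, inverses and
  the Galois action.\<close>

definition local_data where
  "local_data F s \<longleftrightarrow> finite F \<and> (\<forall>x\<in>PP. \<exists>(h, u)\<in>F. x \<in> basic_open I h) \<and>
     (\<forall>(h, u)\<in>F. (\<exists>d. homog d h) \<and> u \<in> Units K \<and> (\<forall>y\<in>basic_open I h. s y = cs y u))"

lemma DD_eq: "DD = PG\<lparr>carrier := carrier DD\<rparr>"
  by (simp add: divisor_group_def Let_def)

lemma carrier_DD: "s \<in> carrier DD \<longleftrightarrow> s \<in> carrier PG \<and> (\<exists>F. local_data F s)"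
  by (simp add: divisor_group_def Let_def local_data_def)

lemma PG_group: "group PG"
  by (rule product_group) (rule normal.factorgroup_is_group[OF cs_normal])

lemma local_data_memberE:
  assumes "local_data F s" "x \<in> PP"
  obtains h u where "(h, u) \<in> F" "x \<in> basic_open I h" "u \<in> Units K" "s x = cs x u"
  using assms unfolding local_data_def by blast

lemma local_dataI:
  assumes "finite F" "\<And>x. x \<in> PP \<Longrightarrow> \<exists>h u. (h, u) \<in> F \<and> x \<in> basic_open I h"
    and "\<And>h u. (h, u) \<in> F \<Longrightarrow> (\<exists>d. homog d h) \<and> u \<in> Units K \<and> (\<forall>y\<in>basic_open I h. s y = cs y u)"
  shows "local_data F s"
  using assms unfolding local_data_def by blast

lemma basic_open_PP: "x \<in> basic_open I h \<Longrightarrow> x \<in> PP"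
  by (simp add: basic_open_def)

lemma DD_subgroup: "subgroup (carrier DD) PG"
proof -
  interpret PG: group PG by (rule PG_group)
  show ?thesis
  proof (rule PG.subgroupI)
    show "carrier DD \<subseteq> carrier PG" using carrier_DD by blast
    have "local_data {(1, \<one>\<^bsub>K\<^esub>)} \<one>\<^bsub>PG\<^esub>"
    proof (rule local_dataI)
      show "\<exists>h u. (h, u) \<in> {(1, \<one>\<^bsub>K\<^esub>)} \<and> x \<in> basic_open I h" if "x \<in> PP" for x
        using that PP_prime(1) by (auto simp: basic_open_def)
      show "(\<exists>d. homog d h) \<and> u \<in> Units K \<and> (\<forall>y\<in>basic_open I h. \<one>\<^bsub>PG\<^esub> y = cs y u)"
        if "(h, u) \<in> {(1, \<one>\<^bsub>K\<^esub>)}" for h u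
        using that homog_one cs_eq_one[of _ "\<one>\<^bsub>K\<^esub>"] subgroup.one_closed[OF local_units_subgroup]
        by (auto simp: basic_open_PP)
    qed simp
    then show "carrier DD \<noteq> {}" using PG.one_closed carrier_DD by blast
  next
    fix s assume s: "s \<in> carrier DD"
    then obtain F where F: "local_data F s" by (auto simp: carrier_DD)
    have si: "inv\<^bsub>PG\<^esub> s = (\<lambda>x\<in>PP. inv\<^bsub>UK Mod Units (LR x)\<^esub> s x)"
      using s normal.factorgroup_is_group[OF cs_normal] by (intro inv_product_group) (auto simp: carrier_DD)
    have "local_data ((\<lambda>(h, u). (h, inv\<^bsub>UK\<^esub> u)) ` F) (inv\<^bsub>PG\<^esub> s)"
    proof (rule local_dataI)
      show "finite ((\<lambda>(h, u). (h, inv\<^bsub>UK\<^esub> u)) ` F)" using F by (simp add: local_data_def)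
      show "\<exists>h u. (h, u) \<in> (\<lambda>(h, u). (h, inv\<^bsub>UK\<^esub> u)) ` F \<and> x \<in> basic_open I h" if x: "x \<in> PP" for x
      proof -
        obtain h u where "(h, u) \<in> F" "x \<in> basic_open I h" using local_data_memberE[OF F x] by metis
        then show ?thesis by force
      qed
      fix h v assume "(h, v) \<in> (\<lambda>(h, u). (h, inv\<^bsub>UK\<^esub> u)) ` F"
      then obtain u where u: "(h, u) \<in> F" "v = inv\<^bsub>UK\<^esub> u" by auto
      then have *: "\<exists>d. homog d h" "u \<in> Units K" "\<And>y. y \<in> basic_open I h \<Longrightarrow> s y = cs y u"
        using F by (auto simp: local_data_def)
      moreover have "(inv\<^bsub>PG\<^esub> s) y = cs y v" if "y \<in> basic_open I h" for y
      proof -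
        have y: "y \<in> PP" using that by (rule basic_open_PP)
        have "cs y u \<in> carrier (UK Mod Units (LR y))" using * by (auto simp: carrier_FactGroup)
        from normal.inv_FactGroup[OF cs_normal[OF y] this]
        have "(inv\<^bsub>PG\<^esub> s) y = set_inv\<^bsub>UK\<^esub> (cs y u)" using y * that by (simp add: si)
        also have "\<dots> = cs y v" using normal.rcos_inv[OF cs_normal[OF y], of u] * u by simp
        finally show ?thesis .
      qed
      ultimately show "(\<exists>d. homog d h) \<and> v \<in> Units K \<and> (\<forall>y\<in>basic_open I h. (inv\<^bsub>PG\<^esub> s) y = cs y v)"
        using UK.inv_closed[of u] u by simp
    qed
    then show "inv\<^bsub>PG\<^esub> s \<in> carrier DD"
      using s PG.inv_closed[of s] by (auto simp: carrier_DD simp del: carrier_product_group inv_product_group)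
  next
    fix s t assume s: "s \<in> carrier DD" and t: "t \<in> carrier DD"
    obtain E where E: "local_data E s" using s by (auto simp: carrier_DD)
    obtain F where F: "local_data F t" using t by (auto simp: carrier_DD)
    \<comment> \<open>The common refinement of the two covers, with the product of the local
      equations; a product of forms is nonzero at a point exactly when both factors are.\<close>
    let ?p = "\<lambda>((h, u), (k, v)). (h * k, u \<otimes>\<^bsub>K\<^esub> v)"
    have open_mult: "x \<in> basic_open I (h * k) \<longleftrightarrow> x \<in> basic_open I h \<and> x \<in> basic_open I k" for x h k
      using PP_prime(2) by (auto simp: basic_open_def)
    have "local_data (?p ` (E \<times> F)) (s \<otimes>\<^bsub>PG\<^esub> t)"
    proof (rule local_dataI)
      show "finite (?p ` (E \<times> F))" using E F by (simp add: local_data_def)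
      show "\<exists>h u. (h, u) \<in> ?p ` (E \<times> F) \<and> x \<in> basic_open I h" if x: "x \<in> PP" for x
      proof -
        obtain h u where h: "(h, u) \<in> E" "x \<in> basic_open I h" using local_data_memberE[OF E x] by metis
        obtain k v where k: "(k, v) \<in> F" "x \<in> basic_open I k" using local_data_memberE[OF F x] by metis
        show ?thesis using h k open_mult by (intro exI[of _ "h * k"] exI[of _ "u \<otimes>\<^bsub>K\<^esub> v"]) force
      qed
      fix hk w assume "(hk, w) \<in> ?p ` (E \<times> F)"
      then obtain h u k v where hk: "(h, u) \<in> E" "(k, v) \<in> F" "hk = h * k" "w = u \<otimes>\<^bsub>K\<^esub> v" by auto
      have 1: "\<exists>d. homog d h" "u \<in> Units K" "\<And>y. y \<in> basic_open I h \<Longrightarrow> s y = cs y u"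
        using E hk by (auto simp: local_data_def)
      have 2: "\<exists>d. homog d k" "v \<in> Units K" "\<And>y. y \<in> basic_open I k \<Longrightarrow> t y = cs y v"
        using F hk by (auto simp: local_data_def)
      have "(s \<otimes>\<^bsub>PG\<^esub> t) y = cs y w" if y: "y \<in> basic_open I hk" for y
      proof -
        have "y \<in> PP" "y \<in> basic_open I h" "y \<in> basic_open I k"
          using y basic_open_PP open_mult hk by auto
        then show ?thesis using 1 2 hk by (simp add: cs_mult)
      qed
      then show "(\<exists>d. homog d hk) \<and> w \<in> Units K \<and> (\<forall>y\<in>basic_open I hk. (s \<otimes>\<^bsub>PG\<^esub> t) y = cs y w)"
        using 1 2 homog_mult hk by (metis K.Units_m_closed)
    qed
    then show "s \<otimes>\<^bsub>PG\<^esub> t \<in> carrier DD"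
      using s t PG.m_closed[of s t] by (auto simp: carrier_DD simp del: carrier_product_group mult_product_group)
  qed
qed

lemma DD_mult: "x \<in> PP \<Longrightarrow> (s \<otimes>\<^bsub>DD\<^esub> t) x = s x <#>\<^bsub>UK\<^esub> t x"
  by (subst DD_eq) simp

lemma DD_eqI: "s \<in> carrier DD \<Longrightarrow> t \<in> carrier DD \<Longrightarrow> (\<And>x. x \<in> PP \<Longrightarrow> s x = t x) \<Longrightarrow> s = t"
  by (rule PiE_ext[of s PP _ t]) (auto simp: carrier_DD)

sublocale DD: comm_group DD
proof -
  have "group (PG\<lparr>carrier := carrier DD\<rparr>)"
    by (rule subgroup.subgroup_is_group[OF DD_subgroup PG_group])
  then have g: "group DD" by (subst DD_eq)
  then interpret D: group DD .
  show "comm_group DD"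
  proof (rule D.group_comm_groupI)
    fix s t assume st: "s \<in> carrier DD" "t \<in> carrier DD"
    show "s \<otimes>\<^bsub>DD\<^esub> t = t \<otimes>\<^bsub>DD\<^esub> s"
    proof (rule DD_eqI)
      fix x assume x: "x \<in> PP"
      obtain F where F: "local_data F s" using st by (auto simp: carrier_DD)
      obtain F' where F': "local_data F' t" using st by (auto simp: carrier_DD)
      obtain u where "u \<in> Units K" "s x = cs x u" using local_data_memberE[OF F x] by metis
      moreover obtain v where "v \<in> Units K" "t x = cs x v" using local_data_memberE[OF F' x] by metis
      ultimately show "(s \<otimes>\<^bsub>DD\<^esub> t) x = (t \<otimes>\<^bsub>DD\<^esub> s) x"
        using x K.m_comm[of u v] by (simp add: DD_mult cs_mult K.Units_closed)
    qed (use st in auto)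
  qed
qed

lemma DD_coset:
  assumes "s \<in> carrier DD" "x \<in> PP"
  obtains u where "u \<in> Units K" "s x = cs x u"
proof -
  obtain F where "local_data F s" using assms(1) by (auto simp: carrier_DD)
  then show ?thesis using local_data_memberE[OF _ assms(2)] that by metis
qed

lemma DD_one: "x \<in> PP \<Longrightarrow> \<one>\<^bsub>DD\<^esub> x = Units (LR x)"
  by (subst DD_eq) simp

lemma div_map_apply: "x \<in> PP \<Longrightarrow> div_map I u x = cs x u"
  by (simp add: div_map_def)

lemma div_map_closed:
  assumes u: "u \<in> Units K" shows "div_map I u \<in> carrier DD"
proof -
  have "local_data {(1, u)} (div_map I u)"
  proof (rule local_dataI)
    show "\<exists>h u'. (h, u') \<in> {(1, u)} \<and> x \<in> basic_open I h" if "x \<in> PP" for x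
      using that PP_prime(1) by (auto simp: basic_open_def)
    show "(\<exists>d. homog d h) \<and> u' \<in> Units K \<and> (\<forall>y\<in>basic_open I h. div_map I u y = cs y u')"
      if "(h, u') \<in> {(1, u)}" for h u'
      using that homog_one u by (auto simp: basic_open_PP div_map_apply)
  qed simp
  moreover have "div_map I u \<in> carrier PG"
    using u by (auto simp: div_map_def carrier_FactGroup)
  ultimately show ?thesis by (auto simp: carrier_DD)
qed

lemma div_map_hom: "div_map I \<in> hom UK DD"
proof (rule homI)
  fix u v assume "u \<in> carrier UK" "v \<in> carrier UK"
  then show "div_map I (u \<otimes>\<^bsub>UK\<^esub> v) = div_map I u \<otimes>\<^bsub>DD\<^esub> div_map I v"
    using div_map_closed[of u] div_map_closed[of v]
    by (intro DD_eqI DD.m_closed div_map_closed) (auto simp: DD_mult div_map_apply cs_mult)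
qed (use div_map_closed in auto)

lemma div_map_kernel:
  assumes "u \<in> Units K" shows "div_map I u = \<one>\<^bsub>DD\<^esub> \<longleftrightarrow> u \<in> Units Rg"
proof
  assume "div_map I u = \<one>\<^bsub>DD\<^esub>"
  then have "cs x u = Units (LR x)" if "x \<in> PP" for x using div_map_apply[OF that, of u] DD_one[OF that] by simp
  then have "u \<in> Units (LR x)" if "x \<in> PP" for x using cs_eq_one[OF that assms] that by blast
  then show "u \<in> Units Rg" using assms Units_regular_iff by blast
next
  assume u: "u \<in> Units Rg"
  show "div_map I u = \<one>\<^bsub>DD\<^esub>"
  proof (rule DD_eqI[OF div_map_closed[OF assms] DD.one_closed])
    fix x assume x: "x \<in> PP"
    then have "u \<in> Units (LR x)" using u Units_regular_iff by blast
    then have "cs x u = Units (LR x)" using cs_eq_one[OF x assms] by blast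
    then show "div_map I u x = \<one>\<^bsub>DD\<^esub> x"
      using div_map_apply[OF x, of u] DD_one[OF x] by (simp only:)
  qed
qed

lemma principal_subgroup: "subgroup (principal_divisors I) DD"
proof -
  interpret group_hom UK DD "div_map I"
    using div_map_hom UK.is_group DD.is_group by (simp add: group_hom_def group_hom_axioms_def)
  show ?thesis using img_is_subgroup by (simp add: principal_divisors_def)
qed

abbreviation "Pic \<equiv> DD Mod principal_divisors I"

lemma pic_map_surj: "pic_map I ` carrier DD = carrier Pic"
  by (simp add: carrier_FactGroup pic_map_def)

lemma pic_map_kernel: "s \<in> carrier DD \<Longrightarrow> pic_map I s = \<one>\<^bsub>Pic\<^esub> \<longleftrightarrow> s \<in> div_map I ` carrier UK"
  using DD.coset_join1[of "principal_divisors I" s] DD.coset_join2[of s "principal_divisors I"] principal_subgroup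
    subgroup.subset[OF principal_subgroup]
  by (auto simp: pic_map_def principal_divisors_def)

end


lemma quotient_module:
  assumes D: "galois_module G D" and S: "subgroup S (grp D)"
    and act: "\<And>g. g \<in> G \<Longrightarrow> act D g ` S = S"
    and q: "\<And>s. q s = S #>\<^bsub>grp D\<^esub> s"
  defines "M \<equiv> \<lparr>grp = grp D Mod S, act = (\<lambda>g. image (act D g))\<rparr>"
  shows "galois_module G M" and "module_hom G D M q"
proof -
  interpret D: galois_module G D by fact
  have coset: "act D g ` q s = q (act D g s)" if g: "g \<in> G" and s: "s \<in> carrier (grp D)" for g s
  proof -
    have "act D g ` q s = (\<lambda>h. act D g (h \<otimes>\<^bsub>grp D\<^esub> s)) ` S" by (auto simp: q r_coset_def)
    also have "\<dots> = (\<lambda>h. act D g h \<otimes>\<^bsub>grp D\<^esub> act D g s) ` S"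
      by (rule image_cong[OF refl]) (rule hom_mult[OF D.act_hom[OF g] subgroup.mem_carrier[OF S] s])
    also have "\<dots> = (\<lambda>h. h \<otimes>\<^bsub>grp D\<^esub> act D g s) ` (act D g ` S)" by (simp add: image_image)
    finally show ?thesis using act[OF g] by (auto simp: q r_coset_def)
  qed
  have N: "S \<lhd> grp D" using S D.normal_iff_subgroup by blast
  have cM: "comm_group (grp M)" unfolding M_def using D.abelian_FactGroup[OF S] by simp
  have carr: "x \<in> carrier (grp M) \<longleftrightarrow> (\<exists>s\<in>carrier (grp D). x = q s)" for x
    by (auto simp: M_def carrier_FactGroup q)
  have qm: "q s \<otimes>\<^bsub>grp M\<^esub> q t = q (s \<otimes>\<^bsub>grp D\<^esub> t)" if "s \<in> carrier (grp D)" "t \<in> carrier (grp D)" for s t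
    using normal.rcos_sum[OF N that] by (simp add: M_def q)
  have aM: "act M g (q s) = q (act D g s)" if "g \<in> G" "s \<in> carrier (grp D)" for g s
    using coset[OF that] by (simp add: M_def)
  show M: "galois_module G M"
  proof (intro galois_module.intro galois_module_axioms.intro cM)
    show "g \<circ> h \<in> G" if "g \<in> G" "h \<in> G" for g h using that by (rule D.G_comp)
    show "act M g \<in> hom (grp M) (grp M)" if g: "g \<in> G" for g
    proof (rule homI)
      show "act M g x \<in> carrier (grp M)" if "x \<in> carrier (grp M)" for x
        using that g aM unfolding carr by fastforce
      show "act M g (x \<otimes>\<^bsub>grp M\<^esub> y) = act M g x \<otimes>\<^bsub>grp M\<^esub> act M g y"
        if xy: "x \<in> carrier (grp M)" "y \<in> carrier (grp M)" for x y
      proof -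
        obtain s t where "s \<in> carrier (grp D)" "t \<in> carrier (grp D)" "x = q s" "y = q t"
          using xy unfolding carr by blast
        then show ?thesis using g by (simp add: qm aM hom_mult[OF D.act_hom[OF g]])
      qed
    qed
    show "act M (g \<circ> h) x = act M g (act M h x)" if g: "g \<in> G" "h \<in> G" and x: "x \<in> carrier (grp M)" for g h x
    proof -
      obtain s where "s \<in> carrier (grp D)" "x = q s" using x unfolding carr by blast
      then show ?thesis using g D.G_comp by (simp add: aM D.act_comp)
    qed
    show "\<exists>F. finite F \<and> (\<forall>g\<in>G. \<forall>h\<in>G. (\<forall>y\<in>F. g y = h y) \<longrightarrow> act M g x = act M h x)"
      if x: "x \<in> carrier (grp M)" for x
    proof -
      obtain s where s: "s \<in> carrier (grp D)" "x = q s" using x unfolding carr by blast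
      obtain F where "finite F" "\<forall>g\<in>G. \<forall>h\<in>G. (\<forall>y\<in>F. g y = h y) \<longrightarrow> act D g s = act D h s"
        using D.act_discrete[OF s(1)] by blast
      moreover from this have "act M g x = act M h x" if "g \<in> G" "h \<in> G" "\<forall>y\<in>F. g y = h y" for g h
        using that aM[OF that(1) s(1)] aM[OF that(2) s(1)] s(2) by metis
      ultimately show ?thesis by blast
    qed
  qed
  show "module_hom G D M q"
  proof (intro module_hom.intro module_hom_axioms.intro D M)
    show "q \<in> hom (grp D) (grp M)" using carr qm by (intro homI) auto
  qed (simp add: aM)
qed

section \<open>Galois action on rational functions, divisors and divisor classes\<close>

locale galois_fraction_ideal =
  fixes \<iota> :: "'k::field \<Rightarrow> 'a::field" and I0 :: "('n::finite, 'k) mpoly set"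
  assumes \<iota>: "rhom \<iota>"
begin

abbreviation "I \<equiv> ext_ideal \<iota> I0"
abbreviation "G \<equiv> gal \<iota>"

sublocale fraction_ideal I
  by (rule fraction_ideal.intro[OF ext_ideal_ideal])

abbreviation mp :: "('a \<Rightarrow> 'a) \<Rightarrow> ('n, 'a) mpoly \<Rightarrow> ('n, 'a) mpoly" where
  "mp \<equiv> Poly_Mapping.map"

lemma rhom_mp: "g \<in> G \<Longrightarrow> rhom (mp g)"
  by (rule rhom_poly_mapping_map[OF gal_rhom])

lemma mp_comp: "g \<in> G \<Longrightarrow> h \<in> G \<Longrightarrow> mp (g \<circ> h) p = mp g (mp h p)"
  by (simp add: map_map rhom_zero[OF gal_rhom] comp_def)

lemma mp_inv:
  assumes "g \<in> G"
  obtains h where "h \<in> G" "\<And>p. mp g (mp h p) = p" "\<And>p. mp h (mp g p) = p"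
proof -
  obtain h where "h \<in> G" "\<And>x. g (h x) = x" "\<And>x. h (g x) = x" using gal_inv[OF assms] by metis
  then show ?thesis using that assms by (simp add: map_map rhom_zero[OF gal_rhom] map_id)
qed

lemma mp_I:
  assumes "g \<in> G" "p \<in> I" shows "mp g p \<in> I"
  by (rule map_ext_ideal[OF gal_rhom[OF assms(1)] \<iota> gal_fix[OF assms(1)] assms(2)])

lemma mp_I_iff: "g \<in> G \<Longrightarrow> mp g p \<in> I \<longleftrightarrow> p \<in> I"
  using mp_I mp_inv by metis

lemma mp_homog: "g \<in> G \<Longrightarrow> homog d p \<Longrightarrow> homog d (mp g p)"
  by (rule homog_map[OF rhom_zero[OF gal_rhom]])

lemma mp_fracs:
  assumes g: "g \<in> G" and ab: "(a, b) \<in> fracs I"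
  shows "(mp g a, mp g b) \<in> fracs I"
proof -
  obtain h where h: "h \<in> G" "\<And>p. mp g (mp h p) = p" "\<And>p. mp h (mp g p) = p" using mp_inv[OF g] by metis
  obtain d where "homog d a" "homog d b" using ab by (auto simp: fracs_def)
  then have "homog d (mp g a)" "homog d (mp g b)" using mp_homog[OF g] by auto
  moreover have "f \<in> I" if "mp g b * f \<in> I" for f
  proof -
    have "mp h (mp g b * f) \<in> I" using mp_I[OF h(1) that] .
    then have "b * mp h f \<in> I" by (simp add: rhom_mult[OF rhom_mp[OF h(1)]] h)
    then have "mp h f \<in> I" using ab by (simp add: fracs_def)
    then show ?thesis using mp_I_iff[OF h(1)] by simp
  qed
  ultimately show ?thesis unfolding fracs_def by blast
qed

text \<open>One inclusion is a direct computation valid for every element of the group; applied to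
  the inverse element it yields the other.\<close>

lemma act_frac_class:
  assumes g: "g \<in> G" and ab: "(a, b) \<in> fracs I"
  shows "act_frac g (frac_class I a b) = frac_class I (mp g a) (mp g b)"
proof -
  have sub: "act_frac g (frac_class I a b) \<subseteq> frac_class I (mp g a) (mp g b)" if g: "g \<in> G" for g a b
  proof -
    have "(mp g c, mp g d) \<in> frac_class I (mp g a) (mp g b)" if "(c, d) \<in> frac_class I a b" for c d
      using that mp_fracs[OF g] mp_I[OF g, of "a * d - c * b"]
      by (simp add: frac_class_def rhom_diff[OF rhom_mp[OF g]] rhom_mult[OF rhom_mp[OF g]])
    then show ?thesis by (auto simp: act_frac_def)
  qed
  obtain h where h: "h \<in> G" "\<And>p. mp g (mp h p) = p" "\<And>p. mp h (mp g p) = p" using mp_inv[OF g] by metis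
  have "(c, d) \<in> act_frac g (frac_class I a b)" if "(c, d) \<in> frac_class I (mp g a) (mp g b)" for c d
  proof -
    have "(mp h c, mp h d) \<in> act_frac h (frac_class I (mp g a) (mp g b))"
      using that by (force simp: act_frac_def)
    then have "(mp h c, mp h d) \<in> frac_class I a b" using sub[OF h(1), of "mp g a" "mp g b"] by (auto simp: h)
    then have "(mp g (mp h c), mp g (mp h d)) \<in> act_frac g (frac_class I a b)" by (force simp: act_frac_def)
    then show ?thesis by (simp add: h)
  qed
  then have "frac_class I (mp g a) (mp g b) \<subseteq> act_frac g (frac_class I a b)" by (rule subrelI)
  then show ?thesis by (rule subset_antisym[OF sub[OF g]])
qed

lemma act_frac_K:
  assumes g: "g \<in> G"
  shows "u \<in> carrier K \<Longrightarrow> act_frac g u \<in> carrier K"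
    and "u \<in> carrier K \<Longrightarrow> v \<in> carrier K \<Longrightarrow> act_frac g (u \<otimes>\<^bsub>K\<^esub> v) = act_frac g u \<otimes>\<^bsub>K\<^esub> act_frac g v"
    and "act_frac g \<one>\<^bsub>K\<^esub> = \<one>\<^bsub>K\<^esub>"
proof -
  show "act_frac g u \<in> carrier K" if u: "u \<in> carrier K" for u
  proof -
    obtain a b where "(a, b) \<in> fracs I" "u = frac_class I a b" using u unfolding carrier_K by blast
    then show ?thesis using act_frac_class[OF g] mp_fracs[OF g] unfolding carrier_K by metis
  qed
  show "act_frac g (u \<otimes>\<^bsub>K\<^esub> v) = act_frac g u \<otimes>\<^bsub>K\<^esub> act_frac g v" if uv: "u \<in> carrier K" "v \<in> carrier K"
  proof -
    obtain a b c d where "(a, b) \<in> fracs I" "(c, d) \<in> fracs I" "u = frac_class I a b" "v = frac_class I c d"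
      using uv unfolding carrier_K by blast
    then show ?thesis
      by (simp add: mult_K act_frac_class[OF g] mp_fracs[OF g] fracs_mult rhom_mult[OF rhom_mp[OF g]])
  qed
  show "act_frac g \<one>\<^bsub>K\<^esub> = \<one>\<^bsub>K\<^esub>"
    by (simp add: one_K act_frac_class[OF g fracs_one] rhom_one[OF rhom_mp[OF g]])
qed

lemma act_frac_comp:
  fixes u :: "(('n, 'a) mpoly \<times> ('n, 'a) mpoly) set"
  shows "g \<in> G \<Longrightarrow> h \<in> G \<Longrightarrow> act_frac (g \<circ> h) u = act_frac g (act_frac h u)"
  by (simp add: act_frac_def image_image map_prod_def mp_comp case_prod_beta)

lemma act_frac_discrete:
  assumes "u \<in> carrier K"
  shows "\<exists>F. finite F \<and> (\<forall>g\<in>G. \<forall>h\<in>G. (\<forall>y\<in>F. g y = h y) \<longrightarrow> act_frac g u = act_frac h u)"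
proof -
  obtain a b where ab: "(a, b) \<in> fracs I" "u = frac_class I a b" using assms unfolding carrier_K by blast
  \<comment> \<open>The coefficients of one representative suffice, because the action on a class is
    determined by any single member.\<close>
  let ?F = "Poly_Mapping.lookup a ` Poly_Mapping.keys a \<union> Poly_Mapping.lookup b ` Poly_Mapping.keys b"
  have "act_frac g u = act_frac h u" if gh: "g \<in> G" "h \<in> G" "\<forall>y\<in>?F. g y = h y" for g h
  proof -
    have "mp g a = mp h a" "mp g b = mp h b"
      using gh by (auto intro!: map_cong_coeffs rhom_zero[OF gal_rhom])
    then show ?thesis using ab gh by (simp add: act_frac_class)
  qed
  moreover have "finite ?F" by simp
  ultimately show ?thesis by blast
qed

lemma act_frac_Units:
  assumes g: "g \<in> G" and u: "u \<in> Units K"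
  shows "act_frac g u \<in> Units K" "inv\<^bsub>K\<^esub> (act_frac g u) = act_frac g (inv\<^bsub>K\<^esub> u)"
proof -
  have c: "u \<in> carrier K" "inv\<^bsub>K\<^esub> u \<in> carrier K" using u by auto
  have e: "act_frac g u \<otimes>\<^bsub>K\<^esub> act_frac g (inv\<^bsub>K\<^esub> u) = \<one>\<^bsub>K\<^esub>" "act_frac g (inv\<^bsub>K\<^esub> u) \<otimes>\<^bsub>K\<^esub> act_frac g u = \<one>\<^bsub>K\<^esub>"
    using act_frac_K(2)[OF g c] act_frac_K(2)[OF g c(2,1)] act_frac_K(3)[OF g] u by simp_all
  show "act_frac g u \<in> Units K"
    unfolding Units_def using act_frac_K(1)[OF g] c e by blast
  show "inv\<^bsub>K\<^esub> (act_frac g u) = act_frac g (inv\<^bsub>K\<^esub> u)"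
    using act_frac_K(1)[OF g] c e by (intro K.inv_char) auto
qed

lemma units_galois_module: "galois_module G (function_field_units_module I)"
proof (intro galois_module.intro galois_module_axioms.intro)
  show "comm_group (grp (function_field_units_module I))"
    using UK.comm_group_axioms by (simp add: function_field_units_module_def)
  show "g \<circ> h \<in> G" if "g \<in> G" "h \<in> G" for g h using that by (rule gal_comp)
  show "act (function_field_units_module I) g \<in> hom (grp (function_field_units_module I)) (grp (function_field_units_module I))"
    if g: "g \<in> G" for g
    using act_frac_Units(1)[OF g] act_frac_K(2)[OF g]
    by (intro homI) (simp_all add: function_field_units_module_def K.Units_closed)
  show "act (function_field_units_module I) (g \<circ> h) x = act (function_field_units_module I) g (act (function_field_units_module I) h x)"
    if "g \<in> G" "h \<in> G" for g h x
    using that by (simp add: function_field_units_module_def act_frac_comp)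
  fix x assume "x \<in> carrier (grp (function_field_units_module I))"
  then have "x \<in> carrier K" by (simp add: function_field_units_module_def K.Units_closed)
  then obtain F where "finite F" "\<forall>g\<in>G. \<forall>h\<in>G. (\<forall>y\<in>F. g y = h y) \<longrightarrow> act_frac g x = act_frac h x"
    using act_frac_discrete by blast
  then show "\<exists>F. finite F \<and> (\<forall>g\<in>G. \<forall>h\<in>G. (\<forall>y\<in>F. g y = h y) \<longrightarrow>
      act (function_field_units_module I) g x = act (function_field_units_module I) h x)"
    by (simp only: function_field_units_module_def gmodule.simps) blast
qed

lemma vimage_PP:
  assumes g: "g \<in> G" and x: "x \<in> PP"
  shows "mp g -` x \<in> PP"
proof -
  obtain h where h: "h \<in> G" "\<And>p. mp g (mp h p) = p" "\<And>p. mp h (mp g p) = p" using mp_inv[OF g] by metis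
  note gr = rhom_mp[OF g]
  obtain i where i: "mvar i \<notin> x" using x by (auto simp: proj_points_def)
  have x': "ideal x rng" "I \<subseteq> x" "x = Idl\<^bsub>rng\<^esub> {f \<in> x. \<exists>d. homog d f}"
    using x by (auto simp: proj_points_def homog_ideal_def)
  have id: "ideal (mp g -` x) rng" by (rule ideal_vimage[OF gr x'(1)])
  then have "primeideal (mp g -` x) rng"
    using PP_prime[OF x] by (simp add: primeideal_rng_iff rhom_one[OF gr] rhom_mult[OF gr])
  moreover have "I \<subseteq> mp g -` x" using x'(2) mp_I[OF g] by auto
  moreover have "mp g -` x \<subseteq> Idl\<^bsub>rng\<^esub> {f \<in> mp g -` x. \<exists>d. homog d f}"
  proof
    fix f assume "f \<in> mp g -` x"
    then have f: "mp g f \<in> Idl\<^bsub>rng\<^esub> {f \<in> x. \<exists>d. homog d f}" using x'(3) by simp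
    \<comment> \<open>The inverse automorphism carries the homogeneous generators of
      \<open>x\<close> to homogeneous elements of the preimage ideal.\<close>
    have "mp h (mp g f) \<in> Idl\<^bsub>rng\<^esub> {f \<in> mp g -` x. \<exists>d. homog d f}"
    proof (rule rhom_Idl[OF rhom_mp[OF h(1)] Idl_ideal _ f])
      fix s assume "s \<in> {f \<in> x. \<exists>d. homog d f}"
      then show "mp h s \<in> Idl\<^bsub>rng\<^esub> {f \<in> mp g -` x. \<exists>d. homog d f}"
        using mp_homog[OF h(1)] by (intro Idl_self) (auto simp: h)
    qed
    then show "f \<in> Idl\<^bsub>rng\<^esub> {f \<in> mp g -` x. \<exists>d. homog d f}" by (simp add: h)
  qed
  moreover have "Idl\<^bsub>rng\<^esub> {f \<in> mp g -` x. \<exists>d. homog d f} \<subseteq> mp g -` x"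
    by (rule Idl_minimal[OF id]) auto
  moreover have "mvar i \<notin> mp g -` x" using i by (simp add: map_mvar[OF gal_rhom[OF g]])
  ultimately show ?thesis using id by (auto simp: proj_points_def homog_ideal_def)
qed

lemma act_frac_local:
  assumes g: "g \<in> G" and x: "x \<in> PP" and u: "u \<in> carrier (LR (mp g -` x))"
  shows "act_frac g u \<in> carrier (LR x)"
proof -
  obtain a b where "(a, b) \<in> u" "mp g b \<notin> x" "u \<in> carrier K" using u by (auto simp: local_ring_def)
  moreover from this have "(mp g a, mp g b) \<in> act_frac g u" by (force simp: act_frac_def)
  ultimately show ?thesis using act_frac_K(1)[OF g] by (auto simp: local_ring_def)
qed

text \<open>Inclusion holds for every group element and every point; for the inverse element at the
  translated point it gives the reverse inclusion, since translating back returns to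
  \<open>x\<close>.\<close>

lemma act_frac_local_units:
  assumes g: "g \<in> G" and x: "x \<in> PP"
  shows "act_frac g ` Units (LR (mp g -` x)) = Units (LR x)"
proof -
  have sub: "act_frac g u \<in> Units (LR x)" if "g \<in> G" "x \<in> PP" "u \<in> Units (LR (mp g -` x))" for g x u
    using that vimage_PP[OF that(1,2)] act_frac_Units[OF that(1)] act_frac_local[OF that(1,2)]
    by (simp add: Units_local_iff)
  obtain h where h: "h \<in> G" "\<And>p. mp g (mp h p) = p" "\<And>p. mp h (mp g p) = p" using mp_inv[OF g] by metis
  have gh: "act_frac g (act_frac h u) = u" for u :: "(('n, 'a) mpoly \<times> ('n, 'a) mpoly) set"
    by (simp add: act_frac_def image_image map_prod_def case_prod_beta h)
  have "u \<in> act_frac g ` Units (LR (mp g -` x))" if "u \<in> Units (LR x)" for u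
  proof -
    have "mp h -` (mp g -` x) = x" by (auto simp: h)
    then have "act_frac h u \<in> Units (LR (mp g -` x))"
      using sub[OF h(1) vimage_PP[OF g x], of u] that by simp
    then show ?thesis using gh[of u] by (metis imageI)
  qed
  then show ?thesis using sub[OF g x] by blast
qed

lemma act_frac_cs:
  assumes g: "g \<in> G" and x: "x \<in> PP" and u: "u \<in> Units K"
  shows "act_frac g ` cs (mp g -` x) u = cs x (act_frac g u)"
proof -
  have "act_frac g ` cs (mp g -` x) u = (\<lambda>v. act_frac g (v \<otimes>\<^bsub>K\<^esub> u)) ` Units (LR (mp g -` x))"
    by (auto simp: r_coset_def)
  also have "\<dots> = (\<lambda>v. act_frac g v \<otimes>\<^bsub>K\<^esub> act_frac g u) ` Units (LR (mp g -` x))"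
  proof (rule image_cong[OF refl])
    fix v assume "v \<in> Units (LR (mp g -` x))"
    then have "v \<in> carrier K" using Units_local_iff[OF vimage_PP[OF g x]] K.Units_closed by blast
    then show "act_frac g (v \<otimes>\<^bsub>K\<^esub> u) = act_frac g v \<otimes>\<^bsub>K\<^esub> act_frac g u"
      using act_frac_K(2)[OF g] u K.Units_closed by blast
  qed
  also have "\<dots> = (\<lambda>v. v \<otimes>\<^bsub>K\<^esub> act_frac g u) ` (act_frac g ` Units (LR (mp g -` x)))" by (simp add: image_image)
  also have "\<dots> = cs x (act_frac g u)" unfolding act_frac_local_units[OF g x] by (auto simp: r_coset_def)
  finally show ?thesis .
qed

lemma act_div_apply: "x \<in> PP \<Longrightarrow> act_div I g s x = act_frac g ` s (mp g -` x)"
  by (simp add: act_div_def)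

lemma local_data_open:
  assumes "local_data F s" "(h, u) \<in> F" "x \<in> basic_open I h"
  shows "s x = cs x u" "u \<in> Units K"
  using assms by (auto simp: local_data_def)

text \<open>A local equation \<open>u\<close> on the open set of \<open>h\<close> becomes the local
  equation \<open>act_frac g u\<close> on the open set of the translated form. This gives closure of
  the divisors under the action as well as its discreteness.\<close>

lemma act_div_local:
  assumes F: "local_data F s" and hu: "(h, u) \<in> F" and g: "g \<in> G" and x: "x \<in> basic_open I (mp g h)"
  shows "act_div I g s x = cs x (act_frac g u)"
proof -
  have xP: "x \<in> PP" using x by (rule basic_open_PP)
  have "mp g -` x \<in> basic_open I h" using x vimage_PP[OF g xP] by (simp add: basic_open_def)
  then show ?thesis
    using local_data_open[OF F hu] act_frac_cs[OF g xP] by (simp add: act_div_apply[OF xP])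
qed

lemma local_data_act:
  assumes F: "local_data F s" and g: "g \<in> G" and x: "x \<in> PP"
  obtains h u where "(h, u) \<in> F" "x \<in> basic_open I (mp g h)"
proof -
  obtain h u where "(h, u) \<in> F" "mp g -` x \<in> basic_open I h"
    using local_data_memberE[OF F vimage_PP[OF g x]] by metis
  then show ?thesis using that x by (auto simp: basic_open_def)
qed

lemma act_div_closed:
  assumes g: "g \<in> G" and s: "s \<in> carrier DD"
  shows "act_div I g s \<in> carrier DD"
proof -
  obtain F where F: "local_data F s" using s by (auto simp: carrier_DD)
  have "local_data ((\<lambda>(h, u). (mp g h, act_frac g u)) ` F) (act_div I g s)"
  proof (rule local_dataI)
    show "finite ((\<lambda>(h, u). (mp g h, act_frac g u)) ` F)" using F by (simp add: local_data_def)
    show "\<exists>h u. (h, u) \<in> (\<lambda>(h, u). (mp g h, act_frac g u)) ` F \<and> x \<in> basic_open I h" if x: "x \<in> PP" for x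
    proof -
      obtain h u where "(h, u) \<in> F" "x \<in> basic_open I (mp g h)" using local_data_act[OF F g x] by metis
      then show ?thesis by force
    qed
    fix h' u' assume "(h', u') \<in> (\<lambda>(h, u). (mp g h, act_frac g u)) ` F"
    then obtain h u where hu: "(h, u) \<in> F" "h' = mp g h" "u' = act_frac g u" by auto
    then have "\<exists>d. homog d h" "u \<in> Units K" using F by (auto simp: local_data_def)
    then show "(\<exists>d. homog d h') \<and> u' \<in> Units K \<and> (\<forall>y\<in>basic_open I h'. act_div I g s y = cs y u')"
      using hu mp_homog[OF g] act_frac_Units(1)[OF g] act_div_local[OF F hu(1) g] by blast
  qed
  moreover have "act_div I g s \<in> carrier PG"
  proof -
    have "act_div I g s x \<in> carrier (UK Mod Units (LR x))" if x: "x \<in> PP" for x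
    proof -
      obtain u where "u \<in> Units K" "s (mp g -` x) = cs (mp g -` x) u"
        using DD_coset[OF s vimage_PP[OF g x]] by metis
      then show ?thesis
        using act_frac_cs[OF g x] act_frac_Units(1)[OF g] by (simp add: act_div_apply[OF x] carrier_FactGroup)
    qed
    then show ?thesis by (simp add: act_div_def)
  qed
  ultimately show ?thesis using carrier_DD by blast
qed

lemma div_galois_module: "galois_module G (div_module I)"
proof (intro galois_module.intro galois_module_axioms.intro)
  show "comm_group (grp (div_module I))"
    using DD.comm_group_axioms by (simp add: div_module_def)
  show "g \<circ> h \<in> G" if "g \<in> G" "h \<in> G" for g h using that by (rule gal_comp)
  show "act (div_module I) g \<in> hom (grp (div_module I)) (grp (div_module I))" if g: "g \<in> G" for g
  proof (rule homI)
    fix s assume "s \<in> carrier (grp (div_module I))"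
    then have s: "s \<in> carrier DD" by (simp add: div_module_def)
    then show "act (div_module I) g s \<in> carrier (grp (div_module I))"
      using act_div_closed[OF g] by (simp add: div_module_def)
    fix t assume "t \<in> carrier (grp (div_module I))"
    then have t: "t \<in> carrier DD" by (simp add: div_module_def)
    have "act_div I g (s \<otimes>\<^bsub>DD\<^esub> t) = act_div I g s \<otimes>\<^bsub>DD\<^esub> act_div I g t"
    proof (rule DD_eqI)
      fix x assume x: "x \<in> PP"
      note x' = vimage_PP[OF g x]
      obtain u where u: "u \<in> Units K" "s (mp g -` x) = cs (mp g -` x) u" using DD_coset[OF s x'] by metis
      obtain v where v: "v \<in> Units K" "t (mp g -` x) = cs (mp g -` x) v" using DD_coset[OF t x'] by metis
      have "act_div I g (s \<otimes>\<^bsub>DD\<^esub> t) x = cs x (act_frac g (u \<otimes>\<^bsub>K\<^esub> v))"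
        using u v by (simp add: act_div_apply[OF x] DD_mult[OF x'] cs_mult[OF x'] act_frac_cs[OF g x])
      also have "\<dots> = cs x (act_frac g u) <#>\<^bsub>UK\<^esub> cs x (act_frac g v)"
        using u v act_frac_K(2)[OF g] act_frac_Units(1)[OF g] by (simp add: cs_mult[OF x] K.Units_closed)
      also have "\<dots> = (act_div I g s \<otimes>\<^bsub>DD\<^esub> act_div I g t) x"
        using u v by (simp add: act_div_apply[OF x] DD_mult[OF x] act_frac_cs[OF g x])
      finally show "act_div I g (s \<otimes>\<^bsub>DD\<^esub> t) x = (act_div I g s \<otimes>\<^bsub>DD\<^esub> act_div I g t) x" .
    qed (use s t act_div_closed[OF g] in auto)
    then show "act (div_module I) g (s \<otimes>\<^bsub>grp (div_module I)\<^esub> t) =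
        act (div_module I) g s \<otimes>\<^bsub>grp (div_module I)\<^esub> act (div_module I) g t"
      by (simp add: div_module_def)
  qed
  show "act (div_module I) (g \<circ> h) s = act (div_module I) g (act (div_module I) h s)"
    if g: "g \<in> G" "h \<in> G" for g h and s :: "('n, 'a) mpoly set \<Rightarrow> (('n, 'a) mpoly \<times> ('n, 'a) mpoly) set set"
  proof -
    have "act_div I (g \<circ> h) s x = act_div I g (act_div I h s) x" for x
    proof (cases "x \<in> PP")
      case x: True
      have "mp (g \<circ> h) -` x = mp h -` (mp g -` x)" using mp_comp[OF g] by auto
      moreover have "act_frac (g \<circ> h) = (\<lambda>u. act_frac g (act_frac h (u :: (('n, 'a) mpoly \<times> ('n, 'a) mpoly) set)))"
        by (simp add: fun_eq_iff act_frac_comp[OF g])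
      ultimately show ?thesis
        using x vimage_PP[OF g(1) x] by (simp add: act_div_apply image_image)
    qed (simp add: act_div_def)
    then show ?thesis by (simp add: div_module_def fun_eq_iff)
  qed
  fix s assume "s \<in> carrier (grp (div_module I))"
  then have s: "s \<in> carrier DD" by (simp add: div_module_def)
  then obtain F where F: "local_data F s" by (auto simp: carrier_DD)
  have "\<forall>p\<in>F. \<exists>E. finite E \<and> (\<forall>g\<in>G. \<forall>h\<in>G. (\<forall>y\<in>E. g y = h y) \<longrightarrow> act_frac g (snd p) = act_frac h (snd p))"
  proof
    fix p assume "p \<in> F"
    then have "snd p \<in> carrier K" using F K.Units_closed by (auto simp: local_data_def)
    then show "\<exists>E. finite E \<and> (\<forall>g\<in>G. \<forall>h\<in>G. (\<forall>y\<in>E. g y = h y) \<longrightarrow> act_frac g (snd p) = act_frac h (snd p))"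
      by (rule act_frac_discrete)
  qed
  then obtain E where E: "\<And>p. p \<in> F \<Longrightarrow> finite (E p)"
    "\<And>p g h. p \<in> F \<Longrightarrow> g \<in> G \<Longrightarrow> h \<in> G \<Longrightarrow> \<forall>y\<in>E p. g y = h y \<Longrightarrow> act_frac g (snd p) = act_frac h (snd p)"
    by metis
  \<comment> \<open>Controls the forms that define the cover and the local equations on it. Two
    automorphisms that agree on this set move the whole description of \<open>s\<close> in the same
    way.\<close>
  define A where "A = (\<Union>p\<in>F. E p \<union> Poly_Mapping.lookup (fst p) ` Poly_Mapping.keys (fst p))"
  have "finite A" using F E(1) by (auto simp: A_def local_data_def)
  moreover have "act_div I g s = act_div I h s" if g: "g \<in> G" and h: "h \<in> G" and gh: "\<forall>y\<in>A. g y = h y" for g h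
  proof (rule DD_eqI)
    fix x assume x: "x \<in> PP"
    obtain k u where k: "(k, u) \<in> F" "x \<in> basic_open I (mp g k)" using local_data_act[OF F g x] by metis
    have "mp g k = mp h k"
      using gh k(1) by (intro map_cong_coeffs) (force simp: A_def rhom_zero[OF gal_rhom[OF g]] rhom_zero[OF gal_rhom[OF h]])+
    moreover have "act_frac g u = act_frac h u"
      using E(2)[OF k(1) g h] gh k(1) by (force simp: A_def)
    ultimately show "act_div I g s x = act_div I h s x"
      using act_div_local[OF F k(1) g] act_div_local[OF F k(1) h] k(2) by simp
  qed (use act_div_closed s g h in auto)
  ultimately show "\<exists>A. finite A \<and> (\<forall>g\<in>G. \<forall>h\<in>G. (\<forall>y\<in>A. g y = h y) \<longrightarrow> act (div_module I) g s = act (div_module I) h s)"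
    by (simp only: div_module_def gmodule.simps) blast
qed

lemma act_div_div_map:
  assumes g: "g \<in> G" and u: "u \<in> Units K"
  shows "act_div I g (div_map I u) = div_map I (act_frac g u)"
proof (rule DD_eqI)
  fix x assume x: "x \<in> PP"
  show "act_div I g (div_map I u) x = div_map I (act_frac g u) x"
    using act_frac_cs[OF g x u] by (simp add: act_div_apply[OF x] div_map_apply[OF x] div_map_apply[OF vimage_PP[OF g x]])
qed (use act_div_closed[OF g] div_map_closed u act_frac_Units(1)[OF g] in auto)

lemma act_div_principal:
  assumes g: "g \<in> G" shows "act_div I g ` principal_divisors I = principal_divisors I"
proof -
  obtain h where h: "h \<in> G" "\<And>p. mp g (mp h p) = p" "\<And>p. mp h (mp g p) = p" using mp_inv[OF g] by metis
  have gh: "act_frac g (act_frac h u) = u" for u :: "(('n, 'a) mpoly \<times> ('n, 'a) mpoly) set"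
    by (simp add: act_frac_def image_image map_prod_def case_prod_beta h)
  have "act_frac g ` Units K = Units K"
    using act_frac_Units(1)[OF g] act_frac_Units(1)[OF h(1)] gh by (metis image_subsetI subsetI subset_antisym imageI)
  then show ?thesis
    unfolding principal_divisors_def image_image using act_div_div_map[OF g]
    by (metis (no_types, lifting) image_cong image_image)
qed

lemma pic_galois: "galois_module G (pic_module I)" "module_hom G (div_module I) (pic_module I) (pic_map I)"
proof -
  have "pic_module I = \<lparr>grp = grp (div_module I) Mod principal_divisors I, act = (\<lambda>g. image (act (div_module I) g))\<rparr>"
    by (simp add: pic_module_def div_module_def)
  moreover have "subgroup (principal_divisors I) (grp (div_module I))"
    using principal_subgroup by (simp add: div_module_def)
  moreover have "act (div_module I) g ` principal_divisors I = principal_divisors I" if "g \<in> G" for g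
    using act_div_principal[OF that] by (simp add: div_module_def)
  moreover have "pic_map I s = principal_divisors I #>\<^bsub>grp (div_module I)\<^esub> s" for s
    by (simp add: pic_map_def div_module_def)
  ultimately show "galois_module G (pic_module I)" "module_hom G (div_module I) (pic_module I) (pic_map I)"
    using quotient_module[OF div_galois_module] by metis+
qed

lemma div_map_module_hom: "module_hom G (function_field_units_module I) (div_module I) (div_map I)"
proof (intro module_hom.intro module_hom_axioms.intro units_galois_module div_galois_module)
  show "div_map I \<in> hom (grp (function_field_units_module I)) (grp (div_module I))"
    using div_map_hom by (simp add: function_field_units_module_def div_module_def)
qed (simp add: function_field_units_module_def div_module_def act_div_div_map)

lemma act_frac_regular:
  assumes "g \<in> G" "u \<in> Units Rg" shows "act_frac g u \<in> Units Rg"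
proof -
  have u: "u \<in> Units K" "\<And>x. x \<in> PP \<Longrightarrow> u \<in> Units (LR x)" using assms(2) by (auto simp: Units_regular_iff)
  have "act_frac g u \<in> Units (LR x)" if "x \<in> PP" for x
    using act_frac_local_units[OF assms(1) that] u(2)[OF vimage_PP[OF assms(1) that]] by blast
  then show ?thesis using act_frac_Units(1)[OF assms(1) u(1)] by (simp add: Units_regular_iff)
qed

lemma regular_galois_module: "galois_module G (regular_units_module I)"
proof -
  have "regular_units_module I = \<lparr>grp = (grp (function_field_units_module I))\<lparr>carrier := Units Rg\<rparr>,
      act = act (function_field_units_module I)\<rparr>"
    by (simp add: regular_units_module_def function_field_units_module_def regular_units_eq)
  moreover have "subgroup (Units Rg) (grp (function_field_units_module I))"
    using regular_units_subgroup by (simp add: function_field_units_module_def)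
  ultimately show ?thesis
    using submodule[OF units_galois_module, of "Units Rg"] act_frac_regular
    by (simp add: function_field_units_module_def)
qed

lemma inclusion_module_hom: "module_hom G (regular_units_module I) (function_field_units_module I) (\<lambda>u. u)"
proof (intro module_hom.intro module_hom_axioms.intro units_galois_module regular_galois_module)
  show "(\<lambda>u. u) \<in> hom (grp (regular_units_module I)) (grp (function_field_units_module I))"
    by (rule homI) (simp_all add: regular_units_module_def function_field_units_module_def regular_units_eq Units_regular_iff)
qed (simp add: regular_units_module_def function_field_units_module_def)

end

section \<open>Amitsur groups\<close>

text \<open>Discreteness is proved along \<open>tensor_induct\<close>: an elementary tensor is
  controlled by the finite sets of its two factors, a quotient by the union of those of its terms,
  and the neutral element by the empty set.\<close>

lemma tensor_galois_module:
  assumes "galois_module G M" "galois_module G N"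
  shows "galois_module G (tensor_module M N)"
proof -
  interpret M: galois_module G M by fact
  interpret N: galois_module G N by fact
  interpret T: tensor_groups "grp M" "grp N"
    using M.comm_group_axioms N.comm_group_axioms by (simp add: tensor_groups_def)
  note tm = tensor_map_hom[OF M.comm_group_axioms N.comm_group_axioms M.comm_group_axioms N.comm_group_axioms M.act_hom N.act_hom]
  note tp = tensor_map_pure[OF M.comm_group_axioms N.comm_group_axioms M.comm_group_axioms N.comm_group_axioms M.act_hom N.act_hom]
  have s [simp]: "grp (tensor_module M N) = tensor (grp M) (grp N)"
    "act (tensor_module M N) g = tensor_map (grp M) (grp N) (act M g) (act N g)" for g
    by (simp_all add: tensor_module_def)
  show ?thesis
  proof (intro galois_module.intro galois_module_axioms.intro)
    show "comm_group (grp (tensor_module M N))" using T.T.comm_group_axioms by simp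
    show "g \<circ> h \<in> G" if "g \<in> G" "h \<in> G" for g h using that by (rule M.G_comp)
    show "act (tensor_module M N) g \<in> hom (grp (tensor_module M N)) (grp (tensor_module M N))" if "g \<in> G" for g
      using tm[OF that that] by simp
    show "act (tensor_module M N) (g \<circ> h) x = act (tensor_module M N) g (act (tensor_module M N) h x)"
      if g: "g \<in> G" "h \<in> G" and x: "x \<in> carrier (grp (tensor_module M N))" for g h x
    proof (rule T.tensor_hom_eqI[OF x[unfolded s] _ _ T.T.is_group])
      show "act (tensor_module M N) (g \<circ> h) \<in> hom (tensor (grp M) (grp N)) (tensor (grp M) (grp N))"
        using tm[OF M.G_comp[OF g] M.G_comp[OF g]] by simp
      show "(\<lambda>x. act (tensor_module M N) g (act (tensor_module M N) h x)) \<in> hom (tensor (grp M) (grp N)) (tensor (grp M) (grp N))"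
        using hom_compose[OF tm[OF g(2) g(2)] tm[OF g(1) g(1)]] by (simp add: comp_def)
      fix a b assume a: "a \<in> carrier (grp M)" and b: "b \<in> carrier (grp N)"
      note gh = M.G_comp[OF g]
      show "act (tensor_module M N) (g \<circ> h) (pure (grp M) (grp N) a b) =
          act (tensor_module M N) g (act (tensor_module M N) h (pure (grp M) (grp N) a b))"
        unfolding s tp[OF gh gh a b] tp[OF g(2,2) a b]
          tp[OF g(1,1) M.act_closed[OF g(2) a] N.act_closed[OF g(2) b]]
          M.act_comp[OF g a] N.act_comp[OF g b] ..
    qed
    show "\<exists>F. finite F \<and> (\<forall>g\<in>G. \<forall>h\<in>G. (\<forall>y\<in>F. g y = h y) \<longrightarrow> act (tensor_module M N) g x = act (tensor_module M N) h x)"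
      if "x \<in> carrier (grp (tensor_module M N))" for x
    proof -
      have "x \<in> carrier (tensor (grp M) (grp N))" using that by simp
      then have "\<exists>F. finite F \<and> (\<forall>g\<in>G. \<forall>h\<in>G. (\<forall>y\<in>F. g y = h y) \<longrightarrow>
          tensor_map (grp M) (grp N) (act M g) (act N g) x = tensor_map (grp M) (grp N) (act M h) (act N h) x)"
      proof (induction rule: T.tensor_induct)
        case one
        then show ?case using hom_one[OF tm T.T.is_group T.T.is_group] by (intro exI[of _ "{}"]) simp
      next
        case (pure a b)
        obtain E where E: "finite E" "\<And>g h. g \<in> G \<Longrightarrow> h \<in> G \<Longrightarrow> \<forall>y\<in>E. g y = h y \<Longrightarrow> act M g a = act M h a"
          using M.act_discrete[OF pure(1)] by metis
        obtain F where F: "finite F" "\<And>g h. g \<in> G \<Longrightarrow> h \<in> G \<Longrightarrow> \<forall>y\<in>F. g y = h y \<Longrightarrow> act N g b = act N h b"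
          using N.act_discrete[OF pure(2)] by metis
        have "tensor_map (grp M) (grp N) (act M g) (act N g) (pure (grp M) (grp N) a b)
            = tensor_map (grp M) (grp N) (act M h) (act N h) (pure (grp M) (grp N) a b)"
          if "g \<in> G" "h \<in> G" "\<forall>y\<in>E \<union> F. g y = h y" for g h
          using that E(2)[of g h] F(2)[of g h] pure by (simp add: tp)
        then show ?case using E(1) F(1) by (intro exI[of _ "E \<union> F"]) blast
      next
        case (diff s t)
        obtain E where E: "finite E" "\<And>g h. g \<in> G \<Longrightarrow> h \<in> G \<Longrightarrow> \<forall>y\<in>E. g y = h y \<Longrightarrow>
            tensor_map (grp M) (grp N) (act M g) (act N g) s = tensor_map (grp M) (grp N) (act M h) (act N h) s"
          using diff.IH(1) by metis
        obtain F where F: "finite F" "\<And>g h. g \<in> G \<Longrightarrow> h \<in> G \<Longrightarrow> \<forall>y\<in>F. g y = h y \<Longrightarrow>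
            tensor_map (grp M) (grp N) (act M g) (act N g) t = tensor_map (grp M) (grp N) (act M h) (act N h) t"
          using diff.IH(2) by metis
        let ?d = "s \<otimes>\<^bsub>tensor (grp M) (grp N)\<^esub> inv\<^bsub>tensor (grp M) (grp N)\<^esub> t"
        have d: "tensor_map (grp M) (grp N) (act M g) (act N g) ?d =
          tensor_map (grp M) (grp N) (act M g) (act N g) s \<otimes>\<^bsub>tensor (grp M) (grp N)\<^esub>
            inv\<^bsub>tensor (grp M) (grp N)\<^esub> tensor_map (grp M) (grp N) (act M g) (act N g) t" if "g \<in> G" for g
          using diff.hyps hom_mult[OF tm[OF that that]] hom_inv_image[OF tm[OF that that] T.T.is_group T.T.is_group] by simp
        have "tensor_map (grp M) (grp N) (act M g) (act N g) ?d = tensor_map (grp M) (grp N) (act M h) (act N h) ?d"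
          if "g \<in> G" "h \<in> G" "\<forall>y\<in>E \<union> F. g y = h y" for g h
          using that E(2)[of g h] F(2)[of g h] d[of g] d[of h] by simp
        then show ?case using E(1) F(1) by (intro exI[of _ "E \<union> F"]) blast
      qed
      then show ?thesis by simp
    qed
  qed
qed

lemma tensor_module_hom:
  assumes "module_hom G A B f" "galois_module G L"
  shows "module_hom G (tensor_module A L) (tensor_module B L) (tensor_map (grp B) (grp L) f (\<lambda>l. l))"
proof -
  interpret f: module_hom G A B f by fact
  interpret L: galois_module G L by fact
  note cg = f.A.comm_group_axioms f.B.comm_group_axioms L.comm_group_axioms
  note h = tensor_map_hom[OF cg(1,3,2,3) f.hom hom_id]
  interpret A: tensor_groups "grp A" "grp L" using cg by (simp add: tensor_groups_def)
  interpret B: tensor_groups "grp B" "grp L" using cg by (simp add: tensor_groups_def)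
  show ?thesis
  proof (intro module_hom.intro module_hom_axioms.intro tensor_galois_module f.A.galois_module_axioms f.B.galois_module_axioms assms(2))
    show "tensor_map (grp B) (grp L) f (\<lambda>l. l) \<in> hom (grp (tensor_module A L)) (grp (tensor_module B L))"
      using h by (simp add: tensor_module_def)
    fix g x assume g: "g \<in> G" and "x \<in> carrier (grp (tensor_module A L))"
    then have x: "x \<in> carrier (tensor (grp A) (grp L))" by (simp add: tensor_module_def)
    note a = tensor_map_hom[OF cg(1,3,1,3) f.A.act_hom[OF g] L.act_hom[OF g]]
    note b = tensor_map_hom[OF cg(2,3,2,3) f.B.act_hom[OF g] L.act_hom[OF g]]
    note ap = tensor_map_pure[OF cg(1,3,1,3) f.A.act_hom[OF g] L.act_hom[OF g]]
    note bp = tensor_map_pure[OF cg(2,3,2,3) f.B.act_hom[OF g] L.act_hom[OF g]]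
    have "tensor_map (grp B) (grp L) f (\<lambda>l. l) (tensor_map (grp A) (grp L) (act A g) (act L g) x) =
        tensor_map (grp B) (grp L) (act B g) (act L g) (tensor_map (grp B) (grp L) f (\<lambda>l. l) x)"
    proof (rule A.tensor_hom_eqI[OF x _ _ B.T.is_group])
      show "(\<lambda>x. tensor_map (grp B) (grp L) f (\<lambda>l. l) (tensor_map (grp A) (grp L) (act A g) (act L g) x)) \<in> hom (tensor (grp A) (grp L)) (tensor (grp B) (grp L))"
        using hom_compose[OF a h] by (simp add: comp_def)
      show "(\<lambda>x. tensor_map (grp B) (grp L) (act B g) (act L g) (tensor_map (grp B) (grp L) f (\<lambda>l. l) x)) \<in> hom (tensor (grp A) (grp L)) (tensor (grp B) (grp L))"
        using hom_compose[OF h b] by (simp add: comp_def)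
    qed (use g in \<open>simp add: ap bp tensor_map_pure[OF cg(1,3,2,3) f.hom hom_id] f.equivariant\<close>)
    then show "tensor_map (grp B) (grp L) f (\<lambda>l. l) (act (tensor_module A L) g x) =
        act (tensor_module B L) g (tensor_map (grp B) (grp L) f (\<lambda>l. l) x)"
      by (simp add: tensor_module_def)
  qed
qed

lemma tensor_map_comp_trivial:
  assumes "comm_group A" "comm_group B" "comm_group D" "comm_group L" "f \<in> hom A B" "h \<in> hom B D"
    and "\<And>a. a \<in> carrier A \<Longrightarrow> h (f a) = \<one>\<^bsub>D\<^esub>" "x \<in> carrier (tensor A L)"
  shows "tensor_map D L h (\<lambda>l. l) (tensor_map B L f (\<lambda>l. l) x) = \<one>\<^bsub>tensor D L\<^esub>"
proof -
  interpret A: tensor_groups A L using assms by (simp add: tensor_groups_def)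
  interpret D: tensor_groups D L using assms by (simp add: tensor_groups_def)
  show ?thesis
  proof (rule A.tensor_hom_eqI[OF assms(8) _ hom_const_one D.T.is_group, OF _ D.T.is_group])
    show "(\<lambda>x. tensor_map D L h (\<lambda>l. l) (tensor_map B L f (\<lambda>l. l) x)) \<in> hom (tensor A L) (tensor D L)"
      using hom_compose[OF tensor_map_hom[OF assms(1,4,2,4,5) hom_id] tensor_map_hom[OF assms(2,4,3,4,6) hom_id]]
      by (simp add: comp_def)
    show "tensor_map D L h (\<lambda>l. l) (tensor_map B L f (\<lambda>l. l) (pure A L a b)) = \<one>\<^bsub>tensor D L\<^esub>"
      if "a \<in> carrier A" "b \<in> carrier L" for a b
      using that hom_in_carrier[OF assms(5)] hom_one[OF D.pure_hom_left[OF that(2)] D.A.is_group D.T.is_group]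
      by (simp add: tensor_map_pure[OF assms(1,4,2,4,5) hom_id] tensor_map_pure[OF assms(2,4,3,4,6) hom_id] assms(7))
  qed
qed

text \<open>Flatness of the lattice, expressed by dual bases. It yields the tensored sequence of a
  torus from the Picard sequence.\<close>

lemma tensor_four_term:
  assumes "four_term G A B D P f h k" "galois_module G L" "dual_bases (grp L) I e \<kappa>"
  shows "four_term G (tensor_module A L) (tensor_module B L) (tensor_module D L) (tensor_module P L)
    (tensor_map (grp B) (grp L) f (\<lambda>l. l)) (tensor_map (grp D) (grp L) h (\<lambda>l. l)) (tensor_map (grp P) (grp L) k (\<lambda>l. l))"
proof -
  interpret four_term G A B D P f h k by fact
  interpret L: galois_module G L by fact
  note cg = f.A.comm_group_axioms f.B.comm_group_axioms g.B.comm_group_axioms k.B.comm_group_axioms L.comm_group_axioms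
  have s: "grp (tensor_module M L) = tensor (grp M) (grp L)" for M :: "('a \<Rightarrow> 'a, 'x) gmodule" by (simp add: tensor_module_def)
  interpret F: module_hom G "tensor_module A L" "tensor_module B L" "tensor_map (grp B) (grp L) f (\<lambda>l. l)"
    by (rule tensor_module_hom[OF f.module_hom_axioms assms(2)])
  interpret H: module_hom G "tensor_module B L" "tensor_module D L" "tensor_map (grp D) (grp L) h (\<lambda>l. l)"
    by (rule tensor_module_hom[OF g.module_hom_axioms assms(2)])
  interpret K: module_hom G "tensor_module D L" "tensor_module P L" "tensor_map (grp P) (grp L) k (\<lambda>l. l)"
    by (rule tensor_module_hom[OF k.module_hom_axioms assms(2)])
  show ?thesis
  proof unfold_locales
    show "inj_on (tensor_map (grp B) (grp L) f (\<lambda>l. l)) (carrier (grp (tensor_module A L)))"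
      unfolding s by (rule tensor_map_left_inj[OF cg(1) cg(5) assms(3) cg(2) f.hom inj])
    show "tensor_map (grp D) (grp L) h (\<lambda>l. l) x = \<one>\<^bsub>grp (tensor_module D L)\<^esub> \<longleftrightarrow>
        x \<in> tensor_map (grp B) (grp L) f (\<lambda>l. l) ` carrier (grp (tensor_module A L))"
      if "x \<in> carrier (grp (tensor_module B L))" for x
      using tensor_map_left_exact[OF cg(2) cg(5) assms(3) cg(3) g.hom cg(1) f.hom, of x] that exact_B
        tensor_map_comp_trivial[OF cg(1,2,3,5) f.hom g.hom]
      unfolding s by auto
    show "tensor_map (grp P) (grp L) k (\<lambda>l. l) y = \<one>\<^bsub>grp (tensor_module P L)\<^esub> \<longleftrightarrow>
        y \<in> tensor_map (grp D) (grp L) h (\<lambda>l. l) ` carrier (grp (tensor_module B L))"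
      if "y \<in> carrier (grp (tensor_module D L))" for y
      using tensor_map_left_exact[OF cg(3) cg(5) assms(3) cg(4) k.hom cg(2) g.hom, of y] that exact_D
        tensor_map_comp_trivial[OF cg(2,3,4,5) g.hom k.hom]
      unfolding s by auto
    show "tensor_map (grp P) (grp L) k (\<lambda>l. l) ` carrier (grp (tensor_module D L)) = carrier (grp (tensor_module P L))"
      using tensor_map_surj[OF cg(3,4,5) k.hom surj] K.closed unfolding s by blast
  qed
qed

lemma tensor_map_id:
  assumes "comm_group A" "comm_group L" "x \<in> carrier (tensor A L)"
  shows "tensor_map A L (\<lambda>a. a) (\<lambda>l. l) x = x"
proof -
  interpret tensor_groups A L using assms by (simp add: tensor_groups_def)
  show ?thesis
    by (rule tensor_hom_eqI[OF assms(3) tensor_map_hom[OF assms(1,2,1,2) hom_id hom_id] hom_id T.is_group])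
       (simp add: tensor_map_pure[OF assms(1,2,1,2) hom_id hom_id])
qed

section \<open>The Picard sequence as a sequence of Galois modules\<close>

context galois_fraction_ideal
begin

lemma picard_four_term:
  "four_term G (regular_units_module I) (function_field_units_module I) (div_module I) (pic_module I)
    (\<lambda>u. u) (div_map I) (pic_map I)"
proof -
  interpret f: module_hom G "regular_units_module I" "function_field_units_module I" "\<lambda>u. u"
    by (rule inclusion_module_hom)
  interpret g: module_hom G "function_field_units_module I" "div_module I" "div_map I"
    by (rule div_map_module_hom)
  interpret k: module_hom G "div_module I" "pic_module I" "pic_map I"
    by (rule pic_galois)
  show ?thesis
  proof unfold_locales
    fix x assume "x \<in> carrier (grp (function_field_units_module I))"
    then show "div_map I x = \<one>\<^bsub>grp (div_module I)\<^esub> \<longleftrightarrow> x \<in> (\<lambda>u. u) ` carrier (grp (regular_units_module I))"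
      using div_map_kernel[of x]
      by (simp add: function_field_units_module_def div_module_def regular_units_module_def regular_units_eq)
  next
    fix s assume "s \<in> carrier (grp (div_module I))"
    then show "pic_map I s = \<one>\<^bsub>grp (pic_module I)\<^esub> \<longleftrightarrow> s \<in> div_map I ` carrier (grp (function_field_units_module I))"
      using pic_map_kernel[of s]
      by (simp add: function_field_units_module_def div_module_def pic_module_def)
  next
    show "pic_map I ` carrier (grp (div_module I)) = carrier (grp (pic_module I))"
      using pic_map_surj by (simp add: div_module_def pic_module_def)
  qed simp
qed

text \<open>The preimage is the translate by the inverse automorphism. \<open>galois_module\<close>
  does not say that the identity acts trivially, so this is computed on divisors, where it rests on
  their being extensional functions.\<close>

lemma act_pic_surj:
  assumes g: "g \<in> G" and q: "q \<in> carrier (grp (pic_module I))"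
  shows "\<exists>p\<in>carrier (grp (pic_module I)). act (pic_module I) g p = q"
proof -
  interpret P: galois_module G "pic_module I" by (rule pic_galois)
  obtain h where h: "h \<in> G" "\<And>x. g (h x) = x" using gal_inv[OF g] by metis
  have id: "g \<circ> h = (\<lambda>x. x)" using h by (simp add: fun_eq_iff)
  have fr: "act_frac (\<lambda>x. x) u = u" for u :: "(('n, 'a) mpoly \<times> ('n, 'a) mpoly) set"
    by (simp add: act_frac_def map_prod_def map_id case_prod_beta)
  have vi: "mp (\<lambda>x. x) -` x = x" for x by (auto simp: map_id)
  have "act_div I (\<lambda>x. x) s = s" if "s \<in> carrier DD" for s
  proof (rule ext)
    fix x
    have "s \<in> extensional PP" using that by (auto simp: carrier_DD PiE_def)
    then show "act_div I (\<lambda>x. x) s x = s x" by (simp add: act_div_def fr vi extensional_def)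
  qed
  moreover have "q \<subseteq> carrier DD"
  proof -
    obtain s where "s \<in> carrier DD" "q = principal_divisors I #>\<^bsub>DD\<^esub> s"
      using q by (auto simp: pic_module_def carrier_FactGroup)
    then show ?thesis using DD.r_coset_subset_G[OF subgroup.subset[OF principal_subgroup]] by simp
  qed
  ultimately have "act (pic_module I) (g \<circ> h) q = q"
    unfolding id pic_module_def by (auto simp: subset_iff image_iff)
  then show ?thesis using P.act_comp[OF g h(1) q] P.act_closed[OF h(1) q] by metis
qed

end

lemma additive_on_one:
  assumes "comm_group P" "additive_on P \<phi>" shows "\<phi> \<one>\<^bsub>P\<^esub> = 0"
proof -
  interpret comm_group P by fact
  have "\<phi> (\<one>\<^bsub>P\<^esub> \<otimes>\<^bsub>P\<^esub> \<one>\<^bsub>P\<^esub>) = \<phi> \<one>\<^bsub>P\<^esub> + \<phi> \<one>\<^bsub>P\<^esub>" using assms(2) unfolding additive_on_def by blast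
  then show ?thesis by simp
qed

lemma additive_on_int_pow:
  assumes "comm_group P" "additive_on P \<phi>" "x \<in> carrier P"
  shows "\<phi> (x [^]\<^bsub>P\<^esub> (n::int)) = n * \<phi> x"
proof -
  interpret comm_group P by fact
  have add: "\<phi> (a \<otimes>\<^bsub>P\<^esub> b) = \<phi> a + \<phi> b" if "a \<in> carrier P" "b \<in> carrier P" for a b
    using assms(2) that by (simp add: additive_on_def)
  have nat: "\<phi> (x [^]\<^bsub>P\<^esub> (k::nat)) = int k * \<phi> x" for k
    by (induction k) (simp_all add: add assms(3) additive_on_one[OF assms(1,2)] algebra_simps)
  show ?thesis
  proof (cases n rule: int_cases2)
    case (nonneg k) then show ?thesis using nat by (simp add: int_pow_int)
  next
    case (nonpos k)
    have "\<phi> (inv\<^bsub>P\<^esub> (x [^]\<^bsub>P\<^esub> k) \<otimes>\<^bsub>P\<^esub> x [^]\<^bsub>P\<^esub> k) = 0"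
      using assms(3) by (simp add: additive_on_one[OF assms(1,2)])
    then show ?thesis
      using nonpos nat[of k] assms(3) add[of "inv\<^bsub>P\<^esub> (x [^]\<^bsub>P\<^esub> k)" "x [^]\<^bsub>P\<^esub> k"]
      by (simp add: int_pow_neg_int additive_on_one[OF assms(1,2)])
  qed
qed

lemma additive_on_finprod:
  assumes "comm_group P" "additive_on P \<phi>" "f \<in> A \<rightarrow> carrier P"
  shows "\<phi> (finprod P f A) = (\<Sum>i\<in>A. \<phi> (f i))"
proof -
  interpret comm_group P by fact
  show ?thesis
    using assms(3)
  proof (induction A rule: infinite_finite_induct)
    case (insert a A)
    then have "\<phi> (f a \<otimes>\<^bsub>P\<^esub> finprod P f A) = \<phi> (f a) + \<phi> (finprod P f A)"
      using assms(2) by (simp add: additive_on_def Pi_iff)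
    then show ?case using insert by (simp add: Pi_iff)
  qed (simp_all add: additive_on_one[OF assms(1,2)])
qed

section \<open>The Neron-Severi torus and the tensor representing the identity\<close>

locale NS_torus = galois_fraction_ideal \<iota> I0 + N: split_torus \<iota> T r \<psi>
  for \<iota> :: "'k::field \<Rightarrow> 'a::field" and I0 :: "('n::finite, 'k) mpoly set"
    and T :: "('l::finite, 'k) affine_group" and r \<psi> +
  fixes j :: "(('n, 'a) mpoly set \<Rightarrow> (('n, 'a) mpoly \<times> ('n, 'a) mpoly) set set) set \<Rightarrow> ('l, 'a) mpoly set"
  assumes j_iso: "j \<in> iso (grp (pic_module I)) N.C"
    and j_act: "g \<in> G \<Longrightarrow> q \<in> carrier (grp (pic_module I)) \<Longrightarrow>
      j (act (pic_module I) g q) = act (char_module N.TT) g (j q)"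
begin

abbreviation "P \<equiv> grp (pic_module I)"
abbreviation "w \<equiv> \<lambda>q. char_pairing (j q)"

sublocale P: galois_module G "pic_module I" by (rule pic_galois)
sublocale L: galois_module G "cochar_module N.TT" by (rule N.cochar_galois_module)
sublocale PL: tensor_groups P N.L
  using P.comm_group_axioms L.comm_group_axioms by (simp add: tensor_groups_def)

lemma j_closed: "q \<in> carrier P \<Longrightarrow> j q \<in> carrier N.C"
  using j_iso by (auto simp: iso_def hom_def)

lemma biadditive_w: "biadditive P N.L w"
proof -
  have "j \<in> hom P N.C" using j_iso by (simp add: iso_def)
  then show ?thesis
    using N.pairing_add_right N.pairing_add_left j_closed by (simp add: biadditive_def hom_mult)
qed

lemma w_invariant:
  "g \<in> G \<Longrightarrow> q \<in> carrier P \<Longrightarrow> x \<in> carrier N.L \<Longrightarrow>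
    w (act (pic_module I) g q) (act (cochar_module N.TT) g x) = w q x"
  by (simp add: j_act N.pairing_invariant j_closed)

text \<open>The divisor classes that correspond under \<open>j\<close> to the coordinate characters;
  they form the basis of the Picard group dual to \<open>N.basis\<close>.\<close>

definition gen where "gen i = inv_into (carrier P) j (N.dual_basis i)"

lemma gen: "i < r \<Longrightarrow> gen i \<in> carrier P" "i < r \<Longrightarrow> j (gen i) = N.dual_basis i"
proof -
  assume "i < r"
  then have "N.dual_basis i \<in> j ` carrier P"
    using N.dual_basis_closed j_iso by (auto simp: iso_def bij_betw_def)
  then show "gen i \<in> carrier P" "j (gen i) = N.dual_basis i"
    by (simp_all add: gen_def inv_into_into f_inv_into_f)
qed

text \<open>Injectivity of \<open>j\<close> moves the claim to characters, which are separated by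
  their pairings with the basis cocharacters; there duality of the two bases leaves a single
  summand.\<close>

lemma gen_expand:
  assumes q: "q \<in> carrier P"
  shows "finprod P (\<lambda>i. gen i [^]\<^bsub>P\<^esub> w q (N.basis i)) {..<r} = q"
proof -
  let ?q = "finprod P (\<lambda>i. gen i [^]\<^bsub>P\<^esub> w q (N.basis i)) {..<r}"
  have q': "?q \<in> carrier P" using gen(1) by (intro P.finprod_closed) auto
  have "j ?q = j q"
  proof (rule N.chars_separated[OF j_closed[OF q'] j_closed[OF q]])
    fix k assume k: "k < r"
    have add: "additive_on P (\<lambda>q. w q (N.basis k))"
      using biadditive_w N.basis_closed by (simp add: biadditive_def additive_on_def)
    have "w ?q (N.basis k) = (\<Sum>i<r. w (gen i [^]\<^bsub>P\<^esub> w q (N.basis i)) (N.basis k))"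
      using gen(1) by (intro additive_on_finprod[OF P.comm_group_axioms add]) auto
    also have "\<dots> = (\<Sum>i<r. w q (N.basis i) * w (gen i) (N.basis k))"
      using gen(1) by (intro sum.cong refl additive_on_int_pow[OF P.comm_group_axioms add]) auto
    also have "\<dots> = (\<Sum>i<r. if i = k then w q (N.basis k) else 0)"
      by (rule sum.cong) (auto simp: gen(2) N.basis_def N.pairing_dual_basis)
    also have "\<dots> = w q (N.basis k)" using k by simp
    finally show "char_pairing (j ?q) (N.basis k) = char_pairing (j q) (N.basis k)" .
  qed
  then show ?thesis using j_iso q q' by (auto simp: iso_def bij_betw_def inj_on_def)
qed

text \<open>The coevaluation element of a lattice tensored with its dual, i.e. the identity
  endomorphism written in dual bases.\<close>

definition ident where "ident = finprod (tensor P N.L) (\<lambda>i. pure P N.L (gen i) (N.basis i)) {..<r}"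

lemma ident_closed: "ident \<in> carrier (tensor P N.L)"
  unfolding ident_def using gen(1) N.basis_closed by (intro PL.T.finprod_closed) auto

lemma ident_contract:
  assumes q: "q \<in> carrier P"
  shows "tcontract P N.L (w q) ident = q"
proof -
  note add = biadditive_additive[OF biadditive_w q]
  have "tcontract P N.L (w q) ident = finprod P (\<lambda>i. tcontract P N.L (w q) (pure P N.L (gen i) (N.basis i))) {..<r}"
    unfolding ident_def using gen(1) N.basis_closed
    by (intro hom_finprod[OF tcontract_hom[OF P.comm_group_axioms L.comm_group_axioms add] PL.T.comm_group_axioms P.comm_group_axioms]) auto
  also have "\<dots> = finprod P (\<lambda>i. gen i [^]\<^bsub>P\<^esub> w q (N.basis i)) {..<r}"
    using gen(1) N.basis_closed
    by (intro P.finprod_cong') (auto simp: tcontract_pure[OF P.comm_group_axioms L.comm_group_axioms add])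
  finally show ?thesis using gen_expand[OF q] by simp
qed

text \<open>Contraction at \<open>gen i\<close> is contraction with the i-th functional of the dual
  bases of the cocharacter lattice, and these functionals together determine a tensor.\<close>

lemma ident_unique:
  assumes "t \<in> carrier (tensor P N.L)" "\<And>q. q \<in> carrier P \<Longrightarrow> tcontract P N.L (w q) t = q"
  shows "t = ident"
proof (rule tensor_eqI[OF P.comm_group_axioms L.comm_group_axioms N.dual_bases_L assms(1) ident_closed])
  fix i assume "i \<in> {..<r}"
  then show "tcontract P N.L (char_pairing (N.dual_basis i)) t = tcontract P N.L (char_pairing (N.dual_basis i)) ident"
    using assms(2)[OF gen(1)] ident_contract[OF gen(1)] gen(2) by simp
qed

lemma tensor_endo_eq:
  assumes "t \<in> carrier (tensor P N.L)" "x \<in> t" "q \<in> carrier P"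
  shows "tensor_endo \<iota> I0 j x q = tcontract P N.L (w q) t"
  using tcontract_class[OF P.comm_group_axioms L.comm_group_axioms biadditive_additive[OF biadditive_w assms(3)] assms(1,2)]
  by (simp add: tensor_endo_def Let_def)

lemma id_pic_eq: "id_pic \<iota> I0 T j = ident"
proof -
  have c: "grp (pic_cochar \<iota> I0 T) = tensor P N.L" by (simp add: pic_cochar_def tensor_module_def)
  show ?thesis
    unfolding id_pic_def c
  proof (rule the_equality)
    show "ident \<in> carrier (tensor P N.L) \<and> (\<forall>x\<in>ident. \<forall>q\<in>carrier P. tensor_endo \<iota> I0 j x q = q)"
      using ident_closed ident_contract by (simp add: tensor_endo_eq)
    fix t assume t: "t \<in> carrier (tensor P N.L) \<and> (\<forall>x\<in>t. \<forall>q\<in>carrier P. tensor_endo \<iota> I0 j x q = q)"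
    interpret F: comm_group "tensor_free P N.L" by (rule abelian_free_Abelian_group)
    \<comment> \<open>The condition in \<open>id_pic\<close> quantifies over the representatives of
      \<open>t\<close>, so a representative must be produced before it says anything.\<close>
    obtain x where "x \<in> carrier (tensor_free P N.L)" "t = tensor_rel P N.L #>\<^bsub>tensor_free P N.L\<^esub> x"
      using PL.tensor_class t by metis
    then have "x \<in> t" using F.rcos_self[OF _ PL.tensor_rel_subgroup] by simp
    then show "t = ident" using t tensor_endo_eq[of t x] by (intro ident_unique) auto
  qed
qed

text \<open>By uniqueness it is enough to contract the moved tensor. With q = g p, invariance of the
  pairing makes the contraction at \<open>q\<close> equal to g applied to the contraction of
  \<open>ident\<close> at \<open>p\<close>, which is g p = q.\<close>

lemma ident_invariant:
  assumes g: "g \<in> G"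
  shows "tensor_map P N.L (act (pic_module I) g) (act (cochar_module N.TT) g) ident = ident"
proof (rule ident_unique)
  note cg = P.comm_group_axioms L.comm_group_axioms
  note a = P.act_hom[OF g] L.act_hom[OF g]
  show "tensor_map P N.L (act (pic_module I) g) (act (cochar_module N.TT) g) ident \<in> carrier (tensor P N.L)"
    by (rule hom_in_carrier[OF tensor_map_hom[OF cg cg a] ident_closed])
  fix q assume "q \<in> carrier P"
  then obtain p where p: "p \<in> carrier P" "act (pic_module I) g p = q" using act_pic_surj[OF g] by blast
  have "tcontract P N.L (w q) (tensor_map P N.L (act (pic_module I) g) (act (cochar_module N.TT) g) ident) =
      act (pic_module I) g (tcontract P N.L (w p) ident)"
    using w_invariant[OF g p(1)] p(2) \<open>q \<in> carrier P\<close>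
    by (intro tcontract_natural[OF cg(1,1,2,2) a biadditive_additive[OF biadditive_w p(1)]
          biadditive_additive[OF biadditive_w] _ ident_closed]) auto
  then show "tcontract P N.L (w q) (tensor_map P N.L (act (pic_module I) g) (act (cochar_module N.TT) g) ident) = q"
    using ident_contract[OF p(1)] p(2) by simp
qed

text \<open>An instance of \<open>torsor_cup\<close>: the first four-term sequence is that of the
  Neron-Severi torus, the second that of \<open>S\<close>, and the products are \<open>tcup\<close>
  with the pairing transported by \<open>j\<close>. Its hypotheses reduce to
  \<open>tcup_natural\<close> and to the properties of \<open>ident\<close>.\<close>

theorem amitsur_trivial:
  assumes obstruction: "universal_torsor_obstruction \<iota> I0 T j = \<one>\<^bsub>cohomology G 2 (regular_points \<iota> I0 T)\<^esub>"
    and S: "split_torus \<iota> S r' \<psi>'"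
  shows "Am \<iota> I0 S (Suc (Suc n)) = {\<one>\<^bsub>cohomology G (Suc (Suc n)) (regular_points \<iota> I0 S)\<^esub>}"
proof -
  interpret S: split_torus \<iota> S r' \<psi>' by (rule S)
  interpret S: galois_module G "cochar_module S.TT" by (rule S.cochar_galois_module)
  let ?U = "regular_units_module I" and ?K = "function_field_units_module I" and ?D = "div_module I" and ?P = "pic_module I"
  let ?N = "cochar_module N.TT" and ?S = "cochar_module S.TT"
  interpret U: four_term G ?U ?K ?D ?P "\<lambda>u. u" "div_map I" "pic_map I" by (rule picard_four_term)
  let ?cB = "tcup (grp ?K) N.L S.L w" and ?cD = "tcup (grp ?D) N.L S.L w"
  note cgK = U.f.B.comm_group_axioms and cgD = U.g.B.comm_group_axioms and cgP = P.comm_group_axioms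
    and cgN = L.comm_group_axioms and cgS = S.comm_group_axioms
  note PN = cgP cgN cgS biadditive_w
  have s: "grp (tensor_module A B) = tensor (grp A) (grp B)" for A :: "('a \<Rightarrow> 'a, 'x) gmodule" and B :: "('a \<Rightarrow> 'a, 'y) gmodule"
    by (simp add: tensor_module_def)
  have a: "act (tensor_module A B) g = tensor_map (grp A) (grp B) (act A g) (act B g)"
    for A :: "('a \<Rightarrow> 'a, 'x) gmodule" and B :: "('a \<Rightarrow> 'a, 'y) gmodule" and g
    by (simp add: tensor_module_def)
  have cup_nat: "tensor_map (grp B) S.L f (\<lambda>l. l) (tcup (grp A) N.L S.L w x p) =
      tcup (grp B) N.L S.L w (tensor_map (grp B) N.L f (\<lambda>l. l) x) p"
    if "module_hom G A B f" "x \<in> carrier (tensor (grp A) N.L)" "p \<in> carrier (tensor P S.L)"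
    for A :: "('a \<Rightarrow> 'a, 'x) gmodule" and B :: "('a \<Rightarrow> 'a, 'y) gmodule" and f x p
  proof -
    interpret f: module_hom G A B f by (rule that(1))
    show ?thesis
      using tcup_natural[OF PN f.A.comm_group_axioms f.B.comm_group_axioms f.hom that(2,3) hom_id hom_id hom_id]
        tensor_map_id[OF cgP cgS that(3)] by simp
  qed
  have cup_act: "act (tensor_module A ?S) g (tcup (grp A) N.L S.L w x p) =
      tcup (grp A) N.L S.L w (act (tensor_module A ?N) g x) (act (tensor_module ?P ?S) g p)"
    if "galois_module G A" "g \<in> G" "x \<in> carrier (tensor (grp A) N.L)" "p \<in> carrier (tensor P S.L)"
    for A :: "('a \<Rightarrow> 'a, 'x) gmodule" and g x p
  proof -
    interpret A: galois_module G A by (rule that(1))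
    show ?thesis
      unfolding a
    proof (rule tcup_natural[where f="act A g" and \<rho>="act ?P g" and \<nu>="act ?N g" and l="act ?S g" and w=w, OF PN])
      show "w (act ?P g q) (act ?N g x) = w q x" if "q \<in> carrier P" "x \<in> carrier N.L" for q x
        by (rule w_invariant[OF \<open>g \<in> G\<close> that])
    qed (use that P.act_hom L.act_hom S.act_hom A.act_hom A.comm_group_axioms in auto)
  qed
  have cup_left: "(\<lambda>x. tcup A N.L S.L w x p) \<in> hom (tensor A N.L) (tensor A S.L)"
    if "comm_group A" "p \<in> carrier (tensor P S.L)" for A :: "'x monoid" and p
    using tcup_closed[OF PN that(1) _ that(2)] tcup_mult_left[OF PN that(1) _ _ that(2)] by (intro homI) auto
  have amitsur: "amitsur_map \<iota> I0 V n = double_connecting G (regular_points \<iota> I0 V) (rational_points \<iota> I0 V)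
      (div_cochar \<iota> I0 V) (pic_cochar \<iota> I0 V)
      (tensor_map (grp ?K) (grp (cochar_module (base_change \<iota> V))) (\<lambda>u. u) (\<lambda>l. l))
      (tensor_map (grp ?D) (grp (cochar_module (base_change \<iota> V))) (div_map I) (\<lambda>l. l))
      (tensor_map P (grp (cochar_module (base_change \<iota> V))) (pic_map I) (\<lambda>l. l)) n"
    for V :: "('v, 'k) affine_group" and n
    by (simp add: amitsur_map_def Let_def)
  note defs = regular_points_def rational_points_def div_cochar_def pic_cochar_def
  interpret torsor_cup G
    "tensor_module ?U ?N" "tensor_module ?K ?N" "tensor_module ?D ?N" "tensor_module ?P ?N"
    "tensor_map (grp ?K) N.L (\<lambda>u. u) (\<lambda>l. l)" "tensor_map (grp ?D) N.L (div_map I) (\<lambda>l. l)" "tensor_map P N.L (pic_map I) (\<lambda>l. l)"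
    "tensor_module ?U ?S" "tensor_module ?K ?S" "tensor_module ?D ?S" "tensor_module ?P ?S"
    "tensor_map (grp ?K) S.L (\<lambda>u. u) (\<lambda>l. l)" "tensor_map (grp ?D) S.L (div_map I) (\<lambda>l. l)" "tensor_map P S.L (pic_map I) (\<lambda>l. l)"
    ?cB ?cD ident
  proof (intro torsor_cup.intro torsor_cup_axioms.intro
      tensor_four_term[OF picard_four_term L.galois_module_axioms N.dual_bases_L]
      tensor_four_term[OF picard_four_term S.galois_module_axioms S.dual_bases_L], unfold s)
    show "?cB b \<in> hom (tensor P S.L) (tensor (grp ?K) S.L)" if "b \<in> carrier (tensor (grp ?K) N.L)" for b
      by (rule tcup_hom_right[OF PN cgK that])
    show "?cD d \<in> hom (tensor P S.L) (tensor (grp ?D) S.L)" if "d \<in> carrier (tensor (grp ?D) N.L)" for d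
      by (rule tcup_hom_right[OF PN cgD that])
    show "(\<lambda>b. ?cB b p) \<in> hom (tensor (grp ?K) N.L) (tensor (grp ?K) S.L)" if "p \<in> carrier (tensor P S.L)" for p
      by (rule cup_left[OF cgK that])
    show "(\<lambda>d. ?cD d p) \<in> hom (tensor (grp ?D) N.L) (tensor (grp ?D) S.L)" if "p \<in> carrier (tensor P S.L)" for p
      by (rule cup_left[OF cgD that])
    show "act (tensor_module ?K ?S) g (?cB b p) = ?cB (act (tensor_module ?K ?N) g b) (act (tensor_module ?P ?S) g p)"
      if "g \<in> G" "b \<in> carrier (tensor (grp ?K) N.L)" "p \<in> carrier (tensor P S.L)" for g b p
      by (rule cup_act[OF U.f.B.galois_module_axioms that])
    show "act (tensor_module ?D ?S) g (?cD d p) = ?cD (act (tensor_module ?D ?N) g d) (act (tensor_module ?P ?S) g p)"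
      if "g \<in> G" "d \<in> carrier (tensor (grp ?D) N.L)" "p \<in> carrier (tensor P S.L)" for g d p
      by (rule cup_act[OF U.g.B.galois_module_axioms that])
    show "tensor_map (grp ?D) S.L (div_map I) (\<lambda>l. l) (?cB b p) = ?cD (tensor_map (grp ?D) N.L (div_map I) (\<lambda>l. l) b) p"
      if "b \<in> carrier (tensor (grp ?K) N.L)" "p \<in> carrier (tensor P S.L)" for b p
      by (rule cup_nat[OF U.g.module_hom_axioms that])
    show "tensor_map P S.L (pic_map I) (\<lambda>l. l) (?cD d p) = p"
      if d: "d \<in> carrier (tensor (grp ?D) N.L)" "tensor_map P N.L (pic_map I) (\<lambda>l. l) d = ident" and p: "p \<in> carrier (tensor P S.L)" for d p
      using cup_nat[OF U.k.module_hom_axioms d(1) p] d(2)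
        tcup_identity[OF PN ident_closed p ident_contract] by simp
    show "ident \<in> carrier (tensor P N.L)" by (rule ident_closed)
    show "act (tensor_module ?P ?N) g ident = ident" if "g \<in> G" for g
      unfolding a by (rule ident_invariant[OF that])
    \<comment> \<open>The neutral element of a factor group is the subgroup itself, so triviality of
      the obstruction becomes equality with \<open>coboundaries\<close>.\<close>
    show "double_connecting G (tensor_module ?U ?N) (tensor_module ?K ?N) (tensor_module ?D ?N) (tensor_module ?P ?N)
        (tensor_map (grp ?K) N.L (\<lambda>u. u) (\<lambda>l. l)) (tensor_map (grp ?D) N.L (div_map I) (\<lambda>l. l)) (tensor_map P N.L (pic_map I) (\<lambda>l. l))
        0 (cls G 0 (tensor_module ?P ?N) (\<lambda>gs\<in>tuples G 0. ident)) = coboundaries G 2 (tensor_module ?U ?N)"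
      using obstruction
      by (simp add: universal_torsor_obstruction_def id_pic_eq amitsur defs cohomology_def del: tuples_0)
  qed
  have trivial: "amitsur_map \<iota> I0 S n (cls G n (pic_cochar \<iota> I0 S) \<xi>) = coboundaries G (Suc (Suc n)) (regular_points \<iota> I0 S)"
    if "\<xi> \<in> cocycles G n (pic_cochar \<iota> I0 S)" for \<xi>
    using double_connecting_trivial[of \<xi> n] that by (simp add: amitsur defs)
  have "carrier (cohomology G n (pic_cochar \<iota> I0 S)) = cls G n (pic_cochar \<iota> I0 S) ` cocycles G n (pic_cochar \<iota> I0 S)"
    using Y.k.B.carrier_cohomology[of n] by (simp add: defs)
  \<comment> \<open>Existence of a cocycle makes the image a singleton instead of the empty
    set.\<close>
  moreover have "cocycles G n (pic_cochar \<iota> I0 S) \<noteq> {}"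
    using Y.k.B.one_cocycle[of n] by (auto simp: defs)
  ultimately have "amitsur_map \<iota> I0 S n ` carrier (cohomology G n (pic_cochar \<iota> I0 S)) =
      {coboundaries G (Suc (Suc n)) (regular_points \<iota> I0 S)}"
    using trivial by (auto simp: image_image)
  then show ?thesis by (simp add: Am_def cohomology_def)
qed

end

theorem theorem9p3:
  fixes \<iota> :: "'k::field \<Rightarrow> 'a::field"
    and I_X :: "('n::finite, 'k) mpoly set"
    and T_NS :: "('l::finite, 'k) affine_group"
    and j :: "(('n, 'a) mpoly set \<Rightarrow> (('n, 'a) mpoly \<times> ('n, 'a) mpoly) set set) set
                \<Rightarrow> ('l, 'a) mpoly set"
    and T :: "('m::finite, 'k) affine_group"
    and n :: nat
  assumes "is_separable_closure \<iota>"
    and "is_projective_scheme I_X"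
    and "is_smooth I_X"
    and "is_geometrically_connected \<iota> I_X"
    and "\<exists>r::nat. grp (pic_module (ext_ideal \<iota> I_X)) \<cong> free_Abelian_group {..<r}"
    and "is_NS_torus \<iota> I_X T_NS j"
    and "universal_torsor_obstruction \<iota> I_X T_NS j
           = \<one>\<^bsub>cohomology (gal \<iota>) 2 (regular_points \<iota> I_X T_NS)\<^esub>"
    and "is_torus \<iota> T"
    and "n \<ge> 2"
  shows "Am \<iota> I_X T n = {\<one>\<^bsub>cohomology (gal \<iota>) n (regular_points \<iota> I_X T)\<^esub>}"
proof -
  have \<iota>: "rhom \<iota>" using assms(1) by (simp add: is_separable_closure_def rhom_ring_hom)
  have NS: "is_torus \<iota> T_NS" "j \<in> iso (grp (pic_module (ext_ideal \<iota> I_X))) (grp (char_module (base_change \<iota> T_NS)))"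
    "\<And>g q. g \<in> gal \<iota> \<Longrightarrow> q \<in> carrier (grp (pic_module (ext_ideal \<iota> I_X))) \<Longrightarrow>
      j (act (pic_module (ext_ideal \<iota> I_X)) g q) = act (char_module (base_change \<iota> T_NS)) g (j q)"
    using assms(6) by (auto simp: is_NS_torus_def Let_def)
  obtain r \<psi> where N: "split_torus \<iota> T_NS r \<psi>" using torus_split[OF NS(1) \<iota>] by metis
  obtain r' \<psi>' where S: "split_torus \<iota> T r' \<psi>'" using torus_split[OF assms(8) \<iota>] by metis
  have "NS_torus \<iota> I_X T_NS r \<psi> j"
    by (intro NS_torus.intro NS_torus_axioms.intro galois_fraction_ideal.intro \<iota> N NS)
  \<comment> \<open>Since n is at least 2, it equals \<open>Suc (Suc (n - 2))\<close>, and the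
    truncated subtraction in \<open>Am\<close> gives the true degree.\<close>
  from NS_torus.amitsur_trivial[OF this assms(7) S, of "n - 2"] assms(9)
  show ?thesis by (simp add: Suc_diff_le numeral_2_eq_2 Suc_diff_Suc)
qed

end
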